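(* Let $R$ be a commutative Noetherian ring with total quotient ring $Q$, and let $M$ be an $R$-module (not necessarily finitely generated). (1) The following are equivalent: (a) $M$ is flat over $R$. (b) $M\otimes_R Q$ is flat over $Q$, and $\operatorname{Ass}_R(L\otimes_R M)\subseteq \operatorname{Ass}_R L$ for every $R$-module $L$. (c) $M\otimes_R Q$ is flat over $Q$, and $L\otimes_R M$ is torsion-free for every torsion-free $R$-module $L$. (d) $M\otimes_R Q$ is flat over $Q$, and $P\otimes_R M$ is torsion-free for every $P\in\operatorname{Spec} R$. (e) $M\otimes_R Q$ is flat over $Q$, and $\operatorname{Tor}_1^R(R/P,M)$ is torsion-free for every $P\in\operatorname{Spec} R$. (2) Suppose moreover that $R\to S$ is a homomorphism of commutative Noetherian rings, $\mathfrak m$ is a maximal ideal of $R$ with $\mathfrak m S\subseteq \operatorname{Jac}(S)$, and $M$ is a finitely generated $S$-module (regarded as an $R$-module by restriction of scalars). Then conditions (a)–(e) are also equivalent to each of: (d$'$) $M\otimes_R Q$ is flat over $Q$, and $\mathfrak m\otimes_R M$ is torsion-free as an $R$-module. (e$'$) $M\otimes_R Q$ is flat over $Q$, and $\operatorname{Tor}_1^R(R/\mathfrak m,M)$ is torsion-free as an $R$-module. (3) For any $R$-module $M$ (without the extra hypotheses of (2)), the following are equivalent: (i) $M$ is faithfully flat over $R$. (ii) $M\otimes_R Q$ is flat over $Q$, and $\operatorname{Ass}_R(L\otimes_R M)=\operatorname{Ass}_R L$ for every $R$-module $L$. (iii) $M$ is flat over $R$, and $\operatorname{Ass}_R(L\otimes_R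 M)=\operatorname{Ass}_R L$ whenever $L$ is a simple $R$-module.
   Context: All rings are commutative with identity. The total quotient ring $Q$ of $R$ is the localization of $R$ at the set of all its non-zerodivisors. An $R$-module $N$ is torsion-free if every zero-divisor on $N$ is a zero-divisor on $R$, i.e. every non-zerodivisor of $R$ acts injectively on $N$; equivalently, the natural map $N\to N\otimes_R Q$ is injective. $\operatorname{Ass}_R N$ is the set of associated primes of $N$ (primes of the form $\operatorname{ann}_R z$ with $z\in N$), with the convention $\operatorname{Ass} 0=\emptyset$. $\operatorname{Jac}(S)$ is the Jacobson radical of $S$. *)

theory Defs
  imports "HOL-Algebra.Module" "HOL-Algebra.QuotRing" "HOL-Algebra.Ring_Divisibility"
begin

text \<open>
  Modules are records satisfying the locale \<^locale>\<open>module\<close>; its ring fields \<^const>\<open>mult\<close> and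
  \<^const>\<open>one\<close> are unconstrained there, and are left unspecified in the constructions below.
\<close>

section \<open>Linear maps, exactness, sub- and quotient modules\<close>

definition linear_maps ::
  "('a, 'x) ring_scheme \<Rightarrow> ('a, 'l, 'y) module_scheme \<Rightarrow> ('a, 'm, 'z) module_scheme \<Rightarrow> ('l \<Rightarrow> 'm) set"
  where "linear_maps R L M = {f \<in> carrier L \<rightarrow> carrier M.
    (\<forall>x\<in>carrier L. \<forall>y\<in>carrier L. f (x \<oplus>\<^bsub>L\<^esub> y) = f x \<oplus>\<^bsub>M\<^esub> f y) \<and>
    (\<forall>r\<in>carrier R. \<forall>x\<in>carrier L. f (r \<odot>\<^bsub>L\<^esub> x) = r \<odot>\<^bsub>M\<^esub> f x)}"

definition exact_at ::
  "('a, 'l, 'x) module_scheme \<Rightarrow> ('l \<Rightarrow> 'm) \<Rightarrow> ('a, 'm, 'y) module_scheme \<Rightarrow> ('m \<Rightarrow> 'n) \<Rightarrow>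
   ('a, 'n, 'z) module_scheme \<Rightarrow> bool"
  where "exact_at A f B g C \<longleftrightarrow> f ` carrier A = a_kernel B C g"

definition module_span :: "('a, 'x) ring_scheme \<Rightarrow> ('a, 'm, 'y) module_scheme \<Rightarrow> 'm set \<Rightarrow> 'm set"
  where "module_span R M X = \<Inter>{H. submodule H R M \<and> X \<subseteq> H}"

definition fg_module :: "('a, 'x) ring_scheme \<Rightarrow> ('a, 'm, 'y) module_scheme \<Rightarrow> bool"
  where "fg_module R M \<longleftrightarrow> module R M \<and>
    (\<exists>X\<subseteq>carrier M. finite X \<and> module_span R M X = carrier M)"

definition simple_module :: "('a, 'x) ring_scheme \<Rightarrow> ('a, 'm, 'y) module_scheme \<Rightarrow> bool"
  where "simple_module R M \<longleftrightarrow> module R M \<and> carrier M \<noteq> {\<zero>\<^bsub>M\<^esub>} \<and>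
    (\<forall>H. submodule H R M \<longrightarrow> H = {\<zero>\<^bsub>M\<^esub>} \<or> H = carrier M)"

text \<open>The scalar action on cosets follows the pattern of \<^const>\<open>rcoset_mult\<close>.\<close>

definition quotient_module :: "('a, 'm, 'y) module_scheme \<Rightarrow> 'm set \<Rightarrow> ('a, 'm set) module"
  where "quotient_module M N =
    \<lparr>carrier = a_rcosets\<^bsub>M\<^esub> N, mult = undefined, one = undefined, zero = N, add = set_add M,
     smult = (\<lambda>r X. \<Union>x\<in>X. N +>\<^bsub>M\<^esub> (r \<odot>\<^bsub>M\<^esub> x))\<rparr>"

definition ring_as_module :: "('a, 'x) ring_scheme \<Rightarrow> ('a, 'a) module"
  where "ring_as_module R = \<lparr>carrier = carrier R, mult = mult R, one = one R, zero = zero R,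
    add = add R, smult = mult R\<rparr>"

abbreviation ideal_as_module :: "('a, 'x) ring_scheme \<Rightarrow> 'a set \<Rightarrow> ('a, 'a) module"
  where "ideal_as_module R I \<equiv> (ring_as_module R)\<lparr>carrier := I\<rparr>"

abbreviation residue_module :: "('a, 'x) ring_scheme \<Rightarrow> 'a set \<Rightarrow> ('a, 'a set) module"
  where "residue_module R I \<equiv> quotient_module (ring_as_module R) I"

definition restrict_scalars :: "('a \<Rightarrow> 's) \<Rightarrow> ('s, 'm, 'y) module_scheme \<Rightarrow> ('a, 'm) module"
  where "restrict_scalars \<phi> N = \<lparr>carrier = carrier N, mult = mult N, one = one N, zero = zero N,
    add = add N, smult = (\<lambda>r x. \<phi> r \<odot>\<^bsub>N\<^esub> x)\<rparr>"


section \<open>Free modules and tensor products\<close>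

definition free_module :: "('a, 'x) ring_scheme \<Rightarrow> 'i set \<Rightarrow> ('a, 'i \<Rightarrow> 'a) module"
  where "free_module R I =
    \<lparr>carrier = {f. (\<forall>i. f i \<in> carrier R) \<and> (\<forall>i. i \<notin> I \<longrightarrow> f i = \<zero>\<^bsub>R\<^esub>) \<and> finite {i. f i \<noteq> \<zero>\<^bsub>R\<^esub>}},
     mult = undefined, one = undefined, zero = (\<lambda>i. \<zero>\<^bsub>R\<^esub>), add = (\<lambda>f g i. f i \<oplus>\<^bsub>R\<^esub> g i),
     smult = (\<lambda>r f i. r \<otimes>\<^bsub>R\<^esub> f i)\<rparr>"

definition free_basis :: "('a, 'x) ring_scheme \<Rightarrow> 'i \<Rightarrow> 'i \<Rightarrow> 'a"
  where "free_basis R i = (\<lambda>j. if j = i then \<one>\<^bsub>R\<^esub> else \<zero>\<^bsub>R\<^esub>)"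

definition tensor_relations ::
  "('a, 'x) ring_scheme \<Rightarrow> ('a, 'l, 'y) module_scheme \<Rightarrow> ('a, 'm, 'z) module_scheme \<Rightarrow>
   ('l \<times> 'm \<Rightarrow> 'a) set"
  where "tensor_relations R L M =
    (let F = free_module R (carrier L \<times> carrier M); e = (\<lambda>l m. free_basis R (l, m)) in
      {e (l \<oplus>\<^bsub>L\<^esub> l') m \<ominus>\<^bsub>F\<^esub> (e l m \<oplus>\<^bsub>F\<^esub> e l' m) | l l' m.
         l \<in> carrier L \<and> l' \<in> carrier L \<and> m \<in> carrier M} \<union>
      {e l (m \<oplus>\<^bsub>M\<^esub> m') \<ominus>\<^bsub>F\<^esub> (e l m \<oplus>\<^bsub>F\<^esub> e l m') | l m m'.
         l \<in> carrier L \<and> m \<in> carrier M \<and> m' \<in> carrier M} \<union>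
      {e (r \<odot>\<^bsub>L\<^esub> l) m \<ominus>\<^bsub>F\<^esub> r \<odot>\<^bsub>F\<^esub> e l m | r l m.
         r \<in> carrier R \<and> l \<in> carrier L \<and> m \<in> carrier M} \<union>
      {e l (r \<odot>\<^bsub>M\<^esub> m) \<ominus>\<^bsub>F\<^esub> r \<odot>\<^bsub>F\<^esub> e l m | r l m.
         r \<in> carrier R \<and> l \<in> carrier L \<and> m \<in> carrier M})"

definition tensor_kernel ::
  "('a, 'x) ring_scheme \<Rightarrow> ('a, 'l, 'y) module_scheme \<Rightarrow> ('a, 'm, 'z) module_scheme \<Rightarrow>
   ('l \<times> 'm \<Rightarrow> 'a) set"
  where "tensor_kernel R L M =
    module_span R (free_module R (carrier L \<times> carrier M)) (tensor_relations R L M)"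

definition tensor_product ::
  "('a, 'x) ring_scheme \<Rightarrow> ('a, 'l, 'y) module_scheme \<Rightarrow> ('a, 'm, 'z) module_scheme \<Rightarrow>
   ('a, ('l \<times> 'm \<Rightarrow> 'a) set) module"
  where "tensor_product R L M =
    quotient_module (free_module R (carrier L \<times> carrier M)) (tensor_kernel R L M)"

definition pure_tensor ::
  "('a, 'x) ring_scheme \<Rightarrow> ('a, 'l, 'y) module_scheme \<Rightarrow> ('a, 'm, 'z) module_scheme \<Rightarrow>
   'l \<Rightarrow> 'm \<Rightarrow> ('l \<times> 'm \<Rightarrow> 'a) set"
  where "pure_tensor R L M l m =
    tensor_kernel R L M +>\<^bsub>free_module R (carrier L \<times> carrier M)\<^esub> free_basis R (l, m)"

text \<open>
  For linear \<open>f\<close> and \<open>g\<close>, the linear map sending every \<open>l \<otimes> m\<close> to \<open>f l \<otimes> g m\<close>;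
  extensionality makes it unique as a HOL function.
\<close>

definition tensor_map ::
  "('a, 'x) ring_scheme \<Rightarrow> ('a, 'l, 'y) module_scheme \<Rightarrow> ('a, 'm, 'z) module_scheme \<Rightarrow>
   ('a, 'k, 'v) module_scheme \<Rightarrow> ('a, 'n, 'w) module_scheme \<Rightarrow> ('l \<Rightarrow> 'k) \<Rightarrow> ('m \<Rightarrow> 'n) \<Rightarrow>
   ('l \<times> 'm \<Rightarrow> 'a) set \<Rightarrow> ('k \<times> 'n \<Rightarrow> 'a) set"
  where "tensor_map R L M L' M' f g =
    (THE h. h \<in> linear_maps R (tensor_product R L M) (tensor_product R L' M') \<and>
       h \<in> extensional (carrier (tensor_product R L M)) \<and>
       (\<forall>l\<in>carrier L. \<forall>m\<in>carrier M. h (pure_tensor R L M l m) = pure_tensor R L' M' (f l) (g m)))"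

text \<open>
  For a ring homomorphism \<open>\<phi>\<close> from \<open>R\<close> to \<open>A\<close>, the \<open>A\<close>-module \<open>M \<otimes>\<^sub>R A\<close>, on which \<open>a\<close> acts by
  \<open>id \<otimes> (multiplication by a)\<close>.
\<close>

definition base_change ::
  "('a, 'x) ring_scheme \<Rightarrow> ('a, 'm, 'y) module_scheme \<Rightarrow> ('a \<Rightarrow> 'b) \<Rightarrow> ('b, 'z) ring_scheme \<Rightarrow>
   ('b, ('m \<times> 'b \<Rightarrow> 'a) set) module"
  where "base_change R M \<phi> A =
    (let B = restrict_scalars \<phi> (ring_as_module A); T = tensor_product R M B in
      \<lparr>carrier = carrier T, mult = undefined, one = undefined, zero = zero T, add = add T,
       smult = (\<lambda>a. tensor_map R M B M B (\<lambda>x. x) (\<lambda>b. a \<otimes>\<^bsub>A\<^esub> b))\<rparr>)"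


section \<open>The total quotient ring\<close>

definition nonzerodivisors :: "('a, 'x) ring_scheme \<Rightarrow> 'a set"
  where "nonzerodivisors R =
    {s \<in> carrier R. \<forall>r\<in>carrier R. s \<otimes>\<^bsub>R\<^esub> r = \<zero>\<^bsub>R\<^esub> \<longrightarrow> r = \<zero>\<^bsub>R\<^esub>}"

text \<open>The fraction \<open>r/s\<close> as an equivalence class of pairs, for a multiplicative set \<open>S\<close>.\<close>

definition fraction :: "('a, 'x) ring_scheme \<Rightarrow> 'a set \<Rightarrow> 'a \<Rightarrow> 'a \<Rightarrow> ('a \<times> 'a) set"
  where "fraction R S r s = {(r', s') \<in> carrier R \<times> S.
    \<exists>u\<in>S. u \<otimes>\<^bsub>R\<^esub> (r \<otimes>\<^bsub>R\<^esub> s' \<ominus>\<^bsub>R\<^esub> r' \<otimes>\<^bsub>R\<^esub> s) = \<zero>\<^bsub>R\<^esub>}"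

definition localization :: "('a, 'x) ring_scheme \<Rightarrow> 'a set \<Rightarrow> ('a \<times> 'a) set ring"
  where "localization R S =
    \<lparr>carrier = {fraction R S r s | r s. r \<in> carrier R \<and> s \<in> S},
     mult = (\<lambda>X Y. \<Union>(r, s)\<in>X. \<Union>(r', s')\<in>Y. fraction R S (r \<otimes>\<^bsub>R\<^esub> r') (s \<otimes>\<^bsub>R\<^esub> s')),
     one = fraction R S \<one>\<^bsub>R\<^esub> \<one>\<^bsub>R\<^esub>,
     zero = fraction R S \<zero>\<^bsub>R\<^esub> \<one>\<^bsub>R\<^esub>,
     add = (\<lambda>X Y. \<Union>(r, s)\<in>X. \<Union>(r', s')\<in>Y.
       fraction R S (r \<otimes>\<^bsub>R\<^esub> s' \<oplus>\<^bsub>R\<^esub> r' \<otimes>\<^bsub>R\<^esub> s) (s \<otimes>\<^bsub>R\<^esub> s'))\<rparr>"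

definition total_quotient_ring :: "('a, 'x) ring_scheme \<Rightarrow> ('a \<times> 'a) set ring"
  where "total_quotient_ring R = localization R (nonzerodivisors R)"

definition tensor_total_quotient ::
  "('a, 'x) ring_scheme \<Rightarrow> ('a, 'm, 'y) module_scheme \<Rightarrow>
   (('a \<times> 'a) set, ('m \<times> ('a \<times> 'a) set \<Rightarrow> 'a) set) module"
  where "tensor_total_quotient R M =
    base_change R M (\<lambda>r. fraction R (nonzerodivisors R) r \<one>\<^bsub>R\<^esub>) (total_quotient_ring R)"


section \<open>Flatness\<close>

text \<open>
  HOL cannot quantify over modules of all types, so flatness is relative to a type \<open>'u\<close> that
  contains the carriers of the test modules. Any \<open>'u\<close> into which the ring embeds gives the usual
  notion, because all ideals and cyclic modules then have copies in \<open>'u\<close>.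
\<close>

definition flat :: "'u itself \<Rightarrow> ('a, 'x) ring_scheme \<Rightarrow> ('a, 'm) module \<Rightarrow> bool"
  where "flat U R M \<longleftrightarrow> module R M \<and>
    (\<forall>(A :: ('a, 'u) module) (B :: ('a, 'u) module) (C :: ('a, 'u) module) f g.
      module R A \<and> module R B \<and> module R C \<and> f \<in> linear_maps R A B \<and> g \<in> linear_maps R B C \<longrightarrow>
      exact_at A f B g C \<longrightarrow>
      exact_at (tensor_product R A M) (tensor_map R A M B M f (\<lambda>x. x)) (tensor_product R B M)
        (tensor_map R B M C M g (\<lambda>x. x)) (tensor_product R C M))"

definition faithfully_flat :: "'u itself \<Rightarrow> ('a, 'x) ring_scheme \<Rightarrow> ('a, 'm) module \<Rightarrow> bool"
  where "faithfully_flat U R M \<longleftrightarrow> module R M \<and>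
    (\<forall>(A :: ('a, 'u) module) (B :: ('a, 'u) module) (C :: ('a, 'u) module) f g.
      module R A \<and> module R B \<and> module R C \<and> f \<in> linear_maps R A B \<and> g \<in> linear_maps R B C \<longrightarrow>
      (exact_at A f B g C \<longleftrightarrow>
       exact_at (tensor_product R A M) (tensor_map R A M B M f (\<lambda>x. x)) (tensor_product R B M)
         (tensor_map R B M C M g (\<lambda>x. x)) (tensor_product R C M)))"


section \<open>The first Tor module\<close>

definition linear_combination ::
  "('a, 'x) ring_scheme \<Rightarrow> ('a, 'n, 'y) module_scheme \<Rightarrow> ('n \<Rightarrow> 'a) \<Rightarrow> 'n"
  where "linear_combination R N c = (\<Oplus>\<^bsub>N\<^esub> x \<in> {x. c x \<noteq> \<zero>\<^bsub>R\<^esub>}. c x \<odot>\<^bsub>N\<^esub> x)"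

text \<open>
  The start \<open>F\<^sub>2 \<rightarrow> F\<^sub>1 \<rightarrow> F\<^sub>0 \<rightarrow> N \<rightarrow> 0\<close> of the canonical free resolution of \<open>N\<close>: \<open>F\<^sub>0\<close> is free on the
  elements of \<open>N\<close>, and each following module is free on the elements of the preceding kernel. All
  maps send a formal linear combination to its value. \<open>Tor\<^sub>1(N, M)\<close> is the homology of
  \<open>F\<^sub>2 \<otimes> M \<rightarrow> F\<^sub>1 \<otimes> M \<rightarrow> F\<^sub>0 \<otimes> M\<close>.
\<close>

definition res_F0 :: "('a, 'x) ring_scheme \<Rightarrow> ('a, 'n, 'y) module_scheme \<Rightarrow> ('a, 'n \<Rightarrow> 'a) module"
  where "res_F0 R N = free_module R (carrier N)"

definition res_F1 ::
  "('a, 'x) ring_scheme \<Rightarrow> ('a, 'n, 'y) module_scheme \<Rightarrow> ('a, ('n \<Rightarrow> 'a) \<Rightarrow> 'a) module"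
  where "res_F1 R N = free_module R (a_kernel (res_F0 R N) N (linear_combination R N))"

definition res_F2 ::
  "('a, 'x) ring_scheme \<Rightarrow> ('a, 'n, 'y) module_scheme \<Rightarrow> ('a, (('n \<Rightarrow> 'a) \<Rightarrow> 'a) \<Rightarrow> 'a) module"
  where "res_F2 R N =
    free_module R (a_kernel (res_F1 R N) (res_F0 R N) (linear_combination R (res_F0 R N)))"

definition Tor1 ::
  "('a, 'x) ring_scheme \<Rightarrow> ('a, 'n, 'y) module_scheme \<Rightarrow> ('a, 'm, 'z) module_scheme \<Rightarrow>
   ('a, ((('n \<Rightarrow> 'a) \<Rightarrow> 'a) \<times> 'm \<Rightarrow> 'a) set set) module"
  where "Tor1 R N M =
    (let F0 = res_F0 R N; F1 = res_F1 R N; F2 = res_F2 R N;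
         T0 = tensor_product R F0 M; T1 = tensor_product R F1 M; T2 = tensor_product R F2 M;
         d1 = tensor_map R F1 M F0 M (linear_combination R F0) (\<lambda>x. x);
         d2 = tensor_map R F2 M F1 M (linear_combination R F1) (\<lambda>x. x)
     in quotient_module (T1\<lparr>carrier := a_kernel T1 T0 d1\<rparr>) (d2 ` carrier T2))"


section \<open>Torsion-freeness, associated primes, Jacobson radical\<close>

definition torsion_free :: "('a, 'x) ring_scheme \<Rightarrow> ('a, 'n, 'y) module_scheme \<Rightarrow> bool"
  where "torsion_free R N \<longleftrightarrow>
    (\<forall>s\<in>nonzerodivisors R. \<forall>x\<in>carrier N. s \<odot>\<^bsub>N\<^esub> x = \<zero>\<^bsub>N\<^esub> \<longrightarrow> x = \<zero>\<^bsub>N\<^esub>)"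

definition Ass :: "('a, 'x) ring_scheme \<Rightarrow> ('a, 'n, 'y) module_scheme \<Rightarrow> 'a set set"
  where "Ass R N =
    {P. primeideal P R \<and> (\<exists>z\<in>carrier N. P = {r \<in> carrier R. r \<odot>\<^bsub>N\<^esub> z = \<zero>\<^bsub>N\<^esub>})}"

definition jacobson_radical :: "('s, 'x) ring_scheme \<Rightarrow> 's set"
  where "jacobson_radical S = {x \<in> carrier S. \<forall>I. maximalideal I S \<longrightarrow> x \<in> I}"

end

theory Submission
  imports Defs
begin

text \<open>
  Everything is reduced to one condition without test modules, the equational criterion
  \<open>equationally_flat\<close>: whenever \<open>\<Sum> r\<^sub>i m\<^sub>i = 0\<close>, the vector \<open>(m\<^sub>i)\<close> lies in \<open>Syz(r) M\<close>, that is,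
  \<open>m\<^sub>i = \<Sum>\<^sub>j a\<^sub>i\<^sub>j y\<^sub>j\<close> with \<open>\<Sum>\<^sub>i a\<^sub>i\<^sub>j r\<^sub>i = 0\<close> for every \<open>j\<close>. Two facts about tensors make this work.
  If the \<open>b\<^sub>i\<close> generate \<open>L\<close>, then \<open>\<Sum> b\<^sub>i \<otimes> m\<^sub>i = 0\<close> forces \<open>(m\<^sub>i) \<in> Syz(b) M\<close>
  (\<open>generated_tensor_zeroD\<close>), and if \<open>M\<close> satisfies the equational criterion, this holds for all
  elements of any module \<open>L\<close> (\<open>flat_tensor_zeroD\<close>). The second fact gives exactness of \<open>- \<otimes> M\<close> on
  modules of every type; the first one recovers the criterion from the single inclusion of an ideal
  into the ring, which has a copy in the universe \<open>'u\<close>. So flatness relative to \<open>'u\<close> is the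
  equational criterion, and the same holds over the total quotient ring \<open>Q\<close>, because \<open>Q\<close> has at
  most as many elements as \<open>R\<close>.

  If \<open>M\<close> is flat, then \<open>s (\<Sum> l\<^sub>i \<otimes> m\<^sub>i) = 0\<close> turns into relations between the elements \<open>s l\<^sub>i\<close>. This
  shows that \<open>L \<otimes> M\<close> is torsion-free when \<open>L\<close> is, and that the part of \<open>L \<otimes> M\<close> killed by a prime
  \<open>P\<close> comes from the part of \<open>L\<close> killed by \<open>P\<close>, whence \<open>Ass (L \<otimes> M) \<subseteq> Ass L\<close>. Exactness
  kills Tor, and clearing denominators makes \<open>M \<otimes> Q\<close> flat over \<open>Q\<close>.

  For the converses, flatness of \<open>M \<otimes> Q\<close> says that every relation \<open>\<Sum> r\<^sub>i m\<^sub>i = 0\<close> becomes trivial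
  after multiplication by a non-zero-divisor \<open>t\<close> (\<open>generically_flat\<close>); in other words
  \<open>Tor\<^sub>1(R/I, M)\<close> is a torsion module. If it is also torsion-free, as a submodule of a torsion-free
  \<open>I \<otimes> M\<close> or by assumption, it vanishes (an inclusion \<open>Ass (L \<otimes> M) \<subseteq> Ass L\<close> passes torsion-freeness
  from \<open>L\<close> to \<open>L \<otimes> M\<close>, because the zero-divisors on a module over a Noetherian ring are the members of
  its associated primes); this vanishing is \<open>ideal_flat R M I\<close>. An ideal that is
  maximal among those violating it is prime, because for \<open>a b \<in> I\<close> with \<open>a, b \<notin> I\<close> the ideals
  \<open>I + (a)\<close> and \<open>(I : a)\<close> are strictly larger and \<open>Tor\<^sub>1(R/I, M)\<close> sits between the modules belonging
  to them. So it is enough to look at prime ideals. In the situation of the second part it is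
  enough to look at \<open>\<mm>\<close>: for a maximal violating prime \<open>P\<close> choose \<open>a \<in> \<mm> - P\<close>; as \<open>(P : a) = P\<close> and
  \<open>P + (a)\<close> is no violation, multiplication by \<open>a\<close> is surjective on \<open>Tor\<^sub>1(R/P, M)\<close>, which is a
  finitely generated \<open>S\<close>-module, so that Nakayama's lemma applies (\<open>local_criterion\<close>).

  For a flat module, faithful flatness is the condition \<open>\<mm> M \<noteq> M\<close> for all maximal ideals \<open>\<mm>\<close>. If
  \<open>\<mm> M = M\<close>, then \<open>R/\<mm> \<otimes> M = 0\<close> has no associated prime, although \<open>\<mm>\<close> is associated to
  \<open>R/\<mm>\<close>. Conversely, if \<open>P\<close> is the annihilator of \<open>l \<in> L\<close>, faithful flatness provides \<open>l \<otimes> m \<noteq> 0\<close>,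
  and flatness shows that nothing outside \<open>P\<close> kills a nonzero multiple of \<open>l \<otimes> m\<close>.
\<close>

section \<open>Sums indexed by initial segments of the naturals\<close>

text \<open>
  A sum by recursion on the length needs no finiteness or membership conditions to be unfolded, and
  families are concatenated by adding lengths.
\<close>

primrec nsum :: "('a, 'x) ring_scheme \<Rightarrow> (nat \<Rightarrow> 'a) \<Rightarrow> nat \<Rightarrow> 'a"
  where
    "nsum G f 0 = \<zero>\<^bsub>G\<^esub>"
  | "nsum G f (Suc n) = nsum G f n \<oplus>\<^bsub>G\<^esub> f n"

lemma nsum_cong:
  assumes "\<And>i. i < n \<Longrightarrow> f i = g i"
  shows "nsum G f n = nsum G g n"
  using assms by (induction n) auto

context abelian_monoid
begin

lemma nsum_closed [simp, intro]:
  assumes "\<And>i. i < n \<Longrightarrow> f i \<in> carrier G"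
  shows "nsum G f n \<in> carrier G"
  using assms by (induction n) auto

lemma nsum_zero:
  assumes "\<And>i. i < n \<Longrightarrow> f i = \<zero>"
  shows "nsum G f n = \<zero>"
  using assms by (induction n) auto

lemma nsum_add:
  assumes "\<And>i. i < n \<Longrightarrow> f i \<in> carrier G" "\<And>i. i < n \<Longrightarrow> g i \<in> carrier G"
  shows "nsum G (\<lambda>i. f i \<oplus> g i) n = nsum G f n \<oplus> nsum G g n"
  using assms
proof (induction n)
  case (Suc n)
  then have "nsum G f n \<in> carrier G" "nsum G g n \<in> carrier G" "f n \<in> carrier G" "g n \<in> carrier G"
    by auto
  with Suc show ?case by (simp add: a_ac)
qed auto

lemma nsum_swap:
  assumes "\<And>i j. i < n \<Longrightarrow> j < m \<Longrightarrow> f i j \<in> carrier G"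
  shows "nsum G (\<lambda>i. nsum G (f i) m) n = nsum G (\<lambda>j. nsum G (\<lambda>i. f i j) n) m"
  using assms
proof (induction n)
  case 0
  then show ?case by (simp add: nsum_zero)
next
  case (Suc n)
  have "nsum G (\<lambda>j. nsum G (\<lambda>i. f i j) n \<oplus> f n j) m =
        nsum G (\<lambda>j. nsum G (\<lambda>i. f i j) n) m \<oplus> nsum G (f n) m"
    using Suc.prems by (intro nsum_add) auto
  with Suc show ?case by simp
qed

lemma nsum_append:
  assumes "\<And>i. i < n + p \<Longrightarrow> f i \<in> carrier G"
  shows "nsum G f (n + p) = nsum G f n \<oplus> nsum G (\<lambda>i. f (n + i)) p"
  using assms
proof (induction p)
  case (Suc p)
  then have "nsum G f n \<in> carrier G" "nsum G (\<lambda>i. f (n + i)) p \<in> carrier G" "f (n + p) \<in> carrier G"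
    by auto
  with Suc show ?case by (simp add: a_ac)
qed auto

lemma nsum_delta:
  assumes "k < n" "x \<in> carrier G"
  shows "nsum G (\<lambda>i. if i = k then x else \<zero>) n = x"
  using assms
proof (induction n)
  case (Suc n)
  show ?case
  proof (cases "k = n")
    case True
    then have "nsum G (\<lambda>i. if i = k then x else \<zero>) n = \<zero>" by (intro nsum_zero) auto
    with True Suc show ?thesis by auto
  next
    case False
    with Suc show ?thesis by auto
  qed
qed auto

end

lemma (in abelian_group) minus_eq_zero_iff:
  assumes "x \<in> carrier G" "y \<in> carrier G"
  shows "x \<ominus> y = \<zero> \<longleftrightarrow> x = y"
  using add.inv_solve_right[of "\<zero>" x y] assms by (auto simp: a_minus_def r_neg)

lemma (in module) nsum_smult:
  assumes "r \<in> carrier R" "\<And>i. i < n \<Longrightarrow> f i \<in> carrier M"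
  shows "r \<odot>\<^bsub>M\<^esub> nsum M f n = nsum M (\<lambda>i. r \<odot>\<^bsub>M\<^esub> f i) n"
  using assms by (induction n) (auto simp: smult_r_distr)

lemma (in module) nsum_smult_left:
  assumes "x \<in> carrier M" "\<And>i. i < n \<Longrightarrow> r i \<in> carrier R"
  shows "nsum R r n \<odot>\<^bsub>M\<^esub> x = nsum M (\<lambda>i. r i \<odot>\<^bsub>M\<^esub> x) n"
  using assms by (induction n) (auto simp: smult_l_distr)

lemma (in module) nsum_minus:
  assumes "\<And>i. i < n \<Longrightarrow> f i \<in> carrier M"
  shows "\<ominus>\<^bsub>M\<^esub> nsum M f n = nsum M (\<lambda>i. \<ominus>\<^bsub>M\<^esub> f i) n"
  using assms by (induction n) (auto simp: M.minus_add)

section \<open>Linear maps, submodules and quotient modules\<close>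

lemma linear_mapsI:
  assumes "\<And>x. x \<in> carrier L \<Longrightarrow> f x \<in> carrier M"
    and "\<And>x y. x \<in> carrier L \<Longrightarrow> y \<in> carrier L \<Longrightarrow> f (x \<oplus>\<^bsub>L\<^esub> y) = f x \<oplus>\<^bsub>M\<^esub> f y"
    and "\<And>r x. r \<in> carrier R \<Longrightarrow> x \<in> carrier L \<Longrightarrow> f (r \<odot>\<^bsub>L\<^esub> x) = r \<odot>\<^bsub>M\<^esub> f x"
  shows "f \<in> linear_maps R L M"
  using assms unfolding linear_maps_def by auto

lemma linear_maps_closed: "f \<in> linear_maps R L M \<Longrightarrow> x \<in> carrier L \<Longrightarrow> f x \<in> carrier M"
  and linear_maps_add: "f \<in> linear_maps R L M \<Longrightarrow> x \<in> carrier L \<Longrightarrow> y \<in> carrier L \<Longrightarrow>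
    f (x \<oplus>\<^bsub>L\<^esub> y) = f x \<oplus>\<^bsub>M\<^esub> f y"
  and linear_maps_smult: "f \<in> linear_maps R L M \<Longrightarrow> r \<in> carrier R \<Longrightarrow> x \<in> carrier L \<Longrightarrow>
    f (r \<odot>\<^bsub>L\<^esub> x) = r \<odot>\<^bsub>M\<^esub> f x"
  unfolding linear_maps_def by auto

lemma linear_maps_zero:
  assumes "module R L" "module R M" "f \<in> linear_maps R L M"
  shows "f \<zero>\<^bsub>L\<^esub> = \<zero>\<^bsub>M\<^esub>"
proof -
  interpret L: module R L by fact
  interpret M: module R M by fact
  have "f (\<zero>\<^bsub>R\<^esub> \<odot>\<^bsub>L\<^esub> \<zero>\<^bsub>L\<^esub>) = \<zero>\<^bsub>R\<^esub> \<odot>\<^bsub>M\<^esub> f \<zero>\<^bsub>L\<^esub>"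
    by (rule linear_maps_smult[OF assms(3)]) auto
  then show ?thesis using linear_maps_closed[OF assms(3)] by simp
qed

lemma linear_maps_nsum:
  assumes "module R L" "module R M" "f \<in> linear_maps R L M" "\<And>i. i < n \<Longrightarrow> x i \<in> carrier L"
  shows "f (nsum L x n) = nsum M (\<lambda>i. f (x i)) n"
proof -
  interpret L: module R L by fact
  interpret M: module R M by fact
  show ?thesis using assms(4)
    by (induction n) (auto simp: linear_maps_zero[OF assms(1-3)] linear_maps_add[OF assms(3)])
qed

lemma linear_maps_minus:
  assumes "module R L" "module R M" "f \<in> linear_maps R L M" "x \<in> carrier L"
  shows "f (\<ominus>\<^bsub>L\<^esub> x) = \<ominus>\<^bsub>M\<^esub> f x"
proof -
  interpret L: module R L by fact
  interpret M: module R M by fact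
  have "f (\<ominus>\<^bsub>L\<^esub> x \<oplus>\<^bsub>L\<^esub> x) = f (\<ominus>\<^bsub>L\<^esub> x) \<oplus>\<^bsub>M\<^esub> f x"
    by (rule linear_maps_add[OF assms(3)]) (use assms(4) in auto)
  then have "f (\<ominus>\<^bsub>L\<^esub> x) \<oplus>\<^bsub>M\<^esub> f x = \<zero>\<^bsub>M\<^esub>"
    using assms(4) linear_maps_zero[OF assms(1-3)] by (simp add: L.l_neg)
  then show ?thesis using linear_maps_closed[OF assms(3)] assms(4)
    by (simp add: M.minus_equality)
qed

lemma linear_map_kernel_submodule:
  assumes "module R L" "module R M" "f \<in> linear_maps R L M"
  shows "submodule (a_kernel L M f) R L"
proof -
  interpret L: module R L by fact
  interpret M: module R M by fact
  show ?thesis unfolding a_kernel_def'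
    using linear_maps_zero[OF assms] linear_maps_minus[OF assms] linear_maps_add[OF assms(3)]
      linear_maps_smult[OF assms(3)]
    by (intro L.submoduleI) auto
qed

text \<open>Closure under negatives is automatic, because \<open>- x = (-1) x\<close>.\<close>

lemma (in module) submoduleI':
  assumes "H \<subseteq> carrier M" "\<zero>\<^bsub>M\<^esub> \<in> H"
    and "\<And>a b. a \<in> H \<Longrightarrow> b \<in> H \<Longrightarrow> a \<oplus>\<^bsub>M\<^esub> b \<in> H"
    and smult: "\<And>a x. a \<in> carrier R \<Longrightarrow> x \<in> H \<Longrightarrow> a \<odot>\<^bsub>M\<^esub> x \<in> H"
  shows "submodule H R M"
proof (rule submoduleI)
  fix a assume "a \<in> H"
  then have "(\<ominus> \<one>) \<odot>\<^bsub>M\<^esub> a \<in> H" "a \<in> carrier M" using smult assms(1) by auto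
  then show "\<ominus>\<^bsub>M\<^esub> a \<in> H" by (simp add: smult_l_minus)
qed (use assms in auto)

lemma (in module) submodule_zero_mem: "submodule H R M \<Longrightarrow> \<zero>\<^bsub>M\<^esub> \<in> H"
  using submoduleE by (metis M.zero_closed R.zero_closed all_not_in_conv smult_l_null subset_eq)

lemma (in module) submodule_nsum:
  assumes "submodule H R M" "\<And>i. i < n \<Longrightarrow> f i \<in> H"
  shows "nsum M f n \<in> H"
  using assms(2) by (induction n) (auto simp: submodule_zero_mem[OF assms(1)] submoduleE(5)[OF assms(1)])

lemma (in module) submodule_abelian_subgroup:
  assumes "submodule N R M"
  shows "abelian_subgroup N M"
  using assms submodule.axioms(1) additive_subgroup.intro M.abelian_group_axioms
  by (intro abelian_subgroupI3) blast+

context module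
begin

context
  fixes N assumes N: "submodule N R M"
begin

interpretation abelian_subgroup N M
  by (rule submodule_abelian_subgroup[OF N])

lemma quotient_module_carrier:
  "carrier (quotient_module M N) = (\<lambda>x. N +>\<^bsub>M\<^esub> x) ` carrier M"
  unfolding quotient_module_def A_RCOSETS_def' by auto

lemma coset_eq_iff:
  assumes "x \<in> carrier M" "y \<in> carrier M"
  shows "N +>\<^bsub>M\<^esub> x = N +>\<^bsub>M\<^esub> y \<longleftrightarrow> x \<ominus>\<^bsub>M\<^esub> y \<in> N"
proof
  assume "N +>\<^bsub>M\<^esub> x = N +>\<^bsub>M\<^esub> y"
  then have "x \<in> N +>\<^bsub>M\<^esub> y" using a_rcos_self[OF assms(1)] by simp
  then show "x \<ominus>\<^bsub>M\<^esub> y \<in> N" using assms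
    by (simp add: a_rcos_module a_minus_def)
next
  assume "x \<ominus>\<^bsub>M\<^esub> y \<in> N"
  then have "x \<in> N +>\<^bsub>M\<^esub> y" using assms by (simp add: a_rcos_module a_minus_def)
  then show "N +>\<^bsub>M\<^esub> x = N +>\<^bsub>M\<^esub> y" using a_repr_independence' assms
    by (metis M.a_repr_independence N submodule.axioms(1))
qed

lemma coset_eq_zero_iff:
  assumes "x \<in> carrier M"
  shows "N +>\<^bsub>M\<^esub> x = \<zero>\<^bsub>quotient_module M N\<^esub> \<longleftrightarrow> x \<in> N"
  using assms a_rcos_self[OF assms] a_rcos_const unfolding quotient_module_def by auto

lemma coset_add:
  assumes "x \<in> carrier M" "y \<in> carrier M"
  shows "(N +>\<^bsub>M\<^esub> x) \<oplus>\<^bsub>quotient_module M N\<^esub> (N +>\<^bsub>M\<^esub> y) = N +>\<^bsub>M\<^esub> (x \<oplus>\<^bsub>M\<^esub> y)"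
  unfolding quotient_module_def by (simp add: a_rcos_sum assms)

lemma coset_smult:
  assumes r: "r \<in> carrier R" and x: "x \<in> carrier M"
  shows "r \<odot>\<^bsub>quotient_module M N\<^esub> (N +>\<^bsub>M\<^esub> x) = N +>\<^bsub>M\<^esub> (r \<odot>\<^bsub>M\<^esub> x)"
proof -
  have "N +>\<^bsub>M\<^esub> (r \<odot>\<^bsub>M\<^esub> y) = N +>\<^bsub>M\<^esub> (r \<odot>\<^bsub>M\<^esub> x)" if "y \<in> N +>\<^bsub>M\<^esub> x" for y
  proof -
    have y: "y \<in> carrier M" using that x a_rcosets_carrier M.a_rcosetsI[OF submoduleE(1)[OF N] x] by blast
    have "y \<ominus>\<^bsub>M\<^esub> x \<in> N" using that x y by (simp add: a_rcos_module a_minus_def)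
    then have "r \<odot>\<^bsub>M\<^esub> (y \<ominus>\<^bsub>M\<^esub> x) \<in> N" using submoduleE(4)[OF N r] by blast
    then have "(r \<odot>\<^bsub>M\<^esub> y) \<ominus>\<^bsub>M\<^esub> (r \<odot>\<^bsub>M\<^esub> x) \<in> N"
      using r x y by (simp add: a_minus_def smult_r_distr smult_r_minus)
    then show ?thesis using r x y by (simp add: coset_eq_iff)
  qed
  then have "(\<Union>y\<in>N +>\<^bsub>M\<^esub> x. N +>\<^bsub>M\<^esub> (r \<odot>\<^bsub>M\<^esub> y)) = (\<Union>y\<in>N +>\<^bsub>M\<^esub> x. N +>\<^bsub>M\<^esub> (r \<odot>\<^bsub>M\<^esub> x))"
    by (intro SUP_cong) auto
  also have "\<dots> = N +>\<^bsub>M\<^esub> (r \<odot>\<^bsub>M\<^esub> x)" using a_rcos_self[OF x] by blast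
  finally show ?thesis unfolding quotient_module_def by simp
qed

lemma quotient_is_module: "module R (quotient_module M N)"
proof (rule moduleI)
  let ?Q = "quotient_module M N"
  have zero: "\<zero>\<^bsub>?Q\<^esub> = N +>\<^bsub>M\<^esub> \<zero>\<^bsub>M\<^esub>"
    by (metis M.zero_closed coset_eq_zero_iff submodule_zero_mem[OF N])
  have rep: "\<exists>a\<in>carrier M. X = N +>\<^bsub>M\<^esub> a" if "X \<in> carrier ?Q" for X
    using that unfolding quotient_module_carrier by auto
  have cl: "N +>\<^bsub>M\<^esub> a \<in> carrier ?Q" if "a \<in> carrier M" for a
    using that unfolding quotient_module_carrier by auto
  show "abelian_group ?Q"
  proof (rule abelian_groupI)
    show "\<zero>\<^bsub>?Q\<^esub> \<in> carrier ?Q" unfolding zero by (rule cl) simp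
    fix X assume "X \<in> carrier ?Q"
    then obtain a where a: "a \<in> carrier M" "X = N +>\<^bsub>M\<^esub> a" using rep by blast
    show "\<zero>\<^bsub>?Q\<^esub> \<oplus>\<^bsub>?Q\<^esub> X = X"
      unfolding zero a(2) using a(1) by (simp add: coset_add)
    have "(N +>\<^bsub>M\<^esub> (\<ominus>\<^bsub>M\<^esub> a)) \<oplus>\<^bsub>?Q\<^esub> X = \<zero>\<^bsub>?Q\<^esub>"
      unfolding zero a(2) using a(1) by (simp add: coset_add M.l_neg)
    then show "\<exists>Y\<in>carrier ?Q. Y \<oplus>\<^bsub>?Q\<^esub> X = \<zero>\<^bsub>?Q\<^esub>" using cl a(1) by blast
    fix Y assume "Y \<in> carrier ?Q"
    then obtain b where b: "b \<in> carrier M" "Y = N +>\<^bsub>M\<^esub> b" using rep by blast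
    show "X \<oplus>\<^bsub>?Q\<^esub> Y \<in> carrier ?Q" unfolding a(2) b(2) using a(1) b(1) by (simp add: coset_add cl)
    show "X \<oplus>\<^bsub>?Q\<^esub> Y = Y \<oplus>\<^bsub>?Q\<^esub> X"
      unfolding a(2) b(2) using a(1) b(1) by (simp add: coset_add M.a_comm)
    fix Z assume "Z \<in> carrier ?Q"
    then obtain c where c: "c \<in> carrier M" "Z = N +>\<^bsub>M\<^esub> c" using rep by blast
    show "X \<oplus>\<^bsub>?Q\<^esub> Y \<oplus>\<^bsub>?Q\<^esub> Z = X \<oplus>\<^bsub>?Q\<^esub> (Y \<oplus>\<^bsub>?Q\<^esub> Z)"
      unfolding a(2) b(2) c(2) using a(1) b(1) c(1) by (simp add: coset_add M.a_assoc)
  qed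
qed (auto simp: R.is_cring quotient_module_carrier coset_add coset_smult smult_l_distr smult_r_distr smult_assoc1)

lemma coset_linear: "(\<lambda>x. N +>\<^bsub>M\<^esub> x) \<in> linear_maps R M (quotient_module M N)"
  by (rule linear_mapsI) (auto simp: quotient_module_carrier coset_add coset_smult)

end

lemma module_span_submodule:
  assumes "X \<subseteq> carrier M"
  shows "submodule (module_span R M X) R M"
proof (rule submoduleI')
  show "module_span R M X \<subseteq> carrier M"
    unfolding module_span_def using carrier_is_submodule assms by blast
qed (auto simp: module_span_def submodule_zero_mem submoduleE)

lemma module_span_superset: "X \<subseteq> module_span R M X"
  unfolding module_span_def by auto

lemma module_span_least: "submodule H R M \<Longrightarrow> X \<subseteq> H \<Longrightarrow> module_span R M X \<subseteq> H"
  unfolding module_span_def by auto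

end

section \<open>Free modules\<close>

lemma (in cring) free_module_is_module: "module R (free_module R I)"
proof (rule moduleI)
  let ?F = "free_module R I"
  show "abelian_group ?F"
  proof (rule abelian_groupI)
    fix f g assume fg: "f \<in> carrier ?F" "g \<in> carrier ?F"
    have "{i. f i \<oplus> g i \<noteq> \<zero>} \<subseteq> {i. f i \<noteq> \<zero>} \<union> {i. g i \<noteq> \<zero>}" by auto
    then have "finite {i. f i \<oplus> g i \<noteq> \<zero>}"
      using fg unfolding free_module_def by (auto intro: finite_subset)
    then show "f \<oplus>\<^bsub>?F\<^esub> g \<in> carrier ?F" using fg unfolding free_module_def by auto
  next
    fix f assume f: "f \<in> carrier ?F"
    then have fin: "finite {i. f i \<noteq> \<zero>}" by (auto simp: free_module_def)
    have "finite {i. \<ominus> f i \<noteq> \<zero>}"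
      by (rule finite_subset[OF _ fin]) auto
    then show "\<exists>y\<in>carrier ?F. y \<oplus>\<^bsub>?F\<^esub> f = \<zero>\<^bsub>?F\<^esub>"
      using f by (intro bexI[of _ "\<lambda>i. \<ominus> f i"]) (auto simp: free_module_def l_neg)
  qed (auto simp: free_module_def a_ac)
next
  fix r f assume rf: "r \<in> carrier R" "f \<in> carrier (free_module R I)"
  then have fin: "finite {i. f i \<noteq> \<zero>}" by (auto simp: free_module_def)
  have "finite {i. r \<otimes> f i \<noteq> \<zero>}"
    by (rule finite_subset[OF _ fin]) (use rf in auto)
  then show "r \<odot>\<^bsub>free_module R I\<^esub> f \<in> carrier (free_module R I)"
    using rf by (auto simp: free_module_def)
qed (auto simp: free_module_def is_cring l_distr r_distr m_assoc)

lemma (in cring) free_basis_closed: "i \<in> I \<Longrightarrow> free_basis R i \<in> carrier (free_module R I)"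
  by (auto simp: free_module_def free_basis_def intro: finite_subset[of _ "{i}"])

text \<open>
  A finitely supported function arises from zero by adding one scaled basis vector at a time; the
  induction is on a finite set that contains the support.
\<close>

lemma (in cring) free_module_induct [consumes 1, case_names zero add]:
  assumes "c \<in> carrier (free_module R I)"
    and "P \<zero>\<^bsub>free_module R I\<^esub>"
    and step: "\<And>c r i. c \<in> carrier (free_module R I) \<Longrightarrow> P c \<Longrightarrow> r \<in> carrier R \<Longrightarrow> i \<in> I \<Longrightarrow>
      P (c \<oplus>\<^bsub>free_module R I\<^esub> r \<odot>\<^bsub>free_module R I\<^esub> free_basis R i)"
  shows "P c"
proof -
  have "P c" if "finite A" "{i. c i \<noteq> \<zero>} \<subseteq> A" "c \<in> carrier (free_module R I)" for A c
    using that
  proof (induction A arbitrary: c rule: finite_induct)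
    case empty
    then have "c = \<zero>\<^bsub>free_module R I\<^esub>" by (auto simp: free_module_def)
    then show ?case using assms(2) by simp
  next
    case (insert j A)
    show ?case
    proof (cases "c j = \<zero>")
      case True
      then have "{i. c i \<noteq> \<zero>} \<subseteq> A" using insert by auto
      then show ?thesis using insert by blast
    next
      case False
      define d where "d = c(j := \<zero>)"
      have fin: "finite {i. c i \<noteq> \<zero>}" using insert by (auto simp: free_module_def)
      have "finite {i. d i \<noteq> \<zero>}"
        by (rule finite_subset[OF _ fin]) (auto simp: d_def)
      then have d: "d \<in> carrier (free_module R I)" using insert.prems
        by (auto simp: free_module_def d_def)
      have "{i. d i \<noteq> \<zero>} \<subseteq> A" using insert.prems by (auto simp: d_def)
      then have "P d" using insert.IH d by blast
      moreover have "c j \<in> carrier R" "j \<in> I" using insert.prems False by (auto simp: free_module_def)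
      ultimately have "P (d \<oplus>\<^bsub>free_module R I\<^esub> c j \<odot>\<^bsub>free_module R I\<^esub> free_basis R j)"
        using step d by blast
      moreover have "d \<oplus>\<^bsub>free_module R I\<^esub> c j \<odot>\<^bsub>free_module R I\<^esub> free_basis R j = c"
        using insert.prems by (auto simp: free_module_def d_def free_basis_def fun_eq_iff)
      ultimately show ?thesis by simp
    qed
  qed
  then show ?thesis using assms(1) by (auto simp: free_module_def)
qed

definition free_extension ::
  "('a, 'x) ring_scheme \<Rightarrow> ('a, 'v, 'y) module_scheme \<Rightarrow> ('i \<Rightarrow> 'v) \<Rightarrow> ('i \<Rightarrow> 'a) \<Rightarrow> 'v"
  where "free_extension R V \<beta> c = (\<Oplus>\<^bsub>V\<^esub> i \<in> {i. c i \<noteq> \<zero>\<^bsub>R\<^esub>}. c i \<odot>\<^bsub>V\<^esub> \<beta> i)"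

lemma linear_combination_eq_free_extension:
  "linear_combination R N = free_extension R N (\<lambda>x. x)"
  unfolding linear_combination_def free_extension_def by simp

context module
begin

lemma free_extension_superset:
  assumes "\<And>i. i \<in> I \<Longrightarrow> \<beta> i \<in> carrier M" "c \<in> carrier (free_module R I)"
    and "finite A" "{i. c i \<noteq> \<zero>} \<subseteq> A" "A \<subseteq> I"
  shows "free_extension R M \<beta> c = (\<Oplus>\<^bsub>M\<^esub> i \<in> A. c i \<odot>\<^bsub>M\<^esub> \<beta> i)"
  unfolding free_extension_def
  by (rule M.add.finprod_mono_neutral_cong_left) (use assms in \<open>auto simp: free_module_def\<close>)

lemma free_extension_linear:
  assumes "\<And>i. i \<in> I \<Longrightarrow> \<beta> i \<in> carrier M"
  shows "free_extension R M \<beta> \<in> linear_maps R (free_module R I) M"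
proof (rule linear_mapsI)
  let ?F = "free_module R I"
  interpret F: module R ?F by (rule R.free_module_is_module)
  have c: "finite {i. c i \<noteq> \<zero>}" "{i. c i \<noteq> \<zero>} \<subseteq> I" "\<And>i. c i \<in> carrier R" if "c \<in> carrier ?F" for c
    using that by (auto simp: free_module_def)
  fix x assume x: "x \<in> carrier ?F"
  show "free_extension R M \<beta> x \<in> carrier M"
    unfolding free_extension_def using assms c[OF x] by (intro M.finsum_closed) auto
  fix r assume r: "r \<in> carrier R"
  have "free_extension R M \<beta> (r \<odot>\<^bsub>?F\<^esub> x) =
    (\<Oplus>\<^bsub>M\<^esub> i \<in> {i. x i \<noteq> \<zero>}. (r \<odot>\<^bsub>?F\<^esub> x) i \<odot>\<^bsub>M\<^esub> \<beta> i)"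
    by (rule free_extension_superset[OF assms F.smult_closed[OF r x]])
      (use c[OF x] r in \<open>auto simp: free_module_def\<close>)
  also have "\<dots> = (\<Oplus>\<^bsub>M\<^esub> i \<in> {i. x i \<noteq> \<zero>}. r \<odot>\<^bsub>M\<^esub> (x i \<odot>\<^bsub>M\<^esub> \<beta> i))"
    using assms c[OF x] r
    by (intro M.finsum_cong') (auto simp: free_module_def subset_iff smult_assoc1)
  also have "\<dots> = r \<odot>\<^bsub>M\<^esub> free_extension R M \<beta> x"
    unfolding free_extension_def using c[OF x] r assms
    by (intro finsum_smult_ldistr[symmetric]) auto
  finally show "free_extension R M \<beta> (r \<odot>\<^bsub>?F\<^esub> x) = r \<odot>\<^bsub>M\<^esub> free_extension R M \<beta> x" .
next
  let ?F = "free_module R I"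
  interpret F: module R ?F by (rule R.free_module_is_module)
  fix x y assume x: "x \<in> carrier ?F" and y: "y \<in> carrier ?F"
  have c: "finite {i. c i \<noteq> \<zero>}" "{i. c i \<noteq> \<zero>} \<subseteq> I" "\<And>i. c i \<in> carrier R" if "c \<in> carrier ?F" for c
    using that by (auto simp: free_module_def)
  define A where "A = {i. x i \<noteq> \<zero>} \<union> {i. y i \<noteq> \<zero>}"
  have A: "finite A" "A \<subseteq> I" "{i. x i \<noteq> \<zero>} \<subseteq> A" "{i. y i \<noteq> \<zero>} \<subseteq> A"
    using c[OF x] c[OF y] by (auto simp: A_def)
  have "{i. (x \<oplus>\<^bsub>?F\<^esub> y) i \<noteq> \<zero>} \<subseteq> A" by (auto simp: A_def free_module_def)
  then have "free_extension R M \<beta> (x \<oplus>\<^bsub>?F\<^esub> y) = (\<Oplus>\<^bsub>M\<^esub> i \<in> A. (x \<oplus>\<^bsub>?F\<^esub> y) i \<odot>\<^bsub>M\<^esub> \<beta> i)"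
    using A x y by (intro free_extension_superset[OF assms]) auto
  also have "\<dots> = (\<Oplus>\<^bsub>M\<^esub> i \<in> A. x i \<odot>\<^bsub>M\<^esub> \<beta> i \<oplus>\<^bsub>M\<^esub> y i \<odot>\<^bsub>M\<^esub> \<beta> i)"
    using assms c(3)[OF x] c(3)[OF y] A
    by (intro M.finsum_cong') (auto simp: free_module_def subset_iff smult_l_distr)
  also have "\<dots> = (\<Oplus>\<^bsub>M\<^esub> i \<in> A. x i \<odot>\<^bsub>M\<^esub> \<beta> i) \<oplus>\<^bsub>M\<^esub> (\<Oplus>\<^bsub>M\<^esub> i \<in> A. y i \<odot>\<^bsub>M\<^esub> \<beta> i)"
    using assms c(3)[OF x] c(3)[OF y] A by (intro M.finsum_addf) auto
  also have "\<dots> = free_extension R M \<beta> x \<oplus>\<^bsub>M\<^esub> free_extension R M \<beta> y"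
    using A x y by (simp add: free_extension_superset[OF assms])
  finally show "free_extension R M \<beta> (x \<oplus>\<^bsub>?F\<^esub> y) = free_extension R M \<beta> x \<oplus>\<^bsub>M\<^esub> free_extension R M \<beta> y" .
qed

lemma free_extension_basis:
  assumes "\<And>i. i \<in> I \<Longrightarrow> \<beta> i \<in> carrier M" "j \<in> I"
  shows "free_extension R M \<beta> (free_basis R j) = \<beta> j"
proof -
  have "free_extension R M \<beta> (free_basis R j) = (\<Oplus>\<^bsub>M\<^esub> i \<in> {j}. free_basis R j i \<odot>\<^bsub>M\<^esub> \<beta> i)"
    by (rule free_extension_superset[OF assms(1) R.free_basis_closed[OF assms(2)]])
      (use assms in \<open>auto simp: free_basis_def\<close>)
  then show ?thesis using assms by (simp add: free_basis_def)
qed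

end

section \<open>Tensor products\<close>

locale tensor_pair = L: module R L + M: module R M
  for R (structure) and L :: "('a, 'l, 'y) module_scheme" and M :: "('a, 'm, 'z) module_scheme"
begin

abbreviation "FF \<equiv> free_module R (carrier L \<times> carrier M)"
abbreviation "TT \<equiv> tensor_product R L M"
abbreviation pt (infix \<open>\<otimes>\<^sub>t\<close> 75) where "l \<otimes>\<^sub>t m \<equiv> pure_tensor R L M l m"

sublocale FF: module R FF
  by (rule L.R.free_module_is_module)

lemma basis_closed [simp]:
  "l \<in> carrier L \<Longrightarrow> m \<in> carrier M \<Longrightarrow> free_basis R (l, m) \<in> carrier FF"
  by (rule L.R.free_basis_closed) auto

lemma tensor_relations_subset: "tensor_relations R L M \<subseteq> carrier FF"
  unfolding tensor_relations_def Let_def by auto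

lemma kernel_submodule: "submodule (tensor_kernel R L M) R FF"
  unfolding tensor_kernel_def by (rule FF.module_span_submodule[OF tensor_relations_subset])

sublocale TT: module R TT
  unfolding tensor_product_def by (rule FF.quotient_is_module[OF kernel_submodule])

abbreviation "proj \<equiv> (\<lambda>x. tensor_kernel R L M +>\<^bsub>FF\<^esub> x)"

lemma proj_linear: "proj \<in> linear_maps R FF TT"
  unfolding tensor_product_def by (rule FF.coset_linear[OF kernel_submodule])

lemma pure_closed [simp, intro]: "l \<in> carrier L \<Longrightarrow> m \<in> carrier M \<Longrightarrow> l \<otimes>\<^sub>t m \<in> carrier TT"
  unfolding pure_tensor_def by (rule linear_maps_closed[OF proj_linear]) simp

lemma relation_imp_proj_eq:
  assumes "x \<ominus>\<^bsub>FF\<^esub> y \<in> tensor_relations R L M" "x \<in> carrier FF" "y \<in> carrier FF"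
  shows "proj x = proj y"
  using FF.coset_eq_iff[OF kernel_submodule assms(2,3)] FF.module_span_superset assms(1)
  unfolding tensor_kernel_def by blast

lemma pure_add_left:
  assumes "l \<in> carrier L" "l' \<in> carrier L" "m \<in> carrier M"
  shows "(l \<oplus>\<^bsub>L\<^esub> l') \<otimes>\<^sub>t m = l \<otimes>\<^sub>t m \<oplus>\<^bsub>TT\<^esub> l' \<otimes>\<^sub>t m"
proof -
  have "proj (free_basis R (l \<oplus>\<^bsub>L\<^esub> l', m)) = proj (free_basis R (l, m) \<oplus>\<^bsub>FF\<^esub> free_basis R (l', m))"
    by (rule relation_imp_proj_eq) (use assms in \<open>auto simp: tensor_relations_def Let_def\<close>)
  then show ?thesis using assms by (simp add: pure_tensor_def linear_maps_add[OF proj_linear])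
qed

lemma pure_add_right:
  assumes "l \<in> carrier L" "m \<in> carrier M" "m' \<in> carrier M"
  shows "l \<otimes>\<^sub>t (m \<oplus>\<^bsub>M\<^esub> m') = l \<otimes>\<^sub>t m \<oplus>\<^bsub>TT\<^esub> l \<otimes>\<^sub>t m'"
proof -
  have "proj (free_basis R (l, m \<oplus>\<^bsub>M\<^esub> m')) = proj (free_basis R (l, m) \<oplus>\<^bsub>FF\<^esub> free_basis R (l, m'))"
    by (rule relation_imp_proj_eq) (use assms in \<open>auto simp: tensor_relations_def Let_def\<close>)
  then show ?thesis using assms by (simp add: pure_tensor_def linear_maps_add[OF proj_linear])
qed

lemma pure_smult_left:
  assumes "r \<in> carrier R" "l \<in> carrier L" "m \<in> carrier M"
  shows "(r \<odot>\<^bsub>L\<^esub> l) \<otimes>\<^sub>t m = r \<odot>\<^bsub>TT\<^esub> (l \<otimes>\<^sub>t m)"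
proof -
  have "proj (free_basis R (r \<odot>\<^bsub>L\<^esub> l, m)) = proj (r \<odot>\<^bsub>FF\<^esub> free_basis R (l, m))"
    by (rule relation_imp_proj_eq) (use assms in \<open>auto simp: tensor_relations_def Let_def\<close>)
  then show ?thesis using assms by (simp add: pure_tensor_def linear_maps_smult[OF proj_linear])
qed

lemma pure_smult_right:
  assumes "r \<in> carrier R" "l \<in> carrier L" "m \<in> carrier M"
  shows "l \<otimes>\<^sub>t (r \<odot>\<^bsub>M\<^esub> m) = r \<odot>\<^bsub>TT\<^esub> (l \<otimes>\<^sub>t m)"
proof -
  have "proj (free_basis R (l, r \<odot>\<^bsub>M\<^esub> m)) = proj (r \<odot>\<^bsub>FF\<^esub> free_basis R (l, m))"
    by (rule relation_imp_proj_eq) (use assms in \<open>auto simp: tensor_relations_def Let_def\<close>)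
  then show ?thesis using assms by (simp add: pure_tensor_def linear_maps_smult[OF proj_linear])
qed

lemma pure_zero_left [simp]: "m \<in> carrier M \<Longrightarrow> \<zero>\<^bsub>L\<^esub> \<otimes>\<^sub>t m = \<zero>\<^bsub>TT\<^esub>"
  using pure_smult_left[of "\<zero>\<^bsub>R\<^esub>" "\<zero>\<^bsub>L\<^esub>" m] by simp

lemma pure_zero_right [simp]: "l \<in> carrier L \<Longrightarrow> l \<otimes>\<^sub>t \<zero>\<^bsub>M\<^esub> = \<zero>\<^bsub>TT\<^esub>"
  using pure_smult_right[of "\<zero>\<^bsub>R\<^esub>" l "\<zero>\<^bsub>M\<^esub>"] by simp

lemma tensor_induct [consumes 1, case_names zero add]:
  assumes "z \<in> carrier TT" and zero: "P \<zero>\<^bsub>TT\<^esub>"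
    and step: "\<And>z l m. z \<in> carrier TT \<Longrightarrow> P z \<Longrightarrow> l \<in> carrier L \<Longrightarrow> m \<in> carrier M \<Longrightarrow> P (z \<oplus>\<^bsub>TT\<^esub> l \<otimes>\<^sub>t m)"
  shows "P z"
proof -
  obtain c where c: "c \<in> carrier FF" "z = proj c"
    using assms(1) unfolding tensor_product_def FF.quotient_module_carrier[OF kernel_submodule] by auto
  from c(1) have "P (proj c)"
  proof (induction rule: L.R.free_module_induct)
    case zero
    then show ?case using assms(2) linear_maps_zero[OF FF.module_axioms TT.module_axioms proj_linear] by simp
  next
    case (add c r i)
    obtain l m where i: "i = (l, m)" "l \<in> carrier L" "m \<in> carrier M" using add by auto
    have "proj (c \<oplus>\<^bsub>FF\<^esub> r \<odot>\<^bsub>FF\<^esub> free_basis R i) = proj c \<oplus>\<^bsub>TT\<^esub> (r \<odot>\<^bsub>L\<^esub> l) \<otimes>\<^sub>t m"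
      using add i
      by (simp add: linear_maps_add[OF proj_linear] linear_maps_smult[OF proj_linear] pure_smult_left)
        (simp add: pure_tensor_def)
    then show ?case using step[of "proj c" "r \<odot>\<^bsub>L\<^esub> l" m] add i linear_maps_closed[OF proj_linear] by simp
  qed
  with c show ?thesis by simp
qed

lemma tensor_representation:
  assumes "z \<in> carrier TT"
  shows "\<exists>n l m. (\<forall>i. l i \<in> carrier L) \<and> (\<forall>i. m i \<in> carrier M) \<and> z = nsum TT (\<lambda>i. l i \<otimes>\<^sub>t m i) n"
  using assms
proof (induction rule: tensor_induct)
  case zero
  show ?case by (intro exI[of _ 0] exI[of _ "\<lambda>_. \<zero>\<^bsub>L\<^esub>"] exI[of _ "\<lambda>_. \<zero>\<^bsub>M\<^esub>"]) auto
next
  case (add z l m)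
  then obtain n l' m' where h: "\<forall>i. l' i \<in> carrier L" "\<forall>i. m' i \<in> carrier M"
    "z = nsum TT (\<lambda>i. l' i \<otimes>\<^sub>t m' i) n" by blast
  have "nsum TT (\<lambda>i. (l'(n := l)) i \<otimes>\<^sub>t (m'(n := m)) i) n = z"
    unfolding h(3) by (rule nsum_cong) auto
  then have "z \<oplus>\<^bsub>TT\<^esub> l \<otimes>\<^sub>t m = nsum TT (\<lambda>i. (l'(n := l)) i \<otimes>\<^sub>t (m'(n := m)) i) (Suc n)" by simp
  then show ?case using h(1,2) add
    by (intro exI[of _ "Suc n"] exI[of _ "l'(n := l)"] exI[of _ "m'(n := m)"]) auto
qed

definition bilinear :: "('a, 'v, 'w) module_scheme \<Rightarrow> ('l \<Rightarrow> 'm \<Rightarrow> 'v) \<Rightarrow> bool"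
  where "bilinear V \<beta> \<longleftrightarrow>
    (\<forall>l\<in>carrier L. \<forall>m\<in>carrier M. \<beta> l m \<in> carrier V) \<and>
    (\<forall>l\<in>carrier L. \<forall>l'\<in>carrier L. \<forall>m\<in>carrier M. \<beta> (l \<oplus>\<^bsub>L\<^esub> l') m = \<beta> l m \<oplus>\<^bsub>V\<^esub> \<beta> l' m) \<and>
    (\<forall>l\<in>carrier L. \<forall>m\<in>carrier M. \<forall>m'\<in>carrier M. \<beta> l (m \<oplus>\<^bsub>M\<^esub> m') = \<beta> l m \<oplus>\<^bsub>V\<^esub> \<beta> l m') \<and>
    (\<forall>r\<in>carrier R. \<forall>l\<in>carrier L. \<forall>m\<in>carrier M. \<beta> (r \<odot>\<^bsub>L\<^esub> l) m = r \<odot>\<^bsub>V\<^esub> \<beta> l m) \<and>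
    (\<forall>r\<in>carrier R. \<forall>l\<in>carrier L. \<forall>m\<in>carrier M. \<beta> l (r \<odot>\<^bsub>M\<^esub> m) = r \<odot>\<^bsub>V\<^esub> \<beta> l m)"

text \<open>
  The linear extension of \<open>\<beta>\<close> to the free module on \<open>L \<times> M\<close> kills the defining relations, hence
  the submodule that they span, and so descends to the quotient.
\<close>

lemma bilinear_factor:
  assumes "module R V" "bilinear V \<beta>"
  obtains h where "h \<in> linear_maps R TT V" "\<And>l m. l \<in> carrier L \<Longrightarrow> m \<in> carrier M \<Longrightarrow> h (l \<otimes>\<^sub>t m) = \<beta> l m"
proof -
  interpret V: module R V by fact
  note b = assms(2)[unfolded bilinear_def]
  define H where "H = free_extension R V (\<lambda>(l, m). \<beta> l m)"
  have H: "H \<in> linear_maps R FF V"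
    unfolding H_def using b by (intro V.free_extension_linear) auto
  have Hb: "H (free_basis R (l, m)) = \<beta> l m" if "l \<in> carrier L" "m \<in> carrier M" for l m
    unfolding H_def using b that
    by (subst V.free_extension_basis[where I = "carrier L \<times> carrier M"]) auto
  have Hminus: "H (x \<ominus>\<^bsub>FF\<^esub> y) = H x \<ominus>\<^bsub>V\<^esub> H y" if "x \<in> carrier FF" "y \<in> carrier FF" for x y
    using that by (simp add: a_minus_def linear_maps_add[OF H]
        linear_maps_minus[OF FF.module_axioms V.module_axioms H])
  have "tensor_relations R L M \<subseteq> a_kernel FF V H"
  proof
    fix x assume x: "x \<in> tensor_relations R L M"
    then have "H x = \<zero>\<^bsub>V\<^esub>"
      unfolding tensor_relations_def Let_def using b
      by (auto simp: Hminus linear_maps_add[OF H] linear_maps_smult[OF H] Hb V.M.minus_eq V.M.r_neg)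
    then show "x \<in> a_kernel FF V H" using tensor_relations_subset x by (auto simp: a_kernel_def')
  qed
  then have "tensor_kernel R L M \<subseteq> a_kernel FF V H"
    unfolding tensor_kernel_def
    by (intro FF.module_span_least linear_map_kernel_submodule FF.module_axioms V.module_axioms H)
  then have ker: "H x = \<zero>\<^bsub>V\<^esub>" if "x \<in> tensor_kernel R L M" for x using that by (auto simp: a_kernel_def')
  define h where "h = (\<lambda>X. H (SOME x. x \<in> carrier FF \<and> X = proj x))"
  have h: "h (proj x) = H x" if x: "x \<in> carrier FF" for x
  proof -
    define y where "y = (SOME y. y \<in> carrier FF \<and> proj x = proj y)"
    have y: "y \<in> carrier FF \<and> proj x = proj y" unfolding y_def by (rule someI[of _ x]) (use x in auto)
    then have "x \<ominus>\<^bsub>FF\<^esub> y \<in> tensor_kernel R L M" using FF.coset_eq_iff[OF kernel_submodule] x by blast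
    then have "H x \<ominus>\<^bsub>V\<^esub> H y = \<zero>\<^bsub>V\<^esub>" using ker Hminus x y by metis
    then have "H x = H y" using x y linear_maps_closed[OF H] by (simp add: V.M.minus_eq_zero_iff)
    then show ?thesis by (simp add: h_def y_def)
  qed
  have TTc: "\<exists>x\<in>carrier FF. X = proj x" if "X \<in> carrier TT" for X
    using that unfolding tensor_product_def FF.quotient_module_carrier[OF kernel_submodule] by auto
  have "h \<in> linear_maps R TT V"
  proof (rule linear_mapsI)
    fix X Y assume "X \<in> carrier TT" "Y \<in> carrier TT"
    then obtain x y where "x \<in> carrier FF" "X = proj x" "y \<in> carrier FF" "Y = proj y" using TTc by meson
    then show "h (X \<oplus>\<^bsub>TT\<^esub> Y) = h X \<oplus>\<^bsub>V\<^esub> h Y"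
      by (simp add: linear_maps_add[OF proj_linear, symmetric] h linear_maps_add[OF H])
  next
    fix r X assume "r \<in> carrier R" "X \<in> carrier TT"
    moreover from this obtain x where "x \<in> carrier FF" "X = proj x" using TTc by meson
    ultimately show "h (r \<odot>\<^bsub>TT\<^esub> X) = r \<odot>\<^bsub>V\<^esub> h X"
      by (simp add: linear_maps_smult[OF proj_linear, symmetric] h linear_maps_smult[OF H])
  next
    fix X assume "X \<in> carrier TT"
    then obtain x where "x \<in> carrier FF" "X = proj x" using TTc by meson
    then show "h X \<in> carrier V" by (simp add: h linear_maps_closed[OF H])
  qed
  moreover have "h (l \<otimes>\<^sub>t m) = \<beta> l m" if "l \<in> carrier L" "m \<in> carrier M" for l m
    using that by (simp add: pure_tensor_def h Hb)
  ultimately show ?thesis using that by blast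
qed

lemma linear_maps_TT_eqI:
  assumes "module R V" "h \<in> linear_maps R TT V" "h' \<in> linear_maps R TT V"
    and eq: "\<And>l m. l \<in> carrier L \<Longrightarrow> m \<in> carrier M \<Longrightarrow> h (l \<otimes>\<^sub>t m) = h' (l \<otimes>\<^sub>t m)"
    and "z \<in> carrier TT"
  shows "h z = h' z"
  using \<open>z \<in> carrier TT\<close>
proof (induction rule: tensor_induct)
  case zero
  show ?case by (metis linear_maps_zero[OF TT.module_axioms assms(1)] assms(2,3))
next
  case (add z l m)
  then show ?case by (simp add: linear_maps_add[OF assms(2)] linear_maps_add[OF assms(3)] eq)
qed

end

text \<open>
  The definite description in \<^const>\<open>tensor_map\<close> denotes: the universal property provides such a
  map, and pure tensors generate, so two extensional ones agree.
\<close>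

lemma
  assumes "module R L" "module R M" "module R L'" "module R M'"
    and f: "f \<in> linear_maps R L L'" and g: "g \<in> linear_maps R M M'"
  shows tensor_map_linear:
      "tensor_map R L M L' M' f g \<in> linear_maps R (tensor_product R L M) (tensor_product R L' M')"
    and tensor_map_pure: "\<And>l m. l \<in> carrier L \<Longrightarrow> m \<in> carrier M \<Longrightarrow>
      tensor_map R L M L' M' f g (pure_tensor R L M l m) = pure_tensor R L' M' (f l) (g m)"
proof -
  interpret A: tensor_pair R L M using assms by (intro tensor_pair.intro)
  interpret B: tensor_pair R L' M' using assms by (intro tensor_pair.intro)
  define P where "P = (\<lambda>h. h \<in> linear_maps R A.TT B.TT \<and>
       h \<in> extensional (carrier A.TT) \<and>
       (\<forall>l\<in>carrier L. \<forall>m\<in>carrier M. h (pure_tensor R L M l m) = pure_tensor R L' M' (f l) (g m)))"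
  have "A.bilinear B.TT (\<lambda>l m. pure_tensor R L' M' (f l) (g m))"
    unfolding A.bilinear_def
    by (simp add: linear_maps_closed[OF f] linear_maps_closed[OF g] linear_maps_add[OF f]
        linear_maps_add[OF g] linear_maps_smult[OF f] linear_maps_smult[OF g]
        B.pure_add_left B.pure_add_right B.pure_smult_left B.pure_smult_right)
  then obtain h where h: "h \<in> linear_maps R A.TT B.TT"
    "\<And>l m. l \<in> carrier L \<Longrightarrow> m \<in> carrier M \<Longrightarrow> h (pure_tensor R L M l m) = pure_tensor R L' M' (f l) (g m)"
    using A.bilinear_factor[OF B.TT.module_axioms] by blast
  have "P (restrict h (carrier A.TT))"
    unfolding P_def using h by (auto simp: linear_maps_def)
  moreover have "k = k'" if k: "P k" and k': "P k'" for k k'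
  proof (rule extensionalityI[of _ "carrier A.TT"])
    show "k \<in> extensional (carrier A.TT)" "k' \<in> extensional (carrier A.TT)"
      using k k' unfolding P_def by blast+
    have lin: "k \<in> linear_maps R A.TT B.TT" "k' \<in> linear_maps R A.TT B.TT"
      using k k' unfolding P_def by blast+
    have eq: "k (pure_tensor R L M l m) = k' (pure_tensor R L M l m)"
      if "l \<in> carrier L" "m \<in> carrier M" for l m
      using k k' that unfolding P_def by metis
    show "k z = k' z" if "z \<in> carrier A.TT" for z
      using A.linear_maps_TT_eqI[OF B.TT.module_axioms lin eq that] .
  qed
  ultimately have "P (THE h. P h)" by (metis theI')
  then have *: "P (tensor_map R L M L' M' f g)" unfolding tensor_map_def P_def by simp
  from * show "tensor_map R L M L' M' f g \<in> linear_maps R A.TT B.TT" unfolding P_def by simp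
  fix l m assume "l \<in> carrier L" "m \<in> carrier M"
  with * show "tensor_map R L M L' M' f g (pure_tensor R L M l m) = pure_tensor R L' M' (f l) (g m)"
    unfolding P_def by simp
qed

section \<open>Vectors of relations\<close>

text \<open>
  The additive span of the vectors \<open>k y = (k\<^sub>i y)\<^sub>i\<close> in \<open>M\<^sup>I\<close>. If \<open>K\<close> is a module of coefficient
  vectors, this is \<open>K M\<close>, the image of \<open>K \<otimes> M\<close>; it is also meaningful for infinite index sets.
\<close>

inductive_set coeff_span :: "('a, 'm, 'z) module_scheme \<Rightarrow> ('i \<Rightarrow> 'a) set \<Rightarrow> ('i \<Rightarrow> 'm) set"
  for M :: "('a, 'm, 'z) module_scheme" and K :: "('i \<Rightarrow> 'a) set"
  where
    zero: "(\<lambda>i. \<zero>\<^bsub>M\<^esub>) \<in> coeff_span M K"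
  | add: "v \<in> coeff_span M K \<Longrightarrow> k \<in> K \<Longrightarrow> y \<in> carrier M \<Longrightarrow>
      (\<lambda>i. v i \<oplus>\<^bsub>M\<^esub> k i \<odot>\<^bsub>M\<^esub> y) \<in> coeff_span M K"

definition coeffs :: "('a, 'x) ring_scheme \<Rightarrow> ('i \<Rightarrow> 'a) set \<Rightarrow> bool"
  where "coeffs R K \<longleftrightarrow> (\<forall>k\<in>K. \<forall>i. k i \<in> carrier R)"

lemma coeffsD: "coeffs R K \<Longrightarrow> k \<in> K \<Longrightarrow> k i \<in> carrier R"
  unfolding coeffs_def by blast

definition syzygies ::
  "('a, 'x) ring_scheme \<Rightarrow> ('a, 'l, 'y) module_scheme \<Rightarrow> nat \<Rightarrow> (nat \<Rightarrow> 'l) \<Rightarrow> (nat \<Rightarrow> 'a) set"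
  where "syzygies R L n l =
    {k. (\<forall>i. k i \<in> carrier R) \<and> nsum L (\<lambda>i. k i \<odot>\<^bsub>L\<^esub> l i) n = \<zero>\<^bsub>L\<^esub>}"

text \<open>
  If \<open>m\<^sub>i = \<Sum>\<^sub>j a\<^sub>i\<^sub>j y\<^sub>j\<close> and \<open>\<Sum>\<^sub>i a\<^sub>i\<^sub>j l\<^sub>i = 0\<close> for all \<open>j\<close>, then \<open>\<Sum>\<^sub>i l\<^sub>i \<otimes> m\<^sub>i = 0\<close> for an obvious
  reason. Vectors are total functions, and only the entries below \<open>n\<close> are compared.
\<close>

definition trivial_relation ::
  "('a, 'x) ring_scheme \<Rightarrow> ('a, 'l, 'y) module_scheme \<Rightarrow> ('a, 'm, 'z) module_scheme \<Rightarrow>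
   nat \<Rightarrow> (nat \<Rightarrow> 'l) \<Rightarrow> (nat \<Rightarrow> 'm) \<Rightarrow> bool"
  where "trivial_relation R L M n l m \<longleftrightarrow>
    (\<exists>v\<in>coeff_span M (syzygies R L n l). \<forall>i<n. v i = m i)"

text \<open>
  The equational criterion for flatness. It quantifies over elements only, so no universe of test
  modules enters.
\<close>

definition equationally_flat :: "('a, 'x) ring_scheme \<Rightarrow> ('a, 'm, 'z) module_scheme \<Rightarrow> bool"
  where "equationally_flat R M \<longleftrightarrow>
    (\<forall>n r m. (\<forall>i. r i \<in> carrier R) \<and> (\<forall>i. m i \<in> carrier M) \<and>
       nsum M (\<lambda>i. r i \<odot>\<^bsub>M\<^esub> m i) n = \<zero>\<^bsub>M\<^esub> \<longrightarrow>
       trivial_relation R (ring_as_module R) M n r m)"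

lemma nsum_ring_as_module [simp]: "nsum (ring_as_module R) f n = nsum R f n"
  by (induction n) (auto simp: ring_as_module_def)

lemma ring_as_module_simps [simp]:
  "carrier (ring_as_module R) = carrier R" "zero (ring_as_module R) = zero R"
  "add (ring_as_module R) = add R" "smult (ring_as_module R) = mult R"
  by (auto simp: ring_as_module_def)

lemma (in cring) ring_as_module_is_module: "module R (ring_as_module R)"
proof (rule moduleI)
  have inv: "\<exists>y\<in>carrier R. y \<oplus> x = \<zero>" if "x \<in> carrier R" for x
    using that by (intro bexI[of _ "\<ominus> x"]) (auto simp: l_neg)
  show "abelian_group (ring_as_module R)"
    by (rule abelian_groupI) (auto simp: a_ac inv)
qed (auto simp: is_cring l_distr r_distr m_assoc)

lemma trivial_relation_cong:
  assumes "\<And>i. i < n \<Longrightarrow> l i = l' i" "\<And>i. i < n \<Longrightarrow> m i = m' i"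
  shows "trivial_relation R L M n l m \<longleftrightarrow> trivial_relation R L M n l' m'"
proof -
  have "nsum L (\<lambda>i. k i \<odot>\<^bsub>L\<^esub> l i) n = nsum L (\<lambda>i. k i \<odot>\<^bsub>L\<^esub> l' i) n" for k
    using assms by (intro nsum_cong) auto
  then show ?thesis unfolding trivial_relation_def syzygies_def using assms by simp
qed

lemma coeff_span_mono: "K \<subseteq> K' \<Longrightarrow> v \<in> coeff_span M K \<Longrightarrow> v \<in> coeff_span M K'"
  by (rotate_tac 1, induction rule: coeff_span.induct) (auto intro: coeff_span.intros)

lemma syzygies_coeffs: "coeffs R (syzygies R L n l)"
  by (auto simp: syzygies_def coeffs_def)

context module
begin

lemma combination_add:
  assumes "\<And>i. i < n \<Longrightarrow> k i \<in> carrier R" "\<And>i. i < n \<Longrightarrow> k' i \<in> carrier R"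
    "\<And>i. i < n \<Longrightarrow> b i \<in> carrier M"
  shows "nsum M (\<lambda>i. (k i \<oplus> k' i) \<odot>\<^bsub>M\<^esub> b i) n =
    nsum M (\<lambda>i. k i \<odot>\<^bsub>M\<^esub> b i) n \<oplus>\<^bsub>M\<^esub> nsum M (\<lambda>i. k' i \<odot>\<^bsub>M\<^esub> b i) n"
proof -
  have "nsum M (\<lambda>i. (k i \<oplus> k' i) \<odot>\<^bsub>M\<^esub> b i) n = nsum M (\<lambda>i. k i \<odot>\<^bsub>M\<^esub> b i \<oplus>\<^bsub>M\<^esub> k' i \<odot>\<^bsub>M\<^esub> b i) n"
    using assms by (intro nsum_cong) (auto simp: smult_l_distr)
  then show ?thesis using assms by (simp add: M.nsum_add)
qed

lemma combination_smult:
  assumes "r \<in> carrier R" "\<And>i. i < n \<Longrightarrow> k i \<in> carrier R" "\<And>i. i < n \<Longrightarrow> b i \<in> carrier M"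
  shows "nsum M (\<lambda>i. (r \<otimes> k i) \<odot>\<^bsub>M\<^esub> b i) n = r \<odot>\<^bsub>M\<^esub> nsum M (\<lambda>i. k i \<odot>\<^bsub>M\<^esub> b i) n"
proof -
  have "nsum M (\<lambda>i. (r \<otimes> k i) \<odot>\<^bsub>M\<^esub> b i) n = nsum M (\<lambda>i. r \<odot>\<^bsub>M\<^esub> (k i \<odot>\<^bsub>M\<^esub> b i)) n"
    using assms by (intro nsum_cong) (auto simp: smult_assoc1)
  then show ?thesis using assms by (simp add: nsum_smult)
qed

lemma combination_minus:
  assumes "\<And>i. i < n \<Longrightarrow> k i \<in> carrier R" "\<And>i. i < n \<Longrightarrow> b i \<in> carrier M"
  shows "nsum M (\<lambda>i. (\<ominus> k i) \<odot>\<^bsub>M\<^esub> b i) n = \<ominus>\<^bsub>M\<^esub> nsum M (\<lambda>i. k i \<odot>\<^bsub>M\<^esub> b i) n"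
proof -
  have "nsum M (\<lambda>i. (\<ominus> k i) \<odot>\<^bsub>M\<^esub> b i) n = nsum M (\<lambda>i. \<ominus>\<^bsub>M\<^esub> (k i \<odot>\<^bsub>M\<^esub> b i)) n"
    using assms by (intro nsum_cong) (auto simp: smult_l_minus)
  then show ?thesis using assms by (simp add: nsum_minus)
qed

lemma combination_delta:
  assumes "j < n" "\<And>i. i < n \<Longrightarrow> b i \<in> carrier M"
  shows "nsum M (\<lambda>i. (if i = j then \<one> else \<zero>) \<odot>\<^bsub>M\<^esub> b i) n = b j"
proof -
  have "nsum M (\<lambda>i. (if i = j then \<one> else \<zero>) \<odot>\<^bsub>M\<^esub> b i) n = nsum M (\<lambda>i. if i = j then b j else \<zero>\<^bsub>M\<^esub>) n"
    using assms by (intro nsum_cong) auto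
  then show ?thesis using assms by (simp add: M.nsum_delta)
qed

text \<open>The associative law for a row vector, a matrix and a column of module elements.\<close>

lemma combination_assoc:
  assumes "\<And>j. j < N \<Longrightarrow> e j \<in> carrier R" "\<And>i j. i < n \<Longrightarrow> j < N \<Longrightarrow> a j i \<in> carrier R"
    "\<And>i. i < n \<Longrightarrow> b i \<in> carrier M"
  shows "nsum M (\<lambda>i. nsum R (\<lambda>j. e j \<otimes> a j i) N \<odot>\<^bsub>M\<^esub> b i) n =
    nsum M (\<lambda>j. e j \<odot>\<^bsub>M\<^esub> nsum M (\<lambda>i. a j i \<odot>\<^bsub>M\<^esub> b i) n) N"
proof -
  have "nsum M (\<lambda>i. nsum R (\<lambda>j. e j \<otimes> a j i) N \<odot>\<^bsub>M\<^esub> b i) n =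
    nsum M (\<lambda>i. nsum M (\<lambda>j. (e j \<otimes> a j i) \<odot>\<^bsub>M\<^esub> b i) N) n"
    using assms by (intro nsum_cong nsum_smult_left) auto
  also have "\<dots> = nsum M (\<lambda>j. nsum M (\<lambda>i. (e j \<otimes> a j i) \<odot>\<^bsub>M\<^esub> b i) n) N"
    using assms by (intro M.nsum_swap) auto
  also have "\<dots> = nsum M (\<lambda>j. e j \<odot>\<^bsub>M\<^esub> nsum M (\<lambda>i. a j i \<odot>\<^bsub>M\<^esub> b i) n) N"
    using assms by (intro nsum_cong combination_smult) auto
  finally show ?thesis .
qed

context
  fixes K :: "('i \<Rightarrow> 'a) set"
  assumes K: "coeffs R K"
begin

private lemmas Kc = coeffsD[OF K]

lemma coeff_span_closed: "v \<in> coeff_span M K \<Longrightarrow> v i \<in> carrier M"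
  by (induction rule: coeff_span.induct) (auto simp: Kc)

lemma coeff_span_single:
  assumes "k \<in> K" "y \<in> carrier M"
  shows "(\<lambda>i. k i \<odot>\<^bsub>M\<^esub> y) \<in> coeff_span M K"
  using coeff_span.add[OF coeff_span.zero assms] assms Kc by simp

lemma coeff_span_plus:
  assumes "w \<in> coeff_span M K" "v \<in> coeff_span M K"
  shows "(\<lambda>i. v i \<oplus>\<^bsub>M\<^esub> w i) \<in> coeff_span M K"
  using assms
proof (induction rule: coeff_span.induct)
  case zero
  then show ?case using coeff_span_closed[OF zero] by simp
next
  case (add u k y)
  have "(\<lambda>i. (v i \<oplus>\<^bsub>M\<^esub> u i) \<oplus>\<^bsub>M\<^esub> k i \<odot>\<^bsub>M\<^esub> y) \<in> coeff_span M K"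
    using add by (intro coeff_span.add) auto
  then show ?case using add coeff_span_closed by (simp add: M.a_assoc Kc)
qed

lemma coeff_span_smult:
  assumes "r \<in> carrier R" "v \<in> coeff_span M K"
  shows "(\<lambda>i. r \<odot>\<^bsub>M\<^esub> v i) \<in> coeff_span M K"
  using assms(2)
proof (induction rule: coeff_span.induct)
  case zero
  then show ?case using coeff_span.zero assms by simp
next
  case (add u k y)
  have "(\<lambda>i. r \<odot>\<^bsub>M\<^esub> u i \<oplus>\<^bsub>M\<^esub> k i \<odot>\<^bsub>M\<^esub> (r \<odot>\<^bsub>M\<^esub> y)) \<in> coeff_span M K"
    using add assms by (intro coeff_span.add) auto
  moreover have "r \<odot>\<^bsub>M\<^esub> (u i \<oplus>\<^bsub>M\<^esub> k i \<odot>\<^bsub>M\<^esub> y) = r \<odot>\<^bsub>M\<^esub> u i \<oplus>\<^bsub>M\<^esub> k i \<odot>\<^bsub>M\<^esub> (r \<odot>\<^bsub>M\<^esub> y)" for i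
    using add assms coeff_span_closed
    by (simp add: smult_r_distr Kc smult_assoc1[symmetric] R.m_comm)
  ultimately show ?case by simp
qed

lemma coeff_span_sum:
  assumes "\<And>j. j < N \<Longrightarrow> k j \<in> K" "\<And>j. j < N \<Longrightarrow> y j \<in> carrier M"
  shows "(\<lambda>i. nsum M (\<lambda>j. k j i \<odot>\<^bsub>M\<^esub> y j) N) \<in> coeff_span M K"
  using assms by (induction N) (auto intro: coeff_span.zero coeff_span.add)

lemma coeff_span_representation:
  assumes "v \<in> coeff_span M K"
  shows "\<exists>N k y. (\<forall>j<N. k j \<in> K) \<and> (\<forall>j<N. y j \<in> carrier M) \<and>
    (\<forall>i. v i = nsum M (\<lambda>j. k j i \<odot>\<^bsub>M\<^esub> y j) N)"
  using assms
proof (induction rule: coeff_span.induct)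
  case zero
  then show ?case by (intro exI[of _ 0]) auto
next
  case (add v k y)
  then obtain N k' y' where h: "\<forall>j<N. k' j \<in> K" "\<forall>j<N. y' j \<in> carrier M"
    "\<forall>i. v i = nsum M (\<lambda>j. k' j i \<odot>\<^bsub>M\<^esub> y' j) N" by blast
  have "nsum M (\<lambda>j. (k'(N := k)) j i \<odot>\<^bsub>M\<^esub> (y'(N := y)) j) N = v i" for i
    unfolding h(3)[rule_format] by (rule nsum_cong) auto
  then show ?case using h(1,2) add
    by (intro exI[of _ "Suc N"] exI[of _ "k'(N := k)"] exI[of _ "y'(N := y)"])
      (auto simp: less_Suc_eq)
qed

end

text \<open>
  A matrix acts in the same way on vectors of coefficients and on vectors of module elements.
\<close>

lemma coeff_span_matrix:
  assumes "v \<in> coeff_span M K" and K: "coeffs R K"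
    and K': "coeffs R K'"
    and a: "\<And>i j. j < N \<Longrightarrow> a i j \<in> carrier R"
    and push: "\<And>k. k \<in> K \<Longrightarrow> (\<lambda>i. nsum R (\<lambda>j. a i j \<otimes> k j) N) \<in> K'"
  shows "(\<lambda>i. nsum M (\<lambda>j. a i j \<odot>\<^bsub>M\<^esub> v j) N) \<in> coeff_span M K'"
  using assms(1)
proof (induction rule: coeff_span.induct)
  case zero
  have "nsum M (\<lambda>j. a i j \<odot>\<^bsub>M\<^esub> \<zero>\<^bsub>M\<^esub>) N = \<zero>\<^bsub>M\<^esub>" for i using a by (intro M.nsum_zero) auto
  then show ?case using coeff_span.zero by simp
next
  case (add v k y)
  have v: "v j \<in> carrier M" for j using coeff_span_closed[OF K] add by blast
  note Kc = coeffsD[OF K]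
  have "nsum M (\<lambda>j. a i j \<odot>\<^bsub>M\<^esub> (v j \<oplus>\<^bsub>M\<^esub> k j \<odot>\<^bsub>M\<^esub> y)) N =
    nsum M (\<lambda>j. a i j \<odot>\<^bsub>M\<^esub> v j) N \<oplus>\<^bsub>M\<^esub> nsum R (\<lambda>j. a i j \<otimes> k j) N \<odot>\<^bsub>M\<^esub> y" for i
  proof -
    have "nsum M (\<lambda>j. a i j \<odot>\<^bsub>M\<^esub> (v j \<oplus>\<^bsub>M\<^esub> k j \<odot>\<^bsub>M\<^esub> y)) N =
      nsum M (\<lambda>j. a i j \<odot>\<^bsub>M\<^esub> v j \<oplus>\<^bsub>M\<^esub> (a i j \<otimes> k j) \<odot>\<^bsub>M\<^esub> y) N"
      using a v Kc add by (intro nsum_cong) (auto simp: smult_r_distr smult_assoc1)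
    also have "\<dots> = nsum M (\<lambda>j. a i j \<odot>\<^bsub>M\<^esub> v j) N \<oplus>\<^bsub>M\<^esub> nsum M (\<lambda>j. (a i j \<otimes> k j) \<odot>\<^bsub>M\<^esub> y) N"
      using a v Kc add by (intro M.nsum_add) auto
    also have "nsum M (\<lambda>j. (a i j \<otimes> k j) \<odot>\<^bsub>M\<^esub> y) N = nsum R (\<lambda>j. a i j \<otimes> k j) N \<odot>\<^bsub>M\<^esub> y"
      using a Kc add by (intro nsum_smult_left[symmetric]) auto
    finally show ?thesis .
  qed
  then show ?case using coeff_span.add[OF add.IH push[OF add.hyps(2)] add.hyps(3)] by simp
qed

end

lemma equationally_flatD:
  assumes "equationally_flat R M" "module R M"
    "\<And>i. i < n \<Longrightarrow> r i \<in> carrier R" "\<And>i. i < n \<Longrightarrow> m i \<in> carrier M"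
    "nsum M (\<lambda>i. r i \<odot>\<^bsub>M\<^esub> m i) n = \<zero>\<^bsub>M\<^esub>"
  shows "trivial_relation R (ring_as_module R) M n r m"
proof -
  interpret module R M by fact
  define r' where "r' = (\<lambda>i. if i < n then r i else \<zero>\<^bsub>R\<^esub>)"
  define m' where "m' = (\<lambda>i. if i < n then m i else \<zero>\<^bsub>M\<^esub>)"
  have "nsum M (\<lambda>i. r' i \<odot>\<^bsub>M\<^esub> m' i) n = nsum M (\<lambda>i. r i \<odot>\<^bsub>M\<^esub> m i) n"
    by (rule nsum_cong) (auto simp: r'_def m'_def)
  then have "trivial_relation R (ring_as_module R) M n r' m'"
    using assms(1,3-5) unfolding equationally_flat_def
    by (metis (no_types, lifting) M.zero_closed R.zero_closed m'_def r'_def)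
  then show ?thesis
    by (subst trivial_relation_cong[of n r r' m m']) (auto simp: r'_def m'_def)
qed

section \<open>When a tensor vanishes\<close>

definition function_module :: "('a, 'm, 'z) module_scheme \<Rightarrow> ('a, 'i \<Rightarrow> 'm) module"
  where "function_module M =
    \<lparr>carrier = {f. \<forall>i. f i \<in> carrier M}, mult = undefined, one = undefined, zero = (\<lambda>i. \<zero>\<^bsub>M\<^esub>),
     add = (\<lambda>f g i. f i \<oplus>\<^bsub>M\<^esub> g i), smult = (\<lambda>r f i. r \<odot>\<^bsub>M\<^esub> f i)\<rparr>"

lemma (in module) function_module_is_module: "module R (function_module M)"
proof (rule moduleI)
  have inv: "\<exists>y. (\<forall>i. y i \<in> carrier M) \<and> (\<lambda>i. x i \<oplus>\<^bsub>M\<^esub> y i) = (\<lambda>i. \<zero>\<^bsub>M\<^esub>)" if "\<forall>i. x i \<in> carrier M" for x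
    using that by (intro exI[of _ "\<lambda>i. \<ominus>\<^bsub>M\<^esub> x i"]) (auto simp: M.r_neg)
  show "abelian_group (function_module M)"
    by (rule abelian_groupI) (auto simp: function_module_def M.a_ac inv)
qed (auto simp: function_module_def R.is_cring smult_l_distr smult_r_distr smult_assoc1)

lemma nsum_function_module: "nsum (function_module M) f n = (\<lambda>i. nsum M (\<lambda>j. f j i) n)"
  by (induction n) (auto simp: function_module_def)

lemma nsum_free_module: "nsum (free_module R I) f n = (\<lambda>i. nsum R (\<lambda>j. f j i) n)"
  by (induction n) (auto simp: free_module_def)

lemma (in module) coeff_span_submodule:
  assumes "coeffs R K"
  shows "submodule (coeff_span M K) R (function_module M)"
proof -
  interpret V: module R "function_module M" by (rule function_module_is_module)
  show ?thesis
    by (rule V.submoduleI')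
      (use coeff_span_closed[OF assms] coeff_span_plus[OF assms] coeff_span_smult[OF assms] in
        \<open>auto simp: function_module_def intro: coeff_span.zero\<close>)
qed

lemma (in module) coset_eqI:
  assumes "submodule N R M" "x \<in> carrier M" "y \<in> carrier M" "w \<in> N" "x = w \<oplus>\<^bsub>M\<^esub> y"
  shows "N +>\<^bsub>M\<^esub> x = N +>\<^bsub>M\<^esub> y"
proof -
  have w: "w \<in> carrier M" using assms submoduleE(1) by blast
  have "x \<ominus>\<^bsub>M\<^esub> y = w" using w assms by (simp add: a_minus_def M.a_assoc M.r_neg)
  then show ?thesis using assms by (simp add: coset_eq_iff)
qed

context tensor_pair
begin

text \<open>
  If \<open>c\<close> is linear modulo \<open>K\<close>, then \<open>(l, m) \<mapsto> c(l) m\<close> is bilinear with values in \<open>M\<^sup>I\<close> modulo the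
  span of \<open>K\<close>, and the universal property applies. It is used with two kinds of coordinates \<open>c\<close>:
  those with respect to finitely many generators of \<open>L\<close>, where \<open>K\<close> consists of syzygies, and the
  basis vectors of the free module on all elements of \<open>L\<close>.
\<close>

lemma tensor_sum_zeroD:
  fixes c :: "'l \<Rightarrow> 'i \<Rightarrow> 'a"
  assumes K: "coeffs R K"
    and c: "\<And>l i. l \<in> carrier L \<Longrightarrow> c l i \<in> carrier R"
    and c_add: "\<And>l l'. l \<in> carrier L \<Longrightarrow> l' \<in> carrier L \<Longrightarrow>
      \<exists>k\<in>K. \<forall>i. c (l \<oplus>\<^bsub>L\<^esub> l') i = k i \<oplus> (c l i \<oplus> c l' i)"
    and c_smult: "\<And>r l. r \<in> carrier R \<Longrightarrow> l \<in> carrier L \<Longrightarrow> \<exists>k\<in>K. \<forall>i. c (r \<odot>\<^bsub>L\<^esub> l) i = k i \<oplus> r \<otimes> c l i"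
    and l: "\<And>j. j < n \<Longrightarrow> l j \<in> carrier L" and m: "\<And>j. j < n \<Longrightarrow> m j \<in> carrier M"
    and zero: "nsum TT (\<lambda>j. l j \<otimes>\<^sub>t m j) n = \<zero>\<^bsub>TT\<^esub>"
  shows "(\<lambda>i. nsum M (\<lambda>j. c (l j) i \<odot>\<^bsub>M\<^esub> m j) n) \<in> coeff_span M K"
proof -
  define V where "V = (function_module M :: ('a, 'i \<Rightarrow> 'm) module)"
  define W where "W = coeff_span M K"
  interpret V: module R V unfolding V_def by (rule M.function_module_is_module)
  have W: "submodule W R V" unfolding V_def W_def by (rule M.coeff_span_submodule[OF K])
  interpret Q: module R "quotient_module V W" by (rule V.quotient_is_module[OF W])
  define u where "u = (\<lambda>l m i. c l i \<odot>\<^bsub>M\<^esub> m)"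
  have u: "u l m \<in> carrier V" if "l \<in> carrier L" "m \<in> carrier M" for l m
    using that c by (auto simp: V_def function_module_def u_def)
  have add: "x \<oplus>\<^bsub>V\<^esub> y = (\<lambda>i. x i \<oplus>\<^bsub>M\<^esub> y i)" "r \<odot>\<^bsub>V\<^esub> x = (\<lambda>i. r \<odot>\<^bsub>M\<^esub> x i)" for x y r
    by (auto simp: V_def function_module_def)
  let ?\<beta> = "\<lambda>l m. W +>\<^bsub>V\<^esub> u l m"
  have "bilinear (quotient_module V W) ?\<beta>"
    unfolding bilinear_def
  proof (intro conjI ballI)
    fix l m assume l: "l \<in> carrier L" and m: "m \<in> carrier M"
    show "?\<beta> l m \<in> carrier (quotient_module V W)"
      using u[OF l m] by (simp add: V.quotient_module_carrier[OF W])
    {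
      fix l' assume l': "l' \<in> carrier L"
      obtain k where k: "k \<in> K" "\<And>i. c (l \<oplus>\<^bsub>L\<^esub> l') i = k i \<oplus> (c l i \<oplus> c l' i)"
        using c_add[OF l l'] by blast
      have "?\<beta> (l \<oplus>\<^bsub>L\<^esub> l') m = W +>\<^bsub>V\<^esub> (u l m \<oplus>\<^bsub>V\<^esub> u l' m)"
      proof (rule V.coset_eqI[OF W])
        show "(\<lambda>i. k i \<odot>\<^bsub>M\<^esub> m) \<in> W" unfolding W_def using M.coeff_span_single[OF K] k(1) m by blast
        show "u (l \<oplus>\<^bsub>L\<^esub> l') m = (\<lambda>i. k i \<odot>\<^bsub>M\<^esub> m) \<oplus>\<^bsub>V\<^esub> (u l m \<oplus>\<^bsub>V\<^esub> u l' m)"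
          using coeffsD[OF K k(1)] c l l' m by (simp add: add u_def k(2) M.smult_l_distr)
      qed (use u l l' m in auto)
      then show "?\<beta> (l \<oplus>\<^bsub>L\<^esub> l') m = ?\<beta> l m \<oplus>\<^bsub>quotient_module V W\<^esub> ?\<beta> l' m"
        using u l l' m by (simp add: V.coset_add[OF W])
    next
      fix m' assume m': "m' \<in> carrier M"
      have "u l (m \<oplus>\<^bsub>M\<^esub> m') = u l m \<oplus>\<^bsub>V\<^esub> u l m'"
        using c l m m' by (simp add: add u_def M.smult_r_distr)
      then show "?\<beta> l (m \<oplus>\<^bsub>M\<^esub> m') = ?\<beta> l m \<oplus>\<^bsub>quotient_module V W\<^esub> ?\<beta> l m'"
        using u l m m' by (simp add: V.coset_add[OF W])
    }
  next
    fix r l m assume r: "r \<in> carrier R" and l: "l \<in> carrier L" and m: "m \<in> carrier M"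
    obtain k where k: "k \<in> K" "\<And>i. c (r \<odot>\<^bsub>L\<^esub> l) i = k i \<oplus> r \<otimes> c l i"
      using c_smult[OF r l] by blast
    have "?\<beta> (r \<odot>\<^bsub>L\<^esub> l) m = W +>\<^bsub>V\<^esub> (r \<odot>\<^bsub>V\<^esub> u l m)"
    proof (rule V.coset_eqI[OF W])
      show "(\<lambda>i. k i \<odot>\<^bsub>M\<^esub> m) \<in> W" unfolding W_def using M.coeff_span_single[OF K] k(1) m by blast
      show "u (r \<odot>\<^bsub>L\<^esub> l) m = (\<lambda>i. k i \<odot>\<^bsub>M\<^esub> m) \<oplus>\<^bsub>V\<^esub> (r \<odot>\<^bsub>V\<^esub> u l m)"
        using coeffsD[OF K k(1)] c r l m by (simp add: add u_def k(2) M.smult_l_distr M.smult_assoc1)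
    qed (use u r l m in auto)
    then show "?\<beta> (r \<odot>\<^bsub>L\<^esub> l) m = r \<odot>\<^bsub>quotient_module V W\<^esub> ?\<beta> l m"
      using u r l m by (simp add: V.coset_smult[OF W])
    have "u l (r \<odot>\<^bsub>M\<^esub> m) = r \<odot>\<^bsub>V\<^esub> u l m"
      using c r l m by (simp add: add u_def M.smult_assoc1[symmetric] L.R.m_comm)
    then show "?\<beta> l (r \<odot>\<^bsub>M\<^esub> m) = r \<odot>\<^bsub>quotient_module V W\<^esub> ?\<beta> l m"
      using u r l m by (simp add: V.coset_smult[OF W])
  qed
  then obtain h where h: "h \<in> linear_maps R TT (quotient_module V W)"
    "\<And>l m. l \<in> carrier L \<Longrightarrow> m \<in> carrier M \<Longrightarrow> h (l \<otimes>\<^sub>t m) = ?\<beta> l m"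
    using bilinear_factor[OF Q.module_axioms] by blast
  have "\<zero>\<^bsub>quotient_module V W\<^esub> = h (nsum TT (\<lambda>j. l j \<otimes>\<^sub>t m j) n)"
    unfolding zero using linear_maps_zero[OF TT.module_axioms Q.module_axioms h(1)] by simp
  also have "\<dots> = nsum (quotient_module V W) (\<lambda>j. h (l j \<otimes>\<^sub>t m j)) n"
    using l m by (intro linear_maps_nsum[OF TT.module_axioms Q.module_axioms h(1)]) auto
  also have "\<dots> = nsum (quotient_module V W) (\<lambda>j. W +>\<^bsub>V\<^esub> u (l j) (m j)) n"
    using l m h(2) by (intro nsum_cong) auto
  also have "\<dots> = W +>\<^bsub>V\<^esub> nsum V (\<lambda>j. u (l j) (m j)) n"
    using l m u
    by (intro linear_maps_nsum[OF V.module_axioms Q.module_axioms V.coset_linear[OF W], symmetric]) auto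
  finally have "nsum V (\<lambda>j. u (l j) (m j)) n \<in> W"
    using V.coset_eq_zero_iff[OF W, of "nsum V (\<lambda>j. u (l j) (m j)) n"] u l m by auto
  then show ?thesis unfolding V_def W_def u_def nsum_function_module .
qed

text \<open>
  Coordinates with respect to the generators \<open>b\<close> are linear up to syzygies. The coordinates chosen
  for \<open>b\<^sub>j\<close> itself need not be the \<open>j\<close>-th unit vector, but they differ from it by a syzygy.
\<close>

lemma generated_tensor_zeroD:
  assumes b: "\<And>i. i < n \<Longrightarrow> b i \<in> carrier L"
    and gen: "\<And>x. x \<in> carrier L \<Longrightarrow> \<exists>k. (\<forall>i. k i \<in> carrier R) \<and> x = nsum L (\<lambda>i. k i \<odot>\<^bsub>L\<^esub> b i) n"
    and m: "\<And>i. i < n \<Longrightarrow> m i \<in> carrier M"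
    and zero: "nsum TT (\<lambda>i. b i \<otimes>\<^sub>t m i) n = \<zero>\<^bsub>TT\<^esub>"
  shows "trivial_relation R L M n b m"
proof -
  let ?S = "syzygies R L n b"
  note S = syzygies_coeffs[of R L n b]
  define c where "c = (\<lambda>x. SOME k. (\<forall>i. k i \<in> carrier R) \<and> x = nsum L (\<lambda>i. k i \<odot>\<^bsub>L\<^esub> b i) n)"
  have c: "c x i \<in> carrier R" "nsum L (\<lambda>i. c x i \<odot>\<^bsub>L\<^esub> b i) n = x" if "x \<in> carrier L" for x i
    using someI_ex[OF gen[OF that]] unfolding c_def by auto
  have v: "(\<lambda>i. nsum M (\<lambda>j. c (b j) i \<odot>\<^bsub>M\<^esub> m j) n) \<in> coeff_span M ?S"
  proof (rule tensor_sum_zeroD[OF S c(1) _ _ b m zero])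
    fix x y assume x: "x \<in> carrier L" and y: "y \<in> carrier L"
    let ?k = "\<lambda>i. c (x \<oplus>\<^bsub>L\<^esub> y) i \<oplus> (\<ominus> (c x i \<oplus> c y i))"
    have "nsum L (\<lambda>i. ?k i \<odot>\<^bsub>L\<^esub> b i) n = \<zero>\<^bsub>L\<^esub>"
      using x y b by (simp add: L.combination_add L.combination_minus c L.M.r_neg)
    then have "?k \<in> ?S" using x y by (simp add: syzygies_def c)
    moreover have "c (x \<oplus>\<^bsub>L\<^esub> y) i = ?k i \<oplus> (c x i \<oplus> c y i)" for i
      using x y by (simp add: c L.R.a_assoc L.R.l_neg)
    ultimately show "\<exists>k\<in>?S. \<forall>i. c (x \<oplus>\<^bsub>L\<^esub> y) i = k i \<oplus> (c x i \<oplus> c y i)"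
      by (intro bexI[of _ ?k] allI)
  next
    fix r x assume r: "r \<in> carrier R" and x: "x \<in> carrier L"
    let ?k = "\<lambda>i. c (r \<odot>\<^bsub>L\<^esub> x) i \<oplus> (\<ominus> (r \<otimes> c x i))"
    have "nsum L (\<lambda>i. ?k i \<odot>\<^bsub>L\<^esub> b i) n = \<zero>\<^bsub>L\<^esub>"
      using r x b by (simp add: L.combination_add L.combination_minus L.combination_smult c L.M.r_neg)
    then have "?k \<in> ?S" using r x by (simp add: syzygies_def c)
    moreover have "c (r \<odot>\<^bsub>L\<^esub> x) i = ?k i \<oplus> r \<otimes> c x i" for i
      using r x by (simp add: c L.R.a_assoc L.R.l_neg)
    ultimately show "\<exists>k\<in>?S. \<forall>i. c (r \<odot>\<^bsub>L\<^esub> x) i = k i \<oplus> r \<otimes> c x i"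
      by (intro bexI[of _ ?k] allI)
  qed
  \<comment> \<open>The syzygies by which unit vectors and chosen coordinates of generators differ.\<close>
  define d where "d = (\<lambda>j i. (if i = j then \<one> else \<zero>) \<oplus> (\<ominus> c (b j) i))"
  have d: "d j \<in> ?S" if "j < n" for j
    unfolding d_def syzygies_def using b c that
    by (simp add: L.combination_add L.combination_minus L.combination_delta L.M.r_neg)
  have w: "(\<lambda>i. nsum M (\<lambda>j. d j i \<odot>\<^bsub>M\<^esub> m j) n) \<in> coeff_span M ?S"
    using d m by (intro M.coeff_span_sum[OF S]) auto
  have "nsum M (\<lambda>j. d j i \<odot>\<^bsub>M\<^esub> m j) n \<oplus>\<^bsub>M\<^esub> nsum M (\<lambda>j. c (b j) i \<odot>\<^bsub>M\<^esub> m j) n = m i" if "i < n" for i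
  proof -
    have "nsum M (\<lambda>j. d j i \<odot>\<^bsub>M\<^esub> m j) n \<oplus>\<^bsub>M\<^esub> nsum M (\<lambda>j. c (b j) i \<odot>\<^bsub>M\<^esub> m j) n =
      nsum M (\<lambda>j. (d j i \<oplus> c (b j) i) \<odot>\<^bsub>M\<^esub> m j) n"
      using b c m coeffsD[OF S d] by (intro M.combination_add[symmetric]) auto
    also have "\<dots> = nsum M (\<lambda>j. (if j = i then \<one> else \<zero>) \<odot>\<^bsub>M\<^esub> m j) n"
      using b c by (intro nsum_cong) (auto simp: d_def L.R.a_assoc L.R.l_neg)
    finally show ?thesis using M.combination_delta m that by simp
  qed
  then show ?thesis unfolding trivial_relation_def
    using M.coeff_span_plus[OF S v w] by (intro bexI) auto
qed

text \<open>
  By \<open>\<Sum> l\<^sub>i \<otimes> k\<^sub>i y = (\<Sum> k\<^sub>i l\<^sub>i) \<otimes> y\<close>, membership has to be checked on pure tensors only.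
\<close>

lemma tensor_sum_mem:
  assumes "v \<in> coeff_span M K" and K: "coeffs R K"
    and l: "\<And>i. i < n \<Longrightarrow> l i \<in> carrier L"
    and H: "submodule H R TT"
    and mem: "\<And>k y. k \<in> K \<Longrightarrow> y \<in> carrier M \<Longrightarrow> nsum L (\<lambda>i. k i \<odot>\<^bsub>L\<^esub> l i) n \<otimes>\<^sub>t y \<in> H"
  shows "nsum TT (\<lambda>i. l i \<otimes>\<^sub>t v i) n \<in> H"
  using assms(1)
proof (induction rule: coeff_span.induct)
  case zero
  have "nsum TT (\<lambda>i. l i \<otimes>\<^sub>t \<zero>\<^bsub>M\<^esub>) n = \<zero>\<^bsub>TT\<^esub>" using l by (intro TT.nsum_zero) auto
  then show ?case using TT.submodule_zero_mem[OF H] by simp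
next
  case (add v k y)
  have v: "v i \<in> carrier M" for i using M.coeff_span_closed[OF K] add by blast
  note Kc = coeffsD[OF K]
  have lin: "(\<lambda>x. x \<otimes>\<^sub>t y) \<in> linear_maps R L TT"
    using add by (intro linear_mapsI) (auto simp: pure_add_left pure_smult_left)
  then have "nsum L (\<lambda>i. k i \<odot>\<^bsub>L\<^esub> l i) n \<otimes>\<^sub>t y = nsum TT (\<lambda>i. (k i \<odot>\<^bsub>L\<^esub> l i) \<otimes>\<^sub>t y) n"
    using linear_maps_nsum[OF L.module_axioms TT.module_axioms lin, of n "\<lambda>i. k i \<odot>\<^bsub>L\<^esub> l i"] add Kc l
    by simp
  also have "\<dots> = nsum TT (\<lambda>i. l i \<otimes>\<^sub>t (k i \<odot>\<^bsub>M\<^esub> y)) n"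
    using add Kc l by (intro nsum_cong) (auto simp: pure_smult_left pure_smult_right)
  finally have 1: "nsum TT (\<lambda>i. l i \<otimes>\<^sub>t (k i \<odot>\<^bsub>M\<^esub> y)) n \<in> H" using mem add by metis
  have "nsum TT (\<lambda>i. l i \<otimes>\<^sub>t (v i \<oplus>\<^bsub>M\<^esub> k i \<odot>\<^bsub>M\<^esub> y)) n =
    nsum TT (\<lambda>i. l i \<otimes>\<^sub>t v i \<oplus>\<^bsub>TT\<^esub> l i \<otimes>\<^sub>t (k i \<odot>\<^bsub>M\<^esub> y)) n"
    using add Kc l v by (intro nsum_cong) (auto simp: pure_add_right)
  also have "\<dots> = nsum TT (\<lambda>i. l i \<otimes>\<^sub>t v i) n \<oplus>\<^bsub>TT\<^esub> nsum TT (\<lambda>i. l i \<otimes>\<^sub>t (k i \<odot>\<^bsub>M\<^esub> y)) n"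
    using add Kc l v by (intro TT.nsum_add) auto
  finally show ?case using TT.submoduleE(5)[OF H add.IH 1] by simp
qed

lemma zero_submodule: "submodule {\<zero>\<^bsub>TT\<^esub>} R TT"
  by (rule TT.submoduleI') auto

lemma trivial_relation_tensor_zero:
  assumes "trivial_relation R L M n l m" "\<And>i. i < n \<Longrightarrow> l i \<in> carrier L"
  shows "nsum TT (\<lambda>i. l i \<otimes>\<^sub>t m i) n = \<zero>\<^bsub>TT\<^esub>"
proof -
  obtain v where v: "v \<in> coeff_span M (syzygies R L n l)" "\<And>i. i < n \<Longrightarrow> v i = m i"
    using assms(1) unfolding trivial_relation_def by blast
  have "nsum TT (\<lambda>i. l i \<otimes>\<^sub>t v i) n \<in> {\<zero>\<^bsub>TT\<^esub>}"
    by (rule tensor_sum_mem[OF v(1) syzygies_coeffs assms(2) zero_submodule])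
      (auto simp: syzygies_def)
  moreover have "nsum TT (\<lambda>i. l i \<otimes>\<^sub>t v i) n = nsum TT (\<lambda>i. l i \<otimes>\<^sub>t m i) n"
    using v(2) by (intro nsum_cong) auto
  ultimately show ?thesis by simp
qed

end

text \<open>
  With all elements of \<open>L\<close> as generators, a vanishing tensor has a certificate that involves
  arbitrary further elements of \<open>L\<close>, through linear combinations over \<open>L\<close> of value zero.
\<close>

lemma (in tensor_pair) tensor_sum_zero_free:
  assumes l: "\<And>i. i < n \<Longrightarrow> l i \<in> carrier L" and m: "\<And>i. i < n \<Longrightarrow> m i \<in> carrier M"
    and zero: "nsum TT (\<lambda>i. l i \<otimes>\<^sub>t m i) n = \<zero>\<^bsub>TT\<^esub>"
  shows "(\<lambda>x. nsum M (\<lambda>j. free_basis R (l j) x \<odot>\<^bsub>M\<^esub> m j) n) \<in>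
    coeff_span M (a_kernel (free_module R (carrier L)) L (linear_combination R L))"
proof -
  define F where "F = free_module R (carrier L)"
  interpret F: module R F unfolding F_def by (rule L.R.free_module_is_module)
  define lc where "lc = linear_combination R L"
  have lc: "lc \<in> linear_maps R F L"
    unfolding lc_def F_def linear_combination_eq_free_extension by (rule L.free_extension_linear)
  define b where "b = (\<lambda>x :: 'l. free_basis R x)"
  have b: "b x \<in> carrier F" if "x \<in> carrier L" for x
    unfolding b_def F_def using that by (rule L.R.free_basis_closed)
  have lcb: "lc (b x) = x" if "x \<in> carrier L" for x
    unfolding lc_def b_def linear_combination_eq_free_extension
    using L.free_extension_basis[of "carrier L" "\<lambda>x. x"] that by simp
  define K where "K = a_kernel F L lc"
  have K: "coeffs R K"
    by (auto simp: coeffs_def K_def a_kernel_def' F_def free_module_def)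
  note Kc = coeffsD[OF K]
  have bc: "b x i \<in> carrier R" for x i by (auto simp: b_def free_basis_def)
  have F_add: "x \<oplus>\<^bsub>F\<^esub> y = (\<lambda>i. x i \<oplus> y i)" "r \<odot>\<^bsub>F\<^esub> x = (\<lambda>i. r \<otimes> x i)" for x y r
    by (auto simp: F_def free_module_def)
  have lin: "\<exists>k\<in>K. \<forall>i. x i = k i \<oplus> y i" if "x \<in> carrier F" "y \<in> carrier F" "lc x = lc y" for x y
  proof
    show "x \<oplus>\<^bsub>F\<^esub> (\<ominus>\<^bsub>F\<^esub> y) \<in> K"
      using that linear_maps_closed[OF lc]
      by (simp add: K_def a_kernel_def' linear_maps_add[OF lc] L.M.r_neg
          linear_maps_minus[OF F.module_axioms L.module_axioms lc])
    have "x = (x \<oplus>\<^bsub>F\<^esub> (\<ominus>\<^bsub>F\<^esub> y)) \<oplus>\<^bsub>F\<^esub> y"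
      using that by (simp add: F.M.a_assoc F.M.l_neg)
    then show "\<forall>i. x i = (x \<oplus>\<^bsub>F\<^esub> (\<ominus>\<^bsub>F\<^esub> y)) i \<oplus> y i" by (metis F_add(1))
  qed
  have v: "(\<lambda>x. nsum M (\<lambda>j. b (l j) x \<odot>\<^bsub>M\<^esub> m j) n) \<in> coeff_span M K"
  proof (rule tensor_sum_zeroD[OF K bc _ _ l m zero])
    fix x y assume xy: "x \<in> carrier L" "y \<in> carrier L"
    then have "lc (b (x \<oplus>\<^bsub>L\<^esub> y)) = lc (b x \<oplus>\<^bsub>F\<^esub> b y)" "b x \<oplus>\<^bsub>F\<^esub> b y \<in> carrier F"
      by (simp_all add: b lcb linear_maps_add[OF lc])
    then show "\<exists>k\<in>K. \<forall>i. b (x \<oplus>\<^bsub>L\<^esub> y) i = k i \<oplus> (b x i \<oplus> b y i)"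
      using lin[OF b, of "x \<oplus>\<^bsub>L\<^esub> y" "b x \<oplus>\<^bsub>F\<^esub> b y"] xy by (simp add: F_add)
  next
    fix r x assume rx: "r \<in> carrier R" "x \<in> carrier L"
    then have "lc (b (r \<odot>\<^bsub>L\<^esub> x)) = lc (r \<odot>\<^bsub>F\<^esub> b x)" "r \<odot>\<^bsub>F\<^esub> b x \<in> carrier F"
      by (simp_all add: b lcb linear_maps_smult[OF lc])
    then show "\<exists>k\<in>K. \<forall>i. b (r \<odot>\<^bsub>L\<^esub> x) i = k i \<oplus> r \<otimes> b x i"
      using lin[OF b, of "r \<odot>\<^bsub>L\<^esub> x" "r \<odot>\<^bsub>F\<^esub> b x"] rx by (simp add: F_add)
  qed
  show ?thesis using v unfolding b_def K_def F_def lc_def .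
qed

section \<open>Systems of equations over a flat module\<close>

definition solutions ::
  "('a, 'x) ring_scheme \<Rightarrow> nat \<Rightarrow> (nat \<Rightarrow> 'e \<Rightarrow> 'a) \<Rightarrow> 'e set \<Rightarrow> (nat \<Rightarrow> 'a) set"
  where "solutions R n C X =
    {d. (\<forall>i. d i \<in> carrier R) \<and> (\<forall>x\<in>X. nsum R (\<lambda>i. C i x \<otimes>\<^bsub>R\<^esub> d i) n = \<zero>\<^bsub>R\<^esub>)}"

text \<open>
  Equations are added one at a time. The earlier ones give \<open>m = \<Sum>\<^sub>j d\<^sub>j u\<^sub>j\<close> with solution vectors
  \<open>d\<^sub>j\<close>; the new one then is a single relation between the \<open>u\<^sub>j\<close>, and trivialising it replaces the
  \<open>d\<^sub>j\<close> by combinations that solve it as well.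
\<close>

lemma (in module) equationally_flat_system:
  fixes C :: "nat \<Rightarrow> 'e \<Rightarrow> 'a"
  assumes flat: "equationally_flat R M" and "finite X"
    and C: "\<And>i x. i < n \<Longrightarrow> C i x \<in> carrier R" and m: "\<And>i. i < n \<Longrightarrow> m i \<in> carrier M"
    and eqs: "\<And>x. x \<in> X \<Longrightarrow> nsum M (\<lambda>i. C i x \<odot>\<^bsub>M\<^esub> m i) n = \<zero>\<^bsub>M\<^esub>"
  shows "\<exists>v\<in>coeff_span M (solutions R n C X). \<forall>i<n. v i = m i"
  using \<open>finite X\<close> eqs
proof (induction X rule: finite_induct)
  case empty
  define k where "k = (\<lambda>(j :: nat) i. if j = i then \<one> else \<zero>)"
  have "(\<lambda>i. nsum M (\<lambda>j. k j i \<odot>\<^bsub>M\<^esub> m j) n) \<in> coeff_span M (solutions R n C {})"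
    using m by (intro coeff_span_sum) (auto simp: solutions_def k_def coeffs_def)
  moreover have "nsum M (\<lambda>j. k j i \<odot>\<^bsub>M\<^esub> m j) n = m i" if "i < n" for i
    using combination_delta[OF that m] by (simp add: k_def)
  ultimately show ?case by (intro bexI) auto
next
  case (insert x0 X)
  interpret RR: module R "ring_as_module R" by (rule R.ring_as_module_is_module)
  have sol: "coeffs R (solutions R n C X)" for X by (auto simp: solutions_def coeffs_def)
  obtain v where v: "v \<in> coeff_span M (solutions R n C X)" "\<And>i. i < n \<Longrightarrow> v i = m i"
    using insert by blast
  obtain N d u where d: "\<And>j. j < N \<Longrightarrow> d j \<in> solutions R n C X" and u: "\<And>j. j < N \<Longrightarrow> u j \<in> carrier M"
    and vi: "\<And>i. v i = nsum M (\<lambda>j. d j i \<odot>\<^bsub>M\<^esub> u j) N"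
    using coeff_span_representation[OF sol v(1)] by blast
  note dc = coeffsD[OF sol d]
  define r where "r = (\<lambda>j. nsum R (\<lambda>i. C i x0 \<otimes> d j i) n)"
  have r: "r j \<in> carrier R" if "j < N" for j using that C dc by (auto simp: r_def)
  have "nsum M (\<lambda>j. r j \<odot>\<^bsub>M\<^esub> u j) N = nsum M (\<lambda>j. nsum R (\<lambda>i. C i x0 \<otimes> d j i) n \<odot>\<^bsub>M\<^esub> u j) N"
    by (simp add: r_def)
  also have "\<dots> = nsum M (\<lambda>i. C i x0 \<odot>\<^bsub>M\<^esub> nsum M (\<lambda>j. d j i \<odot>\<^bsub>M\<^esub> u j) N) n"
    using C dc u by (intro combination_assoc) auto
  also have "\<dots> = nsum M (\<lambda>i. C i x0 \<odot>\<^bsub>M\<^esub> m i) n"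
    using v(2) vi by (intro nsum_cong) auto
  also have "\<dots> = \<zero>\<^bsub>M\<^esub>" using insert by simp
  finally have "trivial_relation R (ring_as_module R) M N r u"
    by (intro equationally_flatD[OF flat module_axioms]) (auto simp: r u)
  then obtain w where w: "w \<in> coeff_span M (syzygies R (ring_as_module R) N r)" "\<And>j. j < N \<Longrightarrow> w j = u j"
    unfolding trivial_relation_def by blast
  have "(\<lambda>i. nsum M (\<lambda>j. (if j < N then d j i else \<zero>) \<odot>\<^bsub>M\<^esub> w j) N) \<in> coeff_span M (solutions R n C (insert x0 X))"
  proof (rule coeff_span_matrix[OF w(1) syzygies_coeffs sol])
    show "\<And>i j. j < N \<Longrightarrow> (if j < N then d j i else \<zero>) \<in> carrier R" using dc by auto
    fix k assume k: "k \<in> syzygies R (ring_as_module R) N r"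
    then have kc: "k j \<in> carrier R" for j by (auto simp: syzygies_def)
    define e where "e = (\<lambda>i. nsum R (\<lambda>j. k j \<otimes> d j i) N)"
    have ee: "(\<lambda>i. nsum R (\<lambda>j. (if j < N then d j i else \<zero>) \<otimes> k j) N) = e"
      unfolding e_def using dc kc by (intro ext nsum_cong) (auto simp: R.m_comm)
    have ec: "e i \<in> carrier R" for i unfolding e_def using dc kc by auto
    have *: "nsum R (\<lambda>i. C i x \<otimes> e i) n = nsum R (\<lambda>j. k j \<otimes> nsum R (\<lambda>i. C i x \<otimes> d j i) n) N" for x
    proof -
      have "nsum R (\<lambda>i. C i x \<otimes> e i) n = nsum R (\<lambda>i. e i \<otimes> C i x) n"
        using C ec by (intro nsum_cong) (auto simp: R.m_comm)
      also have "\<dots> = nsum R (\<lambda>j. k j \<otimes> nsum R (\<lambda>i. d j i \<otimes> C i x) n) N"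
        unfolding e_def using RR.combination_assoc[of N k n d "\<lambda>i. C i x"] C dc kc by simp
      also have "\<dots> = nsum R (\<lambda>j. k j \<otimes> nsum R (\<lambda>i. C i x \<otimes> d j i) n) N"
      proof (intro nsum_cong)
        fix j assume "j < N"
        then have "nsum R (\<lambda>i. d j i \<otimes> C i x) n = nsum R (\<lambda>i. C i x \<otimes> d j i) n"
          using C dc by (intro nsum_cong) (auto simp: R.m_comm)
        then show "k j \<otimes> nsum R (\<lambda>i. d j i \<otimes> C i x) n = k j \<otimes> nsum R (\<lambda>i. C i x \<otimes> d j i) n"
          by simp
      qed
      finally show ?thesis .
    qed
    have "nsum R (\<lambda>j. k j \<otimes> nsum R (\<lambda>i. C i x0 \<otimes> d j i) n) N = \<zero>"
      using k by (simp add: syzygies_def r_def)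
    moreover have "nsum R (\<lambda>j. k j \<otimes> nsum R (\<lambda>i. C i x \<otimes> d j i) n) N = \<zero>" if "x \<in> X" for x
      using d that kc by (intro R.nsum_zero) (auto simp: solutions_def)
    ultimately have "e \<in> solutions R n C (insert x0 X)"
      using ec unfolding solutions_def by (auto simp: *)
    then show "(\<lambda>i. nsum R (\<lambda>j. (if j < N then d j i else \<zero>) \<otimes> k j) N) \<in> solutions R n C (insert x0 X)"
      unfolding ee .
  qed
  moreover have "nsum M (\<lambda>j. (if j < N then d j i else \<zero>) \<odot>\<^bsub>M\<^esub> w j) N = m i" if "i < n" for i
  proof -
    have "nsum M (\<lambda>j. (if j < N then d j i else \<zero>) \<odot>\<^bsub>M\<^esub> w j) N = v i"
      unfolding vi using w(2) by (intro nsum_cong) auto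
    then show ?thesis using v(2) that by simp
  qed
  ultimately show ?case by (intro bexI) auto
qed

text \<open>
  The certificate for \<open>\<Sum> l\<^sub>i \<otimes> m\<^sub>i = 0\<close> consists of zero combinations \<open>k\<^sub>j\<close> of elements of \<open>L\<close> and of
  elements \<open>y\<^sub>j\<close> of \<open>M\<close>, and states a finite system of scalar equations satisfied by all \<open>m\<^sub>i\<close> and
  \<open>y\<^sub>j\<close> together. For a solution \<open>d\<close> of the same system in \<open>R\<close>, the combination of the basis vectors
  at the \<open>l\<^sub>i\<close> with coefficients \<open>d\<^sub>i\<close> equals a combination of the \<open>k\<^sub>j\<close>, so its value
  \<open>\<Sum> d\<^sub>i l\<^sub>i\<close> is zero. Flatness expresses the \<open>m\<^sub>i\<close> through such solutions.
\<close>

lemma (in tensor_pair) flat_tensor_zeroD: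
  assumes flat: "equationally_flat R M"
    and l: "\<And>i. i < n \<Longrightarrow> l i \<in> carrier L" and m: "\<And>i. i < n \<Longrightarrow> m i \<in> carrier M"
    and zero: "nsum TT (\<lambda>i. l i \<otimes>\<^sub>t m i) n = \<zero>\<^bsub>TT\<^esub>"
  shows "trivial_relation R L M n l m"
proof -
  define F where "F = free_module R (carrier L)"
  interpret F: module R F unfolding F_def by (rule L.R.free_module_is_module)
  define lc where "lc = linear_combination R L"
  have lc: "lc \<in> linear_maps R F L"
    unfolding lc_def F_def linear_combination_eq_free_extension by (rule L.free_extension_linear)
  define b where "b = (\<lambda>x :: 'l. free_basis R x)"
  have b: "b x \<in> carrier F" if "x \<in> carrier L" for x
    unfolding b_def F_def using that by (rule L.R.free_basis_closed)
  have lcb: "lc (b x) = x" if "x \<in> carrier L" for x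
    unfolding lc_def b_def linear_combination_eq_free_extension
    using L.free_extension_basis[of "carrier L" "\<lambda>x. x"] that by simp
  define K where "K = a_kernel F L lc"
  have K: "coeffs R K"
    by (auto simp: coeffs_def K_def a_kernel_def' F_def free_module_def)
  note Kc = coeffsD[OF K]
  have bc: "b x i \<in> carrier R" for x i by (auto simp: b_def free_basis_def)
  have F_add: "x \<oplus>\<^bsub>F\<^esub> y = (\<lambda>i. x i \<oplus> y i)" "r \<odot>\<^bsub>F\<^esub> x = (\<lambda>i. r \<otimes> x i)" for x y r
    by (auto simp: F_def free_module_def)
  have v: "(\<lambda>x. nsum M (\<lambda>j. b (l j) x \<odot>\<^bsub>M\<^esub> m j) n) \<in> coeff_span M K"
    using tensor_sum_zero_free[OF l m zero] unfolding b_def K_def F_def lc_def by simp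
  obtain N k y where k: "\<And>j. j < N \<Longrightarrow> k j \<in> K" and y: "\<And>j. j < N \<Longrightarrow> y j \<in> carrier M"
    and vi: "\<And>x. nsum M (\<lambda>j. b (l j) x \<odot>\<^bsub>M\<^esub> m j) n = nsum M (\<lambda>j. k j x \<odot>\<^bsub>M\<^esub> y j) N"
    using M.coeff_span_representation[OF K v] by blast
  have kF: "k j \<in> carrier F" "lc (k j) = \<zero>\<^bsub>L\<^esub>" if "j < N" for j
    using k[OF that] by (auto simp: K_def a_kernel_def')
  \<comment> \<open>The unknowns are the \<open>m i\<close> and, shifted by \<open>n\<close>, the \<open>y j\<close>; each point of \<open>X\<close> is one equation.\<close>
  define C where "C = (\<lambda>i x. if i < n then b (l i) x else \<ominus> k (i - n) x)"
  define u where "u = (\<lambda>i. if i < n then m i else y (i - n))"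
  define X where "X = (\<Union>j<N. {x. k j x \<noteq> \<zero>}) \<union> l ` {..<n}"
  have "finite X"
    using kF(1) by (auto simp: X_def F_def free_module_def)
  moreover have Cc: "C i x \<in> carrier R" if "i < n + N" for i x
    using that bc Kc[OF k] by (auto simp: C_def)
  moreover have uc: "u i \<in> carrier M" if "i < n + N" for i using that m y by (auto simp: u_def)
  moreover have "nsum M (\<lambda>i. C i x \<odot>\<^bsub>M\<^esub> u i) (n + N) = \<zero>\<^bsub>M\<^esub>" for x
  proof -
    have "nsum M (\<lambda>i. C i x \<odot>\<^bsub>M\<^esub> u i) (n + N) =
      nsum M (\<lambda>i. C i x \<odot>\<^bsub>M\<^esub> u i) n \<oplus>\<^bsub>M\<^esub> nsum M (\<lambda>i. C (n + i) x \<odot>\<^bsub>M\<^esub> u (n + i)) N"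
      using Cc uc by (intro M.nsum_append) auto
    also have "nsum M (\<lambda>i. C i x \<odot>\<^bsub>M\<^esub> u i) n = nsum M (\<lambda>j. k j x \<odot>\<^bsub>M\<^esub> y j) N"
      unfolding vi[symmetric] by (rule nsum_cong) (auto simp: C_def u_def)
    also have "nsum M (\<lambda>i. C (n + i) x \<odot>\<^bsub>M\<^esub> u (n + i)) N = \<ominus>\<^bsub>M\<^esub> nsum M (\<lambda>j. k j x \<odot>\<^bsub>M\<^esub> y j) N"
      unfolding C_def u_def using M.combination_minus[of N "\<lambda>j. k j x" y] Kc[OF k] y by simp
    finally show ?thesis using Kc[OF k] y by (simp add: M.M.r_neg)
  qed
  ultimately obtain w where w: "w \<in> coeff_span M (solutions R (n + N) C X)" "\<And>i. i < n + N \<Longrightarrow> w i = u i"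
    using M.equationally_flat_system[OF flat, of X "n + N" C u] by blast
  have "solutions R (n + N) C X \<subseteq> syzygies R L n l"
  proof
    fix d assume d: "d \<in> solutions R (n + N) C X"
    have dc: "d i \<in> carrier R" for i using d by (auto simp: solutions_def)
    have "nsum R (\<lambda>i. C i x \<otimes> d i) (n + N) = \<zero>" for x
    proof (cases "x \<in> X")
      case True
      then show ?thesis using d by (auto simp: solutions_def)
    next
      case False
      have "C i x = \<zero>" if "i < n + N" for i
      proof (cases "i < n")
        case True
        then have "l i \<in> X" by (auto simp: X_def)
        then show ?thesis using True False by (auto simp: C_def b_def free_basis_def)
      next
        case F: False
        then have "i - n < N" using that by auto
        then have "k (i - n) x = \<zero>" using False unfolding X_def by blast
        then show ?thesis using F by (auto simp: C_def)
      qed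
      then show ?thesis using dc by (intro L.R.nsum_zero) auto
    qed
    then have eq: "nsum R (\<lambda>i. d i \<otimes> b (l i) x) n = nsum R (\<lambda>j. d (n + j) \<otimes> k j x) N" for x
    proof -
      have "\<zero> = nsum R (\<lambda>i. C i x \<otimes> d i) n \<oplus> nsum R (\<lambda>i. C (n + i) x \<otimes> d (n + i)) N"
        using \<open>\<And>x. nsum R (\<lambda>i. C i x \<otimes> d i) (n + N) = \<zero>\<close>[of x, symmetric] Cc dc
        by (simp add: L.R.nsum_append)
      also have "nsum R (\<lambda>i. C i x \<otimes> d i) n = nsum R (\<lambda>i. d i \<otimes> b (l i) x) n"
        using bc dc by (intro nsum_cong) (auto simp: C_def L.R.m_comm)
      also have "nsum R (\<lambda>i. C (n + i) x \<otimes> d (n + i)) N = nsum R (\<lambda>j. (\<ominus> d (n + j)) \<otimes> k j x) N"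
        using Kc[OF k] dc by (intro nsum_cong) (auto simp: C_def L.R.m_comm L.R.l_minus L.R.r_minus)
      also have "\<dots> = \<ominus> nsum R (\<lambda>j. d (n + j) \<otimes> k j x) N"
      proof -
        interpret RR: module R "ring_as_module R" by (rule L.R.ring_as_module_is_module)
        have "\<ominus>\<^bsub>ring_as_module R\<^esub> z = \<ominus> z" for z by (simp add: a_inv_def m_inv_def)
        then show ?thesis
          using RR.combination_minus[of N "\<lambda>j. d (n + j)" "\<lambda>j. k j x"] Kc[OF k] dc by simp
      qed
      finally have "nsum R (\<lambda>i. d i \<otimes> b (l i) x) n \<ominus> nsum R (\<lambda>j. d (n + j) \<otimes> k j x) N = \<zero>"
        by (simp add: a_minus_def)
      moreover have "nsum R (\<lambda>i. d i \<otimes> b (l i) x) n \<in> carrier R" using dc bc by auto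
      moreover have "nsum R (\<lambda>j. d (n + j) \<otimes> k j x) N \<in> carrier R" using dc Kc[OF k] by auto
      ultimately show ?thesis using L.R.minus_eq_zero_iff by blast
    qed
    have "nsum L (\<lambda>i. d i \<odot>\<^bsub>L\<^esub> l i) n = nsum L (\<lambda>i. lc (d i \<odot>\<^bsub>F\<^esub> b (l i))) n"
      using l dc by (intro nsum_cong) (auto simp: linear_maps_smult[OF lc] b lcb)
    also have "\<dots> = lc (nsum F (\<lambda>i. d i \<odot>\<^bsub>F\<^esub> b (l i)) n)"
      using l dc b by (intro linear_maps_nsum[OF F.module_axioms L.module_axioms lc, symmetric]) auto
    also have "nsum F (\<lambda>i. d i \<odot>\<^bsub>F\<^esub> b (l i)) n = nsum F (\<lambda>j. d (n + j) \<odot>\<^bsub>F\<^esub> k j) N"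
      unfolding F_def nsum_free_module using eq by (simp add: free_module_def)
    also have "lc \<dots> = nsum L (\<lambda>j. lc (d (n + j) \<odot>\<^bsub>F\<^esub> k j)) N"
      using kF dc by (intro linear_maps_nsum[OF F.module_axioms L.module_axioms lc]) auto
    also have "\<dots> = \<zero>\<^bsub>L\<^esub>"
      using kF dc by (intro L.nsum_zero) (auto simp: linear_maps_smult[OF lc])
    finally show "d \<in> syzygies R L n l" using dc by (auto simp: syzygies_def)
  qed
  then have "w \<in> coeff_span M (syzygies R L n l)" using w(1) coeff_span_mono by blast
  moreover have "w i = m i" if "i < n" for i using w(2)[of i] that by (simp add: u_def)
  ultimately show ?thesis unfolding trivial_relation_def by blast
qed

section \<open>Flatness is equational\<close>

lemma linear_map_image_submodule:
  assumes "module R L" "module R M" "f \<in> linear_maps R L M"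
  shows "submodule (f ` carrier L) R M"
proof -
  interpret L: module R L by fact
  interpret M: module R M by fact
  show ?thesis
  proof (rule M.submoduleI')
    show "f ` carrier L \<subseteq> carrier M" using linear_maps_closed[OF assms(3)] by auto
    show "\<zero>\<^bsub>M\<^esub> \<in> f ` carrier L" using linear_maps_zero[OF assms] by force
    fix a b assume "a \<in> f ` carrier L" "b \<in> f ` carrier L"
    then show "a \<oplus>\<^bsub>M\<^esub> b \<in> f ` carrier L"
      by (auto simp: linear_maps_add[OF assms(3), symmetric])
  next
    fix r a assume "r \<in> carrier R" "a \<in> f ` carrier L"
    then show "r \<odot>\<^bsub>M\<^esub> a \<in> f ` carrier L"
      by (auto simp: linear_maps_smult[OF assms(3), symmetric])
  qed
qed

lemma id_linear: "(\<lambda>x. x) \<in> linear_maps R M M"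
  by (rule linear_mapsI) auto

text \<open>
  If \<open>\<Sum> b\<^sub>i \<otimes> m\<^sub>i\<close> goes to zero in \<open>C \<otimes> M\<close>, then \<open>(m\<^sub>i)\<close> is spanned by syzygies \<open>k\<close> of the \<open>g(b\<^sub>i)\<close>,
  so the sum is rewritten in terms of the elements \<open>\<Sum> k\<^sub>i b\<^sub>i\<close> of \<open>ker g = im f\<close>. The three modules may
  have different types, which the canonical resolution needs.
\<close>

theorem equationally_flat_exact:
  assumes A: "module R A" and B: "module R B" and C: "module R C" and M: "module R M"
    and f: "f \<in> linear_maps R A B" and g: "g \<in> linear_maps R B C"
    and exact: "exact_at A f B g C" and flat: "equationally_flat R M"
  shows "exact_at (tensor_product R A M) (tensor_map R A M B M f (\<lambda>x. x)) (tensor_product R B M)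
    (tensor_map R B M C M g (\<lambda>x. x)) (tensor_product R C M)"
proof -
  interpret M: module R M by fact
  interpret B: module R B by fact
  interpret AM: tensor_pair R A M using A M by (rule tensor_pair.intro)
  interpret BM: tensor_pair R B M using B M by (rule tensor_pair.intro)
  interpret CM: tensor_pair R C M using C M by (rule tensor_pair.intro)
  let ?f = "tensor_map R A M B M f (\<lambda>x. x)" and ?g = "tensor_map R B M C M g (\<lambda>x. x)"
  note fl = tensor_map_linear[OF A M B M f id_linear] and fp = tensor_map_pure[OF A M B M f id_linear]
  note gl = tensor_map_linear[OF B M C M g id_linear] and gp = tensor_map_pure[OF B M C M g id_linear]
  have ex: "f ` carrier A = {b \<in> carrier B. g b = \<zero>\<^bsub>C\<^esub>}"
    using exact unfolding exact_at_def a_kernel_def' .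
  let ?H = "?f ` carrier AM.TT"
  have H: "submodule ?H R BM.TT"
    by (rule linear_map_image_submodule[OF AM.TT.module_axioms BM.TT.module_axioms fl])
  show ?thesis unfolding exact_at_def a_kernel_def'
  proof (intro equalityI subsetI)
    fix z assume "z \<in> ?H"
    then obtain x where x: "x \<in> carrier AM.TT" "z = ?f x" by auto
    from x(1) have "?g (?f x) = \<zero>\<^bsub>CM.TT\<^esub>"
    proof (induction rule: AM.tensor_induct)
      case zero
      then show ?case
        by (simp add: linear_maps_zero[OF AM.TT.module_axioms BM.TT.module_axioms fl]
            linear_maps_zero[OF BM.TT.module_axioms CM.TT.module_axioms gl])
    next
      case (add z l m)
      then have "f l \<in> carrier B" "g (f l) = \<zero>\<^bsub>C\<^esub>" using ex by auto
      then show ?case using add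
        by (simp add: linear_maps_add[OF fl] linear_maps_add[OF gl] fp gp linear_maps_closed[OF fl])
    qed
    then show "z \<in> {z \<in> carrier BM.TT. ?g z = \<zero>\<^bsub>CM.TT\<^esub>}"
      using x linear_maps_closed[OF fl] by simp
  next
    fix z assume "z \<in> {z \<in> carrier BM.TT. ?g z = \<zero>\<^bsub>CM.TT\<^esub>}"
    then have z: "z \<in> carrier BM.TT" "?g z = \<zero>\<^bsub>CM.TT\<^esub>" by auto
    obtain n b m where b: "\<And>i. b i \<in> carrier B" and m: "\<And>i. m i \<in> carrier M"
      and zz: "z = nsum BM.TT (\<lambda>i. pure_tensor R B M (b i) (m i)) n"
      using BM.tensor_representation[OF z(1)] by blast
    have gb: "g (b i) \<in> carrier C" for i using linear_maps_closed[OF g b] .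
    have "\<zero>\<^bsub>CM.TT\<^esub> = nsum CM.TT (\<lambda>i. ?g (pure_tensor R B M (b i) (m i))) n"
      using z(2) b m unfolding zz
      by (subst linear_maps_nsum[OF BM.TT.module_axioms CM.TT.module_axioms gl, symmetric]) auto
    then have "nsum CM.TT (\<lambda>i. pure_tensor R C M (g (b i)) (m i)) n = \<zero>\<^bsub>CM.TT\<^esub>"
      using b m by (simp add: gp)
    then have "trivial_relation R C M n (\<lambda>i. g (b i)) m"
      by (intro CM.flat_tensor_zeroD[OF flat] gb m) auto
    then obtain v where v: "v \<in> coeff_span M (syzygies R C n (\<lambda>i. g (b i)))" "\<And>i. i < n \<Longrightarrow> v i = m i"
      unfolding trivial_relation_def by blast
    have "nsum BM.TT (\<lambda>i. pure_tensor R B M (b i) (v i)) n \<in> ?H"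
    proof (rule BM.tensor_sum_mem[OF v(1) syzygies_coeffs b H])
      fix k y assume k: "k \<in> syzygies R C n (\<lambda>i. g (b i))" and y: "y \<in> carrier M"
      have kc: "k i \<in> carrier R" for i using k by (auto simp: syzygies_def)
      let ?x = "nsum B (\<lambda>i. k i \<odot>\<^bsub>B\<^esub> b i) n"
      have x: "?x \<in> carrier B" using kc b by auto
      have "g ?x = nsum C (\<lambda>i. g (k i \<odot>\<^bsub>B\<^esub> b i)) n"
        using kc b by (intro linear_maps_nsum[OF B C g]) auto
      also have "\<dots> = nsum C (\<lambda>i. k i \<odot>\<^bsub>C\<^esub> g (b i)) n"
        using kc b by (intro nsum_cong) (auto simp: linear_maps_smult[OF g])
      finally have "g ?x = \<zero>\<^bsub>C\<^esub>" using k by (simp add: syzygies_def)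
      then obtain a where a: "a \<in> carrier A" "?x = f a" using x ex by blast
      have "pure_tensor R B M ?x y = ?f (pure_tensor R A M a y)"
        unfolding a(2) using a(1) y by (simp add: fp)
      then show "pure_tensor R B M ?x y \<in> ?H" using a(1) y by auto
    qed
    moreover have "nsum BM.TT (\<lambda>i. pure_tensor R B M (b i) (v i)) n = z"
      unfolding zz using v(2) by (intro nsum_cong) auto
    ultimately show "z \<in> ?H" by simp
  qed
qed

corollary equationally_flat_imp_flat:
  assumes "module R M" "equationally_flat R M"
  shows "flat U R M"
  unfolding flat_def using assms by (auto intro: equationally_flat_exact)

text \<open>
  In a torsion-free module the families \<open>l\<close> and \<open>s l\<close> have the same syzygies.
\<close>

lemma flat_tensor_torsion_free:
  assumes L: "module R L" and M: "module R M" and flat: "equationally_flat R M" and tf: "torsion_free R L"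
  shows "torsion_free R (tensor_product R L M)"
  unfolding torsion_free_def
proof (intro ballI impI)
  interpret tensor_pair R L M using L M by (rule tensor_pair.intro)
  fix s z assume s: "s \<in> nonzerodivisors R" and z: "z \<in> carrier TT" and sz: "s \<odot>\<^bsub>TT\<^esub> z = \<zero>\<^bsub>TT\<^esub>"
  have sR: "s \<in> carrier R" using s by (auto simp: nonzerodivisors_def)
  obtain n l m where l: "\<And>i. l i \<in> carrier L" and m: "\<And>i. m i \<in> carrier M"
    and zz: "z = nsum TT (\<lambda>i. l i \<otimes>\<^sub>t m i) n"
    using tensor_representation[OF z] by blast
  have "nsum TT (\<lambda>i. (s \<odot>\<^bsub>L\<^esub> l i) \<otimes>\<^sub>t m i) n = s \<odot>\<^bsub>TT\<^esub> z"
    unfolding zz using sR l m by (simp add: TT.nsum_smult pure_smult_left)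
  then have "trivial_relation R L M n (\<lambda>i. s \<odot>\<^bsub>L\<^esub> l i) m"
    using sz sR l m by (intro flat_tensor_zeroD[OF flat]) auto
  moreover have "syzygies R L n (\<lambda>i. s \<odot>\<^bsub>L\<^esub> l i) \<subseteq> syzygies R L n l"
  proof
    fix k assume k: "k \<in> syzygies R L n (\<lambda>i. s \<odot>\<^bsub>L\<^esub> l i)"
    then have kc: "k i \<in> carrier R" for i by (auto simp: syzygies_def)
    have "s \<odot>\<^bsub>L\<^esub> nsum L (\<lambda>i. k i \<odot>\<^bsub>L\<^esub> l i) n = nsum L (\<lambda>i. k i \<odot>\<^bsub>L\<^esub> (s \<odot>\<^bsub>L\<^esub> l i)) n"
      using sR kc l by (simp add: L.nsum_smult L.smult_assoc1[symmetric] L.R.m_comm)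
    then have "nsum L (\<lambda>i. k i \<odot>\<^bsub>L\<^esub> l i) n = \<zero>\<^bsub>L\<^esub>"
      using tf s kc l k unfolding torsion_free_def syzygies_def by auto
    then show "k \<in> syzygies R L n l" using kc by (auto simp: syzygies_def)
  qed
  ultimately have "trivial_relation R L M n l m"
    unfolding trivial_relation_def using coeff_span_mono by blast
  then show "z = \<zero>\<^bsub>TT\<^esub>" unfolding zz using l by (intro trivial_relation_tensor_zero) auto
qed

section \<open>Ideals, generators, and copies of modules in another type\<close>

lemma (in cring) submodule_ring_iff_ideal: "submodule I R (ring_as_module R) \<longleftrightarrow> ideal I R"
proof
  assume I: "submodule I R (ring_as_module R)"
  interpret RR: module R "ring_as_module R" by (rule ring_as_module_is_module)
  have neg: "\<ominus>\<^bsub>ring_as_module R\<^esub> x = \<ominus> x" for x by (simp add: a_inv_def m_inv_def)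
  note E = RR.submoduleE[OF I, simplified neg ring_as_module_simps]
  show "ideal I R"
  proof (rule idealI[OF ring_axioms])
    show "subgroup I (add_monoid R)"
      using E by (intro add.subgroupI) (auto simp: a_inv_def)
    fix a x assume "a \<in> I" "x \<in> carrier R"
    then show "x \<otimes> a \<in> I" "a \<otimes> x \<in> I" using E(4)[of x a] E(1) m_comm[of a x] by auto
  qed
next
  assume "ideal I R"
  then interpret I: ideal I R .
  interpret RR: module R "ring_as_module R" by (rule ring_as_module_is_module)
  show "submodule I R (ring_as_module R)"
    by (rule RR.submoduleI') (auto simp: I.a_Hcarr I.I_l_closed)
qed

lemma (in cring) ideal_as_module_is_module: "ideal I R \<Longrightarrow> module R (ideal_as_module R I)"
  using submodule.submodule_is_module[OF _ ring_as_module_is_module] submodule_ring_iff_ideal by blast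

lemma nsum_carrier_update [simp]: "nsum (M\<lparr>carrier := H\<rparr>) f n = nsum M f n" for M :: "('a, 'b, 'c) module_scheme"
  by (induction n) auto

definition generators :: "('a, 'x) ring_scheme \<Rightarrow> nat \<Rightarrow> (nat \<Rightarrow> 'a) \<Rightarrow> 'a set \<Rightarrow> bool"
  where "generators R n r I \<longleftrightarrow> (\<forall>i<n. r i \<in> I) \<and>
    (\<forall>x\<in>I. \<exists>k. (\<forall>i. k i \<in> carrier R) \<and> x = nsum R (\<lambda>i. k i \<otimes>\<^bsub>R\<^esub> r i) n)"

definition combinations :: "('a, 'x) ring_scheme \<Rightarrow> nat \<Rightarrow> (nat \<Rightarrow> 'a) \<Rightarrow> 'a set"
  where "combinations R n r = {nsum R (\<lambda>i. k i \<otimes>\<^bsub>R\<^esub> r i) n | k. \<forall>i. k i \<in> carrier R}"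

context cring
begin

lemma combinations_ideal:
  assumes r: "\<And>i. i < n \<Longrightarrow> r i \<in> carrier R"
  shows "ideal (combinations R n r) R" "generators R n r (combinations R n r)"
proof -
  interpret RR: module R "ring_as_module R" by (rule ring_as_module_is_module)
  show "ideal (combinations R n r) R" unfolding submodule_ring_iff_ideal[symmetric]
  proof (rule RR.submoduleI')
    show "combinations R n r \<subseteq> carrier (ring_as_module R)"
      using r by (auto simp: combinations_def)
    have "nsum R (\<lambda>i. \<zero> \<otimes> r i) n = \<zero>" using r by (intro nsum_zero) auto
    then show "\<zero>\<^bsub>ring_as_module R\<^esub> \<in> combinations R n r"
      unfolding combinations_def by (intro CollectI exI[of _ "\<lambda>_. \<zero>"]) auto
    fix a b assume "a \<in> combinations R n r" "b \<in> combinations R n r"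
    then obtain k k' where k: "\<And>i. k i \<in> carrier R" "\<And>i. k' i \<in> carrier R"
      "a = nsum R (\<lambda>i. k i \<otimes> r i) n" "b = nsum R (\<lambda>i. k' i \<otimes> r i) n"
      unfolding combinations_def by auto
    have "a \<oplus> b = nsum R (\<lambda>i. (k i \<oplus> k' i) \<otimes> r i) n"
      unfolding k using RR.combination_add[of n k k' r] k r by simp
    then show "a \<oplus>\<^bsub>ring_as_module R\<^esub> b \<in> combinations R n r"
      unfolding combinations_def using k by (intro CollectI exI[of _ "\<lambda>i. k i \<oplus> k' i"]) auto
  next
    fix x a assume x: "x \<in> carrier R" and "a \<in> combinations R n r"
    then obtain k where k: "\<And>i. k i \<in> carrier R" "a = nsum R (\<lambda>i. k i \<otimes> r i) n"
      unfolding combinations_def by auto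
    have "x \<otimes> a = nsum R (\<lambda>i. (x \<otimes> k i) \<otimes> r i) n"
      unfolding k using RR.combination_smult[of x n k r] k r x by simp
    then show "x \<odot>\<^bsub>ring_as_module R\<^esub> a \<in> combinations R n r"
      unfolding combinations_def using k x by (intro CollectI exI[of _ "\<lambda>i. x \<otimes> k i"]) auto
  qed
  have "r j \<in> combinations R n r" if "j < n" for j
    unfolding combinations_def using RR.combination_delta[of j n r] that r
    by (intro CollectI exI[of _ "\<lambda>i. if i = j then \<one> else \<zero>"]) auto
  then show "generators R n r (combinations R n r)"
    unfolding generators_def by (auto simp: combinations_def)
qed

lemma generatorsD:
  assumes "generators R n r I" "ideal I R"
  shows "\<And>i. i < n \<Longrightarrow> r i \<in> carrier R" "combinations R n r = I"
proof -
  interpret I: ideal I R by fact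
  interpret RR: module R "ring_as_module R" by (rule ring_as_module_is_module)
  show r: "r i \<in> carrier R" if "i < n" for i
    using assms that by (auto simp: generators_def I.a_Hcarr)
  have "nsum R (\<lambda>i. k i \<otimes> r i) n \<in> I" if "\<forall>i. k i \<in> carrier R" for k
    using RR.submodule_nsum[of I n "\<lambda>i. k i \<otimes> r i"] that assms submodule_ring_iff_ideal
    by (simp add: generators_def I.I_l_closed)
  then show "combinations R n r = I"
    using assms(1) by (auto simp: combinations_def generators_def)
qed

end

lemma (in noetherian_ring) exists_generators:
  assumes "cring R" "ideal I R"
  obtains n r where "generators R n r I"
proof -
  interpret cring R by fact
  interpret I: ideal I R by fact
  obtain A where A: "A \<subseteq> carrier R" "finite A" "I = Idl A" using finetely_gen[OF assms(2)] by blast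
  obtain n :: nat and r where nr: "A = r ` {i. i < n}" using finite_imp_nat_seg_image_inj_on[OF A(2)] by blast
  have r: "r i \<in> carrier R" if "i < n" for i using that A(1) nr by auto
  have c: "ideal (combinations R n r) R" "generators R n r (combinations R n r)"
    by (intro combinations_ideal r; assumption)+
  have "A \<subseteq> combinations R n r" using c(2) nr by (auto simp: generators_def)
  then have "I \<subseteq> combinations R n r" unfolding A(3) using c(1) by (rule genideal_minimal[rotated])
  moreover have "r i \<in> I" if "i < n" for i using that nr A genideal_self[of A] by auto
  ultimately have "generators R n r I" unfolding generators_def combinations_def by blast
  then show ?thesis using that by blast
qed

text \<open>
  Transport of structure along an injection; this is how ideals and cyclic modules enter the
  universe.
\<close>

definition module_copy :: "('n \<Rightarrow> 'u) \<Rightarrow> ('a, 'n, 'y) module_scheme \<Rightarrow> ('a, 'u) module"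
  where "module_copy h N = (let g = inv_into (carrier N) h in
    \<lparr>carrier = h ` carrier N, mult = undefined, one = undefined, zero = h \<zero>\<^bsub>N\<^esub>,
     add = (\<lambda>x y. h (g x \<oplus>\<^bsub>N\<^esub> g y)), smult = (\<lambda>r x. h (r \<odot>\<^bsub>N\<^esub> g x))\<rparr>)"

lemma (in module)
  assumes inj: "inj_on h (carrier M)"
  shows module_copy_is_module: "module R (module_copy h M)"
    and module_copy_linear: "h \<in> linear_maps R M (module_copy h M)"
    and module_copy_carrier: "carrier (module_copy h M) = h ` carrier M"
proof -
  have c: "carrier (module_copy h M) = h ` carrier M" "\<zero>\<^bsub>module_copy h M\<^esub> = h \<zero>\<^bsub>M\<^esub>"
    by (auto simp: module_copy_def Let_def)
  have op: "h x \<oplus>\<^bsub>module_copy h M\<^esub> h y = h (x \<oplus>\<^bsub>M\<^esub> y)" "r \<odot>\<^bsub>module_copy h M\<^esub> h x = h (r \<odot>\<^bsub>M\<^esub> x)"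
    if "x \<in> carrier M" "y \<in> carrier M" for x y r
    using inj that by (auto simp: module_copy_def Let_def inv_into_f_f)
  have inv: "\<exists>y\<in>h ` carrier M. h x \<oplus>\<^bsub>module_copy h M\<^esub> y = h \<zero>\<^bsub>M\<^esub>" if "x \<in> carrier M" for x
    using that by (intro bexI[of _ "h (\<ominus>\<^bsub>M\<^esub> x)"]) (auto simp: op M.r_neg)
  have inv': "\<exists>y\<in>h ` carrier M. y \<oplus>\<^bsub>module_copy h M\<^esub> h x = h \<zero>\<^bsub>M\<^esub>" if "x \<in> carrier M" for x
    using that by (intro bexI[of _ "h (\<ominus>\<^bsub>M\<^esub> x)"]) (auto simp: op M.l_neg)
  show "module R (module_copy h M)"
  proof (rule moduleI)
    show "abelian_group (module_copy h M)"
    proof (rule abelian_groupI)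
      fix x assume "x \<in> carrier (module_copy h M)"
      then obtain x' where "x' \<in> carrier M" "x = h x'" by (auto simp: c)
      then show "\<exists>y\<in>carrier (module_copy h M). y \<oplus>\<^bsub>module_copy h M\<^esub> x = \<zero>\<^bsub>module_copy h M\<^esub>"
        using inv' by (simp add: c)
    qed (auto simp: c op M.a_assoc, auto simp: M.a_comm)
  qed (auto simp: c op R.is_cring smult_l_distr smult_r_distr smult_assoc1)
  show "h \<in> linear_maps R M (module_copy h M)" by (rule linear_mapsI) (auto simp: c op)
qed (auto simp: module_copy_def Let_def)

lemma linear_map_combination:
  assumes "module R L" "module R L'" "h \<in> linear_maps R L L'"
    "\<And>i. i < n \<Longrightarrow> k i \<in> carrier R" "\<And>i. i < n \<Longrightarrow> l i \<in> carrier L"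
  shows "h (nsum L (\<lambda>i. k i \<odot>\<^bsub>L\<^esub> l i) n) = nsum L' (\<lambda>i. k i \<odot>\<^bsub>L'\<^esub> h (l i)) n"
proof -
  interpret L: module R L by fact
  have "h (nsum L (\<lambda>i. k i \<odot>\<^bsub>L\<^esub> l i) n) = nsum L' (\<lambda>i. h (k i \<odot>\<^bsub>L\<^esub> l i)) n"
    using assms by (intro linear_maps_nsum[OF assms(1-3)]) auto
  then show ?thesis using assms by (simp add: linear_maps_smult[OF assms(3)] cong: nsum_cong)
qed

lemma trivial_relation_linear:
  assumes "module R L" "module R L'" "h \<in> linear_maps R L L'" "\<And>i. i < n \<Longrightarrow> l i \<in> carrier L"
    "trivial_relation R L M n l m"
  shows "trivial_relation R L' M n (\<lambda>i. h (l i)) m"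
proof -
  have "syzygies R L n l \<subseteq> syzygies R L' n (\<lambda>i. h (l i))"
  proof
    fix k assume k: "k \<in> syzygies R L n l"
    then have kc: "k i \<in> carrier R" for i by (auto simp: syzygies_def)
    have "nsum L' (\<lambda>i. k i \<odot>\<^bsub>L'\<^esub> h (l i)) n = h (nsum L (\<lambda>i. k i \<odot>\<^bsub>L\<^esub> l i) n)"
      using linear_map_combination[OF assms(1-3), of n k l] kc assms(4) by simp
    also have "\<dots> = \<zero>\<^bsub>L'\<^esub>" using k linear_maps_zero[OF assms(1-3)] by (simp add: syzygies_def)
    finally show "k \<in> syzygies R L' n (\<lambda>i. h (l i))" using kc by (simp add: syzygies_def)
  qed
  then show ?thesis using assms(5) coeff_span_mono unfolding trivial_relation_def by blast
qed

lemma trivial_relation_inj: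
  assumes "module R L" "module R L'" "h \<in> linear_maps R L L'" "\<And>i. i < n \<Longrightarrow> l i \<in> carrier L"
    "inj_on h (carrier L)" "trivial_relation R L' M n (\<lambda>i. h (l i)) m"
  shows "trivial_relation R L M n l m"
proof -
  interpret L: module R L by fact
  have "syzygies R L' n (\<lambda>i. h (l i)) \<subseteq> syzygies R L n l"
  proof
    fix k assume k: "k \<in> syzygies R L' n (\<lambda>i. h (l i))"
    then have kc: "k i \<in> carrier R" for i by (auto simp: syzygies_def)
    have "h (nsum L (\<lambda>i. k i \<odot>\<^bsub>L\<^esub> l i) n) = h \<zero>\<^bsub>L\<^esub>"
      using k linear_map_combination[OF assms(1-3), of n k l] kc assms(4) linear_maps_zero[OF assms(1-3)]
      by (simp add: syzygies_def)
    then have "nsum L (\<lambda>i. k i \<odot>\<^bsub>L\<^esub> l i) n = \<zero>\<^bsub>L\<^esub>"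
      using inj_onD[OF assms(5)] kc assms(4) by auto
    then show "k \<in> syzygies R L n l" using kc by (simp add: syzygies_def)
  qed
  then show ?thesis using assms(6) coeff_span_mono unfolding trivial_relation_def by blast
qed

lemma trivial_relation_ideal_iff:
  "trivial_relation R (ideal_as_module R I) M n r m \<longleftrightarrow> trivial_relation R (ring_as_module R) M n r m"
  unfolding trivial_relation_def syzygies_def by simp

text \<open>
  An isomorphic image \<open>L\<close> of the ideal is allowed, to cover the ideal itself as well as its copy in
  the universe.
\<close>

lemma ideal_copy_tensor_zeroD:
  assumes "cring R" and M: "module R M" and I: "ideal I R" and gen: "generators R n r I"
    and L: "module R L" and h: "h \<in> linear_maps R (ideal_as_module R I) L"
    and inj: "inj_on h I" and surj: "h ` I = carrier L" and m: "\<And>i. i < n \<Longrightarrow> m i \<in> carrier M"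
    and zero: "nsum (tensor_product R L M) (\<lambda>i. pure_tensor R L M (h (r i)) (m i)) n =
      \<zero>\<^bsub>tensor_product R L M\<^esub>"
  shows "trivial_relation R (ring_as_module R) M n r m"
proof -
  interpret R: cring R by fact
  interpret tensor_pair R L M using L M by (rule tensor_pair.intro)
  note IM = R.ideal_as_module_is_module[OF I]
  have r: "r i \<in> I" if "i < n" for i using gen that by (simp add: generators_def)
  have "trivial_relation R L M n (\<lambda>i. h (r i)) m"
  proof (rule generated_tensor_zeroD[OF _ _ m zero])
    show "h (r i) \<in> carrier L" if "i < n" for i using r[OF that] surj by auto
    fix x assume "x \<in> carrier L"
    then obtain y where y: "y \<in> I" "x = h y" using surj by blast
    then obtain k where k: "\<And>i. k i \<in> carrier R" "y = nsum R (\<lambda>i. k i \<otimes>\<^bsub>R\<^esub> r i) n"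
      using gen unfolding generators_def by blast
    then have "x = nsum L (\<lambda>i. k i \<odot>\<^bsub>L\<^esub> h (r i)) n"
      using linear_map_combination[OF IM L h, of n k r] r y by simp
    then show "\<exists>k. (\<forall>i. k i \<in> carrier R) \<and> x = nsum L (\<lambda>i. k i \<odot>\<^bsub>L\<^esub> h (r i)) n" using k by blast
  qed
  then have "trivial_relation R (ideal_as_module R I) M n r m"
    by (intro trivial_relation_inj[OF IM L h]) (use r inj in auto)
  then show ?thesis by (simp only: trivial_relation_ideal_iff)
qed

text \<open>
  Let \<open>I\<close> be the ideal generated by the coefficients of the relation. The element \<open>\<Sum> r\<^sub>i \<otimes> m\<^sub>i\<close> of
  \<open>I \<otimes> M\<close> goes to \<open>1 \<otimes> \<Sum> r\<^sub>i m\<^sub>i = 0\<close> in \<open>R \<otimes> M\<close>, so it is zero by flatness, and since the \<open>r\<^sub>i\<close> generate \<open>I\<close> the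
  relation is trivial.
\<close>

theorem flat_imp_equationally_flat:
  fixes R :: "('a, 'x) ring_scheme" and M :: "('a, 'm) module" and \<iota> :: "'a \<Rightarrow> 'u"
  assumes inj: "inj_on \<iota> (carrier R)" and flat: "flat TYPE('u) R M"
  shows "equationally_flat R M"
  unfolding equationally_flat_def
proof (intro allI impI, elim conjE)
  fix n r m assume r: "\<forall>i. r i \<in> carrier R" and m: "\<forall>i. m i \<in> carrier M"
    and rel: "nsum M (\<lambda>i. r i \<odot>\<^bsub>M\<^esub> m i) n = \<zero>\<^bsub>M\<^esub>"
  have M: "module R M" using flat by (simp add: flat_def)
  interpret M: module R M by fact
  define I where "I = combinations R n r"
  have I: "ideal I R" and gen: "generators R n r I"
    unfolding I_def using M.R.combinations_ideal r by auto
  interpret I: ideal I R by fact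
  have I_sub: "I \<subseteq> carrier R" using I.a_subset .
  let ?IM = "ideal_as_module R I" and ?RM = "ring_as_module R"
  note IM = M.R.ideal_as_module_is_module[OF I] and RM = M.R.ring_as_module_is_module
  define B where "B = module_copy \<iota> ?IM"
  define C where "C = module_copy \<iota> ?RM"
  have injI: "inj_on \<iota> I" using inj I_sub inj_on_subset by blast
  have B: "module R B" "\<iota> \<in> linear_maps R ?IM B" "carrier B = \<iota> ` I"
    using module.module_copy_is_module[OF IM, of \<iota>] module.module_copy_linear[OF IM, of \<iota>]
      module.module_copy_carrier[OF IM, of \<iota>] injI unfolding B_def by auto
  have C: "module R C" "\<iota> \<in> linear_maps R ?RM C" "carrier C = \<iota> ` carrier R"
    using module.module_copy_is_module[OF RM, of \<iota>] module.module_copy_linear[OF RM, of \<iota>]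
      module.module_copy_carrier[OF RM, of \<iota>] inj unfolding C_def by auto
  interpret BM: tensor_pair R B M using B M by (intro tensor_pair.intro)
  interpret CM: tensor_pair R C M using C M by (intro tensor_pair.intro)
  \<comment> \<open>The inclusion of the copy of \<open>I\<close> into the copy of \<open>R\<close> is the identity on elements of the universe.\<close>
  have g: "(\<lambda>x. x) \<in> linear_maps R B C"
  proof (rule linear_mapsI)
    show "x \<in> carrier C" if "x \<in> carrier B" for x using that B(3) C(3) I_sub by auto
    fix x y assume "x \<in> carrier B" "y \<in> carrier B"
    then obtain x' y' where "x' \<in> I" "y' \<in> I" "x = \<iota> x'" "y = \<iota> y'" using B(3) by auto
    then show "x \<oplus>\<^bsub>B\<^esub> y = x \<oplus>\<^bsub>C\<^esub> y"
      using linear_maps_add[OF B(2), of x' y'] linear_maps_add[OF C(2), of x' y'] I_sub by auto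
  next
    fix a x assume a: "a \<in> carrier R" and "x \<in> carrier B"
    then obtain x' where "x' \<in> I" "x = \<iota> x'" using B(3) by auto
    then show "a \<odot>\<^bsub>B\<^esub> x = a \<odot>\<^bsub>C\<^esub> x"
      using linear_maps_smult[OF B(2), of a x'] linear_maps_smult[OF C(2), of a x'] I_sub a by auto
  qed
  \<comment> \<open>A zero map out of \<open>B\<close> stands in for the map from the zero module.\<close>
  have f: "(\<lambda>x. \<zero>\<^bsub>B\<^esub>) \<in> linear_maps R B B" by (rule linear_mapsI) auto
  have z: "\<zero>\<^bsub>B\<^esub> = \<zero>\<^bsub>C\<^esub>" using linear_maps_zero[OF B(1) C(1) g] .
  have "exact_at B (\<lambda>x. \<zero>\<^bsub>B\<^esub>) B (\<lambda>x. x) C"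
    unfolding exact_at_def a_kernel_def' using z BM.L.zero_closed by auto
  then have ex: "exact_at BM.TT (tensor_map R B M B M (\<lambda>x. \<zero>\<^bsub>B\<^esub>) (\<lambda>x. x)) BM.TT
      (tensor_map R B M C M (\<lambda>x. x) (\<lambda>x. x)) CM.TT"
    using flat f g B(1) C(1) unfolding flat_def by blast
  let ?f = "tensor_map R B M B M (\<lambda>x. \<zero>\<^bsub>B\<^esub>) (\<lambda>x. x)" and ?g = "tensor_map R B M C M (\<lambda>x. x) (\<lambda>x. x)"
  note fl = tensor_map_linear[OF B(1) M B(1) M f id_linear] and fp = tensor_map_pure[OF B(1) M B(1) M f id_linear]
  note gl = tensor_map_linear[OF B(1) M C(1) M g id_linear] and gp = tensor_map_pure[OF B(1) M C(1) M g id_linear]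
  have f0: "?f x = \<zero>\<^bsub>BM.TT\<^esub>" if "x \<in> carrier BM.TT" for x
    using that
  proof (induction rule: BM.tensor_induct)
    case zero
    then show ?case using linear_maps_zero[OF BM.TT.module_axioms BM.TT.module_axioms fl] .
  next
    case (add z l m)
    then show ?case by (simp add: linear_maps_add[OF fl] fp)
  qed
  have rI: "r i \<in> I" if "i < n" for i using gen that by (simp add: generators_def)
  have rB: "\<iota> (r i) \<in> carrier B" if "i < n" for i using rI[OF that] B(3) by auto
  have one: "\<iota> \<one>\<^bsub>R\<^esub> \<in> carrier C" using C(3) by auto
  let ?z = "nsum BM.TT (\<lambda>i. pure_tensor R B M (\<iota> (r i)) (m i)) n"
  have zc: "?z \<in> carrier BM.TT" using rB m by auto
  have "?g ?z = nsum CM.TT (\<lambda>i. ?g (pure_tensor R B M (\<iota> (r i)) (m i))) n"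
    using rB m by (intro linear_maps_nsum[OF BM.TT.module_axioms CM.TT.module_axioms gl]) auto
  also have "\<dots> = nsum CM.TT (\<lambda>i. pure_tensor R C M (\<iota> \<one>\<^bsub>R\<^esub>) (r i \<odot>\<^bsub>M\<^esub> m i)) n"
  proof (rule nsum_cong)
    fix i assume i: "i < n"
    have "\<iota> (r i) = r i \<odot>\<^bsub>C\<^esub> \<iota> \<one>\<^bsub>R\<^esub>" using linear_maps_smult[OF C(2), of "r i" "\<one>\<^bsub>R\<^esub>"] r by simp
    then show "?g (pure_tensor R B M (\<iota> (r i)) (m i)) = pure_tensor R C M (\<iota> \<one>\<^bsub>R\<^esub>) (r i \<odot>\<^bsub>M\<^esub> m i)"
      using gp[OF rB[OF i], of "m i"] m r one by (simp add: CM.pure_smult_left CM.pure_smult_right)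
  qed
  also have "\<dots> = pure_tensor R C M (\<iota> \<one>\<^bsub>R\<^esub>) (nsum M (\<lambda>i. r i \<odot>\<^bsub>M\<^esub> m i) n)"
  proof -
    have "pure_tensor R C M (\<iota> \<one>\<^bsub>R\<^esub>) \<in> linear_maps R M CM.TT"
      using one by (intro linear_mapsI) (auto simp: CM.pure_add_right CM.pure_smult_right)
    then show ?thesis using r m by (intro linear_maps_nsum[OF M CM.TT.module_axioms, symmetric]) auto
  qed
  finally have "?g ?z = \<zero>\<^bsub>CM.TT\<^esub>" using rel one by simp
  then have "?z \<in> ?f ` carrier BM.TT" using ex zc unfolding exact_at_def a_kernel_def' by blast
  then have "?z = \<zero>\<^bsub>BM.TT\<^esub>" using f0 by auto
  then show "trivial_relation R (ring_as_module R) M n r m"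
    using ideal_copy_tensor_zeroD[OF M.R.is_cring M I gen B(1,2) injI B(3)[symmetric]] m by blast
qed

section \<open>The total quotient ring\<close>

context cring
begin

abbreviation "nzd \<equiv> nonzerodivisors R"
abbreviation "frc \<equiv> fraction R (nonzerodivisors R)"
abbreviation "TQ \<equiv> total_quotient_ring R"

lemma nzd_closed: "s \<in> nzd \<Longrightarrow> s \<in> carrier R"
  by (simp add: nonzerodivisors_def)

lemma nzd_one: "\<one> \<in> nzd"
  by (simp add: nonzerodivisors_def)

lemma nzd_zeroD: "s \<in> nzd \<Longrightarrow> r \<in> carrier R \<Longrightarrow> s \<otimes> r = \<zero> \<Longrightarrow> r = \<zero>"
  by (simp add: nonzerodivisors_def)

lemma nzd_mult:
  assumes "s \<in> nzd" "t \<in> nzd"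
  shows "s \<otimes> t \<in> nzd"
proof -
  have "r = \<zero>" if r: "r \<in> carrier R" "s \<otimes> t \<otimes> r = \<zero>" for r
  proof -
    have "s \<otimes> (t \<otimes> r) = \<zero>" using r assms nzd_closed by (simp add: m_assoc)
    then have "t \<otimes> r = \<zero>" using nzd_zeroD[OF assms(1)] r assms nzd_closed by simp
    then show ?thesis using nzd_zeroD[OF assms(2)] r by simp
  qed
  moreover have "s \<otimes> t \<in> carrier R" using assms nzd_closed by simp
  ultimately show ?thesis unfolding nonzerodivisors_def by blast
qed

lemma nzd_cancel:
  assumes "s \<in> nzd" "a \<in> carrier R" "b \<in> carrier R" "s \<otimes> a = s \<otimes> b"
  shows "a = b"
proof -
  have "s \<otimes> (a \<ominus> b) = \<zero>"
    using assms nzd_closed by (simp add: a_minus_def r_distr r_minus r_neg)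
  then have "a \<ominus> b = \<zero>" using assms nzd_zeroD by simp
  then show ?thesis using assms minus_eq_zero_iff by blast
qed

text \<open>
  Denominators are non-zero-divisors, so the factor \<open>u\<close> in \<^const>\<open>fraction\<close> can be cancelled.
\<close>

lemma mem_fraction_iff:
  assumes "r \<in> carrier R" "s \<in> nzd"
  shows "(r', s') \<in> frc r s \<longleftrightarrow> r' \<in> carrier R \<and> s' \<in> nzd \<and> r \<otimes> s' = r' \<otimes> s"
proof -
  have "(\<exists>u\<in>nzd. u \<otimes> (r \<otimes> s' \<ominus> r' \<otimes> s) = \<zero>) \<longleftrightarrow> r \<otimes> s' = r' \<otimes> s" if "r' \<in> carrier R" "s' \<in> nzd"
  proof -
    have c: "r \<otimes> s' \<in> carrier R" "r' \<otimes> s \<in> carrier R" using that assms nzd_closed by auto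
    have "r \<otimes> s' \<ominus> r' \<otimes> s = \<zero>" if "u \<in> nzd" "u \<otimes> (r \<otimes> s' \<ominus> r' \<otimes> s) = \<zero>" for u
      using nzd_zeroD[OF that(1) minus_closed[OF c] that(2)] .
    moreover have "\<one> \<otimes> (r \<otimes> s' \<ominus> r' \<otimes> s) = r \<otimes> s' \<ominus> r' \<otimes> s"
      using minus_closed[OF c] by (rule l_one)
    ultimately show ?thesis using nzd_one minus_eq_zero_iff[OF c] by metis
  qed
  then show ?thesis unfolding fraction_def by auto
qed

lemma fraction_eq_iff:
  assumes "r \<in> carrier R" "s \<in> nzd" "r' \<in> carrier R" "s' \<in> nzd"
  shows "frc r s = frc r' s' \<longleftrightarrow> r \<otimes> s' = r' \<otimes> s"
proof
  assume "frc r s = frc r' s'"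
  moreover have "(r', s') \<in> frc r' s'" using assms by (simp add: mem_fraction_iff)
  ultimately show "r \<otimes> s' = r' \<otimes> s" using assms mem_fraction_iff by blast
next
  have le: "frc r s \<subseteq> frc r' s'"
    if rs: "r \<in> carrier R" "s \<in> nzd" "r' \<in> carrier R" "s' \<in> nzd" and eq: "r \<otimes> s' = r' \<otimes> s" for r s r' s'
  proof
    fix p assume p: "p \<in> frc r s"
    obtain a b where ab: "p = (a, b)" by (cases p)
    have m: "a \<in> carrier R" "b \<in> nzd" "r \<otimes> b = a \<otimes> s" using p rs unfolding ab by (simp_all add: mem_fraction_iff)
    note c = rs(1,3) m(1) rs(2,4)[THEN nzd_closed] m(2)[THEN nzd_closed]
    have "s \<otimes> (r' \<otimes> b) = (r' \<otimes> s) \<otimes> b" using c by (simp add: m_ac)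
    also have "\<dots> = (r \<otimes> b) \<otimes> s'" using c by (simp add: eq[symmetric] m_ac)
    also have "\<dots> = s \<otimes> (a \<otimes> s')" using c by (simp add: m(3) m_ac)
    finally have "r' \<otimes> b = a \<otimes> s'" using nzd_cancel rs(2) c by simp
    then show "p \<in> frc r' s'" unfolding ab using rs m by (simp add: mem_fraction_iff)
  qed
  assume "r \<otimes> s' = r' \<otimes> s"
  then show "frc r s = frc r' s'" using le[of r s r' s'] le[of r' s' r s] assms by auto
qed

lemma quot_carrier: "carrier TQ = {frc r s | r s. r \<in> carrier R \<and> s \<in> nzd}"
  by (simp add: total_quotient_ring_def localization_def)

lemma quot_closed [simp]: "r \<in> carrier R \<Longrightarrow> s \<in> nzd \<Longrightarrow> frc r s \<in> carrier TQ"
  unfolding quot_carrier by blast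

lemma quotE:
  assumes "x \<in> carrier TQ"
  obtains r s where "r \<in> carrier R" "s \<in> nzd" "x = frc r s"
  using assms unfolding quot_carrier by blast

lemma quot_one: "\<one>\<^bsub>TQ\<^esub> = frc \<one> \<one>" and quot_zero: "\<zero>\<^bsub>TQ\<^esub> = frc \<zero> \<one>"
  by (auto simp: total_quotient_ring_def localization_def)

lemma quot_mult:
  assumes "r \<in> carrier R" "s \<in> nzd" "r' \<in> carrier R" "s' \<in> nzd"
  shows "frc r s \<otimes>\<^bsub>TQ\<^esub> frc r' s' = frc (r \<otimes> r') (s \<otimes> s')"
proof -
  have "frc (a \<otimes> a') (b \<otimes> b') = frc (r \<otimes> r') (s \<otimes> s')"
    if ab: "(a, b) \<in> frc r s" "(a', b') \<in> frc r' s'" for a b a' b'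
  proof -
    have m: "a \<in> carrier R" "b \<in> nzd" "r \<otimes> b = a \<otimes> s" "a' \<in> carrier R" "b' \<in> nzd" "r' \<otimes> b' = a' \<otimes> s'"
      using ab assms by (simp_all add: mem_fraction_iff)
    note c = m(1,4) assms(1,3) assms(2,4)[THEN nzd_closed] m(2,5)[THEN nzd_closed]
    have "(r \<otimes> r') \<otimes> (b \<otimes> b') = (r \<otimes> b) \<otimes> (r' \<otimes> b')" using c by (simp add: m_ac)
    also have "\<dots> = (a \<otimes> a') \<otimes> (s \<otimes> s')" unfolding m(3,6) using c by (simp add: m_ac)
    finally show ?thesis using assms m by (subst fraction_eq_iff) (auto simp: nzd_mult)
  qed
  then have "(\<Union>(a, b)\<in>frc r s. \<Union>(a', b')\<in>frc r' s'. frc (a \<otimes> a') (b \<otimes> b')) =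
    (\<Union>p\<in>frc r s. \<Union>q\<in>frc r' s'. frc (r \<otimes> r') (s \<otimes> s'))"
    by (intro SUP_cong refl) auto
  moreover have "(r, s) \<in> frc r s" "(r', s') \<in> frc r' s'" using assms by (simp_all add: mem_fraction_iff)
  ultimately show ?thesis by (auto simp: total_quotient_ring_def localization_def)
qed

lemma quot_add:
  assumes "r \<in> carrier R" "s \<in> nzd" "r' \<in> carrier R" "s' \<in> nzd"
  shows "frc r s \<oplus>\<^bsub>TQ\<^esub> frc r' s' = frc (r \<otimes> s' \<oplus> r' \<otimes> s) (s \<otimes> s')"
proof -
  have "frc (a \<otimes> b' \<oplus> a' \<otimes> b) (b \<otimes> b') = frc (r \<otimes> s' \<oplus> r' \<otimes> s) (s \<otimes> s')"
    if ab: "(a, b) \<in> frc r s" "(a', b') \<in> frc r' s'" for a b a' b'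
  proof -
    have m: "a \<in> carrier R" "b \<in> nzd" "r \<otimes> b = a \<otimes> s" "a' \<in> carrier R" "b' \<in> nzd" "r' \<otimes> b' = a' \<otimes> s'"
      using ab assms by (simp_all add: mem_fraction_iff)
    note c = m(1,4) assms(1,3) assms(2,4)[THEN nzd_closed] m(2,5)[THEN nzd_closed]
    have "(r \<otimes> s' \<oplus> r' \<otimes> s) \<otimes> (b \<otimes> b') = (r \<otimes> b) \<otimes> (s' \<otimes> b') \<oplus> (r' \<otimes> b') \<otimes> (s \<otimes> b)"
      using c by (simp add: m_ac l_distr r_distr)
    also have "\<dots> = (a \<otimes> b' \<oplus> a' \<otimes> b) \<otimes> (s \<otimes> s')" unfolding m(3,6) using c by (simp add: m_ac l_distr r_distr)
    finally show ?thesis using assms m by (subst fraction_eq_iff) (auto simp: nzd_mult nzd_closed)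
  qed
  then have "(\<Union>(a, b)\<in>frc r s. \<Union>(a', b')\<in>frc r' s'. frc (a \<otimes> b' \<oplus> a' \<otimes> b) (b \<otimes> b')) =
    (\<Union>p\<in>frc r s. \<Union>q\<in>frc r' s'. frc (r \<otimes> s' \<oplus> r' \<otimes> s) (s \<otimes> s'))"
    by (intro SUP_cong refl) auto
  moreover have "(r, s) \<in> frc r s" "(r', s') \<in> frc r' s'" using assms by (simp_all add: mem_fraction_iff)
  ultimately show ?thesis by (auto simp: total_quotient_ring_def localization_def)
qed

lemma fraction_cancel:
  assumes "r \<in> carrier R" "s \<in> nzd" "t \<in> nzd"
  shows "frc (t \<otimes> r) (t \<otimes> s) = frc r s"
  using assms by (subst fraction_eq_iff) (auto simp: nzd_mult nzd_closed m_ac)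

lemma quot_cring: "cring TQ"
proof (rule cringI)
  note simps = quot_add quot_mult quot_one quot_zero nzd_mult nzd_closed nzd_one
  show "abelian_group TQ"
  proof (rule abelian_groupI)
    show "\<zero>\<^bsub>TQ\<^esub> \<in> carrier TQ" by (simp add: simps)
    fix x assume "x \<in> carrier TQ"
    then obtain r s where x: "r \<in> carrier R" "s \<in> nzd" "x = frc r s" by (rule quotE)
    note xc = x(1) x(2)[THEN nzd_closed]
    show "\<zero>\<^bsub>TQ\<^esub> \<oplus>\<^bsub>TQ\<^esub> x = x" using x xc by (simp add: simps)
    have "frc (\<ominus> r) s \<oplus>\<^bsub>TQ\<^esub> x = \<zero>\<^bsub>TQ\<^esub>"
      unfolding quot_zero x(3) using x(1,2) xc
      by (simp add: simps fraction_eq_iff l_distr[symmetric] l_neg)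
    then show "\<exists>y\<in>carrier TQ. y \<oplus>\<^bsub>TQ\<^esub> x = \<zero>\<^bsub>TQ\<^esub>" using x by (intro bexI) auto
    fix y assume "y \<in> carrier TQ"
    then obtain r' s' where y: "r' \<in> carrier R" "s' \<in> nzd" "y = frc r' s'" by (rule quotE)
    note yc = y(1) y(2)[THEN nzd_closed]
    show "x \<oplus>\<^bsub>TQ\<^esub> y \<in> carrier TQ" using x y xc yc by (simp add: simps)
    show "x \<oplus>\<^bsub>TQ\<^esub> y = y \<oplus>\<^bsub>TQ\<^esub> x" unfolding x(3) y(3) using x(1,2) y(1,2) xc yc
      by (simp add: quot_add) (simp add: a_comm m_comm)
    fix z assume "z \<in> carrier TQ"
    then obtain r'' s'' where z: "r'' \<in> carrier R" "s'' \<in> nzd" "z = frc r'' s''" by (rule quotE)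
    note zc = z(1) z(2)[THEN nzd_closed]
    show "x \<oplus>\<^bsub>TQ\<^esub> y \<oplus>\<^bsub>TQ\<^esub> z = x \<oplus>\<^bsub>TQ\<^esub> (y \<oplus>\<^bsub>TQ\<^esub> z)"
      unfolding x(3) y(3) z(3) using x(1,2) y(1,2) z(1,2) xc yc zc
      by (simp add: quot_add nzd_mult l_distr r_distr a_ac m_ac)
  qed
  show "Group.comm_monoid TQ"
  proof (rule comm_monoidI)
    show "\<one>\<^bsub>TQ\<^esub> \<in> carrier TQ" by (simp add: simps)
    fix x assume "x \<in> carrier TQ"
    then obtain r s where x: "r \<in> carrier R" "s \<in> nzd" "x = frc r s" by (rule quotE)
    note xc = x(1) x(2)[THEN nzd_closed]
    show "\<one>\<^bsub>TQ\<^esub> \<otimes>\<^bsub>TQ\<^esub> x = x" using x xc by (simp add: simps)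
    fix y assume "y \<in> carrier TQ"
    then obtain r' s' where y: "r' \<in> carrier R" "s' \<in> nzd" "y = frc r' s'" by (rule quotE)
    note yc = y(1) y(2)[THEN nzd_closed]
    show "x \<otimes>\<^bsub>TQ\<^esub> y \<in> carrier TQ" using x y xc yc by (simp add: simps)
    show "x \<otimes>\<^bsub>TQ\<^esub> y = y \<otimes>\<^bsub>TQ\<^esub> x" unfolding x(3) y(3) using x(1,2) y(1,2) xc yc
      by (simp add: quot_mult) (simp add: m_comm)
    fix z assume "z \<in> carrier TQ"
    then obtain r'' s'' where z: "r'' \<in> carrier R" "s'' \<in> nzd" "z = frc r'' s''" by (rule quotE)
    note zc = z(1) z(2)[THEN nzd_closed]
    show "x \<otimes>\<^bsub>TQ\<^esub> y \<otimes>\<^bsub>TQ\<^esub> z = x \<otimes>\<^bsub>TQ\<^esub> (y \<otimes>\<^bsub>TQ\<^esub> z)"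
      unfolding x(3) y(3) z(3) using x(1,2) y(1,2) z(1,2) xc yc zc
      by (simp add: quot_mult nzd_mult m_ac)
  qed
  fix x y z assume "x \<in> carrier TQ" "y \<in> carrier TQ" "z \<in> carrier TQ"
  then obtain r s r' s' r'' s'' where x: "r \<in> carrier R" "s \<in> nzd" "x = frc r s"
    and y: "r' \<in> carrier R" "s' \<in> nzd" "y = frc r' s'"
    and z: "r'' \<in> carrier R" "s'' \<in> nzd" "z = frc r'' s''"
    by (metis quotE)
  note c = x(1) x(2)[THEN nzd_closed] y(1) y(2)[THEN nzd_closed] z(1) z(2)[THEN nzd_closed]
  show "(x \<oplus>\<^bsub>TQ\<^esub> y) \<otimes>\<^bsub>TQ\<^esub> z = x \<otimes>\<^bsub>TQ\<^esub> z \<oplus>\<^bsub>TQ\<^esub> y \<otimes>\<^bsub>TQ\<^esub> z"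
    unfolding x(3) y(3) z(3) using x(1,2) y(1,2) z(1,2) c
    by (simp add: quot_mult quot_add nzd_mult fraction_eq_iff l_distr r_distr m_ac)
qed

lemma quot_hom: "(\<lambda>r. frc r \<one>) \<in> ring_hom R TQ"
  by (rule ring_hom_memI) (auto simp: nzd_one quot_mult quot_add quot_one)

end

section \<open>Restriction and extension of scalars\<close>

lemma restrict_scalars_simps [simp]:
  "carrier (restrict_scalars \<phi> N) = carrier N" "zero (restrict_scalars \<phi> N) = zero N"
  "add (restrict_scalars \<phi> N) = add N" "smult (restrict_scalars \<phi> N) = (\<lambda>r x. smult N (\<phi> r) x)"
  by (auto simp: restrict_scalars_def)

lemma restrict_scalars_is_module:
  assumes "cring R" "module A N" "\<phi> \<in> ring_hom R A"
  shows "module R (restrict_scalars \<phi> N)"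
proof -
  interpret N: module A N by fact
  have inv: "\<exists>y\<in>carrier N. y \<oplus>\<^bsub>N\<^esub> x = \<zero>\<^bsub>N\<^esub>" if "x \<in> carrier N" for x
    using that by (intro bexI[of _ "\<ominus>\<^bsub>N\<^esub> x"]) (auto simp: N.M.l_neg)
  note h = ring_hom_closed[OF assms(3)] ring_hom_add[OF assms(3)] ring_hom_mult[OF assms(3)] ring_hom_one[OF assms(3)]
  show ?thesis
  proof (rule moduleI)
    show "abelian_group (restrict_scalars \<phi> N)"
      by (rule abelian_groupI) (auto simp: N.M.a_assoc inv, auto simp: N.M.a_comm)
  qed (auto simp: assms(1) h N.smult_l_distr N.smult_r_distr N.smult_assoc1)
qed

text \<open>
  All maps involved are additive, so the axioms have to be checked on pure tensors only.
\<close>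

lemma base_change_is_module:
  assumes "cring A" "module R M" "\<phi> \<in> ring_hom R A"
  shows "module A (base_change R M \<phi> A)"
    and "\<And>m a b. m \<in> carrier M \<Longrightarrow> a \<in> carrier A \<Longrightarrow> b \<in> carrier A \<Longrightarrow>
      a \<odot>\<^bsub>base_change R M \<phi> A\<^esub> pure_tensor R M (restrict_scalars \<phi> (ring_as_module A)) m b =
      pure_tensor R M (restrict_scalars \<phi> (ring_as_module A)) m (a \<otimes>\<^bsub>A\<^esub> b)"
proof -
  interpret A: cring A by fact
  interpret M: module R M by fact
  define B where "B = restrict_scalars \<phi> (ring_as_module A)"
  have B: "module R B" unfolding B_def
    by (rule restrict_scalars_is_module[OF M.R.is_cring A.ring_as_module_is_module assms(3)])
  interpret T: tensor_pair R M B using assms(2) B by (rule tensor_pair.intro)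
  let ?N = "base_change R M \<phi> A"
  have Bs: "carrier B = carrier A" "add B = add A" "\<And>r x. r \<odot>\<^bsub>B\<^esub> x = \<phi> r \<otimes>\<^bsub>A\<^esub> x" "zero B = zero A"
    by (auto simp: B_def)
  have N: "carrier ?N = carrier T.TT" "zero ?N = zero T.TT" "add ?N = add T.TT"
    "\<And>a. smult ?N a = tensor_map R M B M B (\<lambda>x. x) (\<lambda>b. a \<otimes>\<^bsub>A\<^esub> b)"
    by (auto simp: base_change_def B_def Let_def)
  have ml: "(\<lambda>b. a \<otimes>\<^bsub>A\<^esub> b) \<in> linear_maps R B B" if "a \<in> carrier A" for a
    using that ring_hom_closed[OF assms(3)]
    by (intro linear_mapsI) (auto simp: Bs A.r_distr A.m_lcomm)
  have lin: "smult ?N a \<in> linear_maps R T.TT T.TT" if "a \<in> carrier A" for a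
    unfolding N(4) by (rule tensor_map_linear[OF assms(2) B assms(2) B id_linear ml[OF that]])
  have pure: "a \<odot>\<^bsub>?N\<^esub> pure_tensor R M B m b = pure_tensor R M B m (a \<otimes>\<^bsub>A\<^esub> b)"
    if "a \<in> carrier A" "m \<in> carrier M" "b \<in> carrier A" for a m b
    unfolding N(4) using that tensor_map_pure[OF assms(2) B assms(2) B id_linear ml[OF that(1)], of m b]
    by (simp add: Bs)
  have act_zero: "a \<odot>\<^bsub>?N\<^esub> \<zero>\<^bsub>T.TT\<^esub> = \<zero>\<^bsub>T.TT\<^esub>" if "a \<in> carrier A" for a
    by (rule linear_maps_zero[OF T.TT.module_axioms T.TT.module_axioms lin[OF that]])
  show "a \<odot>\<^bsub>?N\<^esub> pure_tensor R M (restrict_scalars \<phi> (ring_as_module A)) m b =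
      pure_tensor R M (restrict_scalars \<phi> (ring_as_module A)) m (a \<otimes>\<^bsub>A\<^esub> b)"
    if "m \<in> carrier M" "a \<in> carrier A" "b \<in> carrier A" for m a b
    using pure that unfolding B_def by blast
  have inv: "\<exists>y\<in>carrier T.TT. y \<oplus>\<^bsub>T.TT\<^esub> x = \<zero>\<^bsub>T.TT\<^esub>" if "x \<in> carrier T.TT" for x
    using that by (intro bexI[of _ "\<ominus>\<^bsub>T.TT\<^esub> x"]) (auto simp: T.TT.M.l_neg)
  have cl: "a \<odot>\<^bsub>?N\<^esub> z \<in> carrier T.TT" if "a \<in> carrier A" "z \<in> carrier T.TT" for a z
    using linear_maps_closed[OF lin] that by blast
  have pc: "pure_tensor R M B m b \<in> carrier T.TT" if "m \<in> carrier M" "b \<in> carrier A" for m b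
    using that by (intro T.pure_closed) (auto simp: Bs)
  show "module A ?N"
  proof (rule moduleI)
    show "cring A" by fact
    show "abelian_group ?N"
      by (rule abelian_groupI) (auto simp: N T.TT.M.a_assoc inv, auto simp: T.TT.M.a_comm)
    show "a \<odot>\<^bsub>?N\<^esub> z \<in> carrier ?N" if "a \<in> carrier A" "z \<in> carrier ?N" for a z
      using cl that unfolding N by blast
    show "a \<odot>\<^bsub>?N\<^esub> (x \<oplus>\<^bsub>?N\<^esub> y) = a \<odot>\<^bsub>?N\<^esub> x \<oplus>\<^bsub>?N\<^esub> a \<odot>\<^bsub>?N\<^esub> y"
      if "a \<in> carrier A" "x \<in> carrier ?N" "y \<in> carrier ?N" for a x y
      using linear_maps_add[OF lin[OF that(1)]] that unfolding N(1,3) by blast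
    show "(a \<oplus>\<^bsub>A\<^esub> b) \<odot>\<^bsub>?N\<^esub> z = a \<odot>\<^bsub>?N\<^esub> z \<oplus>\<^bsub>?N\<^esub> b \<odot>\<^bsub>?N\<^esub> z"
      if ab: "a \<in> carrier A" "b \<in> carrier A" and z: "z \<in> carrier ?N" for a b z
      unfolding N(3) using z[unfolded N(1)]
    proof (induction rule: T.tensor_induct)
      case zero
      then show ?case using ab by (simp add: act_zero)
    next
      case (add z m q)
      have q: "q \<in> carrier A" using add by (simp add: Bs)
      have "(a \<oplus>\<^bsub>A\<^esub> b) \<odot>\<^bsub>?N\<^esub> pure_tensor R M B m q =
        a \<odot>\<^bsub>?N\<^esub> pure_tensor R M B m q \<oplus>\<^bsub>T.TT\<^esub> b \<odot>\<^bsub>?N\<^esub> pure_tensor R M B m q"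
        using ab q add T.pure_add_right[of m "a \<otimes>\<^bsub>A\<^esub> q" "b \<otimes>\<^bsub>A\<^esub> q"] by (simp add: pure A.l_distr Bs)
      then show ?case using add ab q
        by (simp add: linear_maps_add[OF lin] cl pc T.TT.M.a_ac)
    qed
    show "(a \<otimes>\<^bsub>A\<^esub> b) \<odot>\<^bsub>?N\<^esub> z = a \<odot>\<^bsub>?N\<^esub> (b \<odot>\<^bsub>?N\<^esub> z)"
      if ab: "a \<in> carrier A" "b \<in> carrier A" and z: "z \<in> carrier ?N" for a b z
      using z[unfolded N(1)]
    proof (induction rule: T.tensor_induct)
      case zero
      then show ?case using ab by (simp add: act_zero)
    next
      case (add z m q)
      have q: "q \<in> carrier A" using add by (simp add: Bs)
      have "(a \<otimes>\<^bsub>A\<^esub> b) \<odot>\<^bsub>?N\<^esub> pure_tensor R M B m q = a \<odot>\<^bsub>?N\<^esub> (b \<odot>\<^bsub>?N\<^esub> pure_tensor R M B m q)"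
        using ab q add by (simp add: pure A.m_assoc)
      then show ?case using add ab q by (simp add: linear_maps_add[OF lin] cl pc)
    qed
    show "\<one>\<^bsub>A\<^esub> \<odot>\<^bsub>?N\<^esub> z = z" if z: "z \<in> carrier ?N" for z
      using z[unfolded N(1)]
    proof (induction rule: T.tensor_induct)
      case zero
      then show ?case by (simp add: act_zero)
    next
      case (add z m q)
      then show ?case by (simp add: linear_maps_add[OF lin] pure Bs pc)
    qed
  qed
qed

lemma base_change_simps:
  "carrier (base_change R M \<phi> A) = carrier (tensor_product R M (restrict_scalars \<phi> (ring_as_module A)))"
  "zero (base_change R M \<phi> A) = zero (tensor_product R M (restrict_scalars \<phi> (ring_as_module A)))"
  "add (base_change R M \<phi> A) = add (tensor_product R M (restrict_scalars \<phi> (ring_as_module A)))"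
  by (simp_all add: base_change_def Let_def)

lemma nsum_base_change:
  "nsum (base_change R M \<phi> A) f n = nsum (tensor_product R M (restrict_scalars \<phi> (ring_as_module A))) f n"
  by (induction n) (simp_all add: base_change_simps)

section \<open>Modules over the total quotient ring\<close>

text \<open>
  In the abbreviations, \<open>rf r\<close> is \<open>r/1\<close>, \<open>BB\<close> is \<open>Q\<close> as an \<open>R\<close>-module, \<open>MB\<close> and \<open>NQ\<close> are \<open>M \<otimes> Q\<close> over \<open>R\<close>
  and over \<open>Q\<close>, and \<open>\<tau> m s\<close> is \<open>m \<otimes> 1/s\<close>.
\<close>

context module
begin

abbreviation "rf r \<equiv> fraction R (nonzerodivisors R) r \<one>"
abbreviation "BB \<equiv> restrict_scalars (\<lambda>r. fraction R (nonzerodivisors R) r \<one>) (ring_as_module TQ)"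
abbreviation "NQ \<equiv> tensor_total_quotient R M"
abbreviation "MB \<equiv> tensor_product R M BB"
abbreviation "\<tau> m s \<equiv> pure_tensor R M BB m (frc \<one> s)"

interpretation TQ: cring TQ by (rule R.quot_cring)

lemma BB_module: "module R BB"
  by (rule restrict_scalars_is_module[OF R.is_cring TQ.ring_as_module_is_module R.quot_hom])

interpretation T: tensor_pair R M BB
  using module_axioms BB_module by (rule tensor_pair.intro)

lemma NQ_simps: "carrier NQ = carrier MB" "zero NQ = zero MB" "add NQ = add MB" "nsum NQ f n = nsum MB f n"
  by (simp_all add: tensor_total_quotient_def base_change_simps nsum_base_change)

lemma NQ_module: "module TQ NQ"
  unfolding tensor_total_quotient_def
  by (rule base_change_is_module(1)[OF R.quot_cring module_axioms R.quot_hom])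

interpretation NQ: module TQ NQ by (rule NQ_module)

lemma NQ_smult_pure:
  "m \<in> carrier M \<Longrightarrow> a \<in> carrier TQ \<Longrightarrow> b \<in> carrier TQ \<Longrightarrow>
    a \<odot>\<^bsub>NQ\<^esub> pure_tensor R M BB m b = pure_tensor R M BB m (a \<otimes>\<^bsub>TQ\<^esub> b)"
  unfolding tensor_total_quotient_def
  by (rule base_change_is_module(2)[OF R.quot_cring module_axioms R.quot_hom])

lemma tau_closed: "m \<in> carrier M \<Longrightarrow> s \<in> nzd \<Longrightarrow> \<tau> m s \<in> carrier NQ"
  unfolding NQ_simps by (rule T.pure_closed) auto

lemma tau_linear: "s \<in> nzd \<Longrightarrow> (\<lambda>m. \<tau> m s) \<in> linear_maps R M MB"
  by (rule linear_mapsI) (simp_all add: T.pure_add_left T.pure_smult_left)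

lemma tau_add:
  "m \<in> carrier M \<Longrightarrow> m' \<in> carrier M \<Longrightarrow> s \<in> nzd \<Longrightarrow> \<tau> (m \<oplus>\<^bsub>M\<^esub> m') s = \<tau> m s \<oplus>\<^bsub>NQ\<^esub> \<tau> m' s"
  using linear_maps_add[OF tau_linear] unfolding NQ_simps by blast

lemma tau_smult:
  assumes "m \<in> carrier M" "s \<in> nzd" "r \<in> carrier R" "t \<in> nzd"
  shows "frc r t \<odot>\<^bsub>NQ\<^esub> \<tau> m s = \<tau> (r \<odot>\<^bsub>M\<^esub> m) (t \<otimes> s)"
proof -
  note c = assms R.nzd_closed[OF assms(2)] R.nzd_closed[OF assms(4)]
  have "frc r t \<odot>\<^bsub>NQ\<^esub> \<tau> m s = pure_tensor R M BB m (frc r (t \<otimes> s))"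
    using c by (simp add: NQ_smult_pure R.quot_mult R.nzd_one)
  also have "frc r (t \<otimes> s) = r \<odot>\<^bsub>BB\<^esub> frc \<one> (t \<otimes> s)"
    using c by (simp add: R.quot_mult R.nzd_mult R.nzd_one)
  also have "pure_tensor R M BB m (r \<odot>\<^bsub>BB\<^esub> frc \<one> (t \<otimes> s)) = \<tau> (r \<odot>\<^bsub>M\<^esub> m) (t \<otimes> s)"
    using c by (subst T.pure_smult_right) (auto simp: R.nzd_mult T.pure_smult_left)
  finally show ?thesis .
qed

lemma tau_expand:
  assumes "m \<in> carrier M" "s \<in> nzd" "t \<in> nzd"
  shows "\<tau> (t \<odot>\<^bsub>M\<^esub> m) (t \<otimes> s) = \<tau> m s"
proof -
  note c = assms R.nzd_closed[OF assms(2)] R.nzd_closed[OF assms(3)]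
  have "\<tau> (t \<odot>\<^bsub>M\<^esub> m) (t \<otimes> s) = frc t t \<odot>\<^bsub>NQ\<^esub> \<tau> m s" using c by (simp add: tau_smult)
  also have "frc t t = \<one>\<^bsub>TQ\<^esub>"
    using c R.fraction_cancel[of \<one> \<one> t] by (simp add: R.quot_one R.nzd_one)
  finally show ?thesis using tau_closed[OF assms(1,2)] by simp
qed

text \<open>
  By \<open>m \<otimes> r/s = r m \<otimes> 1/s\<close>, fractions can be moved to the left, and a sum of two such tensors has the
  product of the denominators as a common denominator.
\<close>

lemma NQ_elements:
  assumes "z \<in> carrier NQ"
  obtains m s where "m \<in> carrier M" "s \<in> nzd" "z = \<tau> m s"
proof -
  from assms have "z \<in> carrier MB" by (simp add: NQ_simps)
  then have "\<exists>m s. m \<in> carrier M \<and> s \<in> nzd \<and> z = \<tau> m s"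
  proof (induction rule: T.tensor_induct)
    case zero
    have "\<zero>\<^bsub>MB\<^esub> = \<tau> \<zero>\<^bsub>M\<^esub> \<one>" by (simp add: T.pure_zero_left R.nzd_one)
    then show ?case using R.nzd_one by blast
  next
    case (add z l q)
    obtain m s where ms: "m \<in> carrier M" "s \<in> nzd" "z = \<tau> m s" using add by blast
    have "q \<in> carrier TQ" using add(3) by simp
    then obtain r t where rt: "r \<in> carrier R" "t \<in> nzd" "q = frc r t" by (rule R.quotE)
    note c = ms(1,2) rt(1,2) add(2) R.nzd_closed[OF ms(2)] R.nzd_closed[OF rt(2)]
    have q: "q = r \<odot>\<^bsub>BB\<^esub> frc \<one> t" using c by (simp add: rt(3) R.quot_mult R.nzd_one)
    have "pure_tensor R M BB l q = \<tau> (r \<odot>\<^bsub>M\<^esub> l) t"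
      unfolding q using c by (subst T.pure_smult_right) (auto simp: T.pure_smult_left)
    also have "\<dots> = \<tau> (s \<odot>\<^bsub>M\<^esub> (r \<odot>\<^bsub>M\<^esub> l)) (s \<otimes> t)" using c by (simp add: tau_expand)
    finally have 1: "pure_tensor R M BB l q = \<tau> (s \<odot>\<^bsub>M\<^esub> (r \<odot>\<^bsub>M\<^esub> l)) (s \<otimes> t)" .
    have "z = \<tau> (t \<odot>\<^bsub>M\<^esub> m) (s \<otimes> t)" unfolding ms(3) using c tau_expand[of m s t] by (simp add: R.m_comm)
    then have "z \<oplus>\<^bsub>MB\<^esub> pure_tensor R M BB l q = \<tau> (t \<odot>\<^bsub>M\<^esub> m \<oplus>\<^bsub>M\<^esub> s \<odot>\<^bsub>M\<^esub> (r \<odot>\<^bsub>M\<^esub> l)) (s \<otimes> t)"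
      unfolding 1 using c by (subst tau_add) (auto simp: R.nzd_mult NQ_simps)
    then show ?case using c R.nzd_mult by (meson M.add.m_closed smult_closed)
  qed
  then show ?thesis using that by blast
qed

text \<open>
  A certificate for \<open>m \<otimes> 1/s = 0\<close> consists of zero combinations of elements of \<open>M\<close>, weighted by finitely
  many fractions. Clearing their denominators turns it into an identity \<open>t [m] = s k\<close> in the free
  module on \<open>M\<close>, where \<open>k\<close> has value zero, so that \<open>t m = 0\<close>.
\<close>

lemma tau_eq_zero_iff:
  assumes m: "m \<in> carrier M" and s: "s \<in> nzd"
  shows "\<tau> m s = \<zero>\<^bsub>NQ\<^esub> \<longleftrightarrow> (\<exists>t\<in>nzd. t \<odot>\<^bsub>M\<^esub> m = \<zero>\<^bsub>M\<^esub>)"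
proof
  assume "\<exists>t\<in>nzd. t \<odot>\<^bsub>M\<^esub> m = \<zero>\<^bsub>M\<^esub>"
  then obtain t where t: "t \<in> nzd" "t \<odot>\<^bsub>M\<^esub> m = \<zero>\<^bsub>M\<^esub>" by blast
  have "\<tau> m s = \<tau> \<zero>\<^bsub>M\<^esub> (t \<otimes> s)" using tau_expand[OF m s t(1)] t(2) by simp
  then show "\<tau> m s = \<zero>\<^bsub>NQ\<^esub>" using t s by (simp add: NQ_simps R.nzd_mult)
next
  assume zero: "\<tau> m s = \<zero>\<^bsub>NQ\<^esub>"
  define F where "F = free_module R (carrier M)"
  interpret F: module R F unfolding F_def by (rule R.free_module_is_module)
  define lc where "lc = linear_combination R M"
  have lc: "lc \<in> linear_maps R F M"
    unfolding lc_def F_def linear_combination_eq_free_extension by (rule free_extension_linear)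
  define K where "K = a_kernel F M lc"
  define b where "b = free_basis R m"
  have b: "b \<in> carrier F" unfolding b_def F_def using m by (rule R.free_basis_closed)
  have lcb: "lc b = m"
    unfolding lc_def b_def linear_combination_eq_free_extension
    using free_extension_basis[of "carrier M" "\<lambda>x. x"] m by simp
  have bc: "b x \<in> carrier R" for x by (auto simp: b_def free_basis_def)
  have Kc: "k \<in> carrier F" "lc k = \<zero>\<^bsub>M\<^esub>" if "k \<in> K" for k using that by (auto simp: K_def a_kernel_def')
  have FR: "k x \<in> carrier R" if "k \<in> carrier F" for k x using that by (auto simp: F_def free_module_def)
  have F_ops: "(k \<oplus>\<^bsub>F\<^esub> l) x = k x \<oplus> l x" "(r \<odot>\<^bsub>F\<^esub> k) x = r \<otimes> k x" for k l x r
    by (auto simp: F_def free_module_def)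
  have "nsum MB (\<lambda>i. \<tau> m s) 1 = \<zero>\<^bsub>MB\<^esub>"
    using zero tau_closed[OF m s] by (simp add: NQ_simps)
  then have "(\<lambda>x. nsum BB (\<lambda>j. b x \<odot>\<^bsub>BB\<^esub> frc \<one> s) 1) \<in> coeff_span BB K"
    unfolding b_def K_def F_def lc_def
    using m s by (intro T.tensor_sum_zero_free[of 1 "\<lambda>i. m" "\<lambda>i. frc \<one> s"]) auto
  moreover have "\<exists>t\<in>nzd. \<exists>k\<in>K. \<forall>x. rf t \<otimes>\<^bsub>TQ\<^esub> v x = rf (k x)" if "v \<in> coeff_span BB K" for v
    using that
  proof (induction rule: coeff_span.induct)
    case zero
    have "\<zero>\<^bsub>F\<^esub> \<in> K" unfolding K_def a_kernel_def'
      using linear_maps_zero[OF F.module_axioms module_axioms lc] by simp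
    moreover have "rf \<one> \<otimes>\<^bsub>TQ\<^esub> \<zero>\<^bsub>BB\<^esub> = rf (\<zero>\<^bsub>F\<^esub> x)" for x
      by (simp add: R.quot_zero R.quot_mult R.nzd_one F_def free_module_def)
    ultimately show ?case using R.nzd_one by blast
  next
    case (add v k y)
    obtain t l where t: "t \<in> nzd" "l \<in> K" "\<And>x. rf t \<otimes>\<^bsub>TQ\<^esub> v x = rf (l x)" using add.IH by blast
    have "y \<in> carrier TQ" using add(3) by simp
    then obtain p u where y: "p \<in> carrier R" "u \<in> nzd" "y = frc p u" by (rule R.quotE)
    have vc: "v x \<in> carrier TQ" for x
      using module.coeff_span_closed[OF BB_module _ add(1), of x] Kc FR by (auto simp: coeffs_def)
    note c = R.nzd_closed[OF t(1)] R.nzd_closed[OF y(2)] y(1,2) t(1) R.nzd_mult[OF t(1) y(2)] R.nzd_one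
    let ?k = "u \<odot>\<^bsub>F\<^esub> l \<oplus>\<^bsub>F\<^esub> (t \<otimes> p) \<odot>\<^bsub>F\<^esub> k"
    have "?k \<in> K" unfolding K_def a_kernel_def'
      using Kc[OF t(2)] Kc[OF add(2)] c by (simp add: linear_maps_add[OF lc] linear_maps_smult[OF lc])
    moreover have "rf (t \<otimes> u) \<otimes>\<^bsub>TQ\<^esub> (v x \<oplus>\<^bsub>BB\<^esub> k x \<odot>\<^bsub>BB\<^esub> y) = rf (?k x)" for x
    proof -
      have kl: "k x \<in> carrier R" "l x \<in> carrier R" using FR Kc add(2) t(2) by auto
      have "rf (t \<otimes> u) \<otimes>\<^bsub>TQ\<^esub> (v x \<oplus>\<^bsub>BB\<^esub> k x \<odot>\<^bsub>BB\<^esub> y) =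
        rf u \<otimes>\<^bsub>TQ\<^esub> (rf t \<otimes>\<^bsub>TQ\<^esub> v x) \<oplus>\<^bsub>TQ\<^esub> rf (t \<otimes> u) \<otimes>\<^bsub>TQ\<^esub> (rf (k x) \<otimes>\<^bsub>TQ\<^esub> frc p u)"
      proof -
        have "rf (t \<otimes> u) = rf u \<otimes>\<^bsub>TQ\<^esub> rf t" using c by (simp add: R.quot_mult R.m_comm)
        then show ?thesis using c kl vc[of x] by (simp add: y(3) TQ.r_distr TQ.m_assoc)
      qed
      also have "rf (t \<otimes> u) \<otimes>\<^bsub>TQ\<^esub> (rf (k x) \<otimes>\<^bsub>TQ\<^esub> frc p u) = rf (t \<otimes> p \<otimes> k x)"
        using c kl by (simp add: R.quot_mult R.fraction_eq_iff R.m_ac)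
      also have "rf u \<otimes>\<^bsub>TQ\<^esub> (rf t \<otimes>\<^bsub>TQ\<^esub> v x) = rf (u \<otimes> l x)"
        unfolding t(3) using c kl by (simp add: R.quot_mult)
      also have "rf (u \<otimes> l x) \<oplus>\<^bsub>TQ\<^esub> rf (t \<otimes> p \<otimes> k x) = rf (?k x)"
        using c kl by (simp add: R.quot_add F_ops)
      finally show ?thesis .
    qed
    ultimately show ?case using c by blast
  qed
  ultimately obtain t k where t: "t \<in> nzd" and k: "k \<in> K"
    and eq: "\<And>x. rf t \<otimes>\<^bsub>TQ\<^esub> nsum BB (\<lambda>j. b x \<odot>\<^bsub>BB\<^esub> frc \<one> s) 1 = rf (k x)" by blast
  note c = R.nzd_closed[OF t] R.nzd_closed[OF s] s t R.nzd_mult[OF t s] R.nzd_one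
  have "t \<otimes> b x = s \<otimes> k x" for x
  proof -
    have kx: "k x \<in> carrier R" using FR Kc k by blast
    have bs: "b x \<odot>\<^bsub>BB\<^esub> frc \<one> s = frc (b x) s" using c bc by (simp add: R.quot_mult)
    have "frc (b x) s \<in> carrier TQ" using c bc by simp
    then have "rf t \<otimes>\<^bsub>TQ\<^esub> frc (b x) s = rf (k x)" using eq[of x] unfolding bs by simp
    then have "frc (t \<otimes> b x) s = rf (k x)" using c bc by (simp add: R.quot_mult)
    then show ?thesis using c bc kx by (simp add: R.fraction_eq_iff R.m_comm)
  qed
  then have "t \<odot>\<^bsub>F\<^esub> b = s \<odot>\<^bsub>F\<^esub> k" by (auto simp: F_ops)
  then have "lc (t \<odot>\<^bsub>F\<^esub> b) = lc (s \<odot>\<^bsub>F\<^esub> k)" by simp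
  then have "t \<odot>\<^bsub>M\<^esub> m = s \<odot>\<^bsub>M\<^esub> \<zero>\<^bsub>M\<^esub>"
    using c b Kc[OF k] by (simp add: linear_maps_smult[OF lc] lcb)
  then show "\<exists>t\<in>nzd. t \<odot>\<^bsub>M\<^esub> m = \<zero>\<^bsub>M\<^esub>" using t c by auto
qed

lemma common_denominator_ring:
  assumes "\<And>i. i < (n :: nat) \<Longrightarrow> \<alpha> i \<in> carrier TQ"
  shows "\<exists>s\<in>nzd. \<exists>r. (\<forall>i. r i \<in> carrier R) \<and> (\<forall>i<n. \<alpha> i = frc (r i) s)"
  using assms
proof (induction n)
  case 0
  show ?case using R.nzd_one by (intro bexI[of _ \<one>] exI[of _ "\<lambda>_. \<zero>"]) auto
next
  case (Suc n)
  then obtain s r where s: "s \<in> nzd" and r: "\<And>i. r i \<in> carrier R" "\<And>i. i < n \<Longrightarrow> \<alpha> i = frc (r i) s"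
    by (metis less_Suc_eq)
  have "\<alpha> n \<in> carrier TQ" using Suc.prems by simp
  then obtain p u where p: "p \<in> carrier R" "u \<in> nzd" "\<alpha> n = frc p u" by (rule R.quotE)
  note c = R.nzd_closed[OF s] R.nzd_closed[OF p(2)]
  have "\<alpha> i = frc (if i < n then u \<otimes> r i else s \<otimes> p) (u \<otimes> s)" if "i < Suc n" for i
    using that r s p c R.fraction_cancel[of "r i" s u] R.fraction_cancel[of p u s]
    by (auto simp: less_Suc_eq R.m_comm)
  then show ?case using s p r c
    by (intro bexI[of _ "u \<otimes> s"] exI[of _ "\<lambda>i. if i < n then u \<otimes> r i else s \<otimes> p"]) (auto simp: R.nzd_mult)
qed

lemma common_denominator_module:
  assumes "\<And>i. i < (n :: nat) \<Longrightarrow> x i \<in> carrier NQ"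
  shows "\<exists>s\<in>nzd. \<exists>m. (\<forall>i. m i \<in> carrier M) \<and> (\<forall>i<n. x i = \<tau> (m i) s)"
  using assms
proof (induction n)
  case 0
  show ?case using R.nzd_one by (intro bexI[of _ \<one>] exI[of _ "\<lambda>_. \<zero>\<^bsub>M\<^esub>"]) auto
next
  case (Suc n)
  then obtain s r where s: "s \<in> nzd" and r: "\<And>i. r i \<in> carrier M" "\<And>i. i < n \<Longrightarrow> x i = \<tau> (r i) s"
    by (metis less_Suc_eq)
  have "x n \<in> carrier NQ" using Suc.prems by simp
  then obtain p u where p: "p \<in> carrier M" "u \<in> nzd" "x n = \<tau> p u" by (rule NQ_elements)
  note c = R.nzd_closed[OF s] R.nzd_closed[OF p(2)]
  have "x i = \<tau> (if i < n then u \<odot>\<^bsub>M\<^esub> r i else s \<odot>\<^bsub>M\<^esub> p) (u \<otimes> s)" if "i < Suc n" for i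
    using that r s p c tau_expand[of "r i" s u] tau_expand[of p u s]
    by (auto simp: less_Suc_eq R.m_comm)
  then show ?case using s p r c
    by (intro bexI[of _ "u \<otimes> s"] exI[of _ "\<lambda>i. if i < n then u \<odot>\<^bsub>M\<^esub> r i else s \<odot>\<^bsub>M\<^esub> p"])
      (auto simp: R.nzd_mult)
qed

lemma nsum_frac:
  assumes "s \<in> nzd" "\<And>i. i < n \<Longrightarrow> r i \<in> carrier R"
  shows "nsum TQ (\<lambda>i. frc (r i) s) n = frc (nsum R r n) s"
  using assms(2)
proof (induction n)
  case 0
  show ?case using assms(1) R.nzd_closed R.nzd_one by (simp add: R.quot_zero R.fraction_eq_iff)
next
  case (Suc n)
  note c = R.nzd_closed[OF assms(1)] R.nzd_mult[OF assms(1) assms(1)] assms(1)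
  have "nsum R r n \<in> carrier R" "r n \<in> carrier R" using Suc.prems by auto
  then show ?case using Suc c
    by (simp add: R.quot_add R.fraction_eq_iff R.l_distr R.r_distr R.m_ac)
qed

lemma frac_eq_zero_iff:
  assumes "r \<in> carrier R" "s \<in> nzd"
  shows "frc r s = \<zero>\<^bsub>TQ\<^esub> \<longleftrightarrow> r = \<zero>"
  using assms R.nzd_closed by (auto simp: R.quot_zero R.fraction_eq_iff R.nzd_one)

text \<open>
  With common denominators, a relation over \<open>Q\<close> says that \<open>\<Sum> r\<^sub>i m\<^sub>i\<close> is killed by some
  non-zero-divisor \<open>t\<close>. So \<open>\<Sum> r\<^sub>i (t m\<^sub>i) = 0\<close> is a relation over \<open>R\<close>, and its trivialisation becomes one
  over \<open>Q\<close> after division by \<open>t\<close>.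
\<close>

theorem total_quotient_equationally_flat:
  assumes flat: "equationally_flat R M"
  shows "equationally_flat TQ NQ"
  unfolding equationally_flat_def
proof (intro allI impI, elim conjE)
  fix n \<alpha> x assume \<alpha>: "\<forall>i. \<alpha> i \<in> carrier TQ" and x: "\<forall>i. x i \<in> carrier NQ"
    and rel: "nsum NQ (\<lambda>i. \<alpha> i \<odot>\<^bsub>NQ\<^esub> x i) n = \<zero>\<^bsub>NQ\<^esub>"
  obtain u r where u: "u \<in> nzd" and r: "\<And>i. r i \<in> carrier R" "\<And>i. i < n \<Longrightarrow> \<alpha> i = frc (r i) u"
    using common_denominator_ring[of n \<alpha>] \<alpha> by blast
  obtain s m where s: "s \<in> nzd" and m: "\<And>i. m i \<in> carrier M" "\<And>i. i < n \<Longrightarrow> x i = \<tau> (m i) s"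
    using common_denominator_module[of n x] x by blast
  note c = R.nzd_closed[OF s] R.nzd_closed[OF u] R.nzd_mult[OF u s]
  have "nsum NQ (\<lambda>i. \<alpha> i \<odot>\<^bsub>NQ\<^esub> x i) n = nsum MB (\<lambda>i. \<tau> (r i \<odot>\<^bsub>M\<^esub> m i) (u \<otimes> s)) n"
    unfolding NQ_simps by (rule nsum_cong) (simp add: r m tau_smult s u)
  also have "\<dots> = \<tau> (nsum M (\<lambda>i. r i \<odot>\<^bsub>M\<^esub> m i) n) (u \<otimes> s)"
    using r m by (intro linear_maps_nsum[OF module_axioms T.TT.module_axioms tau_linear[OF c(3)], symmetric]) auto
  finally obtain t where t: "t \<in> nzd" "t \<odot>\<^bsub>M\<^esub> nsum M (\<lambda>i. r i \<odot>\<^bsub>M\<^esub> m i) n = \<zero>\<^bsub>M\<^esub>"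
    using rel tau_eq_zero_iff[of "nsum M (\<lambda>i. r i \<odot>\<^bsub>M\<^esub> m i) n" "u \<otimes> s"] r m c by auto
  note tc = R.nzd_closed[OF t(1)] R.nzd_mult[OF t(1) s]
  have "nsum M (\<lambda>i. r i \<odot>\<^bsub>M\<^esub> (t \<odot>\<^bsub>M\<^esub> m i)) n = \<zero>\<^bsub>M\<^esub>"
    using t(2) tc r m by (simp add: nsum_smult smult_assoc1[symmetric] R.m_comm)
  then have "trivial_relation R (ring_as_module R) M n r (\<lambda>i. t \<odot>\<^bsub>M\<^esub> m i)"
    using r m tc by (intro equationally_flatD[OF flat module_axioms]) auto
  then obtain v where v: "v \<in> coeff_span M (syzygies R (ring_as_module R) n r)"
    "\<And>i. i < n \<Longrightarrow> v i = t \<odot>\<^bsub>M\<^esub> m i" unfolding trivial_relation_def by blast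
  from v(1) have "(\<lambda>i. \<tau> (v i) (t \<otimes> s)) \<in> coeff_span NQ (syzygies TQ (ring_as_module TQ) n \<alpha>)"
  proof (induction rule: coeff_span.induct)
    case zero
    have "\<tau> \<zero>\<^bsub>M\<^esub> (t \<otimes> s) = \<zero>\<^bsub>NQ\<^esub>" using tc by (simp add: NQ_simps)
    then show ?case using coeff_span.zero[of NQ] by simp
  next
    case (add v k y)
    have vc: "v i \<in> carrier M" for i using coeff_span_closed[OF syzygies_coeffs add(1)] .
    have kc: "k i \<in> carrier R" for i using add(2) by (simp add: syzygies_def)
    have "nsum TQ (\<lambda>i. rf (k i) \<otimes>\<^bsub>TQ\<^esub> \<alpha> i) n = nsum TQ (\<lambda>i. frc (k i \<otimes> r i) u) n"
      using r kc u R.nzd_closed[OF u] by (intro nsum_cong) (simp add: R.quot_mult R.nzd_one)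
    also have "\<dots> = \<zero>\<^bsub>TQ\<^esub>"
      using add(2) r kc u by (simp add: nsum_frac syzygies_def frac_eq_zero_iff)
    finally have "(\<lambda>i. rf (k i)) \<in> syzygies TQ (ring_as_module TQ) n \<alpha>"
      using kc R.nzd_one by (simp add: syzygies_def)
    then have "(\<lambda>i. \<tau> (v i) (t \<otimes> s) \<oplus>\<^bsub>NQ\<^esub> rf (k i) \<odot>\<^bsub>NQ\<^esub> \<tau> y (t \<otimes> s))
        \<in> coeff_span NQ (syzygies TQ (ring_as_module TQ) n \<alpha>)"
      using add tc tau_closed by (intro coeff_span.add) auto
    moreover have "rf (k i) \<odot>\<^bsub>NQ\<^esub> \<tau> y (t \<otimes> s) = \<tau> (k i \<odot>\<^bsub>M\<^esub> y) (t \<otimes> s)" for i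
      using add kc tc c(1) by (subst tau_smult) (auto simp: R.nzd_one)
    moreover have "\<tau> (v i) (t \<otimes> s) \<oplus>\<^bsub>NQ\<^esub> \<tau> (k i \<odot>\<^bsub>M\<^esub> y) (t \<otimes> s) = \<tau> (v i \<oplus>\<^bsub>M\<^esub> k i \<odot>\<^bsub>M\<^esub> y) (t \<otimes> s)" for i
      using add kc vc tc by (subst tau_add) auto
    ultimately show ?case by simp
  qed
  moreover have "\<tau> (v i) (t \<otimes> s) = x i" if "i < n" for i
    using that m v(2) tau_expand t(1) s by simp
  ultimately show "trivial_relation TQ (ring_as_module TQ) NQ n \<alpha> x"
    unfolding trivial_relation_def by (intro bexI) auto
qed

lemma common_annihilator:
  assumes "\<And>i. i < (n :: nat) \<Longrightarrow> y i \<in> carrier M" "\<And>i. i < n \<Longrightarrow> \<exists>t\<in>nzd. t \<odot>\<^bsub>M\<^esub> y i = \<zero>\<^bsub>M\<^esub>"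
  shows "\<exists>t\<in>nzd. \<forall>i<n. t \<odot>\<^bsub>M\<^esub> y i = \<zero>\<^bsub>M\<^esub>"
  using assms
proof (induction n)
  case 0
  show ?case using R.nzd_one by auto
next
  case (Suc n)
  then obtain t where t: "t \<in> nzd" "\<And>i. i < n \<Longrightarrow> t \<odot>\<^bsub>M\<^esub> y i = \<zero>\<^bsub>M\<^esub>" by (meson less_Suc_eq)
  obtain t' where t': "t' \<in> nzd" "t' \<odot>\<^bsub>M\<^esub> y n = \<zero>\<^bsub>M\<^esub>" using Suc.prems by blast
  note c = R.nzd_closed[OF t(1)] R.nzd_closed[OF t'(1)]
  have "(t' \<otimes> t) \<odot>\<^bsub>M\<^esub> y i = \<zero>\<^bsub>M\<^esub>" if "i < Suc n" for i
  proof (cases "i = n")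
    case True
    have "(t' \<otimes> t) \<odot>\<^bsub>M\<^esub> y i = t \<odot>\<^bsub>M\<^esub> (t' \<odot>\<^bsub>M\<^esub> y i)"
      using c Suc.prems that by (simp add: R.m_comm smult_assoc1[symmetric])
    then show ?thesis using True t' c by simp
  next
    case False
    then show ?thesis using that t c Suc.prems by (simp add: smult_assoc1)
  qed
  then show ?case using R.nzd_mult[OF t'(1) t(1)] by blast
qed

text \<open>
  Clearing denominators in a trivialisation over \<open>Q\<close> yields one over \<open>R\<close> for a multiple of the
  \<open>m\<^sub>i\<close>, up to elements killed by a non-zero-divisor; a further common multiple removes these.
\<close>

theorem total_quotient_flat_trivializes:
  assumes flat: "equationally_flat TQ NQ"
    and r: "\<And>i. i < n \<Longrightarrow> r i \<in> carrier R" and m: "\<And>i. i < n \<Longrightarrow> m i \<in> carrier M"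
    and rel: "nsum M (\<lambda>i. r i \<odot>\<^bsub>M\<^esub> m i) n = \<zero>\<^bsub>M\<^esub>"
  shows "\<exists>t\<in>nzd. trivial_relation R (ring_as_module R) M n r (\<lambda>i. t \<odot>\<^bsub>M\<^esub> m i)"
proof -
  let ?S = "syzygies R (ring_as_module R) n r" and ?SQ = "syzygies TQ (ring_as_module TQ) n (\<lambda>i. rf (r i))"
  have "nsum NQ (\<lambda>i. rf (r i) \<odot>\<^bsub>NQ\<^esub> \<tau> (m i) \<one>) n = nsum MB (\<lambda>i. \<tau> (r i \<odot>\<^bsub>M\<^esub> m i) \<one>) n"
    unfolding NQ_simps by (rule nsum_cong) (simp add: r m tau_smult R.nzd_one)
  also have "\<dots> = \<tau> (nsum M (\<lambda>i. r i \<odot>\<^bsub>M\<^esub> m i) n) \<one>"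
    using r m by (intro linear_maps_nsum[OF module_axioms T.TT.module_axioms tau_linear[OF R.nzd_one], symmetric]) auto
  finally have "nsum NQ (\<lambda>i. rf (r i) \<odot>\<^bsub>NQ\<^esub> \<tau> (m i) \<one>) n = \<zero>\<^bsub>NQ\<^esub>"
    using rel by (simp add: NQ_simps R.nzd_one)
  then have "trivial_relation TQ (ring_as_module TQ) NQ n (\<lambda>i. rf (r i)) (\<lambda>i. \<tau> (m i) \<one>)"
    using r m tau_closed R.nzd_one by (intro equationally_flatD[OF flat NQ_module]) auto
  then obtain w where w: "w \<in> coeff_span NQ ?SQ" "\<And>i. i < n \<Longrightarrow> w i = \<tau> (m i) \<one>"
    unfolding trivial_relation_def by blast
  from w(1) have "\<exists>t\<in>nzd. \<exists>v\<in>coeff_span M ?S. \<forall>i<n. rf t \<odot>\<^bsub>NQ\<^esub> w i = \<tau> (v i) \<one>"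
  proof (induction rule: coeff_span.induct)
    case zero
    have "rf \<one> \<odot>\<^bsub>NQ\<^esub> \<zero>\<^bsub>NQ\<^esub> = \<zero>\<^bsub>NQ\<^esub>" by (simp add: R.nzd_one)
    also have "\<dots> = \<tau> \<zero>\<^bsub>M\<^esub> \<one>" by (simp add: R.nzd_one NQ_simps)
    finally have zero_act: "rf \<one> \<odot>\<^bsub>NQ\<^esub> \<zero>\<^bsub>NQ\<^esub> = \<tau> \<zero>\<^bsub>M\<^esub> \<one>" .
    then show ?case
      by (intro bexI[of _ \<one>] bexI[of _ "\<lambda>_. \<zero>\<^bsub>M\<^esub>"] allI impI zero_act coeff_span.zero R.nzd_one)
  next
    case (add w k y)
    obtain t v where t: "t \<in> nzd" "v \<in> coeff_span M ?S" "\<And>i. i < n \<Longrightarrow> rf t \<odot>\<^bsub>NQ\<^esub> w i = \<tau> (v i) \<one>"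
      using add.IH by blast
    have kc: "k i \<in> carrier TQ" for i using add(2) by (simp add: syzygies_def)
    obtain u a where u: "u \<in> nzd" and a: "\<And>i. a i \<in> carrier R" "\<And>i. i < n \<Longrightarrow> k i = frc (a i) u"
      using common_denominator_ring[of n k] kc by blast
    obtain p s where p: "p \<in> carrier M" "s \<in> nzd" "y = \<tau> p s" using add(3) by (rule NQ_elements)
    have vc: "v i \<in> carrier M" for i using coeff_span_closed[OF syzygies_coeffs t(2)] .
    have wc: "w i \<in> carrier NQ" for i using NQ.coeff_span_closed[OF syzygies_coeffs add(1)] .
    define g where "g = u \<otimes> s"
    have g: "g \<in> nzd" unfolding g_def using u p R.nzd_mult by blast
    note c = R.nzd_closed[OF t(1)] R.nzd_closed[OF u] R.nzd_closed[OF p(2)] R.nzd_closed[OF g] R.nzd_mult[OF g t(1)]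
    have "nsum TQ (\<lambda>i. k i \<otimes>\<^bsub>TQ\<^esub> rf (r i)) n = nsum TQ (\<lambda>i. frc (a i \<otimes> r i) u) n"
      using r a u c by (intro nsum_cong) (simp add: R.quot_mult R.nzd_one)
    also have "\<dots> = frc (nsum R (\<lambda>i. a i \<otimes> r i) n) u" using a r u by (intro nsum_frac) auto
    finally have "nsum R (\<lambda>i. a i \<otimes> r i) n = \<zero>"
      using add(2) a r u frac_eq_zero_iff by (simp add: syzygies_def)
    then have "a \<in> ?S" using a by (simp add: syzygies_def)
    then have mem: "(\<lambda>i. g \<odot>\<^bsub>M\<^esub> v i \<oplus>\<^bsub>M\<^esub> a i \<odot>\<^bsub>M\<^esub> (t \<odot>\<^bsub>M\<^esub> p)) \<in> coeff_span M ?S"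
      using coeff_span_smult[OF syzygies_coeffs c(4) t(2)] p c by (intro coeff_span.add) auto
    have eqn: "rf (g \<otimes> t) \<odot>\<^bsub>NQ\<^esub> (w i \<oplus>\<^bsub>NQ\<^esub> k i \<odot>\<^bsub>NQ\<^esub> y) = \<tau> (g \<odot>\<^bsub>M\<^esub> v i \<oplus>\<^bsub>M\<^esub> a i \<odot>\<^bsub>M\<^esub> (t \<odot>\<^bsub>M\<^esub> p)) \<one>"
      if i: "i < n" for i
    proof -
      have gt: "rf (g \<otimes> t) = rf g \<otimes>\<^bsub>TQ\<^esub> rf t" using c by (simp add: R.quot_mult R.nzd_one)
      have "rf (g \<otimes> t) \<odot>\<^bsub>NQ\<^esub> w i = rf g \<odot>\<^bsub>NQ\<^esub> (rf t \<odot>\<^bsub>NQ\<^esub> w i)"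
        unfolding gt using c wc by (simp add: NQ.smult_assoc1 R.nzd_one)
      also have "\<dots> = \<tau> (g \<odot>\<^bsub>M\<^esub> v i) \<one>"
        using t(3)[OF i] vc c tau_smult[of "v i" \<one> g \<one>] by (simp add: R.nzd_one)
      finally have 1: "rf (g \<otimes> t) \<odot>\<^bsub>NQ\<^esub> w i = \<tau> (g \<odot>\<^bsub>M\<^esub> v i) \<one>" .
      have "k i \<odot>\<^bsub>NQ\<^esub> y = \<tau> (a i \<odot>\<^bsub>M\<^esub> p) g"
        unfolding a(2)[OF i] p(3) g_def using a p u by (simp add: tau_smult)
      then have "rf (g \<otimes> t) \<odot>\<^bsub>NQ\<^esub> (k i \<odot>\<^bsub>NQ\<^esub> y) = \<tau> ((g \<otimes> t) \<odot>\<^bsub>M\<^esub> (a i \<odot>\<^bsub>M\<^esub> p)) g"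
        using a p c g tau_smult[of "a i \<odot>\<^bsub>M\<^esub> p" g "g \<otimes> t" \<one>] by (simp add: R.nzd_one)
      also have "(g \<otimes> t) \<odot>\<^bsub>M\<^esub> (a i \<odot>\<^bsub>M\<^esub> p) = g \<odot>\<^bsub>M\<^esub> (a i \<odot>\<^bsub>M\<^esub> (t \<odot>\<^bsub>M\<^esub> p))"
        using a p c by (simp add: smult_assoc1[symmetric] R.m_ac)
      also have "\<tau> (g \<odot>\<^bsub>M\<^esub> (a i \<odot>\<^bsub>M\<^esub> (t \<odot>\<^bsub>M\<^esub> p))) g = \<tau> (a i \<odot>\<^bsub>M\<^esub> (t \<odot>\<^bsub>M\<^esub> p)) \<one>"
        using tau_expand[of "a i \<odot>\<^bsub>M\<^esub> (t \<odot>\<^bsub>M\<^esub> p)" \<one> g] a p c g by (simp add: R.nzd_one)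
      finally have 2: "rf (g \<otimes> t) \<odot>\<^bsub>NQ\<^esub> (k i \<odot>\<^bsub>NQ\<^esub> y) = \<tau> (a i \<odot>\<^bsub>M\<^esub> (t \<odot>\<^bsub>M\<^esub> p)) \<one>" .
      have "rf (g \<otimes> t) \<odot>\<^bsub>NQ\<^esub> (w i \<oplus>\<^bsub>NQ\<^esub> k i \<odot>\<^bsub>NQ\<^esub> y) = \<tau> (g \<odot>\<^bsub>M\<^esub> v i) \<one> \<oplus>\<^bsub>NQ\<^esub> \<tau> (a i \<odot>\<^bsub>M\<^esub> (t \<odot>\<^bsub>M\<^esub> p)) \<one>"
        using wc kc add(3) c 1 2 by (simp add: NQ.smult_r_distr R.nzd_one)
      then show ?thesis using vc a p c by (simp add: tau_add R.nzd_one)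
    qed
    show ?case
      by (intro bexI[of _ "g \<otimes> t"] bexI[of _ "\<lambda>i. g \<odot>\<^bsub>M\<^esub> v i \<oplus>\<^bsub>M\<^esub> a i \<odot>\<^bsub>M\<^esub> (t \<odot>\<^bsub>M\<^esub> p)"]
          allI impI eqn mem c(5))
  qed
  then obtain t v where t: "t \<in> nzd" and v: "v \<in> coeff_span M ?S"
    and tv: "\<And>i. i < n \<Longrightarrow> rf t \<odot>\<^bsub>NQ\<^esub> w i = \<tau> (v i) \<one>" by blast
  note tc = R.nzd_closed[OF t]
  have vc: "v i \<in> carrier M" for i using coeff_span_closed[OF syzygies_coeffs v] .
  have "\<exists>t'\<in>nzd. t' \<odot>\<^bsub>M\<^esub> (t \<odot>\<^bsub>M\<^esub> m i \<oplus>\<^bsub>M\<^esub> (\<ominus>\<^bsub>M\<^esub> v i)) = \<zero>\<^bsub>M\<^esub>" if i: "i < n" for i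
  proof -
    have "\<tau> (t \<odot>\<^bsub>M\<^esub> m i) \<one> = \<tau> (v i) \<one>"
      using tv[OF i] w(2)[OF i] m[OF i] tc tau_smult[of "m i" \<one> t \<one>] by (simp add: R.nzd_one)
    then have "\<tau> (t \<odot>\<^bsub>M\<^esub> m i \<oplus>\<^bsub>M\<^esub> (\<ominus>\<^bsub>M\<^esub> v i)) \<one> = \<tau> (v i) \<one> \<oplus>\<^bsub>NQ\<^esub> \<tau> (\<ominus>\<^bsub>M\<^esub> v i) \<one>"
      using m[OF i] tc vc by (simp add: tau_add R.nzd_one)
    also have "\<dots> = \<tau> (v i \<oplus>\<^bsub>M\<^esub> (\<ominus>\<^bsub>M\<^esub> v i)) \<one>" using vc by (intro tau_add[symmetric]) (auto simp: R.nzd_one)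
    also have "\<dots> = \<zero>\<^bsub>NQ\<^esub>" using vc by (simp add: M.r_neg NQ_simps R.nzd_one)
    finally show ?thesis using tau_eq_zero_iff[of "t \<odot>\<^bsub>M\<^esub> m i \<oplus>\<^bsub>M\<^esub> (\<ominus>\<^bsub>M\<^esub> v i)" \<one>] m[OF i] tc vc R.nzd_one by auto
  qed
  then obtain t' where t': "t' \<in> nzd" "\<And>i. i < n \<Longrightarrow> t' \<odot>\<^bsub>M\<^esub> (t \<odot>\<^bsub>M\<^esub> m i \<oplus>\<^bsub>M\<^esub> (\<ominus>\<^bsub>M\<^esub> v i)) = \<zero>\<^bsub>M\<^esub>"
    using common_annihilator[of n "\<lambda>i. t \<odot>\<^bsub>M\<^esub> m i \<oplus>\<^bsub>M\<^esub> (\<ominus>\<^bsub>M\<^esub> v i)"] m tc vc by auto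
  note tc' = R.nzd_closed[OF t'(1)]
  have "t' \<odot>\<^bsub>M\<^esub> v i = (t' \<otimes> t) \<odot>\<^bsub>M\<^esub> m i" if i: "i < n" for i
  proof -
    have "(t' \<otimes> t) \<odot>\<^bsub>M\<^esub> m i \<ominus>\<^bsub>M\<^esub> t' \<odot>\<^bsub>M\<^esub> v i = \<zero>\<^bsub>M\<^esub>"
      using t'(2)[OF i] m[OF i] vc tc tc' by (simp add: smult_r_distr smult_r_minus smult_assoc1 a_minus_def)
    then show ?thesis
      using M.minus_eq_zero_iff[of "(t' \<otimes> t) \<odot>\<^bsub>M\<^esub> m i" "t' \<odot>\<^bsub>M\<^esub> v i"] m[OF i] vc tc tc' by simp
  qed
  then have "trivial_relation R (ring_as_module R) M n r (\<lambda>i. (t' \<otimes> t) \<odot>\<^bsub>M\<^esub> m i)"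
    unfolding trivial_relation_def using coeff_span_smult[OF syzygies_coeffs tc' v] by (intro bexI) auto
  then show ?thesis using R.nzd_mult[OF t'(1) t] by blast
qed

end

text \<open>
  For infinite \<open>R\<close> there are no more pairs of elements than elements. For finite \<open>R\<close> every
  non-zero-divisor is a unit, so that every fraction has denominator \<open>1\<close>.
\<close>

lemma (in cring) total_quotient_universe:
  fixes \<iota> :: "'a \<Rightarrow> 'u"
  assumes inj: "inj_on \<iota> (carrier R)"
  obtains \<kappa> :: "('a \<times> 'a) set \<Rightarrow> 'u" where "inj_on \<kappa> (carrier TQ)"
proof -
  have "\<exists>f :: ('a \<times> 'a) set \<Rightarrow> 'a. inj_on f (carrier TQ) \<and> f ` carrier TQ \<subseteq> carrier R"
  proof (cases "finite (carrier R)")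
    case True
    have sub: "carrier TQ \<subseteq> (\<lambda>r. frc r \<one>) ` carrier R"
    proof
      fix x assume "x \<in> carrier TQ"
      then obtain r s where x: "r \<in> carrier R" "s \<in> nzd" "x = frc r s" by (rule quotE)
      have sc: "s \<in> carrier R" using x nzd_closed by blast
      have "inj_on ((\<otimes>) s) (carrier R)" using nzd_cancel[OF x(2)] by (auto intro: inj_onI)
      moreover have "(\<otimes>) s ` carrier R \<subseteq> carrier R" using sc by auto
      ultimately have "(\<otimes>) s ` carrier R = carrier R" using True by (simp add: endo_inj_surj)
      then obtain y where y: "y \<in> carrier R" "s \<otimes> y = \<one>" by (metis imageE one_closed)
      have "r \<otimes> \<one> = (r \<otimes> y) \<otimes> s" using x(1) y sc by (simp add: m_assoc m_comm[of y s])
      then have "x = frc (r \<otimes> y) \<one>"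
        unfolding x(3) using x(1,2) y nzd_one by (subst fraction_eq_iff) auto
      then show "x \<in> (\<lambda>r. frc r \<one>) ` carrier R" using x(1) y by auto
    qed
    have "inv_into (carrier R) (\<lambda>r. frc r \<one>) ` carrier TQ \<subseteq> carrier R"
      using sub by (auto intro: inv_into_into)
    then show ?thesis using inj_on_inv_into[OF sub] by blast
  next
    case False
    have "(card_of (carrier TQ), card_of (carrier R \<times> carrier R)) \<in> ordLeq"
    proof (rule surj_imp_ordLeq)
      show "carrier TQ \<subseteq> (\<lambda>(r, s). frc r s) ` (carrier R \<times> carrier R)"
        unfolding quot_carrier using nzd_closed by auto
    qed
    moreover have "(card_of (carrier R \<times> carrier R), card_of (carrier R)) \<in> ordIso" using False by (rule card_of_Times_same_infinite)
    ultimately have "(card_of (carrier TQ), card_of (carrier R)) \<in> ordLeq" by (rule ordLeq_ordIso_trans)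
    then show ?thesis unfolding card_of_ordLeq[symmetric] by blast
  qed
  then obtain f :: "('a \<times> 'a) set \<Rightarrow> 'a" where f: "inj_on f (carrier TQ)" "f ` carrier TQ \<subseteq> carrier R" by blast
  have "inj_on (\<iota> \<circ> f) (carrier TQ)"
    using f inj by (intro comp_inj_on) (auto intro: inj_on_subset)
  then show ?thesis using that by blast
qed

section \<open>Ideals all of whose relations are trivial\<close>

text \<open>
  This is the vanishing of \<open>Tor\<^sub>1(R/I, M)\<close>, or the injectivity of \<open>I \<otimes> M \<rightarrow> M\<close>, in terms of
  generators. All finite generating families are admitted at once, which makes it unnecessary to
  compare two of them.
\<close>

definition ideal_flat :: "('a, 'x) ring_scheme \<Rightarrow> ('a, 'm, 'z) module_scheme \<Rightarrow> 'a set \<Rightarrow> bool"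
  where "ideal_flat R M I \<longleftrightarrow>
    (\<forall>n r m. generators R n r I \<and> (\<forall>i<n. m i \<in> carrier M) \<and>
       nsum M (\<lambda>i. r i \<odot>\<^bsub>M\<^esub> m i) n = \<zero>\<^bsub>M\<^esub> \<longrightarrow>
       trivial_relation R (ring_as_module R) M n r m)"

text \<open>
  The meaning over \<open>R\<close> of flatness of \<open>M \<otimes> Q\<close> over \<open>Q\<close>: all \<open>Tor\<^sub>1(R/I, M)\<close> with \<open>I\<close> finitely
  generated are torsion modules.
\<close>

definition generically_flat :: "('a, 'x) ring_scheme \<Rightarrow> ('a, 'm, 'z) module_scheme \<Rightarrow> bool"
  where "generically_flat R M \<longleftrightarrow>
    (\<forall>n r m. (\<forall>i<n. r i \<in> carrier R) \<and> (\<forall>i<n. m i \<in> carrier M) \<and>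
       nsum M (\<lambda>i. r i \<odot>\<^bsub>M\<^esub> m i) n = \<zero>\<^bsub>M\<^esub> \<longrightarrow>
       (\<exists>t\<in>nonzerodivisors R. trivial_relation R (ring_as_module R) M n r (\<lambda>i. t \<odot>\<^bsub>M\<^esub> m i)))"

text \<open>
  As \<open>(t m\<^sub>i)\<close> is trivial for some non-zero-divisor \<open>t\<close>, the element \<open>\<Sum> r\<^sub>i \<otimes> m\<^sub>i\<close> of \<open>I \<otimes> M\<close> is killed
  by \<open>t\<close>, hence zero.
\<close>

lemma torsion_free_ideal_flat:
  assumes "cring R" and M: "module R M" and gf: "generically_flat R M" and I: "ideal I R"
    and L: "module R L" and h: "h \<in> linear_maps R (ideal_as_module R I) L"
    and inj: "inj_on h I" and surj: "h ` I = carrier L"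
    and tf: "torsion_free R (tensor_product R L M)"
  shows "ideal_flat R M I"
  unfolding ideal_flat_def
proof (intro allI impI, elim conjE)
  fix n r m assume gen: "generators R n r I" and m: "\<forall>i<n. m i \<in> carrier M"
    and rel: "nsum M (\<lambda>i. r i \<odot>\<^bsub>M\<^esub> m i) n = \<zero>\<^bsub>M\<^esub>"
  interpret R: cring R by fact
  interpret tensor_pair R L M using L M by (rule tensor_pair.intro)
  have rI: "r i \<in> I" if "i < n" for i using gen that by (simp add: generators_def)
  have hr: "h (r i) \<in> carrier L" if "i < n" for i using rI[OF that] surj by auto
  obtain t where t: "t \<in> nonzerodivisors R" "trivial_relation R (ring_as_module R) M n r (\<lambda>i. t \<odot>\<^bsub>M\<^esub> m i)"
    using gf m rel R.generatorsD(1)[OF gen I] unfolding generically_flat_def by blast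
  have tc: "t \<in> carrier R" using t R.nzd_closed by blast
  have "trivial_relation R (ideal_as_module R I) M n r (\<lambda>i. t \<odot>\<^bsub>M\<^esub> m i)"
    using t(2) by (simp only: trivial_relation_ideal_iff)
  then have "trivial_relation R L M n (\<lambda>i. h (r i)) (\<lambda>i. t \<odot>\<^bsub>M\<^esub> m i)"
    using rI by (intro trivial_relation_linear[OF R.ideal_as_module_is_module[OF I] L h]) auto
  then have "nsum TT (\<lambda>i. h (r i) \<otimes>\<^sub>t (t \<odot>\<^bsub>M\<^esub> m i)) n = \<zero>\<^bsub>TT\<^esub>"
    using hr by (intro trivial_relation_tensor_zero) auto
  moreover have "nsum TT (\<lambda>i. h (r i) \<otimes>\<^sub>t (t \<odot>\<^bsub>M\<^esub> m i)) n = t \<odot>\<^bsub>TT\<^esub> nsum TT (\<lambda>i. h (r i) \<otimes>\<^sub>t m i) n"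
    using hr tc m by (simp add: TT.nsum_smult pure_smult_right cong: nsum_cong)
  ultimately have "nsum TT (\<lambda>i. h (r i) \<otimes>\<^sub>t m i) n = \<zero>\<^bsub>TT\<^esub>"
    using tf t(1) hr m unfolding torsion_free_def by auto
  then show "trivial_relation R (ring_as_module R) M n r m"
    using ideal_copy_tensor_zeroD[OF \<open>cring R\<close> M I gen L h inj surj] m by blast
qed

section \<open>The first Tor module\<close>

lemma linear_maps_compose:
  assumes "f \<in> linear_maps R A B" "g \<in> linear_maps R B C"
  shows "(\<lambda>x. g (f x)) \<in> linear_maps R A C"
  by (rule linear_mapsI)
    (simp_all add: linear_maps_closed[OF assms(1)] linear_maps_closed[OF assms(2)] linear_maps_add[OF assms(1)]
      linear_maps_add[OF assms(2)] linear_maps_smult[OF assms(1)] linear_maps_smult[OF assms(2)])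

lemma (in module) torsion_free_quotient_iff:
  assumes W: "submodule W R M"
  shows "torsion_free R (quotient_module M W) \<longleftrightarrow>
    (\<forall>s\<in>nonzerodivisors R. \<forall>x\<in>carrier M. s \<odot>\<^bsub>M\<^esub> x \<in> W \<longrightarrow> x \<in> W)"
proof -
  have "(s \<odot>\<^bsub>quotient_module M W\<^esub> (W +>\<^bsub>M\<^esub> x) = \<zero>\<^bsub>quotient_module M W\<^esub>) = (s \<odot>\<^bsub>M\<^esub> x \<in> W)"
    "(W +>\<^bsub>M\<^esub> x = \<zero>\<^bsub>quotient_module M W\<^esub>) = (x \<in> W)"
    if "s \<in> nonzerodivisors R" "x \<in> carrier M" for s x
    using that R.nzd_closed by (auto simp: coset_smult[OF W] coset_eq_zero_iff[OF W])
  then show ?thesis unfolding torsion_free_def quotient_module_carrier[OF W] by auto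
qed

lemma (in cring) free_module_linear_eqI:
  assumes "module R V" "f \<in> linear_maps R (free_module R I) V" "g \<in> linear_maps R (free_module R I) V"
    "\<And>i. i \<in> I \<Longrightarrow> f (free_basis R i) = g (free_basis R i)" "c \<in> carrier (free_module R I)"
  shows "f c = g c"
proof -
  interpret F: module R "free_module R I" by (rule free_module_is_module)
  from assms(5) show ?thesis
  proof (induction rule: free_module_induct)
    case zero
    show ?case
      by (metis linear_maps_zero[OF F.module_axioms assms(1)] assms(2,3))
  next
    case (add c r i)
    then show ?case
      by (simp add: linear_maps_add[OF assms(2)] linear_maps_add[OF assms(3)] linear_maps_smult[OF assms(2)]
          linear_maps_smult[OF assms(3)] free_basis_closed assms(4))
  qed
qed

text \<open>
  Names for the start of the canonical resolution of \<open>N\<close>; \<open>d1\<close> and \<open>d2\<close> are its differentials after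
  tensoring with \<open>M\<close>, whose homology is Tor.
\<close>

locale canonical_resolution = N: module R N + M: module R M
  for R (structure) and N :: "('a, 'n, 'y) module_scheme" and M :: "('a, 'm, 'z) module_scheme"
begin

abbreviation "F0 \<equiv> res_F0 R N"
abbreviation "F1 \<equiv> res_F1 R N"
abbreviation "F2 \<equiv> res_F2 R N"
abbreviation "lc0 \<equiv> linear_combination R N"
abbreviation "lc1 \<equiv> linear_combination R F0"
abbreviation "lc2 \<equiv> linear_combination R F1"
abbreviation "K1 \<equiv> a_kernel F0 N lc0"
abbreviation "K2 \<equiv> a_kernel F1 F0 lc1"

sublocale F0: module R F0
  unfolding res_F0_def by (rule N.R.free_module_is_module)
sublocale F1: module R F1
  unfolding res_F1_def by (rule N.R.free_module_is_module)
sublocale F2: module R F2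
  unfolding res_F2_def by (rule N.R.free_module_is_module)

lemma lc0_linear: "lc0 \<in> linear_maps R F0 N"
  unfolding res_F0_def linear_combination_eq_free_extension by (rule N.free_extension_linear)

lemma lc0_basis: "x \<in> carrier N \<Longrightarrow> lc0 (free_basis R x) = x"
  unfolding linear_combination_eq_free_extension using N.free_extension_basis[of "carrier N" "\<lambda>x. x"] by simp

lemma lc1_linear: "lc1 \<in> linear_maps R F1 F0"
  unfolding res_F1_def linear_combination_eq_free_extension
  by (rule F0.free_extension_linear) (auto simp: a_kernel_def')

lemma lc1_basis: "x \<in> K1 \<Longrightarrow> lc1 (free_basis R x) = x"
  unfolding linear_combination_eq_free_extension[of R F0]
  by (rule F0.free_extension_basis[of K1 "\<lambda>x. x"]) (auto simp: a_kernel_def')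

lemma lc2_linear: "lc2 \<in> linear_maps R F2 F1"
  unfolding res_F2_def linear_combination_eq_free_extension
  by (rule F1.free_extension_linear) (auto simp: a_kernel_def')

lemma lc2_basis: "x \<in> K2 \<Longrightarrow> lc2 (free_basis R x) = x"
  unfolding linear_combination_eq_free_extension[of R F1]
  by (rule F1.free_extension_basis[of K2 "\<lambda>x. x"]) (auto simp: a_kernel_def')

lemma basis1_closed: "x \<in> K1 \<Longrightarrow> free_basis R x \<in> carrier F1"
  unfolding res_F1_def by (rule N.R.free_basis_closed)

lemma basis2_closed: "x \<in> K2 \<Longrightarrow> free_basis R x \<in> carrier F2"
  unfolding res_F2_def by (rule N.R.free_basis_closed)

lemma resolution_exact: "exact_at F2 lc2 F1 lc1 F0"
  unfolding exact_at_def
proof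
  have "submodule K2 R F1"
    by (rule linear_map_kernel_submodule[OF F1.module_axioms F0.module_axioms lc1_linear])
  note K2 = F1.submoduleE(4,5)[OF this] F1.submodule_zero_mem[OF this]
  show "lc2 ` carrier F2 \<subseteq> K2"
  proof clarify
    fix c assume "c \<in> carrier F2"
    then show "lc2 c \<in> K2" unfolding res_F2_def
    proof (induction rule: N.R.free_module_induct)
      case zero
      show ?case using linear_maps_zero[OF F2.module_axioms F1.module_axioms lc2_linear] K2(3)
        by (simp add: res_F2_def)
    next
      case (add c r i)
      then have "c \<in> carrier F2" "free_basis R i \<in> carrier F2" using basis2_closed by (auto simp: res_F2_def)
      then have "lc2 (c \<oplus>\<^bsub>F2\<^esub> r \<odot>\<^bsub>F2\<^esub> free_basis R i) = lc2 c \<oplus>\<^bsub>F1\<^esub> r \<odot>\<^bsub>F1\<^esub> i"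
        using add by (simp add: linear_maps_add[OF lc2_linear] linear_maps_smult[OF lc2_linear] lc2_basis)
      then show ?case using add K2 by (simp add: res_F2_def)
    qed
  qed
  show "K2 \<subseteq> lc2 ` carrier F2" using lc2_basis basis2_closed by (metis imageI subsetI)
qed

sublocale T0: tensor_pair R F0 M ..
sublocale T1: tensor_pair R F1 M ..
sublocale T2: tensor_pair R F2 M ..

abbreviation "d1 \<equiv> tensor_map R F1 M F0 M lc1 (\<lambda>x. x)"
abbreviation "d2 \<equiv> tensor_map R F2 M F1 M lc2 (\<lambda>x. x)"

lemmas d1_linear = tensor_map_linear[OF F1.module_axioms M.module_axioms F0.module_axioms M.module_axioms lc1_linear id_linear]
lemmas d1_pure = tensor_map_pure[OF F1.module_axioms M.module_axioms F0.module_axioms M.module_axioms lc1_linear id_linear]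
lemmas d2_linear = tensor_map_linear[OF F2.module_axioms M.module_axioms F1.module_axioms M.module_axioms lc2_linear id_linear]
lemmas d2_pure = tensor_map_pure[OF F2.module_axioms M.module_axioms F1.module_axioms M.module_axioms lc2_linear id_linear]

lemma lc1_lc2: "x \<in> carrier F2 \<Longrightarrow> lc1 (lc2 x) = \<zero>\<^bsub>F0\<^esub>"
  using resolution_exact unfolding exact_at_def a_kernel_def' by auto

lemma d1_d2:
  assumes "x \<in> carrier T2.TT"
  shows "d1 (d2 x) = \<zero>\<^bsub>T0.TT\<^esub>"
  using assms
proof (induction rule: T2.tensor_induct)
  case zero
  show ?case
    by (simp add: linear_maps_zero[OF T2.TT.module_axioms T1.TT.module_axioms d2_linear]
        linear_maps_zero[OF T1.TT.module_axioms T0.TT.module_axioms d1_linear])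
next
  case (add z l m)
  then show ?case
    by (simp add: linear_maps_add[OF d1_linear] linear_maps_add[OF d2_linear] d1_pure d2_pure lc1_lc2
        linear_maps_closed[OF d2_linear] linear_maps_closed[OF lc2_linear])
qed

text \<open>
  Tor is the quotient of the kernel of \<open>d\<^sub>1\<close> by the image of \<open>d\<^sub>2\<close>; working with representatives
  avoids its nested type.
\<close>

lemma Tor1_torsion_free_iff:
  "torsion_free R (Tor1 R N M) \<longleftrightarrow> (\<forall>s\<in>nonzerodivisors R. \<forall>x\<in>carrier T1.TT.
    d1 x = \<zero>\<^bsub>T0.TT\<^esub> \<longrightarrow> s \<odot>\<^bsub>T1.TT\<^esub> x \<in> d2 ` carrier T2.TT \<longrightarrow> x \<in> d2 ` carrier T2.TT)"
proof -
  define Z where "Z = a_kernel T1.TT T0.TT d1"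
  define V where "V = T1.TT\<lparr>carrier := Z\<rparr>"
  define W where "W = d2 ` carrier T2.TT"
  have Z: "submodule Z R T1.TT" unfolding Z_def
    by (rule linear_map_kernel_submodule[OF T1.TT.module_axioms T0.TT.module_axioms d1_linear])
  have V: "module R V" unfolding V_def
    by (rule submodule.submodule_is_module[OF Z T1.TT.module_axioms])
  interpret V: module R V by (rule V)
  have Ws: "submodule W R T1.TT" unfolding W_def
    by (rule linear_map_image_submodule[OF T2.TT.module_axioms T1.TT.module_axioms d2_linear])
  have WZ: "W \<subseteq> Z"
    using d1_d2 linear_maps_closed[OF d2_linear] by (auto simp: W_def Z_def a_kernel_def')
  have Vs: "zero V = zero T1.TT" "add V = add T1.TT" "smult V = smult T1.TT" "carrier V = Z"
    by (auto simp: V_def)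
  have W: "submodule W R V"
    by (rule V.submoduleI')
      (use WZ T1.TT.submodule_zero_mem[OF Ws] T1.TT.submoduleE(4,5)[OF Ws] in \<open>auto simp: Vs\<close>)
  have "Tor1 R N M = quotient_module V W"
    unfolding Tor1_def Let_def V_def W_def Z_def by simp
  then show ?thesis
    using V.torsion_free_quotient_iff[OF W] unfolding Vs W_def Z_def a_kernel_def' by auto
qed

lemma flat_Tor1_torsion_free:
  assumes "equationally_flat R M"
  shows "torsion_free R (Tor1 R N M)"
  using equationally_flat_exact[OF F2.module_axioms F1.module_axioms F0.module_axioms M.module_axioms
      lc2_linear lc1_linear resolution_exact assms]
  unfolding Tor1_torsion_free_iff exact_at_def a_kernel_def' by auto

end

text \<open>
  Let \<open>g\<close> be the basis vector of \<open>F\<^sub>0\<close> at the class of \<open>1\<close>. The elements \<open>r\<^sub>i g\<close> are in the kernel of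
  \<open>F\<^sub>0 \<rightarrow> R/I\<close>, and the relation makes \<open>z = \<Sum> [r\<^sub>i g] \<otimes> m\<^sub>i\<close> a cycle in \<open>F\<^sub>1 \<otimes> M\<close>. Some multiple \<open>t z\<close>
  is a boundary, because \<open>(t m\<^sub>i)\<close> is spanned by syzygies of \<open>r\<close>, so \<open>z\<close> is a boundary as well. The
  identity of \<open>R/I\<close> lifts to a map from the canonical resolution to \<open>0 \<rightarrow> I \<rightarrow> R\<close>. It sends
  boundaries to zero and \<open>z\<close> to \<open>\<Sum> r\<^sub>i \<otimes> m\<^sub>i\<close>, which therefore vanishes in \<open>I \<otimes> M\<close>.
\<close>

lemma Tor1_torsion_free_ideal_flat:
  assumes "cring R" and M: "module R M" and gf: "generically_flat R M" and I: "ideal I R"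
    and tf: "torsion_free R (Tor1 R (residue_module R I) M)"
  shows "ideal_flat R M I"
  unfolding ideal_flat_def
proof (intro allI impI, elim conjE)
  fix n r m assume gen: "generators R n r I" and m: "\<forall>i<n. m i \<in> carrier M"
    and rel: "nsum M (\<lambda>i. r i \<odot>\<^bsub>M\<^esub> m i) n = \<zero>\<^bsub>M\<^esub>"
  interpret R: cring R by fact
  interpret I: ideal I R by fact
  interpret RR: module R "ring_as_module R" by (rule R.ring_as_module_is_module)
  have Is: "submodule I R (ring_as_module R)" using I R.submodule_ring_iff_ideal by blast
  let ?N = "residue_module R I"
  have N: "module R ?N" by (rule RR.quotient_is_module[OF Is])
  interpret canonical_resolution R ?N M using N M by (rule canonical_resolution.intro)
  define \<pi> where "\<pi> = (\<lambda>x. I +>\<^bsub>ring_as_module R\<^esub> x)"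
  have \<pi>: "\<pi> \<in> linear_maps R (ring_as_module R) ?N" unfolding \<pi>_def by (rule RR.coset_linear[OF Is])
  have \<pi>0: "\<pi> x = \<zero>\<^bsub>?N\<^esub> \<longleftrightarrow> x \<in> I" if "x \<in> carrier R" for x
    unfolding \<pi>_def using RR.coset_eq_zero_iff[OF Is] that by simp
  have \<pi>N: "carrier ?N = \<pi> ` carrier R" unfolding \<pi>_def using RR.quotient_module_carrier[OF Is] by simp
  define g where "g = free_basis R (\<pi> \<one>\<^bsub>R\<^esub>)"
  have e: "\<pi> \<one>\<^bsub>R\<^esub> \<in> carrier ?N" using \<pi>N by auto
  have g: "g \<in> carrier F0" unfolding g_def res_F0_def using e by (rule R.free_basis_closed)
  have rI: "r i \<in> I" if "i < n" for i using gen that by (simp add: generators_def)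
  have rc: "r i \<in> carrier R" if "i < n" for i using rI[OF that] by (rule I.a_Hcarr)
  define \<kappa> where "\<kappa> = (\<lambda>i. r i \<odot>\<^bsub>F0\<^esub> g)"
  have \<kappa>: "\<kappa> i \<in> K1" if "i < n" for i
  proof -
    have "lc0 (\<kappa> i) = r i \<odot>\<^bsub>?N\<^esub> \<pi> \<one>\<^bsub>R\<^esub>"
      unfolding \<kappa>_def using g rc[OF that] e by (simp add: linear_maps_smult[OF lc0_linear] g_def lc0_basis)
    also have "\<dots> = \<pi> (r i)" using linear_maps_smult[OF \<pi>, of "r i" "\<one>\<^bsub>R\<^esub>"] rc[OF that] by simp
    finally have "lc0 (\<kappa> i) = \<zero>\<^bsub>?N\<^esub>" using \<pi>0 rI rc that by simp
    then show ?thesis using g rc[OF that] by (simp add: a_kernel_def' \<kappa>_def)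
  qed
  define b where "b = (\<lambda>i. free_basis R (\<kappa> i))"
  have b: "b i \<in> carrier F1" if "i < n" for i unfolding b_def by (rule basis1_closed[OF \<kappa>[OF that]])
  have lcb: "lc1 (b i) = r i \<odot>\<^bsub>F0\<^esub> g" if "i < n" for i
    unfolding b_def lc1_basis[OF \<kappa>[OF that]] by (simp add: \<kappa>_def)
  define z where "z = nsum T1.TT (\<lambda>i. pure_tensor R F1 M (b i) (m i)) n"
  have zc: "z \<in> carrier T1.TT" unfolding z_def using b m by auto
  have "d1 z = nsum T0.TT (\<lambda>i. d1 (pure_tensor R F1 M (b i) (m i))) n"
    unfolding z_def using b m by (intro linear_maps_nsum[OF T1.TT.module_axioms T0.TT.module_axioms d1_linear]) auto
  also have "\<dots> = nsum T0.TT (\<lambda>i. pure_tensor R F0 M g (r i \<odot>\<^bsub>M\<^esub> m i)) n"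
    using b m g rc by (intro nsum_cong) (simp add: d1_pure lcb T0.pure_smult_left T0.pure_smult_right)
  also have "\<dots> = pure_tensor R F0 M g (nsum M (\<lambda>i. r i \<odot>\<^bsub>M\<^esub> m i) n)"
  proof -
    have "pure_tensor R F0 M g \<in> linear_maps R M T0.TT"
      using g by (intro linear_mapsI) (auto simp: T0.pure_add_right T0.pure_smult_right)
    then show ?thesis using rc m by (intro linear_maps_nsum[OF M T0.TT.module_axioms, symmetric]) auto
  qed
  finally have dz: "d1 z = \<zero>\<^bsub>T0.TT\<^esub>" using rel g by simp
  obtain t where t: "t \<in> nonzerodivisors R" "trivial_relation R (ring_as_module R) M n r (\<lambda>i. t \<odot>\<^bsub>M\<^esub> m i)"
    using gf m rel rc unfolding generically_flat_def by blast
  have tc: "t \<in> carrier R" using t R.nzd_closed by blast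
  obtain v where v: "v \<in> coeff_span M (syzygies R (ring_as_module R) n r)" "\<And>i. i < n \<Longrightarrow> v i = t \<odot>\<^bsub>M\<^esub> m i"
    using t(2) unfolding trivial_relation_def by blast
  let ?H = "d2 ` carrier T2.TT"
  have "nsum T1.TT (\<lambda>i. pure_tensor R F1 M (b i) (v i)) n \<in> ?H"
  proof (rule T1.tensor_sum_mem[OF v(1) syzygies_coeffs b])
    show "submodule ?H R T1.TT"
      by (rule linear_map_image_submodule[OF T2.TT.module_axioms T1.TT.module_axioms d2_linear])
    fix k y assume k: "k \<in> syzygies R (ring_as_module R) n r" and y: "y \<in> carrier M"
    have kc: "k i \<in> carrier R" for i using k by (simp add: syzygies_def)
    let ?x = "nsum F1 (\<lambda>i. k i \<odot>\<^bsub>F1\<^esub> b i) n"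
    have x: "?x \<in> carrier F1" using kc b by auto
    have "lc1 ?x = nsum F0 (\<lambda>i. k i \<odot>\<^bsub>F0\<^esub> lc1 (b i)) n"
      using kc b by (intro linear_map_combination[OF F1.module_axioms F0.module_axioms lc1_linear]) auto
    also have "\<dots> = nsum F0 (\<lambda>i. (k i \<otimes>\<^bsub>R\<^esub> r i) \<odot>\<^bsub>F0\<^esub> g) n"
      using kc rc g by (intro nsum_cong) (simp add: lcb F0.smult_assoc1)
    also have "\<dots> = nsum R (\<lambda>i. k i \<otimes>\<^bsub>R\<^esub> r i) n \<odot>\<^bsub>F0\<^esub> g"
      using kc rc g by (intro F0.nsum_smult_left[symmetric]) auto
    finally have "?x \<in> K2" using x g k by (simp add: a_kernel_def' syzygies_def)
    then have "pure_tensor R F1 M ?x y = d2 (pure_tensor R F2 M (free_basis R ?x) y)"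
      using y by (simp add: d2_pure basis2_closed lc2_basis)
    then show "pure_tensor R F1 M ?x y \<in> ?H" using basis2_closed[OF \<open>?x \<in> K2\<close>] y by auto
  qed
  moreover have "nsum T1.TT (\<lambda>i. pure_tensor R F1 M (b i) (v i)) n = t \<odot>\<^bsub>T1.TT\<^esub> z"
    unfolding z_def using b m tc v(2) by (simp add: T1.TT.nsum_smult T1.pure_smult_right cong: nsum_cong)
  ultimately have "z \<in> ?H" using tf t(1) zc dz unfolding Tor1_torsion_free_iff by auto
  \<comment> \<open>A lift of the identity of \<open>R/I\<close> to a map from the canonical resolution to \<open>I \<rightarrow> R\<close>, with \<open>1\<close> over \<open>1\<close>.\<close>
  define \<rho> where "\<rho> = (\<lambda>X. if X = \<pi> \<one>\<^bsub>R\<^esub> then \<one>\<^bsub>R\<^esub> else SOME x. x \<in> carrier R \<and> \<pi> x = X)"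
  have \<rho>: "\<rho> X \<in> carrier R \<and> \<pi> (\<rho> X) = X" if "X \<in> carrier ?N" for X
  proof (cases "X = \<pi> \<one>\<^bsub>R\<^esub>")
    case False
    have "\<exists>x. x \<in> carrier R \<and> \<pi> x = X" using that \<pi>N by auto
    then show ?thesis using someI_ex[of "\<lambda>x. x \<in> carrier R \<and> \<pi> x = X"] False by (simp add: \<rho>_def)
  qed (auto simp: \<rho>_def)
  define \<Lambda> where "\<Lambda> = free_extension R (ring_as_module R) \<rho>"
  have \<Lambda>: "\<Lambda> \<in> linear_maps R F0 (ring_as_module R)"
    unfolding \<Lambda>_def res_F0_def using \<rho> by (intro RR.free_extension_linear) auto
  have \<Lambda>b: "\<Lambda> (free_basis R X) = \<rho> X" if "X \<in> carrier ?N" for X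
    unfolding \<Lambda>_def using \<rho> that by (intro RR.free_extension_basis[where I = "carrier ?N"]) auto
  have \<pi>\<Lambda>: "\<pi> (\<Lambda> c) = lc0 c" if "c \<in> carrier F0" for c
  proof -
    have "(\<lambda>c. \<pi> (\<Lambda> c)) \<in> linear_maps R F0 ?N"
      by (rule linear_maps_compose[OF \<Lambda> \<pi>])
    then show ?thesis
      using R.free_module_linear_eqI[OF N, of "\<lambda>c. \<pi> (\<Lambda> c)" "carrier ?N" lc0 c] that lc0_linear \<Lambda>b \<rho> lc0_basis
      unfolding res_F0_def by simp
  qed
  have \<Lambda>K: "\<Lambda> c \<in> I" if "c \<in> K1" for c
    using that \<pi>\<Lambda>[of c] \<pi>0[of "\<Lambda> c"] linear_maps_closed[OF \<Lambda>, of c] by (simp add: a_kernel_def')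
  let ?IM = "ideal_as_module R I"
  have IM: "module R ?IM" by (rule R.ideal_as_module_is_module[OF I])
  interpret IM: tensor_pair R ?IM M using IM M by (rule tensor_pair.intro)
  define \<Phi> where "\<Phi> = free_extension R ?IM \<Lambda>"
  have \<Phi>: "\<Phi> \<in> linear_maps R F1 ?IM"
    unfolding \<Phi>_def res_F1_def using \<Lambda>K by (intro IM.L.free_extension_linear) auto
  have \<Phi>b: "\<Phi> (free_basis R c) = \<Lambda> c" if "c \<in> K1" for c
    unfolding \<Phi>_def using \<Lambda>K that by (intro IM.L.free_extension_basis[where I = K1]) auto
  have \<Phi>\<Lambda>: "\<Phi> x = \<Lambda> (lc1 x)" if "x \<in> carrier F1" for x
  proof -
    have 1: "\<Phi> \<in> linear_maps R F1 (ring_as_module R)"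
      using \<Phi> I.a_subset unfolding linear_maps_def by auto
    have 2: "(\<lambda>c. \<Lambda> (lc1 c)) \<in> linear_maps R F1 (ring_as_module R)"
      by (rule linear_maps_compose[OF lc1_linear \<Lambda>])
    show ?thesis
      using R.free_module_linear_eqI[OF RR.module_axioms, of \<Phi> K1 "\<lambda>c. \<Lambda> (lc1 c)" x] that 1 2 \<Phi>b lc1_basis
      unfolding res_F1_def by simp
  qed
  let ?\<Psi> = "tensor_map R F1 M ?IM M \<Phi> (\<lambda>x. x)"
  note \<Psi>l = tensor_map_linear[OF F1.module_axioms M IM M \<Phi> id_linear]
    and \<Psi>p = tensor_map_pure[OF F1.module_axioms M IM M \<Phi> id_linear]
  have "?\<Psi> (d2 w) = \<zero>\<^bsub>IM.TT\<^esub>" if "w \<in> carrier T2.TT" for w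
    using that
  proof (induction rule: T2.tensor_induct)
    case zero
    show ?case
      by (simp only: linear_maps_zero[OF T2.TT.module_axioms T1.TT.module_axioms d2_linear]
          linear_maps_zero[OF T1.TT.module_axioms IM.TT.module_axioms \<Psi>l])
  next
    case (add w l y)
    have "\<Phi> (lc2 l) = \<zero>\<^bsub>?IM\<^esub>"
      using \<Phi>\<Lambda>[of "lc2 l"] linear_maps_closed[OF lc2_linear add(2)] lc1_lc2[OF add(2)]
        linear_maps_zero[OF F0.module_axioms RR.module_axioms \<Lambda>] by simp
    then have "?\<Psi> (d2 (pure_tensor R F2 M l y)) = \<zero>\<^bsub>IM.TT\<^esub>"
      using add(2,3) \<Psi>p[of "lc2 l" y] linear_maps_closed[OF lc2_linear add(2)] IM.pure_zero_left[of y]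
      by (simp add: d2_pure)
    then show ?case using add
      by (simp add: linear_maps_add[OF d2_linear] linear_maps_add[OF \<Psi>l] linear_maps_closed[OF d2_linear])
  qed
  then have "?\<Psi> z = \<zero>\<^bsub>IM.TT\<^esub>" using \<open>z \<in> ?H\<close> by auto
  moreover have "?\<Psi> z = nsum IM.TT (\<lambda>i. ?\<Psi> (pure_tensor R F1 M (b i) (m i))) n"
    unfolding z_def using b m by (intro linear_maps_nsum[OF T1.TT.module_axioms IM.TT.module_axioms \<Psi>l]) auto
  moreover have "?\<Psi> (pure_tensor R F1 M (b i) (m i)) = pure_tensor R ?IM M (r i) (m i)" if i: "i < n" for i
  proof -
    have "\<Phi> (b i) = \<Lambda> (\<kappa> i)" unfolding b_def by (rule \<Phi>b[OF \<kappa>[OF i]])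
    also have "\<dots> = r i \<otimes>\<^bsub>R\<^esub> \<Lambda> g" unfolding \<kappa>_def using linear_maps_smult[OF \<Lambda> rc[OF i] g] by simp
    also have "\<Lambda> g = \<one>\<^bsub>R\<^esub>" unfolding g_def using \<Lambda>b[OF e] by (simp add: \<rho>_def)
    finally show ?thesis using b[OF i] m i rc[OF i] by (simp add: \<Psi>p)
  qed
  ultimately have "nsum IM.TT (\<lambda>i. pure_tensor R ?IM M ((\<lambda>x. x) (r i)) (m i)) n = \<zero>\<^bsub>IM.TT\<^esub>"
    by (simp cong: nsum_cong)
  then show "trivial_relation R (ring_as_module R) M n r m"
    by (intro ideal_copy_tensor_zeroD[OF \<open>cring R\<close> M I gen IM id_linear]) (use m in auto)
qed

section \<open>Enlarging an ideal by one element\<close>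

context module
begin

text \<open>
  The relation, padded by the coefficient \<open>a\<close> with module element zero, is trivial over the ideal
  generated by the \<open>r\<^sub>i\<close> and \<open>a\<close>. The last entries \<open>k\<^sub>j n\<close> of the syzygies lie in \<open>((r) : a)\<close> and satisfy
  a relation with the same \<open>y\<^sub>j\<close>.
\<close>

lemma relations_after_adjoining:
  assumes r: "\<And>i. i < n \<Longrightarrow> r i \<in> carrier R" and a: "a \<in> carrier R"
    and J: "ideal_flat R M (combinations R (Suc n) (r(n := a)))"
    and m: "\<And>i. i < n \<Longrightarrow> m i \<in> carrier M" and rel: "nsum M (\<lambda>i. r i \<odot>\<^bsub>M\<^esub> m i) n = \<zero>\<^bsub>M\<^esub>"
  shows "\<exists>N k y. (\<forall>j<N. \<forall>i. k j i \<in> carrier R) \<and> (\<forall>j<N. y j \<in> carrier M) \<and>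
    (\<forall>j<N. k j n \<otimes> a = \<ominus> nsum R (\<lambda>i. k j i \<otimes> r i) n) \<and>
    (\<forall>i<n. m i = nsum M (\<lambda>j. k j i \<odot>\<^bsub>M\<^esub> y j) N) \<and>
    nsum M (\<lambda>j. k j n \<odot>\<^bsub>M\<^esub> y j) N = \<zero>\<^bsub>M\<^esub>"
proof -
  define r' where "r' = r(n := a)"
  define m' where "m' = m(n := \<zero>\<^bsub>M\<^esub>)"
  have r': "r' i \<in> carrier R" if "i < Suc n" for i using that r a by (auto simp: r'_def less_Suc_eq)
  have m': "m' i \<in> carrier M" if "i < Suc n" for i using that m by (auto simp: m'_def less_Suc_eq)
  have "nsum M (\<lambda>i. r' i \<odot>\<^bsub>M\<^esub> m' i) n = nsum M (\<lambda>i. r i \<odot>\<^bsub>M\<^esub> m i) n"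
    by (rule nsum_cong) (auto simp: r'_def m'_def)
  then have "nsum M (\<lambda>i. r' i \<odot>\<^bsub>M\<^esub> m' i) (Suc n) = \<zero>\<^bsub>M\<^esub>"
    using rel a by (simp add: r'_def m'_def)
  moreover have "generators R (Suc n) r' (combinations R (Suc n) r')"
    by (rule R.combinations_ideal(2)) (rule r')
  ultimately have "trivial_relation R (ring_as_module R) M (Suc n) r' m'"
    using J m' unfolding ideal_flat_def r'_def[symmetric] by blast
  then obtain v where v: "v \<in> coeff_span M (syzygies R (ring_as_module R) (Suc n) r')"
    "\<And>i. i < Suc n \<Longrightarrow> v i = m' i" unfolding trivial_relation_def by blast
  obtain N k y where k: "\<forall>j<N. k j \<in> syzygies R (ring_as_module R) (Suc n) r'"
    and y: "\<forall>j<N. y j \<in> carrier M" and vi: "\<forall>i. v i = nsum M (\<lambda>j. k j i \<odot>\<^bsub>M\<^esub> y j) N"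
    using coeff_span_representation[OF syzygies_coeffs v(1)] by blast
  have kc: "k j i \<in> carrier R" if "j < N" for j i using k that by (auto simp: syzygies_def)
  have "k j n \<otimes> a = \<ominus> nsum R (\<lambda>i. k j i \<otimes> r i) n" if j: "j < N" for j
  proof -
    have "nsum R (\<lambda>i. k j i \<otimes> r' i) n = nsum R (\<lambda>i. k j i \<otimes> r i) n"
      by (rule nsum_cong) (auto simp: r'_def)
    moreover have "nsum R (\<lambda>i. k j i \<otimes> r' i) (Suc n) = \<zero>" using k j by (simp add: syzygies_def)
    ultimately have "nsum R (\<lambda>i. k j i \<otimes> r i) n \<oplus> k j n \<otimes> a = \<zero>" by (simp add: r'_def)
    moreover have "nsum R (\<lambda>i. k j i \<otimes> r i) n \<in> carrier R" "k j n \<otimes> a \<in> carrier R" using kc[OF j] r a by auto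
    ultimately show ?thesis by (metis R.a_comm R.minus_equality)
  qed
  moreover have "m i = nsum M (\<lambda>j. k j i \<odot>\<^bsub>M\<^esub> y j) N" if "i < n" for i
    using v(2)[of i] vi that by (simp add: m'_def)
  moreover have "nsum M (\<lambda>j. k j n \<odot>\<^bsub>M\<^esub> y j) N = \<zero>\<^bsub>M\<^esub>" using v(2)[of n] vi by (simp add: m'_def)
  ultimately show ?thesis using kc y by blast
qed

text \<open>
  If \<open>1 = \<Sum> k\<^sub>i r\<^sub>i\<close>, then \<open>e\<^sub>j - r\<^sub>j k\<close> is a syzygy for the \<open>j\<close>-th unit vector \<open>e\<^sub>j\<close>, and the sum of these
  syzygies times the \<open>m\<^sub>j\<close> is the vector \<open>m\<close>.
\<close>

lemma ideal_flat_carrier: "ideal_flat R M (carrier R)"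
  unfolding ideal_flat_def
proof (intro allI impI, elim conjE)
  fix n r m assume gen: "generators R n r (carrier R)" and m: "\<forall>i<n. m i \<in> carrier M"
    and rel: "nsum M (\<lambda>i. r i \<odot>\<^bsub>M\<^esub> m i) n = \<zero>\<^bsub>M\<^esub>"
  interpret RR: module R "ring_as_module R" by (rule R.ring_as_module_is_module)
  have r: "r i \<in> carrier R" if "i < n" for i using gen that by (simp add: generators_def)
  obtain k where k: "\<And>i. k i \<in> carrier R" "\<one> = nsum R (\<lambda>i. k i \<otimes> r i) n"
    using gen R.one_closed unfolding generators_def by blast
  define d where "d = (\<lambda>j i. (if i = j then \<one> else \<zero>) \<oplus> (\<ominus> (r j \<otimes> k i)))"
  have dc: "d j i \<in> carrier R" if "j < n" for j i using that r k by (auto simp: d_def)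
  have "d j \<in> syzygies R (ring_as_module R) n r" if j: "j < n" for j
  proof -
    have "nsum R (\<lambda>i. d j i \<otimes> r i) n = r j \<oplus> \<ominus> (r j \<otimes> \<one>)"
    proof -
      have neg: "\<ominus>\<^bsub>ring_as_module R\<^esub> x = \<ominus> x" for x by (simp add: a_inv_def m_inv_def)
      have "nsum R (\<lambda>i. d j i \<otimes> r i) n = nsum R (\<lambda>i. (if i = j then \<one> else \<zero>) \<otimes> r i) n
          \<oplus> nsum R (\<lambda>i. (\<ominus> (r j \<otimes> k i)) \<otimes> r i) n"
        unfolding d_def using RR.combination_add[of n "\<lambda>i. if i = j then \<one> else \<zero>" "\<lambda>i. \<ominus> (r j \<otimes> k i)" r] r k j
        by simp
      also have "nsum R (\<lambda>i. (if i = j then \<one> else \<zero>) \<otimes> r i) n = r j"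
        using RR.combination_delta[of j n r] r j by simp
      also have "nsum R (\<lambda>i. (\<ominus> (r j \<otimes> k i)) \<otimes> r i) n = \<ominus> nsum R (\<lambda>i. (r j \<otimes> k i) \<otimes> r i) n"
        using RR.combination_minus[of n "\<lambda>i. r j \<otimes> k i" r] r k j by (simp add: neg)
      also have "nsum R (\<lambda>i. (r j \<otimes> k i) \<otimes> r i) n = r j \<otimes> nsum R (\<lambda>i. k i \<otimes> r i) n"
        using RR.combination_smult[of "r j" n k r] r k j by simp
      finally show ?thesis unfolding k(2)[symmetric] .
    qed
    then show ?thesis using r[OF j] dc[OF j] by (simp add: syzygies_def R.r_neg)
  qed
  then have w: "(\<lambda>i. nsum M (\<lambda>j. d j i \<odot>\<^bsub>M\<^esub> m j) n) \<in> coeff_span M (syzygies R (ring_as_module R) n r)"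
    using m by (intro coeff_span_sum[OF syzygies_coeffs]) auto
  moreover have "nsum M (\<lambda>j. d j i \<odot>\<^bsub>M\<^esub> m j) n = m i" if i: "i < n" for i
  proof -
    have "nsum M (\<lambda>j. d j i \<odot>\<^bsub>M\<^esub> m j) n =
      nsum M (\<lambda>j. (if j = i then \<one> else \<zero>) \<odot>\<^bsub>M\<^esub> m j) n \<oplus>\<^bsub>M\<^esub> nsum M (\<lambda>j. (\<ominus> k i \<otimes> r j) \<odot>\<^bsub>M\<^esub> m j) n"
    proof -
      have "nsum M (\<lambda>j. d j i \<odot>\<^bsub>M\<^esub> m j) n =
        nsum M (\<lambda>j. ((if j = i then \<one> else \<zero>) \<oplus> (\<ominus> k i \<otimes> r j)) \<odot>\<^bsub>M\<^esub> m j) n"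
      proof (rule nsum_cong)
        fix j assume "j < n"
        then have "\<ominus> (r j \<otimes> k i) = \<ominus> k i \<otimes> r j"
          using r k by (simp add: R.l_minus R.m_comm[of "r j" "k i"])
        then show "d j i \<odot>\<^bsub>M\<^esub> m j = ((if j = i then \<one> else \<zero>) \<oplus> (\<ominus> k i \<otimes> r j)) \<odot>\<^bsub>M\<^esub> m j"
          by (auto simp: d_def)
      qed
      then show ?thesis using r k m combination_add[of n "\<lambda>j. if j = i then \<one> else \<zero>" "\<lambda>j. \<ominus> k i \<otimes> r j" m] by simp
    qed
    also have "nsum M (\<lambda>j. (if j = i then \<one> else \<zero>) \<odot>\<^bsub>M\<^esub> m j) n = m i"
      using combination_delta[of i n m] i m by simp
    also have "nsum M (\<lambda>j. (\<ominus> k i \<otimes> r j) \<odot>\<^bsub>M\<^esub> m j) n = \<zero>\<^bsub>M\<^esub>"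
      using combination_smult[of "\<ominus> k i" n r m] r k m rel by simp
    finally show ?thesis using m i by simp
  qed
  ultimately show "trivial_relation R (ring_as_module R) M n r m"
    unfolding trivial_relation_def by (intro bexI) auto
qed

lemma colon_ideal:
  assumes "ideal I R" "a \<in> carrier R"
  shows "ideal {c \<in> carrier R. c \<otimes> a \<in> I} R"
proof -
  interpret I: ideal I R by fact
  interpret RR: module R "ring_as_module R" by (rule R.ring_as_module_is_module)
  have "submodule {c \<in> carrier R. c \<otimes> a \<in> I} R (ring_as_module R)"
  proof (rule RR.submoduleI')
    fix x y assume "x \<in> {c \<in> carrier R. c \<otimes> a \<in> I}" "y \<in> {c \<in> carrier R. c \<otimes> a \<in> I}"
    then show "x \<oplus>\<^bsub>ring_as_module R\<^esub> y \<in> {c \<in> carrier R. c \<otimes> a \<in> I}"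
      using assms(2) by (simp add: R.l_distr)
  next
    fix x y assume "x \<in> carrier R" "y \<in> {c \<in> carrier R. c \<otimes> a \<in> I}"
    then show "x \<odot>\<^bsub>ring_as_module R\<^esub> y \<in> {c \<in> carrier R. c \<otimes> a \<in> I}"
      using assms(2) I.I_l_closed[of "y \<otimes> a" x] by (simp add: R.m_assoc)
  qed (use assms in auto)
  then show ?thesis using R.submodule_ring_iff_ideal by blast
qed

text \<open>
  The element form of the exact sequence \<open>Tor\<^sub>1(R/(I : a), M) \<rightarrow> Tor\<^sub>1(R/I, M) \<rightarrow> Tor\<^sub>1(R/(I + (a)), M)\<close>.
  Passing to \<open>I + (a)\<close> leaves the relation \<open>\<Sum> c\<^sub>j y\<^sub>j = 0\<close> with \<open>c\<^sub>j \<in> (I : a)\<close>. The \<open>c\<^sub>j\<close> are extended to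
  generators of \<open>(I : a)\<close>, with zero module elements, to trivialise it; multiplication by \<open>- a\<close>
  carries this back to \<open>I\<close>.
\<close>

lemma ideal_flat_from_larger:
  assumes noeth: "noetherian_ring R" and I: "ideal I R" and gen: "generators R n r I" and a: "a \<in> carrier R"
    and J: "ideal_flat R M (combinations R (Suc n) (r(n := a)))"
    and J': "ideal_flat R M {c \<in> carrier R. c \<otimes> a \<in> I}"
    and m: "\<And>i. i < n \<Longrightarrow> m i \<in> carrier M" and rel: "nsum M (\<lambda>i. r i \<odot>\<^bsub>M\<^esub> m i) n = \<zero>\<^bsub>M\<^esub>"
  shows "trivial_relation R (ring_as_module R) M n r m"
proof -
  interpret RR: module R "ring_as_module R" by (rule R.ring_as_module_is_module)
  note r = R.generatorsD(1)[OF gen I] and comb = R.generatorsD(2)[OF gen I]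
  interpret I: ideal I R by fact
  obtain N k y where k: "\<And>j i. j < N \<Longrightarrow> k j i \<in> carrier R" and y: "\<And>j. j < N \<Longrightarrow> y j \<in> carrier M"
    and ka: "\<And>j. j < N \<Longrightarrow> k j n \<otimes> a = \<ominus> nsum R (\<lambda>i. k j i \<otimes> r i) n"
    and mi: "\<And>i. i < n \<Longrightarrow> m i = nsum M (\<lambda>j. k j i \<odot>\<^bsub>M\<^esub> y j) N"
    and z: "nsum M (\<lambda>j. k j n \<odot>\<^bsub>M\<^esub> y j) N = \<zero>\<^bsub>M\<^esub>"
    using relations_after_adjoining[OF r a J m rel] by blast
  let ?J' = "{c \<in> carrier R. c \<otimes> a \<in> I}"
  have idJ': "ideal ?J' R" by (rule colon_ideal[OF I a])
  obtain p b where b: "generators R p b ?J'"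
    using noetherian_ring.exists_generators[OF noeth R.is_cring idJ'] by blast
  define c where "c = (\<lambda>j. if j < N then k j n else b (j - N))"
  define y' where "y' = (\<lambda>j. if j < N then y j else \<zero>\<^bsub>M\<^esub>)"
  have cJ: "c j \<in> ?J'" if "j < N + p" for j
  proof (cases "j < N")
    case True
    have "nsum R (\<lambda>i. k j i \<otimes> r i) n \<in> I" using k[OF True] comb unfolding combinations_def by blast
    then have "k j n \<otimes> a \<in> I" using ka[OF True] I.a_inv_closed by simp
    then show ?thesis using True k by (simp add: c_def)
  next
    case False
    then show ?thesis using that b by (auto simp: c_def generators_def)
  qed
  have genc: "generators R (N + p) c ?J'"
    unfolding generators_def
  proof (intro conjI allI impI ballI)
    show "c j \<in> ?J'" if "j < N + p" for j using cJ[OF that] .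
    fix x assume "x \<in> ?J'"
    then obtain e where e: "\<And>i. e i \<in> carrier R" "x = nsum R (\<lambda>i. e i \<otimes> b i) p"
      using b unfolding generators_def by blast
    define e' where "e' = (\<lambda>j. if j < N then \<zero> else e (j - N))"
    have ec: "e' i \<in> carrier R" for i using e by (auto simp: e'_def)
    have "nsum R (\<lambda>i. e' i \<otimes> c i) (N + p) = nsum R (\<lambda>i. e' i \<otimes> c i) N \<oplus> nsum R (\<lambda>i. e' (N + i) \<otimes> c (N + i)) p"
      using ec cJ by (intro R.nsum_append) auto
    also have "nsum R (\<lambda>i. e' i \<otimes> c i) N = \<zero>" using cJ by (intro R.nsum_zero) (simp add: e'_def)
    also have "nsum R (\<lambda>i. e' (N + i) \<otimes> c (N + i)) p = x" unfolding e(2) by (simp add: e'_def c_def)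
    finally have "x = nsum R (\<lambda>i. e' i \<otimes> c i) (N + p)"
      using \<open>x \<in> ?J'\<close> by simp
    then show "\<exists>k. (\<forall>i. k i \<in> carrier R) \<and> x = nsum R (\<lambda>i. k i \<otimes> c i) (N + p)" using ec by blast
  qed
  have y'c: "y' j \<in> carrier M" for j using y by (simp add: y'_def)
  have cc: "c j \<in> carrier R" if "j < N + p" for j using cJ[OF that] by simp
  have split: "nsum M (\<lambda>j. q j \<odot>\<^bsub>M\<^esub> y' j) (N + p) = nsum M (\<lambda>j. q j \<odot>\<^bsub>M\<^esub> y j) N"
    if q: "\<And>j. j < N + p \<Longrightarrow> q j \<in> carrier R" for q
  proof -
    have "nsum M (\<lambda>j. q j \<odot>\<^bsub>M\<^esub> y' j) (N + p) = nsum M (\<lambda>j. q j \<odot>\<^bsub>M\<^esub> y' j) N \<oplus>\<^bsub>M\<^esub>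
      nsum M (\<lambda>j. q (N + j) \<odot>\<^bsub>M\<^esub> y' (N + j)) p" using q y'c by (intro M.nsum_append) auto
    also have "nsum M (\<lambda>j. q (N + j) \<odot>\<^bsub>M\<^esub> y' (N + j)) p = \<zero>\<^bsub>M\<^esub>"
      using q by (intro M.nsum_zero) (simp add: y'_def)
    also have "nsum M (\<lambda>j. q j \<odot>\<^bsub>M\<^esub> y' j) N = nsum M (\<lambda>j. q j \<odot>\<^bsub>M\<^esub> y j) N"
      by (rule nsum_cong) (simp add: y'_def)
    finally show ?thesis using q y by simp
  qed
  have "nsum M (\<lambda>j. c j \<odot>\<^bsub>M\<^esub> y' j) (N + p) = nsum M (\<lambda>j. k j n \<odot>\<^bsub>M\<^esub> y j) N"
  proof -
    have "nsum M (\<lambda>j. c j \<odot>\<^bsub>M\<^esub> y' j) (N + p) = nsum M (\<lambda>j. c j \<odot>\<^bsub>M\<^esub> y j) N"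
      by (rule split) (rule cc)
    also have "\<dots> = nsum M (\<lambda>j. k j n \<odot>\<^bsub>M\<^esub> y j) N" by (rule nsum_cong) (simp add: c_def)
    finally show ?thesis .
  qed
  then have "trivial_relation R (ring_as_module R) M (N + p) c y'"
    using J' genc y'c z unfolding ideal_flat_def by simp
  then obtain w where w: "w \<in> coeff_span M (syzygies R (ring_as_module R) (N + p) c)"
    "\<And>j. j < N + p \<Longrightarrow> w j = y' j" unfolding trivial_relation_def by blast
  have "\<exists>e. (\<forall>i. e i \<in> carrier R) \<and> c j \<otimes> a = nsum R (\<lambda>i. e i \<otimes> r i) n" if "j < N + p" for j
    using cJ[OF that] gen unfolding generators_def by blast
  then obtain E where E: "\<And>j i. j < N + p \<Longrightarrow> E j i \<in> carrier R"
    "\<And>j. j < N + p \<Longrightarrow> c j \<otimes> a = nsum R (\<lambda>i. E j i \<otimes> r i) n" by metis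
  \<comment> \<open>Row \<open>j\<close> of \<open>K\<close> expresses \<open>- c j \<otimes> a\<close> through the generators of \<open>I\<close>.\<close>
  define K where "K = (\<lambda>j i. if j < N then k j i else if j < N + p then \<ominus> E j i else \<zero>)"
  have Kc: "K j i \<in> carrier R" for j i using k E by (simp add: K_def)
  have neg: "\<ominus>\<^bsub>ring_as_module R\<^esub> x = \<ominus> x" for x by (simp add: a_inv_def m_inv_def)
  have Kr: "nsum R (\<lambda>i. K j i \<otimes> r i) n = \<ominus> (c j \<otimes> a)" if j: "j < N + p" for j
  proof (cases "j < N")
    case True
    have "nsum R (\<lambda>i. k j i \<otimes> r i) n \<in> carrier R" using k[OF True] r by auto
    then show ?thesis using ka[OF True] True by (simp add: K_def c_def)
  next
    case False
    have "nsum R (\<lambda>i. K j i \<otimes> r i) n = nsum R (\<lambda>i. (\<ominus> E j i) \<otimes> r i) n" using False j by (simp add: K_def)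
    also have "\<dots> = \<ominus> nsum R (\<lambda>i. E j i \<otimes> r i) n"
      using RR.combination_minus[of n "E j" r] E j r by (simp add: neg)
    finally show ?thesis using E(2)[OF j] by simp
  qed
  have "(\<lambda>i. nsum M (\<lambda>j. K j i \<odot>\<^bsub>M\<^esub> w j) (N + p)) \<in> coeff_span M (syzygies R (ring_as_module R) n r)"
  proof (rule coeff_span_matrix[OF w(1) syzygies_coeffs syzygies_coeffs])
    show "K j i \<in> carrier R" for i j by (rule Kc)
    fix d assume d: "d \<in> syzygies R (ring_as_module R) (N + p) c"
    then have dc: "d j \<in> carrier R" for j by (simp add: syzygies_def)
    have "nsum R (\<lambda>i. nsum R (\<lambda>j. K j i \<otimes> d j) (N + p) \<otimes> r i) n =
      nsum R (\<lambda>i. nsum R (\<lambda>j. d j \<otimes> K j i) (N + p) \<otimes> r i) n"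
      using Kc dc by (simp add: R.m_comm)
    also have "\<dots> = nsum R (\<lambda>j. d j \<otimes> nsum R (\<lambda>i. K j i \<otimes> r i) n) (N + p)"
      using RR.combination_assoc[of "N + p" d n K r] dc Kc r by simp
    also have "\<dots> = nsum R (\<lambda>j. (\<ominus> a) \<otimes> (d j \<otimes> c j)) (N + p)"
      using dc cc a by (intro nsum_cong) (simp add: Kr R.r_minus R.l_minus R.m_ac)
    also have "\<dots> = (\<ominus> a) \<otimes> nsum R (\<lambda>j. d j \<otimes> c j) (N + p)"
      using RR.nsum_smult[of "\<ominus> a" "N + p" "\<lambda>j. d j \<otimes> c j"] dc cc a by simp
    finally have "nsum R (\<lambda>i. nsum R (\<lambda>j. K j i \<otimes> d j) (N + p) \<otimes> r i) n = \<zero>"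
      using d a by (simp add: syzygies_def)
    then show "(\<lambda>i. nsum R (\<lambda>j. K j i \<otimes> d j) (N + p)) \<in> syzygies R (ring_as_module R) n r"
      using Kc dc by (simp add: syzygies_def)
  qed
  moreover have "nsum M (\<lambda>j. K j i \<odot>\<^bsub>M\<^esub> w j) (N + p) = m i" if i: "i < n" for i
  proof -
    have "nsum M (\<lambda>j. K j i \<odot>\<^bsub>M\<^esub> w j) (N + p) = nsum M (\<lambda>j. K j i \<odot>\<^bsub>M\<^esub> y' j) (N + p)"
      by (rule nsum_cong) (simp add: w(2))
    also have "\<dots> = nsum M (\<lambda>j. K j i \<odot>\<^bsub>M\<^esub> y j) N" using Kc by (intro split) auto
    also have "\<dots> = m i" unfolding mi[OF i] by (rule nsum_cong) (simp add: K_def)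
    finally show ?thesis .
  qed
  ultimately show ?thesis unfolding trivial_relation_def by (intro bexI) auto
qed

end

section \<open>Prime ideals suffice\<close>

lemma (in noetherian_ring) exists_maximal_member:
  assumes "\<A> \<noteq> {}" "\<And>I. I \<in> \<A> \<Longrightarrow> ideal I R"
  shows "\<exists>I\<in>\<A>. \<forall>J\<in>\<A>. I \<subseteq> J \<longrightarrow> J = I"
proof (rule subset_Zorn_nonempty[OF assms(1)])
  fix C assume C: "C \<noteq> {}" "subset.chain \<A> C"
  then have "C \<subseteq> \<A>" unfolding pred_on.chain_def by blast
  have "subset.chain {I. ideal I R} C"
    using C(2) assms(2) unfolding pred_on.chain_def by auto
  then have "\<Union>C \<in> C" by (rule ideal_chain_is_trivial[OF C(1)])
  then show "\<Union>C \<in> \<A>" using \<open>C \<subseteq> \<A>\<close> by (rule subsetD[rotated])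
qed

lemma (in module) adjoining_larger:
  assumes I: "ideal I R" and gen: "generators R n r I" and a: "a \<in> carrier R" "a \<notin> I"
  shows "ideal (combinations R (Suc n) (r(n := a))) R" "I \<subset> combinations R (Suc n) (r(n := a))"
proof -
  note r = R.generatorsD(1)[OF gen I]
  let ?J = "combinations R (Suc n) (r(n := a))"
  have r': "(r(n := a)) i \<in> carrier R" if "i < Suc n" for i using that r a by (auto simp: less_Suc_eq)
  show J: "ideal ?J R" by (rule R.combinations_ideal(1)) (rule r')
  have gJ: "generators R (Suc n) (r(n := a)) ?J" by (rule R.combinations_ideal(2)) (rule r')
  have "I \<subseteq> ?J"
  proof
    fix x assume "x \<in> I"
    then obtain k where k: "\<And>i. k i \<in> carrier R" "x = nsum R (\<lambda>i. k i \<otimes> r i) n"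
      using gen unfolding generators_def by blast
    define k' where "k' = k(n := \<zero>)"
    have "nsum R (\<lambda>i. k' i \<otimes> (r(n := a)) i) n = x"
      unfolding k(2) by (rule nsum_cong) (simp add: k'_def)
    moreover have "x \<in> carrier R" unfolding k(2) using k(1) r by auto
    ultimately have "x = nsum R (\<lambda>i. k' i \<otimes> (r(n := a)) i) (Suc n)" using a by (simp add: k'_def)
    moreover have "k' i \<in> carrier R" for i using k by (simp add: k'_def)
    ultimately show "x \<in> ?J" unfolding combinations_def by blast
  qed
  moreover have "a \<in> ?J" using gJ unfolding generators_def by (metis fun_upd_same lessI)
  ultimately show "I \<subset> ?J" using a by blast
qed

text \<open>
  For \<open>a b \<in> I\<close> with \<open>a, b \<notin> I\<close>, the ideal \<open>I + (a)\<close> is larger than \<open>I\<close> because of \<open>a\<close>, and \<open>(I : a)\<close>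
  because of \<open>b\<close>.
\<close>

lemma (in module) maximal_non_flat_prime:
  assumes noeth: "noetherian_ring R" and I: "ideal I R" and nf: "\<not> ideal_flat R M I"
    and larger: "\<And>J. ideal J R \<Longrightarrow> I \<subset> J \<Longrightarrow> ideal_flat R M J"
  shows "primeideal I R"
proof (rule primeidealI[OF I R.is_cring])
  interpret I: ideal I R by fact
  show "carrier R \<noteq> I" using nf ideal_flat_carrier by blast
  fix a b assume ab: "a \<in> carrier R" "b \<in> carrier R" "a \<otimes> b \<in> I"
  show "a \<in> I \<or> b \<in> I"
  proof (rule ccontr)
    assume nab: "\<not> (a \<in> I \<or> b \<in> I)"
    let ?J' = "{c \<in> carrier R. c \<otimes> a \<in> I}"
    have "I \<subseteq> ?J'"
    proof
      fix c assume "c \<in> I"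
      then show "c \<in> ?J'" using I.I_r_closed[OF _ ab(1), of c] I.a_Hcarr[of c] by simp
    qed
    moreover have "b \<in> ?J'" using ab by (simp add: R.m_comm)
    ultimately have J': "ideal_flat R M ?J'"
      using nab by (intro larger colon_ideal[OF I ab(1)]) auto
    have "ideal_flat R M I"
      unfolding ideal_flat_def
    proof (intro allI impI, elim conjE)
      fix n r m assume gen: "generators R n r I" and m: "\<forall>i<n. m i \<in> carrier M"
        and rel: "nsum M (\<lambda>i. r i \<odot>\<^bsub>M\<^esub> m i) n = \<zero>\<^bsub>M\<^esub>"
      have "ideal_flat R M (combinations R (Suc n) (r(n := a)))"
        using adjoining_larger[OF I gen ab(1)] nab by (intro larger) auto
      then show "trivial_relation R (ring_as_module R) M n r m"
        using ideal_flat_from_larger[OF noeth I gen ab(1) _ J'] m rel by blast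
    qed
    then show False using nf by blast
  qed
qed

lemma (in module) exists_prime_non_flat:
  assumes noeth: "noetherian_ring R" and ne: "\<not> equationally_flat R M"
  obtains P where "primeideal P R" "\<not> ideal_flat R M P"
    "\<And>J. ideal J R \<Longrightarrow> P \<subset> J \<Longrightarrow> ideal_flat R M J"
proof -
  interpret noetherian_ring R by fact
  let ?A = "{I. ideal I R \<and> \<not> ideal_flat R M I}"
  have "?A \<noteq> {}"
  proof
    assume "?A = {}"
    then have all: "ideal I R \<Longrightarrow> ideal_flat R M I" for I by blast
    have "equationally_flat R M" unfolding equationally_flat_def
    proof (intro allI impI, elim conjE)
      fix n r m assume h: "\<forall>i. r i \<in> carrier R" "\<forall>i. m i \<in> carrier M"
        "nsum M (\<lambda>i. r i \<odot>\<^bsub>M\<^esub> m i) n = \<zero>\<^bsub>M\<^esub>"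
      then show "trivial_relation R (ring_as_module R) M n r m"
        using all[OF R.combinations_ideal(1), of n r] R.combinations_ideal(2)[of n r]
        unfolding ideal_flat_def by blast
    qed
    then show False using ne by blast
  qed
  then obtain P where P: "P \<in> ?A" "\<And>J. J \<in> ?A \<Longrightarrow> P \<subseteq> J \<Longrightarrow> J = P"
    using exists_maximal_member[of ?A] by blast
  have larger: "ideal_flat R M J" if "ideal J R" "P \<subset> J" for J using P(2)[of J] that by blast
  have "primeideal P R" using P(1) larger by (intro maximal_non_flat_prime[OF noeth]) auto
  then show ?thesis using that P(1) larger by blast
qed

theorem (in module) equationally_flat_if_prime_flat:
  assumes "noetherian_ring R" "\<And>P. primeideal P R \<Longrightarrow> ideal_flat R M P"
  shows "equationally_flat R M"
  using exists_prime_non_flat[OF assms(1)] assms(2) by blast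

section \<open>Finitely generated modules over a Noetherian ring\<close>

context module
begin

lemma module_span_mono: "X \<subseteq> Y \<Longrightarrow> module_span R M X \<subseteq> module_span R M Y"
  unfolding module_span_def by blast

lemma module_span_insert:
  assumes X: "insert x X \<subseteq> carrier M"
  shows "module_span R M (insert x X) =
    {w \<oplus>\<^bsub>M\<^esub> s \<odot>\<^bsub>M\<^esub> x | w s. w \<in> module_span R M X \<and> s \<in> carrier R}" (is "_ = ?H")
proof
  have XS: "submodule (module_span R M X) R M" using X by (intro module_span_submodule) auto
  note E = submoduleE[OF XS] submodule_zero_mem[OF XS]
  have wc: "w \<in> carrier M" if "w \<in> module_span R M X" for w using E(1) that by blast
  have x: "x \<in> carrier M" using X by simp
  have "submodule ?H R M"
  proof (rule submoduleI')
    show "?H \<subseteq> carrier M" using wc x by auto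
    have "\<zero>\<^bsub>M\<^esub> = \<zero>\<^bsub>M\<^esub> \<oplus>\<^bsub>M\<^esub> \<zero> \<odot>\<^bsub>M\<^esub> x" using x by simp
    then show "\<zero>\<^bsub>M\<^esub> \<in> ?H" using E(7) by blast
    fix a b assume "a \<in> ?H" "b \<in> ?H"
    then obtain w s w' s' where h: "a = w \<oplus>\<^bsub>M\<^esub> s \<odot>\<^bsub>M\<^esub> x" "w \<in> module_span R M X" "s \<in> carrier R"
      "b = w' \<oplus>\<^bsub>M\<^esub> s' \<odot>\<^bsub>M\<^esub> x" "w' \<in> module_span R M X" "s' \<in> carrier R" by blast
    have "a \<oplus>\<^bsub>M\<^esub> b = (w \<oplus>\<^bsub>M\<^esub> w') \<oplus>\<^bsub>M\<^esub> (s \<oplus> s') \<odot>\<^bsub>M\<^esub> x"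
      unfolding h using h wc x by (simp add: smult_l_distr M.a_ac)
    then show "a \<oplus>\<^bsub>M\<^esub> b \<in> ?H" using h E(5) by blast
  next
    fix r a assume r: "r \<in> carrier R" and "a \<in> ?H"
    then obtain w s where h: "a = w \<oplus>\<^bsub>M\<^esub> s \<odot>\<^bsub>M\<^esub> x" "w \<in> module_span R M X" "s \<in> carrier R" by blast
    have "r \<odot>\<^bsub>M\<^esub> a = r \<odot>\<^bsub>M\<^esub> w \<oplus>\<^bsub>M\<^esub> (r \<otimes> s) \<odot>\<^bsub>M\<^esub> x"
      unfolding h using h wc x r by (simp add: smult_r_distr smult_assoc1)
    then show "r \<odot>\<^bsub>M\<^esub> a \<in> ?H" using h r E(4) by blast
  qed
  moreover have "insert x X \<subseteq> ?H"
  proof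
    fix y assume "y \<in> insert x X"
    then consider "y = x" | "y \<in> X" by blast
    then show "y \<in> ?H"
    proof cases
      case 1
      have "y = \<zero>\<^bsub>M\<^esub> \<oplus>\<^bsub>M\<^esub> \<one> \<odot>\<^bsub>M\<^esub> x" using x 1 by simp
      then show ?thesis using E(7) by blast
    next
      case 2
      then have "y \<in> module_span R M X" using module_span_superset by blast
      moreover have "y = y \<oplus>\<^bsub>M\<^esub> \<zero> \<odot>\<^bsub>M\<^esub> x" using wc calculation x by simp
      ultimately show ?thesis by blast
    qed
  qed
  ultimately show "module_span R M (insert x X) \<subseteq> ?H" by (rule module_span_least)
  have YS: "submodule (module_span R M (insert x X)) R M" using X by (rule module_span_submodule)
  have "x \<in> module_span R M (insert x X)" using module_span_superset by blast
  moreover have "module_span R M X \<subseteq> module_span R M (insert x X)" by (rule module_span_mono) auto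
  ultimately show "?H \<subseteq> module_span R M (insert x X)"
    using submoduleE(4,5)[OF YS] by blast
qed

lemma module_span_empty: "module_span R M {} = {\<zero>\<^bsub>M\<^esub>}"
proof
  have "submodule {\<zero>\<^bsub>M\<^esub>} R M" by (rule submoduleI') auto
  then show "module_span R M {} \<subseteq> {\<zero>\<^bsub>M\<^esub>}" by (rule module_span_least) auto
  show "{\<zero>\<^bsub>M\<^esub>} \<subseteq> module_span R M {}" using module_span_submodule[of "{}"] submodule_zero_mem by auto
qed

text \<open>
  Induction on the number of generators. The coefficients of the last generator \<open>x\<close> in members of \<open>H\<close>
  form an ideal; members of \<open>H\<close> that realise its finitely many generators, together with generators
  of the submodule of \<open>H\<close> that avoids \<open>x\<close>, generate \<open>H\<close>.
\<close>

theorem noetherian_submodule_fg: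
  assumes noeth: "noetherian_ring R" and X: "finite X" "X \<subseteq> carrier M"
    and H: "submodule H R M" "H \<subseteq> module_span R M X"
  shows "\<exists>Y. finite Y \<and> Y \<subseteq> H \<and> H = module_span R M Y"
  using X H
proof (induction X arbitrary: H rule: finite_induct)
  case empty
  have "H = {\<zero>\<^bsub>M\<^esub>}" using empty submodule_zero_mem unfolding module_span_empty by blast
  then show ?case using module_span_empty by (intro exI[of _ "{}"]) auto
next
  case (insert x X)
  interpret noetherian_ring R by (rule noeth)
  have XS: "submodule (module_span R M X) R M" using insert by (intro module_span_submodule) auto
  note E = submoduleE[OF XS] submodule_zero_mem[OF XS]
  note HE = submoduleE[OF insert.prems(2)] submodule_zero_mem[OF insert.prems(2)]
  have x: "x \<in> carrier M" using insert by simp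
  interpret RR: module R "ring_as_module R" by (rule R.ring_as_module_is_module)
  \<comment> \<open>The coefficients of \<open>x\<close> that occur in members of a given submodule \<open>G\<close> form an ideal.\<close>
  define I where "I = (\<lambda>G. {s \<in> carrier R. \<exists>w\<in>module_span R M X. w \<oplus>\<^bsub>M\<^esub> s \<odot>\<^bsub>M\<^esub> x \<in> G})"
  have wc: "w \<in> carrier M" if "w \<in> module_span R M X" for w using E(1) that by blast
  have idI: "ideal (I G) R" if G: "submodule G R M" for G
    unfolding R.submodule_ring_iff_ideal[symmetric]
  proof (rule RR.submoduleI')
    note GE = submoduleE[OF G] submodule_zero_mem[OF G]
    show "I G \<subseteq> carrier (ring_as_module R)" by (auto simp: I_def)
    have "\<zero>\<^bsub>M\<^esub> \<oplus>\<^bsub>M\<^esub> \<zero> \<odot>\<^bsub>M\<^esub> x \<in> G" using x GE by simp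
    then show "\<zero>\<^bsub>ring_as_module R\<^esub> \<in> I G" using E(7) by (auto simp: I_def)
    fix s t assume "s \<in> I G" "t \<in> I G"
    then obtain w w' where h: "s \<in> carrier R" "t \<in> carrier R" "w \<in> module_span R M X" "w' \<in> module_span R M X"
      "w \<oplus>\<^bsub>M\<^esub> s \<odot>\<^bsub>M\<^esub> x \<in> G" "w' \<oplus>\<^bsub>M\<^esub> t \<odot>\<^bsub>M\<^esub> x \<in> G" unfolding I_def by blast
    have "(w \<oplus>\<^bsub>M\<^esub> s \<odot>\<^bsub>M\<^esub> x) \<oplus>\<^bsub>M\<^esub> (w' \<oplus>\<^bsub>M\<^esub> t \<odot>\<^bsub>M\<^esub> x) = (w \<oplus>\<^bsub>M\<^esub> w') \<oplus>\<^bsub>M\<^esub> (s \<oplus> t) \<odot>\<^bsub>M\<^esub> x"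
      using h wc x by (simp add: smult_l_distr M.a_ac)
    then have "(w \<oplus>\<^bsub>M\<^esub> w') \<oplus>\<^bsub>M\<^esub> (s \<oplus> t) \<odot>\<^bsub>M\<^esub> x \<in> G" using GE(5)[OF h(5,6)] by simp
    then show "s \<oplus>\<^bsub>ring_as_module R\<^esub> t \<in> I G" using h E(5)[OF h(3,4)] by (auto simp: I_def)
  next
    note GE = submoduleE[OF G] submodule_zero_mem[OF G]
    fix r s assume r: "r \<in> carrier R" and "s \<in> I G"
    then obtain w where h: "s \<in> carrier R" "w \<in> module_span R M X" "w \<oplus>\<^bsub>M\<^esub> s \<odot>\<^bsub>M\<^esub> x \<in> G" unfolding I_def by blast
    have "r \<odot>\<^bsub>M\<^esub> (w \<oplus>\<^bsub>M\<^esub> s \<odot>\<^bsub>M\<^esub> x) = r \<odot>\<^bsub>M\<^esub> w \<oplus>\<^bsub>M\<^esub> (r \<otimes> s) \<odot>\<^bsub>M\<^esub> x"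
      using h wc x r by (simp add: smult_r_distr smult_assoc1)
    then have "r \<odot>\<^bsub>M\<^esub> w \<oplus>\<^bsub>M\<^esub> (r \<otimes> s) \<odot>\<^bsub>M\<^esub> x \<in> G" using GE(4)[OF r h(3)] by simp
    then show "r \<odot>\<^bsub>ring_as_module R\<^esub> s \<in> I G" using h r E(4)[OF r h(2)] by (auto simp: I_def)
  qed
  obtain A where A: "A \<subseteq> carrier R" "finite A" "I H = Idl A" using finetely_gen[OF idI[OF insert.prems(2)]] by blast
  have "\<exists>h\<in>H. \<exists>w\<in>module_span R M X. h = w \<oplus>\<^bsub>M\<^esub> s \<odot>\<^bsub>M\<^esub> x" if "s \<in> A" for s
    using that R.genideal_self[OF A(1)] A(3) unfolding I_def by blast
  then obtain f where f: "\<And>s. s \<in> A \<Longrightarrow> f s \<in> H \<and> (\<exists>w\<in>module_span R M X. f s = w \<oplus>\<^bsub>M\<^esub> s \<odot>\<^bsub>M\<^esub> x)" by metis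
  define H' where "H' = H \<inter> module_span R M X"
  have H'S: "submodule H' R M" unfolding H'_def
    by (rule submoduleI') (use HE E in auto)
  have "X \<subseteq> carrier M" "H' \<subseteq> module_span R M X" using insert.prems(1) by (auto simp: H'_def)
  then obtain Y' where Y': "finite Y'" "Y' \<subseteq> H'" "H' = module_span R M Y'"
    using insert.IH[OF _ H'S] by blast
  define Y where "Y = Y' \<union> f ` A"
  have YH: "Y \<subseteq> H" using Y' f by (auto simp: Y_def H'_def)
  then have Yc: "Y \<subseteq> carrier M" using HE by blast
  have YS: "submodule (module_span R M Y) R M" by (rule module_span_submodule[OF Yc])
  note YE = submoduleE[OF YS]
  have span_le: "module_span R M Y \<subseteq> H" using insert.prems(2) YH by (rule module_span_least)
  have H'_le: "H' \<subseteq> module_span R M Y" unfolding Y'(3) by (rule module_span_mono) (auto simp: Y_def)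
  have "A \<subseteq> I (module_span R M Y)"
  proof
    fix s assume s: "s \<in> A"
    then have "f s \<in> module_span R M Y" using module_span_superset[of Y] by (auto simp: Y_def)
    then show "s \<in> I (module_span R M Y)" using f[OF s] s A(1) unfolding I_def by auto
  qed
  then have I_le: "I H \<subseteq> I (module_span R M Y)"
    unfolding A(3) using idI[OF YS] by (rule R.genideal_minimal[rotated])
  have "H \<subseteq> module_span R M Y"
  proof
    fix h assume h: "h \<in> H"
    then obtain w s where ws: "h = w \<oplus>\<^bsub>M\<^esub> s \<odot>\<^bsub>M\<^esub> x" "w \<in> module_span R M X" "s \<in> carrier R"
      using insert.prems module_span_insert[of x X] by blast
    then have "s \<in> I H" using h by (auto simp: I_def)
    then obtain w' where w': "w' \<in> module_span R M X" "w' \<oplus>\<^bsub>M\<^esub> s \<odot>\<^bsub>M\<^esub> x \<in> module_span R M Y"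
      using I_le unfolding I_def by blast
    let ?y = "w' \<oplus>\<^bsub>M\<^esub> s \<odot>\<^bsub>M\<^esub> x"
    have c: "w \<in> carrier M" "w' \<in> carrier M" "s \<odot>\<^bsub>M\<^esub> x \<in> carrier M" using wc ws w' x by auto
    have eq: "h \<oplus>\<^bsub>M\<^esub> (\<ominus>\<^bsub>M\<^esub> ?y) = w \<oplus>\<^bsub>M\<^esub> (\<ominus>\<^bsub>M\<^esub> w')"
    proof -
      have "h \<oplus>\<^bsub>M\<^esub> (\<ominus>\<^bsub>M\<^esub> ?y) = w \<oplus>\<^bsub>M\<^esub> (s \<odot>\<^bsub>M\<^esub> x \<oplus>\<^bsub>M\<^esub> (\<ominus>\<^bsub>M\<^esub> w' \<oplus>\<^bsub>M\<^esub> \<ominus>\<^bsub>M\<^esub> (s \<odot>\<^bsub>M\<^esub> x)))"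
        unfolding ws(1) using c by (simp add: M.minus_add M.a_assoc)
      also have "s \<odot>\<^bsub>M\<^esub> x \<oplus>\<^bsub>M\<^esub> (\<ominus>\<^bsub>M\<^esub> w' \<oplus>\<^bsub>M\<^esub> \<ominus>\<^bsub>M\<^esub> (s \<odot>\<^bsub>M\<^esub> x)) = \<ominus>\<^bsub>M\<^esub> w'"
        using c by (simp add: M.a_lcomm[of "s \<odot>\<^bsub>M\<^esub> x"] M.r_neg)
      finally show ?thesis .
    qed
    have "?y \<in> H" using w'(2) span_le by blast
    then have "h \<oplus>\<^bsub>M\<^esub> (\<ominus>\<^bsub>M\<^esub> ?y) \<in> H" using HE(3,5) h by blast
    moreover have "h \<oplus>\<^bsub>M\<^esub> (\<ominus>\<^bsub>M\<^esub> ?y) \<in> module_span R M X" unfolding eq using E(3,5) ws(2) w'(1) by blast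
    ultimately have "h \<oplus>\<^bsub>M\<^esub> (\<ominus>\<^bsub>M\<^esub> ?y) \<in> module_span R M Y" using H'_le unfolding H'_def by blast
    then have "(h \<oplus>\<^bsub>M\<^esub> (\<ominus>\<^bsub>M\<^esub> ?y)) \<oplus>\<^bsub>M\<^esub> ?y \<in> module_span R M Y" using YE(5) w'(2) by blast
    moreover have "(h \<oplus>\<^bsub>M\<^esub> (\<ominus>\<^bsub>M\<^esub> ?y)) \<oplus>\<^bsub>M\<^esub> ?y = h"
      using h HE(1) c by (simp add: M.a_assoc M.l_neg subset_iff)
    ultimately show "h \<in> module_span R M Y" by simp
  qed
  then show ?case using span_le Y' A(2) YH by (intro exI[of _ Y]) (auto simp: Y_def)
qed

end

lemma (in noetherian_ring) exists_maximalideal: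
  assumes "ideal I R" "I \<noteq> carrier R"
  obtains \<mm> where "maximalideal \<mm> R" "I \<subseteq> \<mm>"
proof -
  define A where "A = {J. ideal J R \<and> J \<noteq> carrier R \<and> I \<subseteq> J}"
  have "\<exists>\<mm>\<in>A. \<forall>J\<in>A. \<mm> \<subseteq> J \<longrightarrow> J = \<mm>"
    by (rule exists_maximal_member) (use assms in \<open>auto simp: A_def\<close>)
  then obtain \<mm> where m: "\<mm> \<in> A" "\<And>J. J \<in> A \<Longrightarrow> \<mm> \<subseteq> J \<Longrightarrow> J = \<mm>"
    by meson
  have mA: "ideal \<mm> R" "carrier R \<noteq> \<mm>" "I \<subseteq> \<mm>" using m(1) by (simp_all add: A_def eq_commute)
  have "maximalideal \<mm> R"
  proof (rule maximalidealI[OF mA(1,2)])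
    fix J assume J: "ideal J R" "\<mm> \<subseteq> J" "J \<subseteq> carrier R"
    show "J = \<mm> \<or> J = carrier R"
    proof (cases "J = carrier R")
      case False
      then have "J \<in> A" using J mA(3) unfolding A_def by simp
      then show ?thesis using m(2) J(2) by blast
    qed simp
  qed
  then show ?thesis using that mA(3) by blast
qed

lemma (in noetherian_ring) one_minus_jacobson_unit:
  assumes cr: "cring R" and j: "j \<in> jacobson_radical R" and s: "s \<in> carrier R"
  obtains u where "u \<in> carrier R" "u \<otimes> (\<one> \<ominus> j \<otimes> s) = \<one>"
proof -
  interpret cring R by (rule cr)
  have jc: "j \<in> carrier R" using j by (simp add: jacobson_radical_def)
  let ?x = "\<one> \<ominus> j \<otimes> s"
  have xc: "?x \<in> carrier R" using jc s by simp
  have "PIdl ?x = carrier R"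
  proof (rule ccontr)
    assume "PIdl ?x \<noteq> carrier R"
    then obtain \<mm> where m: "maximalideal \<mm> R" "PIdl ?x \<subseteq> \<mm>"
      using exists_maximalideal[OF cgenideal_ideal[OF xc]] by blast
    interpret m: maximalideal \<mm> R by (rule m(1))
    have "j \<in> \<mm>" using j m(1) by (simp add: jacobson_radical_def)
    then have "j \<otimes> s \<in> \<mm>" using s by (rule m.I_r_closed)
    moreover have "?x \<in> \<mm>" using m(2) cgenideal_self[OF xc] by blast
    ultimately have "?x \<oplus> j \<otimes> s \<in> \<mm>" by (intro m.a_closed)
    moreover have "?x \<oplus> j \<otimes> s = \<one>" using jc s by (simp add: a_minus_def a_assoc l_neg)
    ultimately have "\<one> \<in> \<mm>" by simp
    then have "\<mm> = carrier R" by (rule m.one_imp_carrier)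
    then show False using m.I_notcarr by simp
  qed
  then have "\<one> \<in> PIdl ?x" by simp
  then show ?thesis using that unfolding cgenideal_def by auto
qed

text \<open>
  Nakayama's lemma modulo \<open>B\<close>. One generator \<open>x\<close> is eliminated at a time: it satisfies
  \<open>(1 - j s) x = b + j w\<close> with \<open>w\<close> in the span of the others and with an invertible \<open>1 - j s\<close>.
\<close>

theorem (in module) nakayama:
  assumes noeth: "noetherian_ring R" and j: "j \<in> jacobson_radical R"
    and B: "submodule B R M" and "finite Y" "Y \<subseteq> carrier M"
    and gen: "\<And>y. y \<in> Y \<Longrightarrow> \<exists>b\<in>B. \<exists>z\<in>module_span R M Y. y = b \<oplus>\<^bsub>M\<^esub> j \<odot>\<^bsub>M\<^esub> z"
  shows "Y \<subseteq> B"
  using assms(4-)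
proof (induction Y rule: finite_induct)
  case empty
  then show ?case by simp
next
  case (insert x Y)
  interpret noetherian_ring R by (rule noeth)
  have jc: "j \<in> carrier R" using j by (simp add: jacobson_radical_def)
  note BE = submoduleE[OF B]
  have YS: "submodule (module_span R M Y) R M" using insert by (intro module_span_submodule) auto
  note YE = submoduleE[OF YS]
  have x: "x \<in> carrier M" using insert by simp
  have span: "\<exists>w\<in>module_span R M Y. \<exists>s\<in>carrier R. z = w \<oplus>\<^bsub>M\<^esub> s \<odot>\<^bsub>M\<^esub> x"
    if "z \<in> module_span R M (insert x Y)" for z
    using that module_span_insert[of x Y] insert.prems(1) by blast
  obtain b z where bz: "b \<in> B" "z \<in> module_span R M (insert x Y)" "x = b \<oplus>\<^bsub>M\<^esub> j \<odot>\<^bsub>M\<^esub> z"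
    using insert.prems(2)[of x] by blast
  obtain w s where ws: "w \<in> module_span R M Y" "s \<in> carrier R" "z = w \<oplus>\<^bsub>M\<^esub> s \<odot>\<^bsub>M\<^esub> x"
    using span[OF bz(2)] by blast
  have bc: "b \<in> carrier M" "w \<in> carrier M" using bz(1) ws(1) BE(1) YE(1) by blast+
  obtain u where u: "u \<in> carrier R" "u \<otimes> (\<one> \<ominus> j \<otimes> s) = \<one>"
    using one_minus_jacobson_unit[OF R.is_cring j ws(2)] by blast
  have c: "\<one> \<ominus> j \<otimes> s \<in> carrier R" "b \<oplus>\<^bsub>M\<^esub> j \<odot>\<^bsub>M\<^esub> w \<in> carrier M" "(j \<otimes> s) \<odot>\<^bsub>M\<^esub> x \<in> carrier M"
    using ws(2) jc x bc by auto
  have "x = b \<oplus>\<^bsub>M\<^esub> j \<odot>\<^bsub>M\<^esub> (w \<oplus>\<^bsub>M\<^esub> s \<odot>\<^bsub>M\<^esub> x)" using bz(3) unfolding ws(3) .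
  also have "\<dots> = (b \<oplus>\<^bsub>M\<^esub> j \<odot>\<^bsub>M\<^esub> w) \<oplus>\<^bsub>M\<^esub> (j \<otimes> s) \<odot>\<^bsub>M\<^esub> x"
    using ws(2) bc jc x by (simp add: smult_r_distr smult_assoc1 M.a_assoc)
  finally have "b \<oplus>\<^bsub>M\<^esub> j \<odot>\<^bsub>M\<^esub> w = x \<oplus>\<^bsub>M\<^esub> \<ominus>\<^bsub>M\<^esub> ((j \<otimes> s) \<odot>\<^bsub>M\<^esub> x)"
    using M.add.inv_solve_right[OF c(2) x c(3)] by blast
  also have "\<dots> = (\<one> \<ominus> j \<otimes> s) \<odot>\<^bsub>M\<^esub> x"
    using ws(2) jc x by (simp add: a_minus_def smult_l_distr smult_l_minus)
  finally have "u \<odot>\<^bsub>M\<^esub> (b \<oplus>\<^bsub>M\<^esub> j \<odot>\<^bsub>M\<^esub> w) = (u \<otimes> (\<one> \<ominus> j \<otimes> s)) \<odot>\<^bsub>M\<^esub> x"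
    using u(1) c(1) x by (simp add: smult_assoc1)
  then have "u \<odot>\<^bsub>M\<^esub> (b \<oplus>\<^bsub>M\<^esub> j \<odot>\<^bsub>M\<^esub> w) = x" unfolding u(2) using x by simp
  moreover have "u \<odot>\<^bsub>M\<^esub> (b \<oplus>\<^bsub>M\<^esub> j \<odot>\<^bsub>M\<^esub> w) = u \<odot>\<^bsub>M\<^esub> b \<oplus>\<^bsub>M\<^esub> j \<odot>\<^bsub>M\<^esub> (u \<odot>\<^bsub>M\<^esub> w)"
    using u(1) jc bc by (simp add: smult_r_distr smult_assoc1[symmetric] R.m_comm)
  ultimately have xeq: "x = u \<odot>\<^bsub>M\<^esub> b \<oplus>\<^bsub>M\<^esub> j \<odot>\<^bsub>M\<^esub> (u \<odot>\<^bsub>M\<^esub> w)" by metis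
  have "Y \<subseteq> B"
  proof (rule insert.IH)
    show "Y \<subseteq> carrier M" using insert by simp
    fix y assume "y \<in> Y"
    then obtain b' z' where bz': "b' \<in> B" "z' \<in> module_span R M (insert x Y)" "y = b' \<oplus>\<^bsub>M\<^esub> j \<odot>\<^bsub>M\<^esub> z'"
      using insert.prems(2)[of y] by blast
    obtain w' s' where ws': "w' \<in> module_span R M Y" "s' \<in> carrier R" "z' = w' \<oplus>\<^bsub>M\<^esub> s' \<odot>\<^bsub>M\<^esub> x"
      using span[OF bz'(2)] by blast
    have bc': "b' \<in> carrier M" "w' \<in> carrier M" using bz'(1) ws'(1) BE(1) YE(1) by blast+
    have "s' \<odot>\<^bsub>M\<^esub> x = s' \<odot>\<^bsub>M\<^esub> (u \<odot>\<^bsub>M\<^esub> b) \<oplus>\<^bsub>M\<^esub> j \<odot>\<^bsub>M\<^esub> (s' \<odot>\<^bsub>M\<^esub> (u \<odot>\<^bsub>M\<^esub> w))"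
    proof -
      have "s' \<odot>\<^bsub>M\<^esub> x = s' \<odot>\<^bsub>M\<^esub> (u \<odot>\<^bsub>M\<^esub> b \<oplus>\<^bsub>M\<^esub> j \<odot>\<^bsub>M\<^esub> (u \<odot>\<^bsub>M\<^esub> w))"
        using xeq by (rule arg_cong)
      also have "\<dots> = s' \<odot>\<^bsub>M\<^esub> (u \<odot>\<^bsub>M\<^esub> b) \<oplus>\<^bsub>M\<^esub> j \<odot>\<^bsub>M\<^esub> (s' \<odot>\<^bsub>M\<^esub> (u \<odot>\<^bsub>M\<^esub> w))"
        using ws'(2) u(1) bc jc by (simp add: smult_r_distr smult_assoc1[symmetric] R.m_ac)
      finally show ?thesis .
    qed
    then have "y = (b' \<oplus>\<^bsub>M\<^esub> (j \<otimes> (s' \<otimes> u)) \<odot>\<^bsub>M\<^esub> b) \<oplus>\<^bsub>M\<^esub> j \<odot>\<^bsub>M\<^esub> (w' \<oplus>\<^bsub>M\<^esub> (j \<otimes> (s' \<otimes> u)) \<odot>\<^bsub>M\<^esub> w)"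
      unfolding bz'(3) ws'(3) using ws'(2) u(1) bc bc' jc
      by (simp add: smult_r_distr smult_assoc1 M.a_ac)
    moreover have "b' \<oplus>\<^bsub>M\<^esub> (j \<otimes> (s' \<otimes> u)) \<odot>\<^bsub>M\<^esub> b \<in> B"
      using bz'(1) bz(1) ws'(2) u(1) jc by (intro BE(5) BE(4)) auto
    moreover have "w' \<oplus>\<^bsub>M\<^esub> (j \<otimes> (s' \<otimes> u)) \<odot>\<^bsub>M\<^esub> w \<in> module_span R M Y"
      using ws'(1,2) ws(1) u(1) jc by (intro YE(5) YE(4)) auto
    ultimately show "\<exists>b\<in>B. \<exists>z\<in>module_span R M Y. y = b \<oplus>\<^bsub>M\<^esub> j \<odot>\<^bsub>M\<^esub> z" by blast
  qed
  moreover from this have "module_span R M Y \<subseteq> B" by (rule module_span_least[OF B])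
  then have "x \<in> B" using ws(1) u(1) jc bz(1) by (subst xeq) (intro BE(5) BE(4), auto)
  ultimately show ?case by simp
qed

section \<open>The local criterion\<close>

lemma (in module) vector_module_fg:
  fixes n :: nat
  assumes X: "finite X" "X \<subseteq> carrier M" "module_span R M X = carrier M"
  shows "\<exists>E. finite E \<and> E \<subseteq> carrier (function_module M) \<and>
    {f. (\<forall>i. f i \<in> carrier M) \<and> (\<forall>i\<ge>n. f i = \<zero>\<^bsub>M\<^esub>)} \<subseteq> module_span R (function_module M :: ('a, nat \<Rightarrow> 'c) module) E"
proof -
  define V where "V = (function_module M :: ('a, nat \<Rightarrow> 'c) module)"
  interpret V: module R V unfolding V_def by (rule function_module_is_module)
  define e where "e = (\<lambda>(i :: nat) u k. if k = i then u else \<zero>\<^bsub>M\<^esub>)"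
  define E where "E = (\<Union>i<n. e i ` X)"
  have V_simps: "carrier V = {f. \<forall>i. f i \<in> carrier M}" "f \<oplus>\<^bsub>V\<^esub> g = (\<lambda>i. f i \<oplus>\<^bsub>M\<^esub> g i)"
    "r \<odot>\<^bsub>V\<^esub> f = (\<lambda>i. r \<odot>\<^bsub>M\<^esub> f i)" "\<zero>\<^bsub>V\<^esub> = (\<lambda>i. \<zero>\<^bsub>M\<^esub>)" for f g r
    by (auto simp: V_def function_module_def)
  have E: "finite E" "E \<subseteq> carrier V" using X by (auto simp: E_def V_simps e_def)
  have ES: "submodule (module_span R V E) R V" by (rule V.module_span_submodule[OF E(2)])
  have e_span: "e i u \<in> module_span R V E" if "i < n" "u \<in> carrier M" for i u
  proof -
    have "submodule {u \<in> carrier M. e i u \<in> module_span R V E} R M"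
    proof (rule submoduleI')
      have "e i \<zero>\<^bsub>M\<^esub> = \<zero>\<^bsub>V\<^esub>" by (auto simp: e_def V_simps)
      then show "\<zero>\<^bsub>M\<^esub> \<in> {u \<in> carrier M. e i u \<in> module_span R V E}"
        using V.submodule_zero_mem[OF ES] by simp
      fix a b assume ab: "a \<in> {u \<in> carrier M. e i u \<in> module_span R V E}" "b \<in> {u \<in> carrier M. e i u \<in> module_span R V E}"
      have "e i (a \<oplus>\<^bsub>M\<^esub> b) = e i a \<oplus>\<^bsub>V\<^esub> e i b" using ab by (auto simp: e_def V_simps)
      then show "a \<oplus>\<^bsub>M\<^esub> b \<in> {u \<in> carrier M. e i u \<in> module_span R V E}"
        using ab V.submoduleE(5)[OF ES] by simp
    next
      fix r a assume ra: "r \<in> carrier R" "a \<in> {u \<in> carrier M. e i u \<in> module_span R V E}"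
      have "e i (r \<odot>\<^bsub>M\<^esub> a) = r \<odot>\<^bsub>V\<^esub> e i a" using ra by (auto simp: e_def V_simps)
      then show "r \<odot>\<^bsub>M\<^esub> a \<in> {u \<in> carrier M. e i u \<in> module_span R V E}"
        using ra V.submoduleE(4)[OF ES] by simp
    qed auto
    moreover have "X \<subseteq> {u \<in> carrier M. e i u \<in> module_span R V E}"
    proof
      fix y assume y: "y \<in> X"
      then have "e i y \<in> E" using that by (auto simp: E_def)
      then show "y \<in> {u \<in> carrier M. e i u \<in> module_span R V E}"
        using V.module_span_superset[of E] X(2) y by auto
    qed
    ultimately have "module_span R M X \<subseteq> {u \<in> carrier M. e i u \<in> module_span R V E}"
      by (rule module_span_least)
    then show ?thesis using X(3) that by blast
  qed
  have "f \<in> module_span R V E" if f: "\<forall>i. f i \<in> carrier M" "\<forall>i\<ge>n. f i = \<zero>\<^bsub>M\<^esub>" for f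
  proof -
    have "nsum V (\<lambda>i. e i (f i)) n k = f k" for k
    proof -
      have "nsum V (\<lambda>i. e i (f i)) n k = nsum M (\<lambda>i. e i (f i) k) n"
        unfolding V_def nsum_function_module ..
      also have "\<dots> = nsum M (\<lambda>i. if i = k then f k else \<zero>\<^bsub>M\<^esub>) n"
        by (rule nsum_cong) (auto simp: e_def)
      also have "\<dots> = f k"
      proof (cases "k < n")
        case True
        then show ?thesis using f(1) by (simp add: M.nsum_delta)
      next
        case False
        then show ?thesis using f(2) by (subst M.nsum_zero) auto
      qed
      finally show ?thesis .
    qed
    moreover have "nsum V (\<lambda>i. e i (f i)) n \<in> module_span R V E"
      using e_span f by (intro V.submodule_nsum[OF ES]) auto
    moreover have "nsum V (\<lambda>i. e i (f i)) n = f" using calculation(1) by (rule ext)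
    ultimately show ?thesis by simp
  qed
  then show ?thesis using E unfolding V_def by (intro exI[of _ E]) auto
qed

text \<open>
  Let \<open>P\<close> be a maximal violating ideal; it is prime and different from \<open>\<mm>\<close>, so there is \<open>a \<in> \<mm> - P\<close>.
  Let \<open>Z\<close> be the \<open>S\<close>-module of all vectors \<open>m\<close> with \<open>\<Sum> r\<^sub>i m\<^sub>i = 0\<close>, for generators \<open>r\<close> of \<open>P\<close>, and
  let \<open>B\<close> consist of the trivial ones. Passing to \<open>P + (a)\<close> leaves coefficients \<open>c\<^sub>j\<close> with
  \<open>c\<^sub>j a \<in> P\<close>, so \<open>c\<^sub>j \<in> P\<close>, and writing them in terms of \<open>r\<close> gives \<open>Z \<subseteq> B + a Z\<close>. Since \<open>Z\<close> is finitely
  generated over \<open>S\<close> and \<open>a\<close> acts through the Jacobson radical, \<open>Z = B\<close>.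
\<close>

theorem local_criterion:
  fixes R :: "('a, 'x) ring_scheme" and S :: "('s, 'y) ring_scheme" and N :: "('s, 'n, 'w) module_scheme"
  assumes R: "cring R" "noetherian_ring R" and S: "cring S" "noetherian_ring S"
    and \<phi>: "\<phi> \<in> ring_hom R S" and mm: "maximalideal \<mm> R"
    and jac: "Idl\<^bsub>S\<^esub> (\<phi> ` \<mm>) \<subseteq> jacobson_radical S"
    and fg: "fg_module S N" and M: "M = restrict_scalars \<phi> N" and flat: "ideal_flat R M \<mm>"
  shows "equationally_flat R M"
proof (rule ccontr)
  assume "\<not> equationally_flat R M"
  have N: "module S N" using fg by (simp add: fg_module_def)
  interpret S: cring S by fact
  interpret N: module S N by fact
  have modM: "module R M" unfolding M by (rule restrict_scalars_is_module[OF R(1) N \<phi>])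
  interpret M: module R M by fact
  obtain P where P: "primeideal P R" "\<not> ideal_flat R M P"
    "\<And>J. ideal J R \<Longrightarrow> P \<subset> J \<Longrightarrow> ideal_flat R M J"
    using M.exists_prime_non_flat[OF R(2) \<open>\<not> equationally_flat R M\<close>] by blast
  interpret P: primeideal P R by fact
  interpret mm: maximalideal \<mm> R by fact
  have Pid: "ideal P R" ..
  have "\<not> \<mm> \<subseteq> P"
  proof
    assume "\<mm> \<subseteq> P"
    then have "P = \<mm> \<or> P = carrier R" using mm.I_maximal[OF Pid] P.a_subset by blast
    then show False using P(2) flat P.I_notcarr by blast
  qed
  then obtain a where a: "a \<in> \<mm>" "a \<notin> P" by blast
  have ac: "a \<in> carrier R" using a(1) by (rule mm.a_Hcarr)
  note h = ring_hom_closed[OF \<phi>] ring_hom_add[OF \<phi>] ring_hom_mult[OF \<phi>]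
  have "\<phi> ` \<mm> \<subseteq> carrier S" using h(1) mm.a_Hcarr by blast
  then have jac_a: "\<phi> a \<in> jacobson_radical S" using jac S.genideal_self[of "\<phi> ` \<mm>"] a(1) by blast
  have "ideal_flat R M P"
    unfolding ideal_flat_def
  proof (intro allI impI, elim conjE)
    fix n r m assume gen: "generators R n r P" and m: "\<forall>i<n. m i \<in> carrier M"
      and rel: "nsum M (\<lambda>i. r i \<odot>\<^bsub>M\<^esub> m i) n = \<zero>\<^bsub>M\<^esub>"
    note r = M.R.generatorsD(1)[OF gen Pid] and comb = M.R.generatorsD(2)[OF gen Pid]
    have J: "ideal_flat R M (combinations R (Suc n) (r(n := a)))"
      using M.adjoining_larger[OF Pid gen ac a(2)] by (intro P(3)) auto
    let ?S = "syzygies R (ring_as_module R) n r"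
    have Ms: "carrier M = carrier N" "zero M = zero N" "add M = add N" "\<And>r x. r \<odot>\<^bsub>M\<^esub> x = \<phi> r \<odot>\<^bsub>N\<^esub> x"
      "\<And>f n. nsum M f n = nsum N f n"
    proof -
      show "nsum M f n = nsum N f n" for f n unfolding M by (induction n) auto
    qed (auto simp: M)
    define V where "V = (function_module N :: ('s, nat \<Rightarrow> 'n) module)"
    interpret V: module S V unfolding V_def by (rule N.function_module_is_module)
    have V_simps: "carrier V = {f. \<forall>i. f i \<in> carrier N}" "f \<oplus>\<^bsub>V\<^esub> g = (\<lambda>i. f i \<oplus>\<^bsub>N\<^esub> g i)"
      "s \<odot>\<^bsub>V\<^esub> f = (\<lambda>i. s \<odot>\<^bsub>N\<^esub> f i)" "\<zero>\<^bsub>V\<^esub> = (\<lambda>i. \<zero>\<^bsub>N\<^esub>)" for f g s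
      by (auto simp: V_def function_module_def)
    \<comment> \<open>Entries from \<open>n\<close> on are zero in \<open>Z\<close>, which makes it finitely generated; \<open>B\<close> ignores them.\<close>
    define Z where "Z = {f. (\<forall>i. f i \<in> carrier N) \<and> (\<forall>i\<ge>n. f i = \<zero>\<^bsub>N\<^esub>) \<and>
      nsum N (\<lambda>i. \<phi> (r i) \<odot>\<^bsub>N\<^esub> f i) n = \<zero>\<^bsub>N\<^esub>}"
    define B where "B = {f. (\<forall>i. f i \<in> carrier N) \<and> (\<exists>v\<in>coeff_span M ?S. \<forall>i<n. v i = f i)}"
    have \<phi>r: "\<phi> (r i) \<in> carrier S" if "i < n" for i using h(1) r that by blast
    have Z: "submodule Z S V"
    proof (rule V.submoduleI')
      show "Z \<subseteq> carrier V" by (auto simp: Z_def V_simps)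
      show "\<zero>\<^bsub>V\<^esub> \<in> Z" unfolding Z_def V_simps using \<phi>r by (auto intro!: N.nsum_zero)
      fix f g assume fg: "f \<in> Z" "g \<in> Z"
      have "nsum N (\<lambda>i. \<phi> (r i) \<odot>\<^bsub>N\<^esub> (f i \<oplus>\<^bsub>N\<^esub> g i)) n =
        nsum N (\<lambda>i. \<phi> (r i) \<odot>\<^bsub>N\<^esub> f i \<oplus>\<^bsub>N\<^esub> \<phi> (r i) \<odot>\<^bsub>N\<^esub> g i) n"
        using \<phi>r fg by (intro nsum_cong) (auto simp: Z_def N.smult_r_distr)
      also have "\<dots> = nsum N (\<lambda>i. \<phi> (r i) \<odot>\<^bsub>N\<^esub> f i) n \<oplus>\<^bsub>N\<^esub> nsum N (\<lambda>i. \<phi> (r i) \<odot>\<^bsub>N\<^esub> g i) n"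
        using \<phi>r fg by (intro N.nsum_add) (auto simp: Z_def)
      finally show "f \<oplus>\<^bsub>V\<^esub> g \<in> Z" using fg by (simp add: Z_def V_simps)
    next
      fix s f assume s: "s \<in> carrier S" and f: "f \<in> Z"
      have "nsum N (\<lambda>i. \<phi> (r i) \<odot>\<^bsub>N\<^esub> (s \<odot>\<^bsub>N\<^esub> f i)) n = nsum N (\<lambda>i. s \<odot>\<^bsub>N\<^esub> (\<phi> (r i) \<odot>\<^bsub>N\<^esub> f i)) n"
        using \<phi>r f s by (intro nsum_cong) (simp add: Z_def N.smult_assoc1[symmetric] S.m_comm)
      also have "\<dots> = s \<odot>\<^bsub>N\<^esub> nsum N (\<lambda>i. \<phi> (r i) \<odot>\<^bsub>N\<^esub> f i) n"
        using \<phi>r f s by (intro N.nsum_smult[symmetric]) (auto simp: Z_def)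
      finally show "s \<odot>\<^bsub>V\<^esub> f \<in> Z" using f s by (simp add: Z_def V_simps)
    qed
    have scale: "(\<lambda>i. s \<odot>\<^bsub>N\<^esub> v i) \<in> coeff_span M ?S" if s: "s \<in> carrier S" and v: "v \<in> coeff_span M ?S" for s v
      using v
    proof (induction rule: coeff_span.induct)
      case zero
      then show ?case using coeff_span.zero[of M ?S] s by (simp add: Ms)
    next
      case (add v k y)
      have kc: "\<phi> (k i) \<in> carrier S" for i using h(1) add(2) by (auto simp: syzygies_def)
      have vc: "v i \<in> carrier N" for i using M.coeff_span_closed[OF syzygies_coeffs add(1), of i] by (simp add: Ms)
      have "(\<lambda>i. s \<odot>\<^bsub>N\<^esub> v i \<oplus>\<^bsub>M\<^esub> k i \<odot>\<^bsub>M\<^esub> (s \<odot>\<^bsub>N\<^esub> y)) \<in> coeff_span M ?S"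
        using add s by (intro coeff_span.add) (auto simp: Ms)
      moreover have "s \<odot>\<^bsub>N\<^esub> (v i \<oplus>\<^bsub>M\<^esub> k i \<odot>\<^bsub>M\<^esub> y) = s \<odot>\<^bsub>N\<^esub> v i \<oplus>\<^bsub>M\<^esub> k i \<odot>\<^bsub>M\<^esub> (s \<odot>\<^bsub>N\<^esub> y)" for i
        using add(3) s kc vc by (simp add: Ms N.smult_r_distr N.smult_assoc1[symmetric] S.m_comm)
      ultimately show ?case by simp
    qed
    have BI: "f \<in> B" if "\<And>i. f i \<in> carrier N" "v \<in> coeff_span M ?S" "\<And>i. i < n \<Longrightarrow> v i = f i" for f v
      unfolding B_def using that by blast
    have B: "submodule B S V"
    proof (rule V.submoduleI')
      show "B \<subseteq> carrier V" by (auto simp: B_def V_simps)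
      show "\<zero>\<^bsub>V\<^esub> \<in> B" unfolding V_simps by (rule BI[OF _ coeff_span.zero]) (simp_all add: Ms)
      fix f g assume fg: "f \<in> B" "g \<in> B"
      then obtain v w where vw: "v \<in> coeff_span M ?S" "w \<in> coeff_span M ?S" "\<And>i. i < n \<Longrightarrow> v i = f i" "\<And>i. i < n \<Longrightarrow> w i = g i"
        unfolding B_def by blast
      have "(\<lambda>i. v i \<oplus>\<^bsub>M\<^esub> w i) \<in> coeff_span M ?S" by (rule M.coeff_span_plus[OF syzygies_coeffs vw(2,1)])
      then show "f \<oplus>\<^bsub>V\<^esub> g \<in> B" unfolding V_simps
        by (rule BI[rotated]) (use fg vw(3,4) in \<open>auto simp: Ms B_def\<close>)
    next
      fix s f assume s: "s \<in> carrier S" and f: "f \<in> B"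
      then obtain v where v: "v \<in> coeff_span M ?S" "\<And>i. i < n \<Longrightarrow> v i = f i" unfolding B_def by blast
      from scale[OF s v(1)] show "s \<odot>\<^bsub>V\<^esub> f \<in> B" unfolding V_simps
        by (rule BI[rotated]) (use f s v(2) in \<open>auto simp: B_def\<close>)
    qed
    obtain X where X: "X \<subseteq> carrier N" "finite X" "module_span S N X = carrier N"
      using fg unfolding fg_module_def by blast
    obtain E where E: "finite E" "E \<subseteq> carrier V"
      "{f. (\<forall>i. f i \<in> carrier N) \<and> (\<forall>i\<ge>n. f i = \<zero>\<^bsub>N\<^esub>)} \<subseteq> module_span S V E"
      using N.vector_module_fg[OF X(2,1,3), of n] unfolding V_def by blast
    have "Z \<subseteq> module_span S V E" using E(3) by (auto simp: Z_def)
    then obtain Y where Y: "finite Y" "Y \<subseteq> Z" "Z = module_span S V Y"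
      using V.noetherian_submodule_fg[OF S(2) E(1,2) Z] by blast
    \<comment> \<open>The inclusion \<open>Z \<subseteq> B + a Z\<close>, checked on generators of \<open>Z\<close>.\<close>
    have "Y \<subseteq> B"
    proof (rule V.nakayama[OF S(2) jac_a B Y(1)])
      show "Y \<subseteq> carrier V" using Y(2) by (auto simp: Z_def V_simps)
      fix z assume "z \<in> Y"
      then have z: "z \<in> Z" using Y by blast
      have zc: "z i \<in> carrier M" for i using z by (simp add: Z_def Ms)
      have zrel: "nsum M (\<lambda>i. r i \<odot>\<^bsub>M\<^esub> z i) n = \<zero>\<^bsub>M\<^esub>" using z by (simp add: Z_def Ms)
      obtain q k y where k: "\<And>j i. j < q \<Longrightarrow> k j i \<in> carrier R" and y: "\<And>j. j < q \<Longrightarrow> y j \<in> carrier M"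
        and ka: "\<And>j. j < q \<Longrightarrow> k j n \<otimes>\<^bsub>R\<^esub> a = \<ominus>\<^bsub>R\<^esub> nsum R (\<lambda>i. k j i \<otimes>\<^bsub>R\<^esub> r i) n"
        and zi: "\<And>i. i < n \<Longrightarrow> z i = nsum M (\<lambda>j. k j i \<odot>\<^bsub>M\<^esub> y j) q"
        and cy: "nsum M (\<lambda>j. k j n \<odot>\<^bsub>M\<^esub> y j) q = \<zero>\<^bsub>M\<^esub>"
        using M.relations_after_adjoining[OF r ac J zc zrel] by blast
      have "k j n \<in> P" if j: "j < q" for j
      proof -
        have "nsum R (\<lambda>i. k j i \<otimes>\<^bsub>R\<^esub> r i) n \<in> P" using k[OF j] comb unfolding combinations_def by blast
        then have "k j n \<otimes>\<^bsub>R\<^esub> a \<in> P" unfolding ka[OF j] by (rule P.a_inv_closed)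
        then show ?thesis using P.I_prime[OF k[OF j] ac] a(2) by blast
      qed
      then have "\<exists>e. (\<forall>i. e i \<in> carrier R) \<and> k j n = nsum R (\<lambda>i. e i \<otimes>\<^bsub>R\<^esub> r i) n" if "j < q" for j
        using gen that unfolding generators_def by blast
      then obtain e where e: "\<And>j i. j < q \<Longrightarrow> e j i \<in> carrier R"
        "\<And>j. j < q \<Longrightarrow> k j n = nsum R (\<lambda>i. e j i \<otimes>\<^bsub>R\<^esub> r i) n" by metis
      \<comment> \<open>With \<open>k\<^sub>j n = \<Sum> e\<^sub>j\<^sub>i r\<^sub>i\<close> the rows \<open>k\<^sub>j + a e\<^sub>j\<close> are syzygies, and \<open>z = b + a \<zeta>\<close> by regrouping.\<close>
      define \<zeta> where "\<zeta> = (\<lambda>i. if i < n then nsum M (\<lambda>j. (\<ominus>\<^bsub>R\<^esub> e j i) \<odot>\<^bsub>M\<^esub> y j) q else \<zero>\<^bsub>M\<^esub>)"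
      define d where "d = (\<lambda>j i. k j i \<oplus>\<^bsub>R\<^esub> a \<otimes>\<^bsub>R\<^esub> e j i)"
      define b where "b = (\<lambda>i. if i < n then nsum M (\<lambda>j. d j i \<odot>\<^bsub>M\<^esub> y j) q else \<zero>\<^bsub>M\<^esub>)"
      have dc: "d j i \<in> carrier R" if "j < q" for j i using that k e ac by (simp add: d_def)
      interpret RR: module R "ring_as_module R" by (rule M.R.ring_as_module_is_module)
      have ds: "d j \<in> ?S" if j: "j < q" for j
      proof -
        have "nsum R (\<lambda>i. d j i \<otimes>\<^bsub>R\<^esub> r i) n = nsum R (\<lambda>i. k j i \<otimes>\<^bsub>R\<^esub> r i) n \<oplus>\<^bsub>R\<^esub> nsum R (\<lambda>i. (a \<otimes>\<^bsub>R\<^esub> e j i) \<otimes>\<^bsub>R\<^esub> r i) n"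
          unfolding d_def using RR.combination_add[of n "k j" "\<lambda>i. a \<otimes>\<^bsub>R\<^esub> e j i" r] k e ac r j by simp
        also have "nsum R (\<lambda>i. (a \<otimes>\<^bsub>R\<^esub> e j i) \<otimes>\<^bsub>R\<^esub> r i) n = a \<otimes>\<^bsub>R\<^esub> k j n"
          unfolding e(2)[OF j] using RR.combination_smult[of a n "e j" r] e ac r j by simp
        also have "a \<otimes>\<^bsub>R\<^esub> k j n = \<ominus>\<^bsub>R\<^esub> nsum R (\<lambda>i. k j i \<otimes>\<^bsub>R\<^esub> r i) n"
          using ka[OF j] k[OF j] ac by (simp add: M.R.m_comm)
        finally have "nsum R (\<lambda>i. d j i \<otimes>\<^bsub>R\<^esub> r i) n = \<zero>\<^bsub>R\<^esub>"
          using k[OF j] r by (simp add: M.R.r_neg)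
        then show ?thesis using dc[OF j] by (simp add: syzygies_def)
      qed
      have \<zeta>c: "\<zeta> i \<in> carrier M" for i using e y by (auto simp: \<zeta>_def)
      have bc: "b i \<in> carrier M" for i using dc y by (auto simp: b_def)
      have "nsum M (\<lambda>i. r i \<odot>\<^bsub>M\<^esub> \<zeta> i) n = nsum M (\<lambda>i. r i \<odot>\<^bsub>M\<^esub> nsum M (\<lambda>j. (\<ominus>\<^bsub>R\<^esub> e j i) \<odot>\<^bsub>M\<^esub> y j) q) n"
        by (rule nsum_cong) (simp add: \<zeta>_def)
      also have "\<dots> = nsum M (\<lambda>j. nsum R (\<lambda>i. r i \<otimes>\<^bsub>R\<^esub> (\<ominus>\<^bsub>R\<^esub> e j i)) n \<odot>\<^bsub>M\<^esub> y j) q"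
        using r e y by (intro M.combination_assoc[symmetric]) auto
      also have "\<dots> = nsum M (\<lambda>j. (\<ominus>\<^bsub>R\<^esub> k j n) \<odot>\<^bsub>M\<^esub> y j) q"
      proof (rule nsum_cong)
        fix j assume j: "j < q"
        have neg: "\<ominus>\<^bsub>ring_as_module R\<^esub> x = \<ominus>\<^bsub>R\<^esub> x" for x by (simp add: a_inv_def m_inv_def)
        have "nsum R (\<lambda>i. r i \<otimes>\<^bsub>R\<^esub> (\<ominus>\<^bsub>R\<^esub> e j i)) n = nsum R (\<lambda>i. (\<ominus>\<^bsub>R\<^esub> e j i) \<otimes>\<^bsub>R\<^esub> r i) n"
          using r e(1)[OF j] by (intro nsum_cong) (simp add: M.R.m_comm)
        also have "\<dots> = \<ominus>\<^bsub>R\<^esub> k j n"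
          unfolding e(2)[OF j] using RR.combination_minus[of n "e j" r] e(1)[OF j] r by (simp add: neg)
        finally show "nsum R (\<lambda>i. r i \<otimes>\<^bsub>R\<^esub> (\<ominus>\<^bsub>R\<^esub> e j i)) n \<odot>\<^bsub>M\<^esub> y j = (\<ominus>\<^bsub>R\<^esub> k j n) \<odot>\<^bsub>M\<^esub> y j" by simp
      qed
      also have "\<dots> = \<ominus>\<^bsub>M\<^esub> nsum M (\<lambda>j. k j n \<odot>\<^bsub>M\<^esub> y j) q" using k y by (intro M.combination_minus) auto
      finally have "nsum M (\<lambda>i. r i \<odot>\<^bsub>M\<^esub> \<zeta> i) n = \<zero>\<^bsub>M\<^esub>" using cy by simp
      then have \<zeta>Z: "\<zeta> \<in> Z" using \<zeta>c by (auto simp: Z_def Ms \<zeta>_def)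
      have "(\<lambda>i. nsum M (\<lambda>j. d j i \<odot>\<^bsub>M\<^esub> y j) q) \<in> coeff_span M ?S"
        using ds y by (intro M.coeff_span_sum[OF syzygies_coeffs]) auto
      then have bB: "b \<in> B" by (rule BI[rotated]) (use bc in \<open>simp_all add: Ms b_def\<close>)
      have "z i = b i \<oplus>\<^bsub>M\<^esub> a \<odot>\<^bsub>M\<^esub> \<zeta> i" for i
      proof (cases "i < n")
        case True
        have "a \<odot>\<^bsub>M\<^esub> \<zeta> i = nsum M (\<lambda>j. (a \<otimes>\<^bsub>R\<^esub> (\<ominus>\<^bsub>R\<^esub> e j i)) \<odot>\<^bsub>M\<^esub> y j) q"
          using True M.combination_smult[of a q "\<lambda>j. \<ominus>\<^bsub>R\<^esub> e j i" y] ac e y by (simp add: \<zeta>_def)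
        then have "b i \<oplus>\<^bsub>M\<^esub> a \<odot>\<^bsub>M\<^esub> \<zeta> i = nsum M (\<lambda>j. (d j i \<oplus>\<^bsub>R\<^esub> a \<otimes>\<^bsub>R\<^esub> (\<ominus>\<^bsub>R\<^esub> e j i)) \<odot>\<^bsub>M\<^esub> y j) q"
          using True dc ac e y by (simp add: b_def M.combination_add)
        also have "\<dots> = nsum M (\<lambda>j. k j i \<odot>\<^bsub>M\<^esub> y j) q"
          using k e ac by (intro nsum_cong) (simp add: d_def M.R.a_assoc M.R.r_minus M.R.r_neg)
        finally show ?thesis using zi[OF True] by simp
      next
        case False
        then show ?thesis using z ac h(1)[OF ac] by (simp add: Z_def b_def \<zeta>_def Ms)
      qed
      then have "z = b \<oplus>\<^bsub>V\<^esub> \<phi> a \<odot>\<^bsub>V\<^esub> \<zeta>" by (auto simp: V_simps Ms)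
      then show "\<exists>b\<in>B. \<exists>z'\<in>module_span S V Y. z = b \<oplus>\<^bsub>V\<^esub> \<phi> a \<odot>\<^bsub>V\<^esub> z'"
        using bB \<zeta>Z Y(3) by blast
    qed
    then have ZB: "Z \<subseteq> B" using V.module_span_least[OF B] Y(3) by blast
    define m' where "m' = (\<lambda>i. if i < n then m i else \<zero>\<^bsub>N\<^esub>)"
    have "nsum N (\<lambda>i. \<phi> (r i) \<odot>\<^bsub>N\<^esub> m' i) n = nsum M (\<lambda>i. r i \<odot>\<^bsub>M\<^esub> m i) n"
      unfolding Ms by (rule nsum_cong) (simp add: m'_def)
    then have "m' \<in> Z" using m rel by (auto simp: Z_def m'_def Ms)
    then have "m' \<in> B" using ZB by blast
    then obtain v where "v \<in> coeff_span M ?S" "\<And>i. i < n \<Longrightarrow> v i = m' i" unfolding B_def by blast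
    then show "trivial_relation R (ring_as_module R) M n r m"
      unfolding trivial_relation_def m'_def by (intro bexI) auto
  qed
  then show False using P(2) by blast
qed

section \<open>Associated primes\<close>

lemma (in module) smult_commute:
  assumes "a \<in> carrier R" "b \<in> carrier R" "x \<in> carrier M"
  shows "a \<odot>\<^bsub>M\<^esub> (b \<odot>\<^bsub>M\<^esub> x) = b \<odot>\<^bsub>M\<^esub> (a \<odot>\<^bsub>M\<^esub> x)"
  using assms by (metis R.m_comm smult_assoc1)

lemma (in module) annihilator_ideal:
  assumes "x \<in> carrier M"
  shows "ideal {r \<in> carrier R. r \<odot>\<^bsub>M\<^esub> x = \<zero>\<^bsub>M\<^esub>} R"
proof -
  interpret RR: module R "ring_as_module R" by (rule R.ring_as_module_is_module)
  have "submodule {r \<in> carrier R. r \<odot>\<^bsub>M\<^esub> x = \<zero>\<^bsub>M\<^esub>} R (ring_as_module R)"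
    by (rule RR.submoduleI') (use assms in \<open>auto simp: smult_l_distr smult_assoc1\<close>)
  then show ?thesis using R.submodule_ring_iff_ideal by blast
qed

text \<open>
  Among the annihilators of nonzero multiples of \<open>x\<close> there is a maximal one, say that of \<open>y\<close>. If
  \<open>a b y = 0\<close> and \<open>b y \<noteq> 0\<close>, then \<open>b y\<close> has no larger annihilator than \<open>y\<close>, so \<open>a y = 0\<close>.
\<close>

lemma (in module) exists_prime_annihilator:
  assumes noeth: "noetherian_ring R" and x: "x \<in> carrier M" "x \<noteq> \<zero>\<^bsub>M\<^esub>"
  obtains r where "r \<in> carrier R" "r \<odot>\<^bsub>M\<^esub> x \<noteq> \<zero>\<^bsub>M\<^esub>"
    "primeideal {a \<in> carrier R. a \<odot>\<^bsub>M\<^esub> (r \<odot>\<^bsub>M\<^esub> x) = \<zero>\<^bsub>M\<^esub>} R"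
proof -
  interpret noetherian_ring R by (rule noeth)
  define ann where "ann = (\<lambda>y. {a \<in> carrier R. a \<odot>\<^bsub>M\<^esub> y = \<zero>\<^bsub>M\<^esub>})"
  define A where "A = {ann (r \<odot>\<^bsub>M\<^esub> x) | r. r \<in> carrier R \<and> r \<odot>\<^bsub>M\<^esub> x \<noteq> \<zero>\<^bsub>M\<^esub>}"
  have "ann (\<one> \<odot>\<^bsub>M\<^esub> x) \<in> A" using x unfolding A_def by (intro CollectI exI[of _ \<one>]) simp
  then have "A \<noteq> {}" by blast
  moreover have "ideal I R" if "I \<in> A" for I
    using that annihilator_ideal x(1) unfolding A_def ann_def by auto
  ultimately have "\<exists>I\<in>A. \<forall>J\<in>A. I \<subseteq> J \<longrightarrow> J = I" by (rule exists_maximal_member)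
  then obtain r where r: "r \<in> carrier R" "r \<odot>\<^bsub>M\<^esub> x \<noteq> \<zero>\<^bsub>M\<^esub>"
    and max: "\<And>J. J \<in> A \<Longrightarrow> ann (r \<odot>\<^bsub>M\<^esub> x) \<subseteq> J \<Longrightarrow> J = ann (r \<odot>\<^bsub>M\<^esub> x)"
    unfolding A_def by blast
  let ?y = "r \<odot>\<^bsub>M\<^esub> x"
  have y: "?y \<in> carrier M" using r x by simp
  have "primeideal (ann ?y) R"
  proof (rule primeidealI)
    show "ideal (ann ?y) R" unfolding ann_def by (rule annihilator_ideal[OF y])
    show "cring R" by (rule R.is_cring)
    have "\<one> \<notin> ann ?y" using r y by (simp add: ann_def)
    then show "carrier R \<noteq> ann ?y" using R.one_closed by metis
    fix a b assume ab: "a \<in> carrier R" "b \<in> carrier R" "a \<otimes> b \<in> ann ?y"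
    show "a \<in> ann ?y \<or> b \<in> ann ?y"
    proof (cases "b \<odot>\<^bsub>M\<^esub> ?y = \<zero>\<^bsub>M\<^esub>")
      case True
      then show ?thesis using ab by (simp add: ann_def)
    next
      case False
      have by_eq: "b \<odot>\<^bsub>M\<^esub> ?y = (b \<otimes> r) \<odot>\<^bsub>M\<^esub> x" using ab r x by (simp add: smult_assoc1)
      have "ann (b \<odot>\<^bsub>M\<^esub> ?y) \<in> A"
        unfolding A_def by_eq using False ab r unfolding by_eq by blast
      moreover have "ann ?y \<subseteq> ann (b \<odot>\<^bsub>M\<^esub> ?y)"
      proof
        fix c assume c: "c \<in> ann ?y"
        have "c \<odot>\<^bsub>M\<^esub> (b \<odot>\<^bsub>M\<^esub> ?y) = b \<odot>\<^bsub>M\<^esub> (c \<odot>\<^bsub>M\<^esub> ?y)"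
          using c ab y by (intro smult_commute) (auto simp: ann_def)
        then show "c \<in> ann (b \<odot>\<^bsub>M\<^esub> ?y)" using c ab by (simp add: ann_def)
      qed
      ultimately have "ann (b \<odot>\<^bsub>M\<^esub> ?y) = ann ?y" by (rule max)
      moreover have "a \<in> ann (b \<odot>\<^bsub>M\<^esub> ?y)" using ab y by (simp add: ann_def smult_assoc1)
      ultimately show ?thesis by blast
    qed
  qed
  then show ?thesis using that r unfolding ann_def by blast
qed

context tensor_pair
begin

text \<open>
  One annihilating element \<open>p\<close> at a time: \<open>\<Sum> p l\<^sub>i \<otimes> m\<^sub>i = 0\<close> is trivial, and the syzygies \<open>k\<close> of the
  \<open>p l\<^sub>i\<close> produce the new elements \<open>\<Sum> k\<^sub>i l\<^sub>i\<close>, which \<open>p\<close> kills.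
\<close>

lemma flat_annihilated_tensor:
  assumes flat: "equationally_flat R M" and z: "z \<in> carrier TT"
    and p: "\<And>t. t < q \<Longrightarrow> p t \<in> carrier R" "\<And>t. t < (q :: nat) \<Longrightarrow> p t \<odot>\<^bsub>TT\<^esub> z = \<zero>\<^bsub>TT\<^esub>"
  shows "\<exists>n l m. (\<forall>i<n. l i \<in> carrier L \<and> m i \<in> carrier M \<and> (\<forall>t<q. p t \<odot>\<^bsub>L\<^esub> l i = \<zero>\<^bsub>L\<^esub>)) \<and>
    z = nsum TT (\<lambda>i. l i \<otimes>\<^sub>t m i) n"
  using p
proof (induction q)
  case 0
  obtain n l m where "\<forall>i. l i \<in> carrier L" "\<forall>i. m i \<in> carrier M" "z = nsum TT (\<lambda>i. l i \<otimes>\<^sub>t m i) n"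
    using tensor_representation[OF z] by blast
  then show ?case by (intro exI[of _ n] exI[of _ l] exI[of _ m]) simp
next
  case (Suc q)
  obtain n l m where h: "\<forall>i<n. l i \<in> carrier L \<and> m i \<in> carrier M \<and> (\<forall>t<q. p t \<odot>\<^bsub>L\<^esub> l i = \<zero>\<^bsub>L\<^esub>)"
    and zz: "z = nsum TT (\<lambda>i. l i \<otimes>\<^sub>t m i) n"
    using Suc.IH[OF Suc.prems(1)[OF less_SucI] Suc.prems(2)[OF less_SucI]] by blast
  have l: "l i \<in> carrier L" and m: "m i \<in> carrier M" and pl: "t < q \<Longrightarrow> p t \<odot>\<^bsub>L\<^esub> l i = \<zero>\<^bsub>L\<^esub>" if "i < n" for i t
    using h that by auto
  have pq: "p q \<in> carrier R" using Suc.prems by simp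
  have "nsum TT (\<lambda>i. (p q \<odot>\<^bsub>L\<^esub> l i) \<otimes>\<^sub>t m i) n = p q \<odot>\<^bsub>TT\<^esub> z"
    unfolding zz using pq l m by (simp add: TT.nsum_smult pure_smult_left cong: nsum_cong)
  then have "nsum TT (\<lambda>i. (p q \<odot>\<^bsub>L\<^esub> l i) \<otimes>\<^sub>t m i) n = \<zero>\<^bsub>TT\<^esub>" using Suc.prems by simp
  then have "trivial_relation R L M n (\<lambda>i. p q \<odot>\<^bsub>L\<^esub> l i) m"
    using pq l m by (intro flat_tensor_zeroD[OF flat]) auto
  then obtain v where v: "v \<in> coeff_span M (syzygies R L n (\<lambda>i. p q \<odot>\<^bsub>L\<^esub> l i))" "\<forall>i<n. v i = m i"
    unfolding trivial_relation_def by blast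
  obtain N k y where k: "\<forall>j<N. k j \<in> syzygies R L n (\<lambda>i. p q \<odot>\<^bsub>L\<^esub> l i)" and y: "\<forall>j<N. y j \<in> carrier M"
    and vi: "\<forall>i. v i = nsum M (\<lambda>j. k j i \<odot>\<^bsub>M\<^esub> y j) N"
    using M.coeff_span_representation[OF syzygies_coeffs v(1)] by blast
  have kc: "k j i \<in> carrier R" if "j < N" for i j using k that by (auto simp: syzygies_def)
  define l' where "l' = (\<lambda>j. nsum L (\<lambda>i. k j i \<odot>\<^bsub>L\<^esub> l i) n)"
  have l': "l' j \<in> carrier L" if "j < N" for j unfolding l'_def using kc[OF that] l by auto
  have scale: "r \<odot>\<^bsub>L\<^esub> l' j = nsum L (\<lambda>i. k j i \<odot>\<^bsub>L\<^esub> (r \<odot>\<^bsub>L\<^esub> l i)) n" if "j < N" "r \<in> carrier R" for r j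
  proof -
    have "r \<odot>\<^bsub>L\<^esub> l' j = nsum L (\<lambda>i. r \<odot>\<^bsub>L\<^esub> (k j i \<odot>\<^bsub>L\<^esub> l i)) n"
      unfolding l'_def using kc[OF that(1)] l that(2) by (intro L.nsum_smult) auto
    also have "\<dots> = nsum L (\<lambda>i. k j i \<odot>\<^bsub>L\<^esub> (r \<odot>\<^bsub>L\<^esub> l i)) n"
      using kc[OF that(1)] l that(2) by (intro nsum_cong L.smult_commute) auto
    finally show ?thesis .
  qed
  have kill: "p t \<odot>\<^bsub>L\<^esub> l' j = \<zero>\<^bsub>L\<^esub>" if "j < N" "t < Suc q" for j t
  proof (cases "t = q")
    case True
    then show ?thesis using scale[OF that(1) pq] k that by (simp add: syzygies_def)
  next
    case False
    then have t: "t < q" using that by simp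
    have "nsum L (\<lambda>i. k j i \<odot>\<^bsub>L\<^esub> (p t \<odot>\<^bsub>L\<^esub> l i)) n = \<zero>\<^bsub>L\<^esub>"
      using kc[OF that(1)] pl t by (intro L.nsum_zero) auto
    then show ?thesis using scale[OF that(1), of "p t"] Suc.prems(1)[OF that(2)] by simp
  qed
  have "z = nsum TT (\<lambda>i. nsum TT (\<lambda>j. (k j i \<odot>\<^bsub>L\<^esub> l i) \<otimes>\<^sub>t y j) N) n"
    unfolding zz
  proof (rule nsum_cong)
    fix i assume i: "i < n"
    have lin: "pure_tensor R L M (l i) \<in> linear_maps R M TT"
      using l[OF i] by (intro linear_mapsI) (auto simp: pure_add_right pure_smult_right)
    have "l i \<otimes>\<^sub>t m i = l i \<otimes>\<^sub>t nsum M (\<lambda>j. k j i \<odot>\<^bsub>M\<^esub> y j) N" using v(2) vi i by metis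
    also have "\<dots> = nsum TT (\<lambda>j. l i \<otimes>\<^sub>t (k j i \<odot>\<^bsub>M\<^esub> y j)) N"
      using kc y by (intro linear_maps_nsum[OF M.module_axioms TT.module_axioms lin]) auto
    also have "\<dots> = nsum TT (\<lambda>j. (k j i \<odot>\<^bsub>L\<^esub> l i) \<otimes>\<^sub>t y j) N"
      using kc y l[OF i] by (intro nsum_cong) (simp add: pure_smult_left pure_smult_right)
    finally show "l i \<otimes>\<^sub>t m i = nsum TT (\<lambda>j. (k j i \<odot>\<^bsub>L\<^esub> l i) \<otimes>\<^sub>t y j) N" .
  qed
  also have "\<dots> = nsum TT (\<lambda>j. nsum TT (\<lambda>i. (k j i \<odot>\<^bsub>L\<^esub> l i) \<otimes>\<^sub>t y j) n) N"
    using kc l y by (intro TT.nsum_swap) auto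
  also have "\<dots> = nsum TT (\<lambda>j. l' j \<otimes>\<^sub>t y j) N"
  proof (rule nsum_cong)
    fix j assume j: "j < N"
    have lin: "(\<lambda>x. x \<otimes>\<^sub>t y j) \<in> linear_maps R L TT"
      using y j by (intro linear_mapsI) (auto simp: pure_add_left pure_smult_left)
    show "nsum TT (\<lambda>i. (k j i \<odot>\<^bsub>L\<^esub> l i) \<otimes>\<^sub>t y j) n = l' j \<otimes>\<^sub>t y j"
      unfolding l'_def using kc[OF j] l
        linear_maps_nsum[OF L.module_axioms TT.module_axioms lin, of n "\<lambda>i. k j i \<odot>\<^bsub>L\<^esub> l i"] by simp
  qed
  finally have "z = nsum TT (\<lambda>j. l' j \<otimes>\<^sub>t y j) N" .
  then show ?case using l' y kill by blast
qed

text \<open>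
  If \<open>P\<close> is the annihilator of \<open>z\<close>, then \<open>z = \<Sum> l\<^sub>i \<otimes> m\<^sub>i\<close> with \<open>P l\<^sub>i = 0\<close>. Were \<open>P\<close> not associated to
  \<open>L\<close>, each \<open>l\<^sub>i\<close> would be killed by some element outside \<open>P\<close>, and the product of these elements, which
  is outside \<open>P\<close> too, would kill \<open>z\<close>.
\<close>

theorem flat_Ass_subset:
  assumes noeth: "noetherian_ring R" and flat: "equationally_flat R M"
  shows "Ass R TT \<subseteq> Ass R L"
proof
  fix P assume "P \<in> Ass R TT"
  then obtain z where P: "primeideal P R" and z: "z \<in> carrier TT"
    and Pz: "P = {r \<in> carrier R. r \<odot>\<^bsub>TT\<^esub> z = \<zero>\<^bsub>TT\<^esub>}" unfolding Ass_def by blast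
  interpret P: primeideal P R by (rule P)
  have Pid: "ideal P R" ..
  obtain q p where p: "generators R q p P"
    using noetherian_ring.exists_generators[OF noeth L.R.is_cring Pid] by blast
  have pP: "p t \<in> P" if "t < q" for t using p that by (simp add: generators_def)
  have pR: "p t \<in> carrier R" "p t \<odot>\<^bsub>TT\<^esub> z = \<zero>\<^bsub>TT\<^esub>" if "t < q" for t using pP[OF that] Pz by blast+
  have "\<exists>n l m. (\<forall>i<n. l i \<in> carrier L \<and> m i \<in> carrier M \<and> (\<forall>t<q. p t \<odot>\<^bsub>L\<^esub> l i = \<zero>\<^bsub>L\<^esub>)) \<and>
    z = nsum TT (\<lambda>i. l i \<otimes>\<^sub>t m i) n"
    by (rule flat_annihilated_tensor[OF flat z]) (rule pR, assumption)+
  then obtain n l m where h: "\<forall>i<n. l i \<in> carrier L \<and> m i \<in> carrier M \<and> (\<forall>t<q. p t \<odot>\<^bsub>L\<^esub> l i = \<zero>\<^bsub>L\<^esub>)"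
    and zz: "z = nsum TT (\<lambda>i. l i \<otimes>\<^sub>t m i) n" by blast
  have l: "l i \<in> carrier L" and m: "m i \<in> carrier M" and pl: "t < q \<Longrightarrow> p t \<odot>\<^bsub>L\<^esub> l i = \<zero>\<^bsub>L\<^esub>" if "i < n" for i t
    using h that by auto
  have Pl: "r \<odot>\<^bsub>L\<^esub> l i = \<zero>\<^bsub>L\<^esub>" if i: "i < n" and r: "r \<in> P" for r i
  proof -
    obtain k where k: "\<And>t. k t \<in> carrier R" "r = nsum R (\<lambda>t. k t \<otimes> p t) q"
      using p r unfolding generators_def by blast
    have "r \<odot>\<^bsub>L\<^esub> l i = nsum L (\<lambda>t. (k t \<otimes> p t) \<odot>\<^bsub>L\<^esub> l i) q"
      unfolding k(2) by (rule L.nsum_smult_left[OF l[OF i]]) (simp add: k(1) pR(1))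
    also have "\<dots> = \<zero>\<^bsub>L\<^esub>"
      by (rule L.nsum_zero) (simp add: k(1) pR(1) l[OF i] pl[OF i] L.smult_assoc1)
    finally show ?thesis .
  qed
  show "P \<in> Ass R L"
  proof (rule ccontr)
    assume nP: "P \<notin> Ass R L"
    have killed: "\<exists>s\<in>carrier R. s \<notin> P \<and> s \<odot>\<^bsub>L\<^esub> l i = \<zero>\<^bsub>L\<^esub>" if i: "i < n" for i
    proof (rule ccontr)
      assume "\<not> ?thesis"
      then have "P = {r \<in> carrier R. r \<odot>\<^bsub>L\<^esub> l i = \<zero>\<^bsub>L\<^esub>}" using Pl[OF i] P.a_Hcarr by blast
      then show False using nP P l[OF i] unfolding Ass_def by blast
    qed
    have "\<exists>s\<in>carrier R. s \<notin> P \<and> (\<forall>i<k. s \<odot>\<^bsub>L\<^esub> l i = \<zero>\<^bsub>L\<^esub>)" if "k \<le> n" for k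
      using that
    proof (induction k)
      case 0
      have "\<one> \<notin> P" using P.one_imp_carrier P.I_notcarr by blast
      then show ?case using L.R.one_closed by blast
    next
      case (Suc k)
      then obtain s where s: "s \<in> carrier R" "s \<notin> P" "\<forall>i<k. s \<odot>\<^bsub>L\<^esub> l i = \<zero>\<^bsub>L\<^esub>" by auto
      obtain s' where s': "s' \<in> carrier R" "s' \<notin> P" "s' \<odot>\<^bsub>L\<^esub> l k = \<zero>\<^bsub>L\<^esub>" using killed[of k] Suc.prems by auto
      have "s \<otimes> s' \<notin> P" using P.I_prime[OF s(1) s'(1)] s(2) s'(2) by blast
      moreover have "(s \<otimes> s') \<odot>\<^bsub>L\<^esub> l i = \<zero>\<^bsub>L\<^esub>" if i: "i < Suc k" for i
      proof (cases "i = k")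
        case True
        then show ?thesis using s s' l[of k] Suc.prems by (simp add: L.smult_assoc1)
      next
        case False
        then have "s \<odot>\<^bsub>L\<^esub> l i = \<zero>\<^bsub>L\<^esub>" using s(3) i by simp
        moreover have "(s \<otimes> s') \<odot>\<^bsub>L\<^esub> l i = s' \<odot>\<^bsub>L\<^esub> (s \<odot>\<^bsub>L\<^esub> l i)"
          using s(1) s'(1) l[of i] i Suc.prems by (simp add: L.smult_assoc1 L.smult_commute[of s s'])
        ultimately show ?thesis using s'(1) by simp
      qed
      ultimately show ?case using s(1) s'(1) by blast
    qed
    then obtain s where s: "s \<in> carrier R" "s \<notin> P" "\<And>i. i < n \<Longrightarrow> s \<odot>\<^bsub>L\<^esub> l i = \<zero>\<^bsub>L\<^esub>" by blast
    have "s \<odot>\<^bsub>TT\<^esub> z = nsum TT (\<lambda>i. (s \<odot>\<^bsub>L\<^esub> l i) \<otimes>\<^sub>t m i) n"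
      unfolding zz using s(1) l m by (simp add: TT.nsum_smult pure_smult_left cong: nsum_cong)
    also have "\<dots> = \<zero>\<^bsub>TT\<^esub>" using s(3) m by (intro TT.nsum_zero) simp
    finally show False using s(1,2) Pz by blast
  qed
qed

text \<open>
  A non-zero-divisor that kills a nonzero tensor lies in an associated prime of \<open>L \<otimes> M\<close>, hence of \<open>L\<close>.
\<close>

lemma Ass_subset_torsion_free:
  assumes noeth: "noetherian_ring R" and sub: "Ass R TT \<subseteq> Ass R L" and tf: "torsion_free R L"
  shows "torsion_free R TT"
  unfolding torsion_free_def
proof (intro ballI impI, rule ccontr)
  fix s z assume s: "s \<in> nonzerodivisors R" and z: "z \<in> carrier TT" "s \<odot>\<^bsub>TT\<^esub> z = \<zero>\<^bsub>TT\<^esub>" "z \<noteq> \<zero>\<^bsub>TT\<^esub>"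
  have sc: "s \<in> carrier R" using s L.R.nzd_closed by blast
  obtain r where r: "r \<in> carrier R" "r \<odot>\<^bsub>TT\<^esub> z \<noteq> \<zero>\<^bsub>TT\<^esub>"
    and P: "primeideal {a \<in> carrier R. a \<odot>\<^bsub>TT\<^esub> (r \<odot>\<^bsub>TT\<^esub> z) = \<zero>\<^bsub>TT\<^esub>} R" (is "primeideal ?P R")
    using TT.exists_prime_annihilator[OF noeth z(1,3)] by blast
  have "?P \<in> Ass R TT" unfolding Ass_def using P r(1) z(1) by blast
  then obtain w where w: "w \<in> carrier L" "?P = {a \<in> carrier R. a \<odot>\<^bsub>L\<^esub> w = \<zero>\<^bsub>L\<^esub>}"
    using sub unfolding Ass_def by blast
  have "s \<odot>\<^bsub>TT\<^esub> (r \<odot>\<^bsub>TT\<^esub> z) = r \<odot>\<^bsub>TT\<^esub> (s \<odot>\<^bsub>TT\<^esub> z)"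
    using sc r(1) z(1) by (rule TT.smult_commute)
  then have "s \<in> ?P" using sc z(2) r(1) by simp
  then have "s \<odot>\<^bsub>L\<^esub> w = \<zero>\<^bsub>L\<^esub>" using w(2) by blast
  then have "w = \<zero>\<^bsub>L\<^esub>" using tf s w(1) unfolding torsion_free_def by blast
  then have "\<one> \<in> ?P" using w by simp
  then show False using r z(1) by simp
qed

section \<open>Faithful flatness\<close>

lemma flat_pure_tensor_zeroD:
  assumes flat: "equationally_flat R M" and l: "l \<in> carrier L" and m: "m \<in> carrier M"
    and zero: "l \<otimes>\<^sub>t m = \<zero>\<^bsub>TT\<^esub>"
  shows "trivial_relation R L M 1 (\<lambda>_. l) (\<lambda>_. m)"
  using l m zero by (intro flat_tensor_zeroD[OF flat]) auto

end

text \<open>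
  The submodule \<open>I M\<close>.
\<close>

definition ideal_multiples :: "('a, 'm, 'z) module_scheme \<Rightarrow> 'a set \<Rightarrow> 'm set"
  where "ideal_multiples M I = {nsum M (\<lambda>j. c j \<odot>\<^bsub>M\<^esub> y j) N | N c y. \<forall>j<(N::nat). c j \<in> I \<and> y j \<in> carrier M}"

lemma ideal_multiples_mono: "I \<subseteq> J \<Longrightarrow> ideal_multiples M I \<subseteq> ideal_multiples M J"
  unfolding ideal_multiples_def by blast

lemma (in module) trivial_relation_ideal_multiples:
  assumes "trivial_relation R L M n l m" "i < n"
    and "\<And>k. k \<in> syzygies R L n l \<Longrightarrow> k i \<in> I"
  shows "m i \<in> ideal_multiples M I"
proof -
  obtain v where v: "v \<in> coeff_span M (syzygies R L n l)" "\<forall>i<n. v i = m i"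
    using assms(1) unfolding trivial_relation_def by blast
  obtain N k y where k: "\<forall>j<N. k j \<in> syzygies R L n l" and y: "\<forall>j<N. y j \<in> carrier M"
    and vi: "\<forall>i. v i = nsum M (\<lambda>j. k j i \<odot>\<^bsub>M\<^esub> y j) N"
    using coeff_span_representation[OF syzygies_coeffs v(1)] by blast
  have "m i = nsum M (\<lambda>j. k j i \<odot>\<^bsub>M\<^esub> y j) N" using v(2) vi assms(2) by metis
  moreover have "\<forall>j<N. k j i \<in> I \<and> y j \<in> carrier M" using k y assms(3) by blast
  ultimately show ?thesis unfolding ideal_multiples_def
    by (intro CollectI exI[of _ N] exI[of _ "\<lambda>j. k j i"] exI[of _ y] conjI)
qed

text \<open>
  Otherwise \<open>R l \<otimes> M\<close>, which embeds into \<open>L \<otimes> M\<close> by flatness, would vanish.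
\<close>

lemma (in tensor_pair) faithfully_flat_nonzero:
  assumes ff: "\<And>A :: ('a, 'l) module. module R A \<Longrightarrow>
      (\<And>z. z \<in> carrier (tensor_product R A M) \<Longrightarrow> z = \<zero>\<^bsub>tensor_product R A M\<^esub>) \<Longrightarrow> carrier A = {\<zero>\<^bsub>A\<^esub>}"
    and flat: "equationally_flat R M" and l: "l \<in> carrier L" "l \<noteq> \<zero>\<^bsub>L\<^esub>"
  shows "\<exists>m\<in>carrier M. l \<otimes>\<^sub>t m \<noteq> \<zero>\<^bsub>TT\<^esub>"
proof (rule ccontr)
  assume "\<not> ?thesis"
  then have all: "l \<otimes>\<^sub>t m = \<zero>\<^bsub>TT\<^esub>" if "m \<in> carrier M" for m using that by blast
  define H where "H = (\<lambda>r. r \<odot>\<^bsub>L\<^esub> l) ` carrier R"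
  define A :: "('a, 'l) module" where "A = module.truncate (L\<lparr>carrier := H\<rparr>)"
  have A_simps: "carrier A = H" "zero A = zero L" "add A = add L" "smult A = smult L"
    by (simp_all add: A_def module.defs)
  have nsumA: "nsum A f n = nsum L f n" for f n by (induction n) (auto simp: A_simps)
  have lin: "(\<lambda>r. r \<odot>\<^bsub>L\<^esub> l) \<in> linear_maps R (ring_as_module R) L"
    using l(1) by (intro linear_mapsI) (auto simp: L.smult_l_distr L.smult_assoc1)
  have H: "submodule H R L"
    unfolding H_def using linear_map_image_submodule[OF L.R.ring_as_module_is_module L.module_axioms lin] by simp
  note HE = L.submoduleE[OF H] L.submodule_zero_mem[OF H]
  have HL: "x \<in> carrier L" if "x \<in> H" for x using HE(1) that by blast
  have A: "module R A"
  proof (rule moduleI)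
    show "abelian_group A"
    proof (rule abelian_groupI)
      fix x assume "x \<in> carrier A"
      then show "\<exists>y\<in>carrier A. y \<oplus>\<^bsub>A\<^esub> x = \<zero>\<^bsub>A\<^esub>"
        using HE(3) HL by (intro bexI[of _ "\<ominus>\<^bsub>L\<^esub> x"]) (auto simp: A_simps L.M.l_neg)
    qed (use HE(5,7) HL in \<open>auto simp: A_simps L.M.a_assoc\<close>, use HL in \<open>auto simp: A_simps L.M.a_comm\<close>)
  qed (use HE(4) HL in \<open>auto simp: A_simps L.R.is_cring L.smult_l_distr L.smult_r_distr L.smult_assoc1\<close>)
  interpret A: tensor_pair R A M using A M.module_axioms by (rule tensor_pair.intro)
  have lH: "l \<in> H" unfolding H_def using l(1) by (intro image_eqI[of _ _ "\<one>"]) auto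
  have pure0: "pure_tensor R A M l m = \<zero>\<^bsub>A.TT\<^esub>" if m: "m \<in> carrier M" for m
  proof -
    have "trivial_relation R L M 1 (\<lambda>_. l) (\<lambda>_. m)" using flat_pure_tensor_zeroD[OF flat l(1) m all[OF m]] .
    moreover have "syzygies R L 1 (\<lambda>_. l) = syzygies R A 1 (\<lambda>_. l)"
      unfolding syzygies_def nsumA A_simps ..
    ultimately have "trivial_relation R A M 1 (\<lambda>_. l) (\<lambda>_. m)" unfolding trivial_relation_def by simp
    then have "nsum A.TT (\<lambda>_. pure_tensor R A M l m) 1 = \<zero>\<^bsub>A.TT\<^esub>"
      using lH by (intro A.trivial_relation_tensor_zero) (auto simp: A_simps)
    then show ?thesis using lH m by (simp add: A_simps)
  qed
  have "z = \<zero>\<^bsub>A.TT\<^esub>" if "z \<in> carrier A.TT" for z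
    using that
  proof (induction rule: A.tensor_induct)
    case (add z x m)
    obtain r where r: "r \<in> carrier R" "x = r \<odot>\<^bsub>A\<^esub> l" using add(2) unfolding A_simps H_def by blast
    have "pure_tensor R A M x m = \<zero>\<^bsub>A.TT\<^esub>"
      unfolding r(2) using A.pure_smult_left[OF r(1), of l m] pure0[OF add(3)] r(1) lH add(3)
      by (simp add: A_simps(1))
    then show ?case using add by simp
  qed simp
  then have "carrier A = {\<zero>\<^bsub>A\<^esub>}" by (rule ff[OF A])
  then show False using lH l(2) by (simp add: A_simps)
qed

text \<open>
  The sequence \<open>A \<rightarrow> A \<rightarrow> A\<close> of zero maps is exact only for \<open>A = 0\<close>.
\<close>

lemma faithfully_flat_zero:
  fixes A :: "('a, 'u) module" and M :: "('a, 'm) module"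
  assumes ff: "faithfully_flat TYPE('u) R M" and A: "module R A"
    and zero: "\<And>z. z \<in> carrier (tensor_product R A M) \<Longrightarrow> z = \<zero>\<^bsub>tensor_product R A M\<^esub>"
  shows "carrier A = {\<zero>\<^bsub>A\<^esub>}"
proof -
  have M: "module R M" using ff by (simp add: faithfully_flat_def)
  interpret tensor_pair R A M using A M by (rule tensor_pair.intro)
  let ?f = "\<lambda>x. \<zero>\<^bsub>A\<^esub>"
  have f: "?f \<in> linear_maps R A A" by (rule linear_mapsI) auto
  let ?F = "tensor_map R A M A M ?f (\<lambda>x. x)"
  have Fc: "?F z = \<zero>\<^bsub>TT\<^esub>" if "z \<in> carrier TT" for z
    using zero[OF linear_maps_closed[OF tensor_map_linear[OF A M A M f id_linear] that]] .
  have "carrier TT = {\<zero>\<^bsub>TT\<^esub>}" using zero by auto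
  then have "exact_at TT ?F TT ?F TT"
    unfolding exact_at_def a_kernel_def' using Fc by auto
  then have "exact_at A ?f A ?f A"
    using ff A f unfolding faithfully_flat_def by blast
  then show ?thesis unfolding exact_at_def a_kernel_def' using L.zero_closed by auto
qed

text \<open>
  Let \<open>P\<close> be the annihilator of \<open>l\<close>, and \<open>l \<otimes> m \<noteq> 0\<close>. Some nonzero multiple \<open>l \<otimes> r m\<close> has a prime
  annihilator, which contains \<open>P\<close>. It is not larger: for \<open>s \<notin> P\<close> the elements \<open>s l\<close> and \<open>l\<close> have the same
  annihilator \<open>P\<close>, so by flatness \<open>s l \<otimes> r m = 0\<close> only if \<open>l \<otimes> r m = 0\<close>.
\<close>

theorem faithfully_flat_Ass_superset:
  fixes L :: "('a, 'u) module" and M :: "('a, 'm) module"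
  assumes noeth: "noetherian_ring R" and ff: "faithfully_flat TYPE('u) R M"
    and flat: "equationally_flat R M" and L: "module R L"
  shows "Ass R L \<subseteq> Ass R (tensor_product R L M)"
proof
  have M: "module R M" using ff by (simp add: faithfully_flat_def)
  interpret tensor_pair R L M using L M by (rule tensor_pair.intro)
  fix P assume "P \<in> Ass R L"
  then obtain l where P: "primeideal P R" and l: "l \<in> carrier L"
    and Pl: "P = {r \<in> carrier R. r \<odot>\<^bsub>L\<^esub> l = \<zero>\<^bsub>L\<^esub>}" unfolding Ass_def by blast
  interpret P: primeideal P R by (rule P)
  have "l \<noteq> \<zero>\<^bsub>L\<^esub>"
  proof
    assume "l = \<zero>\<^bsub>L\<^esub>"
    then have "\<one>\<^bsub>R\<^esub> \<in> {r \<in> carrier R. r \<odot>\<^bsub>L\<^esub> l = \<zero>\<^bsub>L\<^esub>}" by simp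
    then have "\<one>\<^bsub>R\<^esub> \<in> P" unfolding Pl[symmetric] .
    then show False using P.one_imp_carrier P.I_notcarr by blast
  qed
  then obtain m where m: "m \<in> carrier M" "pure_tensor R L M l m \<noteq> \<zero>\<^bsub>TT\<^esub>"
    using faithfully_flat_nonzero[OF faithfully_flat_zero[OF ff] flat l] by blast
  obtain r where r: "r \<in> carrier R" "r \<odot>\<^bsub>TT\<^esub> pure_tensor R L M l m \<noteq> \<zero>\<^bsub>TT\<^esub>"
    and P': "primeideal {a \<in> carrier R. a \<odot>\<^bsub>TT\<^esub> (r \<odot>\<^bsub>TT\<^esub> pure_tensor R L M l m) = \<zero>\<^bsub>TT\<^esub>} R" (is "primeideal ?P' R")
    using TT.exists_prime_annihilator[OF noeth pure_closed[OF l m(1)] m(2)] by blast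
  have y: "r \<odot>\<^bsub>TT\<^esub> pure_tensor R L M l m = pure_tensor R L M l (r \<odot>\<^bsub>M\<^esub> m)"
    using r(1) l m(1) by (simp add: pure_smult_right)
  have rm: "r \<odot>\<^bsub>M\<^esub> m \<in> carrier M" using r(1) m(1) by simp
  have act: "a \<odot>\<^bsub>TT\<^esub> pure_tensor R L M l (r \<odot>\<^bsub>M\<^esub> m) = pure_tensor R L M (a \<odot>\<^bsub>L\<^esub> l) (r \<odot>\<^bsub>M\<^esub> m)"
    if "a \<in> carrier R" for a using that l rm by (simp add: pure_smult_left)
  have P_iff: "a \<in> P \<longleftrightarrow> a \<in> carrier R \<and> a \<odot>\<^bsub>L\<^esub> l = \<zero>\<^bsub>L\<^esub>" for a using Pl by blast
  have "P \<subseteq> ?P'"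
  proof
    fix a assume "a \<in> P"
    then show "a \<in> ?P'" unfolding y P_iff using act[of a] rm by simp
  qed
  moreover have "?P' \<subseteq> P"
  proof
    fix s assume "s \<in> ?P'"
    then have s: "s \<in> carrier R" "pure_tensor R L M (s \<odot>\<^bsub>L\<^esub> l) (r \<odot>\<^bsub>M\<^esub> m) = \<zero>\<^bsub>TT\<^esub>" unfolding y using act by auto
    show "s \<in> P"
    proof (rule ccontr)
      assume sP: "s \<notin> P"
      have "trivial_relation R L M 1 (\<lambda>_. s \<odot>\<^bsub>L\<^esub> l) (\<lambda>_. r \<odot>\<^bsub>M\<^esub> m)"
        using s l rm by (intro flat_pure_tensor_zeroD[OF flat]) auto
      moreover have "syzygies R L 1 (\<lambda>_. s \<odot>\<^bsub>L\<^esub> l) \<subseteq> syzygies R L 1 (\<lambda>_. l)"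
      proof
        fix k assume k: "k \<in> syzygies R L 1 (\<lambda>_. s \<odot>\<^bsub>L\<^esub> l)"
        then have kc: "k i \<in> carrier R" for i by (simp add: syzygies_def)
        have "k 0 \<otimes>\<^bsub>R\<^esub> s \<in> P" using k kc s(1) l by (simp add: P_iff syzygies_def L.smult_assoc1)
        then have "k 0 \<in> P" using P.I_prime[OF kc s(1)] sP by blast
        then show "k \<in> syzygies R L 1 (\<lambda>_. l)" using kc l by (simp add: P_iff syzygies_def)
      qed
      ultimately have "trivial_relation R L M 1 (\<lambda>_. l) (\<lambda>_. r \<odot>\<^bsub>M\<^esub> m)"
        unfolding trivial_relation_def using coeff_span_mono by blast
      then have "nsum TT (\<lambda>_. pure_tensor R L M l (r \<odot>\<^bsub>M\<^esub> m)) 1 = \<zero>\<^bsub>TT\<^esub>"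
        using l by (intro trivial_relation_tensor_zero) auto
      then show False using r(2) y l rm by simp
    qed
  qed
  ultimately have "P = ?P'" by blast
  then show "P \<in> Ass R TT" unfolding Ass_def using P r(1) l m(1) by blast
qed

lemma simple_quotient:
  assumes L: "module R L" and mm: "maximalideal \<mm> R"
    and \<pi>: "\<pi> \<in> linear_maps R (ring_as_module R) L" and surj: "\<pi> ` carrier R = carrier L"
    and ker: "\<And>r. r \<in> carrier R \<Longrightarrow> \<pi> r = \<zero>\<^bsub>L\<^esub> \<longleftrightarrow> r \<in> \<mm>"
  shows "simple_module R L" "\<mm> \<in> Ass R L"
proof -
  interpret L: module R L by fact
  interpret mm: maximalideal \<mm> R by fact
  interpret RR: module R "ring_as_module R" by (rule L.R.ring_as_module_is_module)
  have one: "\<one>\<^bsub>R\<^esub> \<notin> \<mm>" using mm.one_imp_carrier mm.I_notcarr by blast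
  have \<pi>c: "\<pi> r \<in> carrier L" if "r \<in> carrier R" for r using surj that by blast
  have \<pi>_mult: "\<pi> (r \<otimes>\<^bsub>R\<^esub> s) = r \<odot>\<^bsub>L\<^esub> \<pi> s" if "r \<in> carrier R" "s \<in> carrier R" for r s
    using linear_maps_smult[OF \<pi>, of r s] that by simp
  show "\<mm> \<in> Ass R L"
  proof -
    have iff: "r \<in> \<mm> \<longleftrightarrow> r \<odot>\<^bsub>L\<^esub> \<pi> \<one>\<^bsub>R\<^esub> = \<zero>\<^bsub>L\<^esub>" if r: "r \<in> carrier R" for r
      using ker[OF r] \<pi>_mult[OF r L.R.one_closed] L.R.r_one[OF r] by metis
    have "\<mm> = {r \<in> carrier R. r \<odot>\<^bsub>L\<^esub> \<pi> \<one>\<^bsub>R\<^esub> = \<zero>\<^bsub>L\<^esub>}"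
    proof (intro equalityI subsetI)
      fix r assume "r \<in> \<mm>"
      then show "r \<in> {r \<in> carrier R. r \<odot>\<^bsub>L\<^esub> \<pi> \<one>\<^bsub>R\<^esub> = \<zero>\<^bsub>L\<^esub>}" using iff mm.a_Hcarr by blast
    next
      fix r assume "r \<in> {r \<in> carrier R. r \<odot>\<^bsub>L\<^esub> \<pi> \<one>\<^bsub>R\<^esub> = \<zero>\<^bsub>L\<^esub>}"
      then show "r \<in> \<mm>" using iff by blast
    qed
    then show ?thesis unfolding Ass_def using L.R.maximalideal_prime[OF mm] \<pi>c by blast
  qed
  have "carrier L \<noteq> {\<zero>\<^bsub>L\<^esub>}" using ker[OF L.R.one_closed] one \<pi>c[OF L.R.one_closed] by blast
  moreover have "H = {\<zero>\<^bsub>L\<^esub>} \<or> H = carrier L" if H: "submodule H R L" for H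
  proof -
    note HE = L.submoduleE[OF H] L.submodule_zero_mem[OF H]
    define J where "J = {r \<in> carrier R. \<pi> r \<in> H}"
    have "submodule J R (ring_as_module R)"
    proof (rule RR.submoduleI')
      show "\<zero>\<^bsub>ring_as_module R\<^esub> \<in> J" using HE(7) linear_maps_zero[OF RR.module_axioms L \<pi>] by (simp add: J_def)
      show "a \<oplus>\<^bsub>ring_as_module R\<^esub> b \<in> J" if "a \<in> J" "b \<in> J" for a b
        using that linear_maps_add[OF \<pi>, of a b] HE(5) by (simp add: J_def)
      show "a \<odot>\<^bsub>ring_as_module R\<^esub> b \<in> J" if "a \<in> carrier R" "b \<in> J" for a b
        using that \<pi>_mult[of a b] HE(4) by (simp add: J_def)
    qed (auto simp: J_def)
    then have J: "ideal J R" using L.R.submodule_ring_iff_ideal by blast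
    have ker0: "\<pi> r = \<zero>\<^bsub>L\<^esub>" if "r \<in> \<mm>" for r using ker mm.a_Hcarr that by blast
    have "\<mm> \<subseteq> J"
    proof
      fix r assume "r \<in> \<mm>"
      then show "r \<in> J" using ker0[of r] HE(7) mm.a_Hcarr[of r] by (simp add: J_def)
    qed
    moreover have "J \<subseteq> carrier R" by (simp add: J_def)
    ultimately have "J = \<mm> \<or> J = carrier R" using mm.I_maximal[OF J] by blast
    moreover have H_eq: "H = \<pi> ` J"
    proof (intro equalityI subsetI)
      fix x assume x: "x \<in> H"
      then obtain r where "r \<in> carrier R" "x = \<pi> r" using HE(1) surj by blast
      then show "x \<in> \<pi> ` J" using x by (simp add: J_def)
    qed (auto simp: J_def)
    moreover have "\<pi> ` \<mm> = {\<zero>\<^bsub>L\<^esub>}"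
    proof (intro equalityI subsetI)
      fix x assume "x \<in> {\<zero>\<^bsub>L\<^esub>}"
      then have "x = \<pi> \<zero>\<^bsub>R\<^esub>" using ker0[OF mm.zero_closed] by simp
      then show "x \<in> \<pi> ` \<mm>" using mm.zero_closed by (rule image_eqI)
    qed (use ker0 in auto)
    ultimately show ?thesis using surj by metis
  qed
  ultimately show "simple_module R L" unfolding simple_module_def using L by blast
qed

text \<open>
  If \<open>\<mm> M = M\<close>, then \<open>R/\<mm> \<otimes> M = 0\<close> has no associated prime, whereas \<open>\<mm>\<close> is one of \<open>R/\<mm>\<close>.
\<close>

lemma simple_Ass_imp_proper:
  fixes R :: "('a, 'x) ring_scheme" and \<iota> :: "'a \<Rightarrow> 'u" and M :: "('a, 'm) module"
  assumes M: "module R M" and inj: "inj_on \<iota> (carrier R)" and mm: "maximalideal \<mm> R"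
    and simple: "\<And>L :: ('a, 'u) module. simple_module R L \<Longrightarrow> Ass R (tensor_product R L M) = Ass R L"
  shows "\<not> carrier M \<subseteq> ideal_multiples M \<mm>"
proof
  assume all: "carrier M \<subseteq> ideal_multiples M \<mm>"
  interpret M: module R M by fact
  interpret mm: maximalideal \<mm> R by fact
  interpret RR: module R "ring_as_module R" by (rule M.R.ring_as_module_is_module)
  have id: "ideal \<mm> R" ..
  have ms: "submodule \<mm> R (ring_as_module R)" using M.R.submodule_ring_iff_ideal id by blast
  let ?N = "residue_module R \<mm>"
  have N: "module R ?N" by (rule RR.quotient_is_module[OF ms])
  interpret N: module R ?N by (rule N)
  define \<pi> where "\<pi> = (\<lambda>x. \<mm> +>\<^bsub>ring_as_module R\<^esub> x)"
  have \<pi>: "\<pi> \<in> linear_maps R (ring_as_module R) ?N" unfolding \<pi>_def by (rule RR.coset_linear[OF ms])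
  have \<pi>0: "\<pi> x = \<zero>\<^bsub>?N\<^esub> \<longleftrightarrow> x \<in> \<mm>" if "x \<in> carrier R" for x
    unfolding \<pi>_def using RR.coset_eq_zero_iff[OF ms] that by simp
  have \<pi>N: "carrier ?N = \<pi> ` carrier R" unfolding \<pi>_def using RR.quotient_module_carrier[OF ms] by simp
  \<comment> \<open>Choosing representatives embeds \<open>R/\<mm>\<close> into the universe.\<close>
  define h where "h = (\<lambda>X. \<iota> (inv_into (carrier R) \<pi> X))"
  have "inj_on (inv_into (carrier R) \<pi>) (carrier ?N)" unfolding \<pi>N by (rule inj_on_inv_into) simp
  then have h: "inj_on h (carrier ?N)"
    unfolding h_def \<pi>N by (intro inj_onI) (metis inj inj_onD inv_into_into f_inv_into_f)
  define L where "L = module_copy h ?N"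
  have L: "module R L" and hl: "h \<in> linear_maps R ?N L" and Lc: "carrier L = h ` carrier ?N"
    unfolding L_def by (rule N.module_copy_is_module[OF h] N.module_copy_linear[OF h] N.module_copy_carrier[OF h])+
  interpret tensor_pair R L M using L M by (rule tensor_pair.intro)
  define \<rho> where "\<rho> = (\<lambda>r. h (\<pi> r))"
  have \<rho>: "\<rho> \<in> linear_maps R (ring_as_module R) L" unfolding \<rho>_def by (rule linear_maps_compose[OF \<pi> hl])
  have \<rho>s: "\<rho> ` carrier R = carrier L" unfolding \<rho>_def Lc \<pi>N by auto
  have \<rho>0: "\<rho> r = \<zero>\<^bsub>L\<^esub> \<longleftrightarrow> r \<in> \<mm>" if r: "r \<in> carrier R" for r
  proof -
    have "\<rho> r = \<zero>\<^bsub>L\<^esub> \<longleftrightarrow> h (\<pi> r) = h \<zero>\<^bsub>?N\<^esub>" unfolding \<rho>_def using linear_maps_zero[OF N L hl] by simp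
    also have "\<dots> \<longleftrightarrow> \<pi> r = \<zero>\<^bsub>?N\<^esub>"
      using inj_on_eq_iff[OF h, of "\<pi> r" "\<zero>\<^bsub>?N\<^esub>"] \<pi>N r by auto
    finally show ?thesis using \<pi>0[OF r] by simp
  qed
  note s = simple_quotient[OF L mm \<rho> \<rho>s \<rho>0]
  have pure0: "pure_tensor R L M l m = \<zero>\<^bsub>TT\<^esub>" if l: "l \<in> carrier L" and m: "m \<in> carrier M" for l m
  proof -
    obtain N c y where c: "\<forall>j<(N::nat). c j \<in> \<mm> \<and> y j \<in> carrier M" "m = nsum M (\<lambda>j. c j \<odot>\<^bsub>M\<^esub> y j) N"
      using all m unfolding ideal_multiples_def by blast
    have cc: "c j \<in> carrier R" if "j < N" for j using c(1) that mm.a_Hcarr by blast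
    obtain r where r: "r \<in> carrier R" "l = \<rho> r" using l \<rho>s by blast
    have lin: "pure_tensor R L M l \<in> linear_maps R M TT"
      using l by (intro linear_mapsI) (auto simp: pure_add_right pure_smult_right)
    have "pure_tensor R L M l m = nsum TT (\<lambda>j. pure_tensor R L M l (c j \<odot>\<^bsub>M\<^esub> y j)) N"
      unfolding c(2) using c(1) cc by (intro linear_maps_nsum[OF M TT.module_axioms lin]) auto
    also have "\<dots> = \<zero>\<^bsub>TT\<^esub>"
    proof (rule TT.nsum_zero)
      fix j assume j: "j < N"
      have "c j \<odot>\<^bsub>L\<^esub> l = \<rho> (c j \<otimes>\<^bsub>R\<^esub> r)" unfolding r(2) using linear_maps_smult[OF \<rho> cc[OF j], of r] r(1) by simp
      also have "\<dots> = \<zero>\<^bsub>L\<^esub>" using \<rho>0[of "c j \<otimes>\<^bsub>R\<^esub> r"] cc[OF j] r(1) c(1) j mm.I_r_closed[of "c j" r] by simp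
      finally have "pure_tensor R L M (c j \<odot>\<^bsub>L\<^esub> l) (y j) = \<zero>\<^bsub>TT\<^esub>" using c(1) j by simp
      then show "pure_tensor R L M l (c j \<odot>\<^bsub>M\<^esub> y j) = \<zero>\<^bsub>TT\<^esub>"
        using l cc[OF j] c(1) j by (simp add: pure_smult_left pure_smult_right)
    qed
    finally show ?thesis .
  qed
  have zero: "z = \<zero>\<^bsub>TT\<^esub>" if "z \<in> carrier TT" for z
    using that by (induction rule: tensor_induct) (simp_all add: pure0)
  have "\<mm> \<in> Ass R TT" using simple[OF s(1)] s(2) by simp
  then obtain z where z: "z \<in> carrier TT" "\<mm> = {r \<in> carrier R. r \<odot>\<^bsub>TT\<^esub> z = \<zero>\<^bsub>TT\<^esub>}" unfolding Ass_def by blast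
  have "\<one>\<^bsub>R\<^esub> \<odot>\<^bsub>TT\<^esub> z = \<zero>\<^bsub>TT\<^esub>" using zero[OF z(1)] TT.smult_one[OF z(1)] by metis
  then have "\<one>\<^bsub>R\<^esub> \<in> \<mm>" using z(2) M.R.one_closed by blast
  then show False using mm.one_imp_carrier mm.I_notcarr by blast
qed

text \<open>
  A failure of exactness is an element \<open>y\<close> outside a submodule \<open>N\<close>: either \<open>y = g (f x)\<close> and \<open>N = 0\<close>, or
  \<open>g y = 0\<close> and \<open>N = im f\<close>. The exactness after tensoring puts all \<open>y \<otimes> m\<close> into the image of \<open>N \<otimes> M\<close>, and
  by flatness \<open>m\<close> is then a combination with coefficients in the proper ideal \<open>(N : y)\<close>. So \<open>M\<close> equals
  its multiple by any maximal ideal that contains \<open>(N : y)\<close>.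
\<close>

theorem proper_imp_faithfully_flat:
  fixes M :: "('a, 'm) module"
  assumes M: "module R M" and noeth: "noetherian_ring R" and flat: "equationally_flat R M"
    and proper: "\<And>\<mm>. maximalideal \<mm> R \<Longrightarrow> \<not> carrier M \<subseteq> ideal_multiples M \<mm>"
  shows "faithfully_flat TYPE('u) R M"
  unfolding faithfully_flat_def
proof (intro conjI allI impI M, elim conjE, intro iffI)
  interpret M: module R M by fact
  have proper': "\<not> carrier M \<subseteq> ideal_multiples M I" if I: "ideal I R" "\<one>\<^bsub>R\<^esub> \<notin> I" for I
  proof -
    have "I \<noteq> carrier R" using I(2) M.R.one_closed by blast
    then obtain \<mm> where m: "maximalideal \<mm> R" "I \<subseteq> \<mm>"
      using noetherian_ring.exists_maximalideal[OF noeth I(1)] by blast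
    show ?thesis using proper[OF m(1)] ideal_multiples_mono[OF m(2), of M] by blast
  qed
  fix A B C :: "('a, 'u) module" and f g
  assume A: "module R A" and B: "module R B" and C: "module R C"
    and f: "f \<in> linear_maps R A B" and g: "g \<in> linear_maps R B C"
  let ?f = "tensor_map R A M B M f (\<lambda>x. x)" and ?g = "tensor_map R B M C M g (\<lambda>x. x)"
  show "exact_at (tensor_product R A M) ?f (tensor_product R B M) ?g (tensor_product R C M)"
    if "exact_at A f B g C" using equationally_flat_exact[OF A B C M f g that flat] .
  assume ex: "exact_at (tensor_product R A M) ?f (tensor_product R B M) ?g (tensor_product R C M)"
  interpret AM: tensor_pair R A M using A M by (rule tensor_pair.intro)
  interpret BM: tensor_pair R B M using B M by (rule tensor_pair.intro)
  interpret CM: tensor_pair R C M using C M by (rule tensor_pair.intro)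
  note fl = tensor_map_linear[OF A M B M f id_linear] and fp = tensor_map_pure[OF A M B M f id_linear]
  note gl = tensor_map_linear[OF B M C M g id_linear] and gp = tensor_map_pure[OF B M C M g id_linear]
  have ex': "?f ` carrier AM.TT = {z \<in> carrier BM.TT. ?g z = \<zero>\<^bsub>CM.TT\<^esub>}"
    using ex unfolding exact_at_def a_kernel_def' .
  show "exact_at A f B g C" unfolding exact_at_def a_kernel_def'
  proof (intro equalityI subsetI)
    fix b assume "b \<in> f ` carrier A"
    then obtain x where x: "x \<in> carrier A" "b = f x" by blast
    have fx: "f x \<in> carrier B" using linear_maps_closed[OF f x(1)] .
    have gfx: "g (f x) \<in> carrier C" using linear_maps_closed[OF g fx] .
    have zero: "pure_tensor R C M (g (f x)) m = \<zero>\<^bsub>CM.TT\<^esub>" if m: "m \<in> carrier M" for m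
    proof -
      have "?f (pure_tensor R A M x m) \<in> ?f ` carrier AM.TT" using x(1) m by auto
      then have "?g (?f (pure_tensor R A M x m)) = \<zero>\<^bsub>CM.TT\<^esub>" using ex' by blast
      then show ?thesis using x(1) fx m by (simp add: fp gp)
    qed
    let ?I = "{r \<in> carrier R. r \<odot>\<^bsub>C\<^esub> g (f x) = \<zero>\<^bsub>C\<^esub>}"
    have "carrier M \<subseteq> ideal_multiples M ?I"
    proof
      fix m assume m: "m \<in> carrier M"
      have tr: "trivial_relation R C M 1 (\<lambda>_. g (f x)) (\<lambda>_. m)"
        by (rule CM.flat_pure_tensor_zeroD[OF flat gfx m zero[OF m]])
      show "m \<in> ideal_multiples M ?I"
        by (rule M.trivial_relation_ideal_multiples[OF tr, of 0]) (use gfx in \<open>auto simp: syzygies_def\<close>)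
    qed
    then have "\<one>\<^bsub>R\<^esub> \<in> ?I" using proper'[OF CM.L.annihilator_ideal[OF gfx]] by blast
    then show "b \<in> {b \<in> carrier B. g b = \<zero>\<^bsub>C\<^esub>}" using x(2) fx gfx by simp
  next
    fix y assume "y \<in> {b \<in> carrier B. g b = \<zero>\<^bsub>C\<^esub>}"
    then have y: "y \<in> carrier B" "g y = \<zero>\<^bsub>C\<^esub>" by auto
    have im: "submodule (f ` carrier A) R B" by (rule linear_map_image_submodule[OF A B f])
    note imE = BM.L.submoduleE[OF im] BM.L.submodule_zero_mem[OF im]
    let ?I = "{r \<in> carrier R. r \<odot>\<^bsub>B\<^esub> y \<in> f ` carrier A}"
    interpret RR: module R "ring_as_module R" by (rule M.R.ring_as_module_is_module)
    have "submodule ?I R (ring_as_module R)"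
      by (rule RR.submoduleI') (use imE(4,5,7) y(1) in \<open>auto simp: BM.L.smult_l_distr BM.L.smult_assoc1\<close>)
    then have I: "ideal ?I R" using M.R.submodule_ring_iff_ideal by blast
    have "carrier M \<subseteq> ideal_multiples M ?I"
    proof
      fix m assume m: "m \<in> carrier M"
      have "?g (pure_tensor R B M y m) = \<zero>\<^bsub>CM.TT\<^esub>" using y m by (simp add: gp)
      then have "pure_tensor R B M y m \<in> ?f ` carrier AM.TT" using ex' y m by auto
      then obtain w where w: "w \<in> carrier AM.TT" "pure_tensor R B M y m = ?f w" by blast
      obtain n x u where x: "\<And>i. x i \<in> carrier A" and u: "\<And>i. u i \<in> carrier M"
        and wx: "w = nsum AM.TT (\<lambda>i. pure_tensor R A M (x i) (u i)) n"
        using AM.tensor_representation[OF w(1)] by blast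
      have fx: "f (x i) \<in> carrier B" for i using linear_maps_closed[OF f x] .
      define l where "l = (\<lambda>i. if i < n then f (x i) else y)"
      define v where "v = (\<lambda>i. if i < n then \<ominus>\<^bsub>M\<^esub> u i else m)"
      have "pure_tensor R B M y m = nsum BM.TT (\<lambda>i. ?f (pure_tensor R A M (x i) (u i))) n"
        unfolding w(2) wx using x u by (intro linear_maps_nsum[OF AM.TT.module_axioms BM.TT.module_axioms fl]) auto
      also have "\<dots> = nsum BM.TT (\<lambda>i. pure_tensor R B M (f (x i)) (u i)) n"
        by (rule nsum_cong) (simp add: fp x u)
      finally have eq: "pure_tensor R B M y m = nsum BM.TT (\<lambda>i. pure_tensor R B M (f (x i)) (u i)) n" .
      have neg: "pure_tensor R B M b (\<ominus>\<^bsub>M\<^esub> u') = \<ominus>\<^bsub>BM.TT\<^esub> pure_tensor R B M b u'"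
        if "b \<in> carrier B" "u' \<in> carrier M" for b u'
      proof -
        have "pure_tensor R B M b \<in> linear_maps R M BM.TT"
          using that by (intro linear_mapsI) (auto simp: BM.pure_add_right BM.pure_smult_right)
        then show ?thesis using linear_maps_minus[OF M BM.TT.module_axioms _ that(2)] by blast
      qed
      have "nsum BM.TT (\<lambda>i. pure_tensor R B M (l i) (v i)) n = nsum BM.TT (\<lambda>i. \<ominus>\<^bsub>BM.TT\<^esub> pure_tensor R B M (f (x i)) (u i)) n"
        by (rule nsum_cong) (simp add: l_def v_def neg fx u)
      also have "\<dots> = \<ominus>\<^bsub>BM.TT\<^esub> pure_tensor R B M y m"
        unfolding eq using fx u by (intro BM.TT.nsum_minus[symmetric]) auto
      finally have "nsum BM.TT (\<lambda>i. pure_tensor R B M (l i) (v i)) (Suc n) = \<zero>\<^bsub>BM.TT\<^esub>"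
        using y(1) m by (simp add: l_def v_def BM.TT.M.l_neg)
      then have tr: "trivial_relation R B M (Suc n) l v"
        using fx u y(1) m by (intro BM.flat_tensor_zeroD[OF flat]) (auto simp: l_def v_def)
      have "k n \<in> ?I" if k: "k \<in> syzygies R B (Suc n) l" for k
      proof -
        have kc: "k i \<in> carrier R" for i using k by (simp add: syzygies_def)
        let ?s = "nsum B (\<lambda>i. k i \<odot>\<^bsub>B\<^esub> l i) n"
        have "?s \<in> f ` carrier A"
          using kc x imE(4) by (intro BM.L.submodule_nsum[OF im]) (auto simp: l_def)
        moreover have "?s \<oplus>\<^bsub>B\<^esub> k n \<odot>\<^bsub>B\<^esub> y = \<zero>\<^bsub>B\<^esub>" using k by (simp add: syzygies_def l_def)
        moreover have "?s \<in> carrier B" using calculation(1) imE(1) by blast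
        ultimately have "k n \<odot>\<^bsub>B\<^esub> y = \<ominus>\<^bsub>B\<^esub> ?s"
          using kc y(1) by (metis BM.L.M.a_comm BM.L.M.minus_equality BM.L.smult_closed)
        then show ?thesis using imE(3)[OF \<open>?s \<in> f ` carrier A\<close>] kc by simp
      qed
      then have "v n \<in> ideal_multiples M ?I" by (intro M.trivial_relation_ideal_multiples[OF tr]) auto
      then show "m \<in> ideal_multiples M ?I" by (simp add: v_def)
    qed
    then have "\<one>\<^bsub>R\<^esub> \<in> ?I" using proper'[OF I] by blast
    then show "y \<in> f ` carrier A" using y(1) by simp
  qed
qed

section \<open>The criteria\<close>

lemma total_quotient_flat_imp_generically_flat:
  fixes R :: "('a, 'x) ring_scheme" and M :: "('a, 'm) module" and \<iota> :: "'a \<Rightarrow> 'u"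
  assumes M: "module R M" and inj: "inj_on \<iota> (carrier R)"
    and flat: "flat TYPE('u) (total_quotient_ring R) (tensor_total_quotient R M)"
  shows "generically_flat R M"
proof -
  interpret M: module R M by fact
  obtain \<kappa> :: "('a \<times> 'a) set \<Rightarrow> 'u" where "inj_on \<kappa> (carrier (total_quotient_ring R))"
    using M.R.total_quotient_universe[OF inj] by blast
  then have "equationally_flat (total_quotient_ring R) (tensor_total_quotient R M)"
    using flat by (rule flat_imp_equationally_flat)
  note t = M.total_quotient_flat_trivializes[OF this]
  show ?thesis
    unfolding generically_flat_def
  proof (intro allI impI, elim conjE)
    fix n r m assume r: "\<forall>i<n. r i \<in> carrier R" and m: "\<forall>i<n. m i \<in> carrier M"
      and rel: "nsum M (\<lambda>i. r i \<odot>\<^bsub>M\<^esub> m i) n = \<zero>\<^bsub>M\<^esub>"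
    show "\<exists>t\<in>nonzerodivisors R. trivial_relation R (ring_as_module R) M n r (\<lambda>i. t \<odot>\<^bsub>M\<^esub> m i)"
      by (rule t) (use r m rel in auto)
  qed
qed

lemma (in cring) ideal_torsion_free: "ideal I R \<Longrightarrow> torsion_free R (ideal_as_module R I)"
  unfolding torsion_free_def by (auto intro: nzd_zeroD ideal.Icarr)

lemma torsion_free_linear_image:
  assumes N: "module R N" and L: "module R L" and h: "h \<in> linear_maps R N L"
    and inj: "inj_on h (carrier N)" and surj: "h ` carrier N = carrier L" and tf: "torsion_free R N"
  shows "torsion_free R L"
  unfolding torsion_free_def
proof (intro ballI impI)
  interpret N: module R N by fact
  fix s x assume s: "s \<in> nonzerodivisors R" and x: "x \<in> carrier L" "s \<odot>\<^bsub>L\<^esub> x = \<zero>\<^bsub>L\<^esub>"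
  have sc: "s \<in> carrier R" using s N.R.nzd_closed by blast
  obtain y where y: "y \<in> carrier N" "x = h y" using x(1) surj by blast
  have "h (s \<odot>\<^bsub>N\<^esub> y) = h \<zero>\<^bsub>N\<^esub>"
    using linear_maps_smult[OF h sc y(1)] x(2) y(2) linear_maps_zero[OF N L h] by metis
  then have "s \<odot>\<^bsub>N\<^esub> y = \<zero>\<^bsub>N\<^esub>" using inj_onD[OF inj] sc y(1) by blast
  then have "y = \<zero>\<^bsub>N\<^esub>" using tf s y(1) unfolding torsion_free_def by blast
  then show "x = \<zero>\<^bsub>L\<^esub>" using y(2) linear_maps_zero[OF N L h] by metis
qed

theorem theorem2p2:
  fixes R :: "('a, 'x) ring_scheme"
    and M :: "('a, 'b) module"
    and \<iota> :: "'a \<Rightarrow> 'u"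
  assumes "cring R" and "noetherian_ring R" and "module R M"
    and universe: "inj_on \<iota> (carrier R)"
  shows
    "let
       MQ_flat = flat TYPE('u) (total_quotient_ring R) (tensor_total_quotient R M);
       cond_a = flat TYPE('u) R M;
       cond_b = (MQ_flat \<and>
         (\<forall>L :: ('a, 'u) module. module R L \<longrightarrow> Ass R (tensor_product R L M) \<subseteq> Ass R L));
       cond_c = (MQ_flat \<and>
         (\<forall>L :: ('a, 'u) module. module R L \<and> torsion_free R L \<longrightarrow>
            torsion_free R (tensor_product R L M)));
       cond_d = (MQ_flat \<and>
         (\<forall>P. primeideal P R \<longrightarrow> torsion_free R (tensor_product R (ideal_as_module R P) M)));
       cond_e = (MQ_flat \<and>
         (\<forall>P. primeideal P R \<longrightarrow> torsion_free R (Tor1 R (residue_module R P) M)));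
       cond_i = faithfully_flat TYPE('u) R M;
       cond_ii = (MQ_flat \<and>
         (\<forall>L :: ('a, 'u) module. module R L \<longrightarrow> Ass R (tensor_product R L M) = Ass R L));
       cond_iii = (flat TYPE('u) R M \<and>
         (\<forall>L :: ('a, 'u) module. simple_module R L \<longrightarrow> Ass R (tensor_product R L M) = Ass R L))
     in
       ((cond_a \<longleftrightarrow> cond_b) \<and> (cond_a \<longleftrightarrow> cond_c) \<and> (cond_a \<longleftrightarrow> cond_d) \<and> (cond_a \<longleftrightarrow> cond_e)) \<and>
       (\<forall>(S :: ('s, 'y) ring_scheme) \<phi> \<mm> (N :: ('s, 'b) module).
          cring S \<and> noetherian_ring S \<and> \<phi> \<in> ring_hom R S \<and>
          maximalideal \<mm> R \<and> Idl\<^bsub>S\<^esub> (\<phi> ` \<mm>) \<subseteq> jacobson_radical S \<and>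
          fg_module S N \<and> M = restrict_scalars \<phi> N \<longrightarrow>
          (cond_a \<longleftrightarrow>
             MQ_flat \<and> torsion_free R (tensor_product R (ideal_as_module R \<mm>) M)) \<and>
          (cond_a \<longleftrightarrow>
             MQ_flat \<and> torsion_free R (Tor1 R (residue_module R \<mm>) M))) \<and>
       ((cond_i \<longleftrightarrow> cond_ii) \<and> (cond_i \<longleftrightarrow> cond_iii))"
proof -
  interpret M: module R M by fact
  note M = \<open>module R M\<close> and cr = \<open>cring R\<close> and noeth = \<open>noetherian_ring R\<close>
  let ?MQ = "flat TYPE('u) (total_quotient_ring R) (tensor_total_quotient R M)"
  let ?flat = "equationally_flat R M"
  let ?b = "\<forall>L :: ('a, 'u) module. module R L \<longrightarrow> Ass R (tensor_product R L M) \<subseteq> Ass R L"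
  let ?c = "\<forall>L :: ('a, 'u) module. module R L \<and> torsion_free R L \<longrightarrow> torsion_free R (tensor_product R L M)"
  let ?ii = "\<forall>L :: ('a, 'u) module. module R L \<longrightarrow> Ass R (tensor_product R L M) = Ass R L"
  let ?iii = "\<forall>L :: ('a, 'u) module. simple_module R L \<longrightarrow> Ass R (tensor_product R L M) = Ass R L"
  have a: "flat TYPE('u) R M \<longleftrightarrow> ?flat"
    using flat_imp_equationally_flat[OF universe] equationally_flat_imp_flat[OF M] by blast
  have MQ: ?MQ if ?flat
    using M.total_quotient_equationally_flat[OF that] by (rule equationally_flat_imp_flat[OF M.NQ_module])
  note gen = total_quotient_flat_imp_generically_flat[OF M universe]
  note tensor = tensor_pair.intro[OF _ M]
  have ideal_mod: "module R (ideal_as_module R I)" "torsion_free R (ideal_as_module R I)" if "ideal I R" for I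
    using M.R.ideal_as_module_is_module[OF that] M.R.ideal_torsion_free[OF that] by auto
  have tensor_tf: "torsion_free R (tensor_product R (ideal_as_module R I) M)" if ?flat "ideal I R" for I
    by (rule flat_tensor_torsion_free[OF ideal_mod(1)[OF that(2)] M that(1) ideal_mod(2)[OF that(2)]])
  have Tor_tf: "torsion_free R (Tor1 R (residue_module R I) M)" if ?flat "ideal I R" for I
  proof -
    interpret RR: module R "ring_as_module R" by (rule M.R.ring_as_module_is_module)
    have "module R (residue_module R I)"
      using that(2) M.R.submodule_ring_iff_ideal by (intro RR.quotient_is_module) blast
    then show ?thesis
      using canonical_resolution.flat_Tor1_torsion_free[OF canonical_resolution.intro[OF _ M] that(1)] by blast
  qed
  have tensor_flat: "ideal_flat R M I"
    if ?MQ "ideal I R" "torsion_free R (tensor_product R (ideal_as_module R I) M)" for I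
    by (rule torsion_free_ideal_flat[OF cr M gen[OF that(1)] that(2) ideal_mod(1)[OF that(2)] id_linear _ _ that(3)]) auto
  have Tor_flat: "ideal_flat R M I"
    if ?MQ "ideal I R" "torsion_free R (Tor1 R (residue_module R I) M)" for I
    by (rule Tor1_torsion_free_ideal_flat[OF cr M gen[OF that(1)] that(2,3)])
  have prime_id: "ideal P R" if "primeideal P R" for P using that by (rule primeideal.axioms(1))
  have b: ?b if ?flat using tensor_pair.flat_Ass_subset[OF tensor noeth that] by blast
  have bc: ?c if ?b
    using tensor_pair.Ass_subset_torsion_free[OF tensor noeth] that by blast
  have c: ?flat if ?MQ ?c
  proof (rule M.equationally_flat_if_prime_flat[OF noeth])
    fix P assume P: "primeideal P R"
    let ?P = "ideal_as_module R P"
    note id = prime_id[OF P]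
    interpret P: module R ?P by (rule ideal_mod(1)[OF id])
    have "P \<subseteq> carrier R" using ideal.Icarr[OF id] by blast
    then have inj: "inj_on \<iota> (carrier ?P)" using universe inj_on_subset by auto
    let ?L = "module_copy \<iota> ?P"
    have L: "module R ?L" and h: "\<iota> \<in> linear_maps R ?P ?L" and s: "\<iota> ` carrier ?P = carrier ?L"
      using P.module_copy_is_module[OF inj] P.module_copy_linear[OF inj] P.module_copy_carrier[OF inj] by auto
    have "torsion_free R ?L"
      by (rule torsion_free_linear_image[OF P.module_axioms L h inj s ideal_mod(2)[OF id]])
    then have "torsion_free R (tensor_product R ?L M)" using that(2) L by blast
    then show "ideal_flat R M P"
      using torsion_free_ideal_flat[OF cr M gen[OF that(1)] id L h] inj s by simp
  qed
  have d: ?flat if ?MQ "\<forall>P. primeideal P R \<longrightarrow> torsion_free R (tensor_product R (ideal_as_module R P) M)"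
    using M.equationally_flat_if_prime_flat[OF noeth] tensor_flat[OF that(1) prime_id] that(2) by blast
  have e: ?flat if ?MQ "\<forall>P. primeideal P R \<longrightarrow> torsion_free R (Tor1 R (residue_module R P) M)"
    using M.equationally_flat_if_prime_flat[OF noeth] Tor_flat[OF that(1) prime_id] that(2) by blast
  have part2: "(?flat \<longleftrightarrow> ?MQ \<and> torsion_free R (tensor_product R (ideal_as_module R \<mm>) M)) \<and>
      (?flat \<longleftrightarrow> ?MQ \<and> torsion_free R (Tor1 R (residue_module R \<mm>) M))"
    if h: "cring S" "noetherian_ring S" "\<phi> \<in> ring_hom R S" "maximalideal \<mm> R"
      "Idl\<^bsub>S\<^esub> (\<phi> ` \<mm>) \<subseteq> jacobson_radical S" "fg_module S N" "M = restrict_scalars \<phi> N"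
    for S :: "('s, 'y) ring_scheme" and \<phi> \<mm> and N :: "('s, 'b) module"
  proof -
    have id: "ideal \<mm> R" using h(4) by (rule maximalideal.axioms(1))
    have "?flat" if "ideal_flat R M \<mm>" by (rule local_criterion[OF cr noeth h that])
    then show ?thesis using MQ tensor_tf Tor_tf tensor_flat Tor_flat id by blast
  qed
  have i_flat: "flat TYPE('u) R M" if "faithfully_flat TYPE('u) R M"
    unfolding flat_def
  proof (intro conjI M allI impI, elim conjE)
    fix A B C :: "('a, 'u) module" and f g
    assume "module R A" "module R B" "module R C" "f \<in> linear_maps R A B" "g \<in> linear_maps R B C"
      "exact_at A f B g C"
    then show "exact_at (tensor_product R A M) (tensor_map R A M B M f (\<lambda>x. x)) (tensor_product R B M)
        (tensor_map R B M C M g (\<lambda>x. x)) (tensor_product R C M)"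
      using that unfolding faithfully_flat_def by simp
  qed
  have i_ii: "?MQ \<and> ?ii" if i: "faithfully_flat TYPE('u) R M"
  proof -
    have flat: ?flat using i_flat[OF i] a by blast
    show ?thesis
      using MQ[OF flat] b[OF flat] faithfully_flat_Ass_superset[OF noeth i flat] by blast
  qed
  have ii_iii: "flat TYPE('u) R M \<and> ?iii" if "?MQ" "?ii"
  proof -
    have "?b" using that(2) by blast
    then have ?flat using c[OF that(1) bc] by blast
    then show ?thesis using a that(2) unfolding simple_module_def by blast
  qed
  have iii_i: "faithfully_flat TYPE('u) R M" if "flat TYPE('u) R M" "?iii"
  proof (rule proper_imp_faithfully_flat[OF M noeth])
    show ?flat using that(1) a by blast
    fix \<mm> assume "maximalideal \<mm> R"
    then show "\<not> carrier M \<subseteq> ideal_multiples M \<mm>"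
      using simple_Ass_imp_proper[OF M universe] that(2) by blast
  qed
  have 1: "?flat \<longleftrightarrow> ?MQ \<and> ?b" "?flat \<longleftrightarrow> ?MQ \<and> ?c"
    using MQ b bc c by blast+
  have 2: "?flat \<longleftrightarrow> ?MQ \<and> (\<forall>P. primeideal P R \<longrightarrow> torsion_free R (tensor_product R (ideal_as_module R P) M))"
    using MQ d tensor_tf prime_id by blast
  have 3: "?flat \<longleftrightarrow> ?MQ \<and> (\<forall>P. primeideal P R \<longrightarrow> torsion_free R (Tor1 R (residue_module R P) M))"
    using MQ e Tor_tf prime_id by blast
  have 4: "faithfully_flat TYPE('u) R M \<longleftrightarrow> ?MQ \<and> ?ii"
    "faithfully_flat TYPE('u) R M \<longleftrightarrow> flat TYPE('u) R M \<and> ?iii"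
    using i_ii ii_iii iii_i by blast+
  show ?thesis
    unfolding Let_def a
    using 1 2 3 4(1) 4(2)[unfolded a] part2
    by (intro conjI allI impI) (assumption | blast)+
qed

end
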